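(* Let $n\ge3$. (a) Let $M$ be a dyadic number and let $1\le p,q\le\infty$ satisfy $q>\frac{2n}{n-1}$, $\frac1p+\frac1q\le1$ and $\frac1p+\frac{2n-1}q<n-1$. Then there is a constant $C=C(p,q,n,M)$ such that $$\|(fd\sigma)^{\vee}\|_{L^q_{t,x}(\mathbb R\times\mathbb R^{n-1})}\le C\|f\|_{L^p(S)}$$ for all $f\in\mathcal L_M\cap L^p(S)$. (b) Let $S_0$ be a compact non-empty subset of the paraboloid $S$, and let $1\le p,q\le\infty$ satisfy $q>\frac{2n}{n-1}$ and $\frac{n+1}q\le\frac{n-1}{p'}$. Then there is a constant $C=C(p,q,n,S_0)$ such that $$\|(fd\sigma)^{\vee}\|_{L^q_{t,x}(\mathbb R\times\mathbb R^{n-1})}\le C\|f\|_{L^p(S)}$$ for all cylindrically symmetric functions $f\in L^p(S)$ supported on $S_0$.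
   Context: Points of $\mathbb R\times\mathbb R^{n-1}$ are written $(t,x)$ or $(\tau,\xi)$. $S=\{(\tau,\xi)\in\mathbb R\times\mathbb R^{n-1}:\tau=|\xi|^2\}$ is the paraboloid, with measure $d\sigma$ given by $\int_S f\,d\sigma=\int_{\mathbb R^{n-1}}f(|\xi|^2,\xi)\,d\xi$; $L^p(S)=L^p(S,d\sigma)$. For $f$ on $S$, $$(fd\sigma)^{\vee}(t,x)=\int_{\mathbb R^{n-1}}f(|\xi|^2,\xi)e^{i(x\cdot\xi+t|\xi|^2)}\,d\xi .$$ A function is cylindrically symmetric if it is invariant under rotations of the $\mathbb R^{n-1}$ variable. A dyadic number is a number $2^j$, $j\in\mathbb Z$. For dyadic $M$, $\mathcal L_M$ is the class of cylindrically symmetric functions supported on $\{(\tau,\xi)\in S: M\le|\xi|\le2M\}$. $p'$ is the conjugate exponent, $1/p+1/p'=1$. *)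

theory Defs
  imports "HOL-Analysis.Analysis" "HOL-Probability.Essential_Supremum"
begin

text \<open>
  The space variable lives in \<open>real ^ 'd\<close>, so \<open>CARD('d)\<close> plays the role of \<open>n - 1\<close>.
  Functions on the paraboloid are functions on \<open>real \<times> real ^ 'd\<close> whose values
  off the paraboloid are never consulted.
\<close>

definition paraboloid :: "(real \<times> (real ^ 'd)) set" where
  "paraboloid = {(\<tau>, \<xi>). \<tau> = (norm \<xi>)\<^sup>2}"

text \<open>
  The completion makes the measurable functions on the paraboloid exactly those \<open>f\<close> for which
  \<open>\<xi> \<mapsto> f (\<bar>\<xi>\<bar>\<^sup>2, \<xi>)\<close> is Lebesgue measurable, rather than only the Borel ones.
\<close>

definition paraboloid_measure :: "(real \<times> (real ^ 'd)) measure" where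
  "paraboloid_measure =
     completion (distr lborel (restrict_space borel paraboloid) (\<lambda>\<xi>. ((norm \<xi>)\<^sup>2, \<xi>)))"

definition Lp_norm :: "ennreal \<Rightarrow> 'a measure \<Rightarrow> ('a \<Rightarrow> complex) \<Rightarrow> ennreal" where
  "Lp_norm p M f =
     (if p = \<infinity> then esssup M (\<lambda>x. ennreal (norm (f x)))
      else let I = (\<integral>\<^sup>+ x. ennreal (norm (f x) powr enn2real p) \<partial>M)
           in if I = \<infinity> then \<infinity> else ennreal (enn2real I powr (1 / enn2real p)))"

definition Lp_space :: "ennreal \<Rightarrow> 'a measure \<Rightarrow> ('a \<Rightarrow> complex) set" where
  "Lp_space p M = {f \<in> borel_measurable M. Lp_norm p M f < \<infinity>}"

text \<open>
  The value is a genuine Lebesgue integral whenever \<open>f\<close> is integrable on the paraboloid, in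
  particular for every boundedly supported \<open>f\<close> in \<open>L\<^sup>p\<close> with \<open>p \<ge> 1\<close>; otherwise the library's
  convention gives 0.
\<close>

definition extension_op ::
    "(real \<times> (real ^ 'd) \<Rightarrow> complex) \<Rightarrow> real \<times> (real ^ 'd) \<Rightarrow> complex" where
  "extension_op f = (\<lambda>(t, x).
     LINT \<xi>|lebesgue. f ((norm \<xi>)\<^sup>2, \<xi>) * exp (\<i> * complex_of_real (x \<bullet> \<xi> + t * (norm \<xi>)\<^sup>2)))"

definition cylindrically_symmetric :: "(real \<times> (real ^ 'd) \<Rightarrow> complex) \<Rightarrow> bool" where
  "cylindrically_symmetric f \<longleftrightarrow>
     (\<forall>A \<tau> \<xi>. rotation_matrix A \<longrightarrow> (\<tau>, \<xi>) \<in> paraboloid \<longrightarrow> f (\<tau>, A *v \<xi>) = f (\<tau>, \<xi>))"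

definition supported_on ::
    "(real \<times> (real ^ 'd) \<Rightarrow> complex) \<Rightarrow> (real \<times> (real ^ 'd)) set \<Rightarrow> bool" where
  "supported_on f A \<longleftrightarrow> (\<forall>z \<in> paraboloid - A. f z = 0)"

definition dyadic :: "real \<Rightarrow> bool" where
  "dyadic M \<longleftrightarrow> (\<exists>j::int. M = 2 powi j)"

definition dyadic_class :: "real \<Rightarrow> (real \<times> (real ^ 'd) \<Rightarrow> complex) set" where
  "dyadic_class M = {f. cylindrically_symmetric f \<and>
     supported_on f {(\<tau>, \<xi>) \<in> paraboloid. M \<le> norm \<xi> \<and> norm \<xi> \<le> 2 * M}}"

end

theory Submission
  imports Defs "HOL-Probability.Probability" "HOL-Real_Asymp.Real_Asymp"
begin

text \<open>
  A cylindrically symmetric \<open>f\<close> has a radial profile \<open>F\<close>, and its extension at \<open>(t, x)\<close> is the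
  one-dimensional integral of \<open>F r * r ^ (d - 1) * \<kappa> (\<rho> * r) * exp (\<i> t r\<^sup>2)\<close> over \<open>r > 0\<close>, where
  \<open>\<rho> = \<bar>x\<bar>\<close> and \<open>\<kappa>\<close> is the Fourier transform of the unit sphere. The Bessel equation gives
  \<open>\<kappa> s\<close> as \<open>s powr (- (d - 1) / 2) * Re (a * exp (\<i> s))\<close> up to an error smaller by a factor \<open>s\<close>.
  For \<open>r\<close> in \<open>[1, 2]\<close> and \<open>\<rho>\<close> in \<open>[R, 2 R]\<close> the main part has phase \<open>t r\<^sup>2 \<plusminus> \<rho> r\<close>; interpolating
  Plancherel in \<open>t\<close>, a bilinear \<open>L\<^sup>4\<close> estimate losing only \<open>R powr \<eta>\<close>, and the trivial bound on functions
  dominated by a constant on a set of given measure yields the estimate with a gain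
  \<open>min R (1 / R) powr \<delta>\<close>, while Hausdorff--Young in \<open>t\<close> handles the error term,
  small \<open>R\<close> and \<open>q > 2 * d / (d - 1)\<close>. Rescaling and summing over dyadic \<open>R\<close> gives (a). In (b), \<open>p\<close>
  may be lowered to the scaling line, since \<open>f\<close> has compact support; there \<open>p < q\<close>, and the gain makes the sum over dyadic \<open>M\<close> and \<open>R\<close> converge.
\<close>

section \<open>One-dimensional estimates for the phase \<open>t r\<^sup>2\<close>\<close>

text \<open>Write \<open>d = n - 1\<close>. For \<open>q > 2 * d / (d - 1)\<close>, Hausdorff--Young
  in t at each fixed radius already decays fast enough in R. The obstacle is the range
  \<open>2 * (d + 1) / d < q \<le> 2 * d / (d - 1)\<close>, where the oscillation in \<rho> has to
  be used as well; the L^4 estimate over \<rho> and t provides this. Its kernel is bounded by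
  \<open>min R (1 / \<bar>r - s\<bar>)\<close>, whose integral grows logarithmically in R, hence the
  loss \<open>R powr \<eta>\<close>; the loss is affordable because the inequality between the
  exponents is strict. Strictness also replaces interpolation theorems: a bound for functions with
  prescribed height and support, at an exponent slightly below p, is summed over the level sets of a
  general function with a geometric gain. Orthogonality always comes from T T* with Gaussian
  weights, whose Fourier transforms are explicit and of mass independent of the width, so that the
  weights can be removed by Fatou. The sphere enters without surface measure, as the radial
  derivative of the ball; this gives polar coordinates, the Bessel equation and the kernel at
  once.\<close>

text \<open>The substitution \<open>x = sqrt (2 * e) * t\<close> turns the characteristic function
  of the standard normal law at \<open>y / sqrt (2 * e)\<close> into this integral.\<close>

lemma gaussian_fourier:
  fixes e y :: real
  assumes e: "e > 0"
  shows "(LINT t|lborel. complex_of_real (exp (- e * t\<^sup>2)) * iexp (t * y))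
           = complex_of_real (sqrt (pi / e) * exp (- y\<^sup>2 / (4 * e)))"
proof -
  let ?c = "sqrt (2 * e)"
  have c: "?c > 0" using e by simp
  have c2: "?c\<^sup>2 = 2 * e" using e by simp
  have "complex_of_real (exp (- ((y / ?c)\<^sup>2) / 2)) = char std_normal_distribution (y / ?c)"
    by (simp add: char_std_normal_distribution)
  also have "\<dots> = (LINT x|lborel. std_normal_density x *\<^sub>R iexp (y / ?c * x))"
    unfolding char_def by (subst integral_density) (auto simp: normal_density_nonneg)
  also have "\<dots> = \<bar>?c\<bar> *\<^sub>R (LINT t|lborel. std_normal_density (0 + ?c * t) *\<^sub>R iexp (y / ?c * (0 + ?c * t)))"
    by (rule lborel_integral_real_affine) (use c in auto)
  also have "(\<lambda>t. std_normal_density (0 + ?c * t) *\<^sub>R iexp (y / ?c * (0 + ?c * t)))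
      = (\<lambda>t. complex_of_real (1 / sqrt (2 * pi)) * (complex_of_real (exp (- e * t\<^sup>2)) * iexp (t * y)))"
    using c e by (auto simp: normal_density_def power_mult_distrib c2 scaleR_conv_of_real mult_ac)
  also have "(LINT t|lborel. complex_of_real (1 / sqrt (2 * pi)) * (complex_of_real (exp (- e * t\<^sup>2)) * iexp (t * y)))
      = complex_of_real (1 / sqrt (2 * pi)) * (LINT t|lborel. (complex_of_real (exp (- e * t\<^sup>2)) * iexp (t * y)))"
    by simp
  finally have *: "complex_of_real (exp (- ((y / ?c)\<^sup>2) / 2)) =
     complex_of_real (?c / sqrt (2 * pi)) * (LINT t|lborel. (complex_of_real (exp (- e * t\<^sup>2)) * iexp (t * y)))"
    using c by (simp add: scaleR_conv_of_real)
  have 1: "- ((y / ?c)\<^sup>2) / 2 = - y\<^sup>2 / (4 * e)" using c2 by (simp add: power_divide)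
  have "sqrt (pi / e) * (?c / sqrt (2 * pi)) = 1"
    using e by (simp add: real_sqrt_mult real_sqrt_divide field_simps)
  hence k: "complex_of_real (sqrt (pi / e)) * complex_of_real (?c / sqrt (2 * pi)) = 1"
    by (simp only: of_real_mult[symmetric] of_real_1)
  show ?thesis
    unfolding of_real_mult *[unfolded 1] mult.assoc[symmetric] k by simp
qed

lemma gaussian_integrable:
  fixes e :: real
  assumes e: "e > 0"
  shows "integrable lborel (\<lambda>t. exp (- e * t\<^sup>2))"
    and "(LINT t|lborel. exp (- e * t\<^sup>2)) = sqrt (pi / e)"
proof -
  have "(LINT t|lborel. complex_of_real (exp (- e * t\<^sup>2))) = complex_of_real (sqrt (pi / e))"
    using gaussian_fourier[OF e, of 0] by simp
  hence 1: "(LINT t|lborel. exp (- e * t\<^sup>2)) = sqrt (pi / e)"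
    by (metis (no_types, lifting) Bochner_Integration.integral_cong of_real_eq_iff integral_complex_of_real)
  \<comment> \<open>Integrability is read off from the value: a non-integrable function has integral
    0 by convention.\<close>
  have "sqrt (pi / e) > 0" using e by simp
  thus "integrable lborel (\<lambda>t. exp (- e * t\<^sup>2))"
    using 1 not_integrable_integral_eq by force
  show "(LINT t|lborel. exp (- e * t\<^sup>2)) = sqrt (pi / e)" by fact
qed

text \<open>Expanding the square gives the quadratic form of h with kernel
  \<open>k x y = (LINT w|N. e w x * cnj (e w y))\<close>. Schur's test bounds it:
  \<open>\<bar>h x\<bar> * \<bar>h y\<bar>\<close> is at most half the sum of the squares and the
  modulus of k is symmetric, so only row integrals over the support of h matter. The bound B may
  vary with x because in the L^4 application the rows grow near the diagonal. Finiteness of N and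
  boundedness of e justify Fubini.\<close>

lemma TTstar_bound:
  fixes h :: "'a \<Rightarrow> complex" and e :: "'w \<Rightarrow> 'a \<Rightarrow> complex"
  assumes N: "finite_measure N" and M: "sigma_finite_measure M"
    and h: "integrable M h"
    and e [measurable]: "(\<lambda>(w, x). e w x) \<in> borel_measurable (N \<Otimes>\<^sub>M M)"
    and e1: "\<And>w x. norm (e w x) \<le> 1"
    and Bm [measurable]: "B \<in> borel_measurable M"
    and B: "\<And>x. x \<in> space M \<Longrightarrow> h x \<noteq> 0 \<Longrightarrow>
       (\<integral>\<^sup>+ y. indicator {y. h y \<noteq> 0} y * ennreal (norm (LINT w|N. e w x * cnj (e w y))) \<partial>M) \<le> B x"
  shows "(\<integral>\<^sup>+ w. ennreal ((norm (LINT x|M. h x * e w x))\<^sup>2) \<partial>N) \<le> (\<integral>\<^sup>+ x. ennreal ((norm (h x))\<^sup>2) * B x \<partial>M)"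
proof -
  interpret N: finite_measure N by fact
  interpret M: sigma_finite_measure M by fact
  interpret MM: pair_sigma_finite M M by unfold_locales
  let ?P = "M \<Otimes>\<^sub>M M"
  note Pfst = sigma_finite_measure.nn_integral_fst[OF MM.sigma_finite_measure_axioms]
  interpret NP: pair_sigma_finite N ?P by unfold_locales
  interpret NM: pair_sigma_finite N M by unfold_locales
  have hm [measurable]: "h \<in> borel_measurable M" using h by auto
  define H where "H z = h (fst z) * cnj (h (snd z))" for z
  define E where "E w z = e w (fst z) * cnj (e w (snd z))" for w z
  define k where "k x y = (LINT w|N. e w x * cnj (e w y))" for x y
  have e' [measurable]: "(\<lambda>x. e (f x) (g x)) \<in> borel_measurable Q"
    if "f \<in> Q \<rightarrow>\<^sub>M N" "g \<in> Q \<rightarrow>\<^sub>M M" for f g and Q :: "'q measure"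
    using measurable_compose[OF measurable_Pair[OF that] e] by simp
  have cnjm [measurable]: "(\<lambda>x. cnj (f x)) \<in> borel_measurable Q" if "f \<in> borel_measurable Q" for f and Q :: "'q measure"
    using that by (rule borel_measurable_continuous_on[OF continuous_on_cnj[OF continuous_on_id]])
  have Hm [measurable]: "H \<in> borel_measurable ?P" unfolding H_def by measurable
  have Em [measurable]: "(\<lambda>(w,z). E w z) \<in> borel_measurable (N \<Otimes>\<^sub>M ?P)" unfolding E_def by measurable
  have km [measurable]: "(\<lambda>(x,y). k x y) \<in> borel_measurable ?P" unfolding k_def by measurable
  have Hint: "integrable ?P H"
  proof (rule integrableI_bounded)
    have "(\<integral>\<^sup>+ z. ennreal (norm (H z)) \<partial>?P) = (\<integral>\<^sup>+ x. \<integral>\<^sup>+ y. ennreal (norm (h x)) * ennreal (norm (h y)) \<partial>M \<partial>M)"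
      by (subst M.nn_integral_fst[symmetric]) (auto simp: H_def norm_mult ennreal_mult)
    also have "\<dots> = (\<integral>\<^sup>+ x. ennreal (norm (h x)) \<partial>M) * (\<integral>\<^sup>+ x. ennreal (norm (h x)) \<partial>M)"
      by (simp add: nn_integral_cmult nn_integral_multc)
    also have "\<dots> < \<infinity>" using h by (simp add: integrable_iff_bounded ennreal_mult_less_top)
    finally show "(\<integral>\<^sup>+ z. ennreal (norm (H z)) \<partial>?P) < \<infinity>" .
  qed measurable
  have int1: "integrable (N \<Otimes>\<^sub>M ?P) (\<lambda>(w,z). H z * E w z)"
  proof (rule integrableI_bounded)
    have "(\<integral>\<^sup>+ p. ennreal (norm ((\<lambda>(w,z). H z * E w z) p)) \<partial>(N \<Otimes>\<^sub>M ?P))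
        = (\<integral>\<^sup>+ w. \<integral>\<^sup>+ z. ennreal (norm (H z * E w z)) \<partial>?P \<partial>N)"
      by (subst Pfst[symmetric]) auto
    also have "\<dots> \<le> (\<integral>\<^sup>+ w. \<integral>\<^sup>+ z. ennreal (norm (H z)) \<partial>?P \<partial>N)"
    proof (intro nn_integral_mono ennreal_leI)
      fix w z show "norm (H z * E w z) \<le> norm (H z)"
        using e1[of w "fst z"] e1[of w "snd z"]
        by (simp add: E_def norm_mult mult_left_le mult_le_one)
    qed
    also have "\<dots> = (\<integral>\<^sup>+ z. ennreal (norm (H z)) \<partial>?P) * emeasure N (space N)" by simp
    also have "\<dots> < \<infinity>" using Hint N.emeasure_finite[of "space N", unfolded less_top]
      by (auto simp: integrable_iff_bounded ennreal_mult_less_top)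
    finally show "(\<integral>\<^sup>+ p. ennreal (norm ((\<lambda>(w,z). H z * E w z) p)) \<partial>(N \<Otimes>\<^sub>M ?P)) < \<infinity>" .
  qed measurable
  have sq: "complex_of_real ((norm (LINT x|M. h x * e w x))\<^sup>2) = (LINT z|?P. H z * E w z)" if w: "w \<in> space N" for w
  proof -
    have he: "integrable M (\<lambda>x. h x * e w x)"
      by (rule Bochner_Integration.integrable_bound[OF h]) (use w e1 in \<open>auto simp: norm_mult mult_left_le\<close>)
    have "integrable ?P (\<lambda>z. H z * E w z)"
    proof (rule Bochner_Integration.integrable_bound[OF Hint])
      show "AE z in ?P. norm (H z * E w z) \<le> norm (H z)"
        using e1[of w] by (auto simp: E_def norm_mult mult_left_le mult_le_one intro!: AE_I2)
      show "(\<lambda>z. H z * E w z) \<in> borel_measurable ?P" unfolding E_def using w by measurable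
    qed
    hence "(LINT z|?P. H z * E w z) = (LINT x|M. LINT y|M. H (x,y) * E w (x,y))"
      by (subst MM.integral_fst'[symmetric]) auto
    also have "\<dots> = (LINT x|M. LINT y|M. (h x * e w x) * cnj (h y * e w y))"
      by (simp add: H_def E_def mult_ac)
    also have "\<dots> = (LINT x|M. h x * e w x) * cnj (LINT x|M. h x * e w x)"
      using he by (simp add: integral_cnj[symmetric] del: complex_cnj_mult)
    finally show ?thesis by (simp only: complex_norm_square)
  qed
  have "integrable N (\<lambda>w. LINT z|?P. H z * E w z)"
    using NP.integrable_fst'[OF int1] by simp
  hence int2: "integrable N (\<lambda>w. complex_of_real ((norm (LINT x|M. h x * e w x))\<^sup>2))"
    by (rule Bochner_Integration.integrable_cong[THEN iffD1, rotated 2]) (auto simp: sq simp del: of_real_power)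
  hence int2': "integrable N (\<lambda>w. (norm (LINT x|M. h x * e w x))\<^sup>2)"
    using complex_of_real_integrable_eq by blast
  have "(\<integral>\<^sup>+ w. ennreal ((norm (LINT x|M. h x * e w x))\<^sup>2) \<partial>N)
      = ennreal (LINT w|N. (norm (LINT x|M. h x * e w x))\<^sup>2)"
    by (rule nn_integral_eq_integral[OF int2']) auto
  also have "ennreal (LINT w|N. (norm (LINT x|M. h x * e w x))\<^sup>2) \<le> ennreal (norm (LINT w|N. complex_of_real ((norm (LINT x|M. h x * e w x))\<^sup>2)))"
    by (intro ennreal_leI) (simp only: integral_complex_of_real norm_of_real abs_ge_self)
  also have "(LINT w|N. complex_of_real ((norm (LINT x|M. h x * e w x))\<^sup>2)) = (LINT w|N. LINT z|?P. H z * E w z)"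
    by (rule Bochner_Integration.integral_cong) (auto simp: sq simp del: of_real_power)
  also have "\<dots> = (LINT z|?P. LINT w|N. H z * E w z)"
    using NP.Fubini_integral[of "\<lambda>w z. H z * E w z"] int1 by (simp add: case_prod_beta')
  also have "\<dots> = (LINT z|?P. H z * k (fst z) (snd z))"
    by (simp add: k_def E_def)
  also have "ennreal (norm (LINT z|?P. H z * k (fst z) (snd z))) \<le> (\<integral>\<^sup>+ z. norm (H z * k (fst z) (snd z)) \<partial>?P)"
    by (rule integral_norm_bound_ennreal)
       (use NP.integrable_snd[OF int1] in \<open>simp add: k_def E_def\<close>)
  also have "\<dots> = (\<integral>\<^sup>+ x. \<integral>\<^sup>+ y. ennreal (norm (h x) * norm (h y) * norm (k x y)) \<partial>M \<partial>M)"
    by (subst M.nn_integral_fst[symmetric]) (auto simp: H_def norm_mult)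
  also have "\<dots> \<le> (\<integral>\<^sup>+ x. \<integral>\<^sup>+ y. (ennreal ((norm (h x))\<^sup>2 / 2) * (indicator {y. h y \<noteq> 0} y * ennreal (norm (k x y)))
       + ennreal ((norm (h y))\<^sup>2 / 2) * (indicator {x. h x \<noteq> 0} x * ennreal (norm (k y x)))) \<partial>M \<partial>M)"
  proof (intro nn_integral_mono)
    fix x y
    have "k y x = cnj (k x y)"
      using Bochner_Integration.integral_cnj[of N "\<lambda>w. e w x * cnj (e w y)"]
      by (simp add: k_def mult.commute)
    hence k: "norm (k y x) = norm (k x y)" by simp
    have "norm (h x) * norm (h y) \<le> (norm (h x))\<^sup>2 / 2 + (norm (h y))\<^sup>2 / 2"
      using sum_squares_bound[of "norm (h x)" "norm (h y)"] by simp
    hence "norm (h x) * norm (h y) * norm (k x y) \<le> ((norm (h x))\<^sup>2 / 2 + (norm (h y))\<^sup>2 / 2) * norm (k x y)"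
      by (intro mult_right_mono) auto
    thus "ennreal (norm (h x) * norm (h y) * norm (k x y)) \<le> ennreal ((norm (h x))\<^sup>2 / 2) * (indicator {y. h y \<noteq> 0} y * ennreal (norm (k x y)))
       + ennreal ((norm (h y))\<^sup>2 / 2) * (indicator {x. h x \<noteq> 0} x * ennreal (norm (k y x)))"
      unfolding k
      by (cases "h x = 0 \<or> h y = 0")
         (auto simp: ennreal_mult'[symmetric] ennreal_plus[symmetric] distrib_right simp del: ennreal_plus intro!: ennreal_leI)
  qed
  also have "\<dots> = (\<integral>\<^sup>+ x. \<integral>\<^sup>+ y. ennreal ((norm (h x))\<^sup>2 / 2) * (indicator {y. h y \<noteq> 0} y * ennreal (norm (k x y))) \<partial>M \<partial>M)
      + (\<integral>\<^sup>+ x. \<integral>\<^sup>+ y. ennreal ((norm (h y))\<^sup>2 / 2) * (indicator {x. h x \<noteq> 0} x * ennreal (norm (k y x))) \<partial>M \<partial>M)"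
    by (subst nn_integral_add[symmetric]) (auto intro!: nn_integral_cong nn_integral_add)
  also have "(\<integral>\<^sup>+ x. \<integral>\<^sup>+ y. ennreal ((norm (h y))\<^sup>2 / 2) * (indicator {x. h x \<noteq> 0} x * ennreal (norm (k y x))) \<partial>M \<partial>M)
      = (\<integral>\<^sup>+ y. \<integral>\<^sup>+ x. ennreal ((norm (h y))\<^sup>2 / 2) * (indicator {x. h x \<noteq> 0} x * ennreal (norm (k y x))) \<partial>M \<partial>M)"
    by (rule MM.Fubini') measurable
  also have "(\<integral>\<^sup>+ x. \<integral>\<^sup>+ y. ennreal ((norm (h x))\<^sup>2 / 2) * (indicator {y. h y \<noteq> 0} y * ennreal (norm (k x y))) \<partial>M \<partial>M)
      \<le> (\<integral>\<^sup>+ x. ennreal ((norm (h x))\<^sup>2 / 2) * B x \<partial>M)"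
  proof (intro nn_integral_mono)
    fix x assume x: "x \<in> space M"
    have "(\<integral>\<^sup>+ y. ennreal ((norm (h x))\<^sup>2 / 2) * (indicator {y. h y \<noteq> 0} y * ennreal (norm (k x y))) \<partial>M)
       = ennreal ((norm (h x))\<^sup>2 / 2) * (\<integral>\<^sup>+ y. (indicator {y. h y \<noteq> 0} y * ennreal (norm (k x y))) \<partial>M)"
      using x by (intro nn_integral_cmult) measurable
    also have "\<dots> \<le> ennreal ((norm (h x))\<^sup>2 / 2) * B x"
    proof (cases "h x = 0")
      case False
      thus ?thesis using B[OF x False] unfolding k_def by (intro mult_left_mono) auto
    qed auto
    finally show "(\<integral>\<^sup>+ y. ennreal ((norm (h x))\<^sup>2 / 2) * (indicator {y. h y \<noteq> 0} y * ennreal (norm (k x y))) \<partial>M)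
       \<le> ennreal ((norm (h x))\<^sup>2 / 2) * B x" .
  qed
  also have "(\<integral>\<^sup>+ x. ennreal ((norm (h x))\<^sup>2 / 2) * B x \<partial>M) + (\<integral>\<^sup>+ x. ennreal ((norm (h x))\<^sup>2 / 2) * B x \<partial>M)
     = (\<integral>\<^sup>+ x. ennreal ((norm (h x))\<^sup>2) * B x \<partial>M)"
    by (subst nn_integral_add[symmetric])
       (auto simp: distrib_right[symmetric] ennreal_plus[symmetric] simp del: ennreal_plus)
  finally show ?thesis by (simp add: add_mono add_left_mono)
qed

text \<open>The Fourier transform of the Gaussian weight with parameter e, by
  \<open>gaussian_fourier\<close>; as e tends to 0 it approximates 2 pi times a point mass.\<close>

definition gauss_hat :: "real \<Rightarrow> real \<Rightarrow> real" where
  "gauss_hat e y = sqrt (pi / e) * exp (- y\<^sup>2 / (4 * e))"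

lemma gauss_hat_nonneg [simp]: "e > 0 \<Longrightarrow> gauss_hat e y \<ge> 0"
  by (simp add: gauss_hat_def)

lemma gauss_hat_measurable [measurable]:
  "f \<in> borel_measurable M \<Longrightarrow> (\<lambda>x. gauss_hat e (f x)) \<in> borel_measurable M"
  unfolding gauss_hat_def by simp

lemma gauss_hat_mono: "e > 0 \<Longrightarrow> \<bar>x\<bar> \<le> \<bar>y\<bar> \<Longrightarrow> gauss_hat e y \<le> gauss_hat e x"
  unfolding gauss_hat_def
  by (intro mult_left_mono) (auto simp: field_simps abs_le_square_iff)

lemma gauss_hat_le: "e > 0 \<Longrightarrow> gauss_hat e y \<le> sqrt (pi / e)"
  unfolding gauss_hat_def by (intro mult_left_le) auto

text \<open>The value does not involve e. This is why kernel bounds obtained with a Gaussian weight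
  survive its removal.\<close>

lemma nn_integral_gauss_hat:
  assumes "e > 0" "c > 0"
  shows "(\<integral>\<^sup>+ x. ennreal (gauss_hat e (c * (x - x0))) \<partial>lborel) = ennreal (2 * pi / c)"
proof -
  let ?d = "c\<^sup>2 / (4 * e)"
  have d: "?d > 0" using assms by simp
  have "(\<integral>\<^sup>+ x. ennreal (gauss_hat e (c * (x - x0))) \<partial>lborel)
      = (\<integral>\<^sup>+ x. ennreal (gauss_hat e (c * x)) \<partial>lborel)"
    by (subst nn_integral_real_affine[where c=1 and t="x0"]) (auto simp: )
  also have "\<dots> = (\<integral>\<^sup>+ x. ennreal (sqrt (pi / e)) * ennreal (exp (- ?d * x\<^sup>2)) \<partial>lborel)"
    using assms by (auto simp: gauss_hat_def ennreal_mult'[symmetric] power_mult_distrib field_simps intro!: nn_integral_cong)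
  also have "\<dots> = ennreal (sqrt (pi / e)) * ennreal (sqrt (pi / ?d))"
    by (subst nn_integral_cmult) (use gaussian_integrable[OF d] in \<open>auto simp: nn_integral_eq_integral\<close>)
  also have "\<dots> = ennreal (sqrt (pi / e) * sqrt (pi / ?d))"
    using assms by (simp add: ennreal_mult')
  also have "sqrt (pi / e) * sqrt (pi / ?d) = sqrt ((2 * pi / c)\<^sup>2)"
    using assms by (simp add: real_sqrt_mult[symmetric] power2_eq_square field_simps)
  also have "\<dots> = 2 * pi / c" using assms by simp
  finally show ?thesis .
qed

text \<open>Fatou's lemma, used to remove the Gaussian weights that make the measure N of
  \<open>TTstar_bound\<close> finite.\<close>

lemma nn_integral_le_of_weights_tendsto_1:
  fixes w :: "nat \<Rightarrow> 'a \<Rightarrow> real" and f :: "'a \<Rightarrow> real"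
  assumes [measurable]: "\<And>n. w n \<in> borel_measurable M" "f \<in> borel_measurable M"
    and lim: "\<And>x. (\<lambda>n. w n x) \<longlonglongrightarrow> 1"
    and le: "\<And>n. (\<integral>\<^sup>+ x. ennreal (w n x * f x) \<partial>M) \<le> C"
  shows "(\<integral>\<^sup>+ x. ennreal (f x) \<partial>M) \<le> C"
proof -
  have "(\<integral>\<^sup>+ x. ennreal (f x) \<partial>M) = (\<integral>\<^sup>+ x. liminf (\<lambda>n. ennreal (w n x * f x)) \<partial>M)"
  proof (intro nn_integral_cong)
    fix x
    have "(\<lambda>n. ennreal (w n x * f x)) \<longlonglongrightarrow> ennreal (1 * f x)"
      by (intro tendsto_ennrealI tendsto_mult tendsto_const lim)
    thus "ennreal (f x) = liminf (\<lambda>n. ennreal (w n x * f x))"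
      using lim_imp_Liminf trivial_limit_sequentially by fastforce
  qed
  also have "\<dots> \<le> liminf (\<lambda>n. \<integral>\<^sup>+ x. ennreal (w n x * f x) \<partial>M)"
    by (rule nn_integral_liminf) measurable
  also have "\<dots> \<le> C"
    by (rule Liminf_le) (use le in auto)
  finally show ?thesis .
qed

section \<open>Plancherel and Hausdorff--Young for the phase t r^2\<close>

text \<open>In the variable \<open>u = r\<^sup>2\<close> this is a one-dimensional Fourier
  transform.\<close>

definition quad_ext :: "(real \<Rightarrow> complex) \<Rightarrow> real \<Rightarrow> complex" where
  "quad_ext h t = (LINT r|lborel. h r * iexp (t * r\<^sup>2))"

lemma quad_ext_measurable [measurable (raw)]:
  assumes "(\<lambda>(x, r). h x r) \<in> borel_measurable (M \<Otimes>\<^sub>M borel)" "f \<in> borel_measurable M"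
  shows "(\<lambda>x. quad_ext (h x) (f x)) \<in> borel_measurable M"
proof -
  have [measurable]: "(\<lambda>(x, r). h x r) \<in> borel_measurable (M \<Otimes>\<^sub>M lborel)"
    using assms(1) by simp
  show ?thesis unfolding quad_ext_def using assms(2) by measurable
qed

text \<open>Plancherel after the substitution \<open>u = r\<^sup>2\<close>, whose Jacobian 2 r is at
  least 2 on [1, 2]; the constant is 2 pi / 2. As a T T* argument: the kernel is
  \<open>gauss_hat e (r\<^sup>2 - s\<^sup>2)\<close>, and since \<open>r + s \<ge> 2\<close> it is
  dominated by \<open>gauss_hat e (2 * (s - r))\<close>, of mass pi for every e.\<close>

lemma quad_ext_L2:
  assumes h: "integrable lborel h" and supp: "\<And>r. r \<notin> {1..2} \<Longrightarrow> h r = 0"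
  shows "(\<integral>\<^sup>+ t. ennreal ((norm (quad_ext h t))\<^sup>2) \<partial>lborel) \<le> ennreal pi * (\<integral>\<^sup>+ r. ennreal ((norm (h r))\<^sup>2) \<partial>lborel)"
proof (rule nn_integral_le_of_weights_tendsto_1[where w = "\<lambda>n t. exp (- inverse (real (Suc n)) * t\<^sup>2)"])
  have hm [measurable]: "h \<in> borel_measurable lborel" using h by auto
  show "(\<lambda>n. exp (- inverse (real (Suc n)) * t\<^sup>2)) \<longlonglongrightarrow> 1" for t
  proof -
    have "(\<lambda>n. exp (- inverse (real (Suc n)) * t\<^sup>2)) \<longlonglongrightarrow> exp (- 0 * t\<^sup>2)"
      by (intro tendsto_intros LIMSEQ_inverse_real_of_nat)
    thus ?thesis by simp
  qed
  fix n :: nat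
  define e where "e = inverse (real (Suc n))"
  have e: "e > 0" by (simp add: e_def)
  define N where "N = density lborel (\<lambda>t. ennreal (exp (- e * t\<^sup>2)))"
  have N: "finite_measure N"
    unfolding N_def by (rule finite_measureI) (use gaussian_integrable[OF e] in \<open>auto simp: emeasure_density nn_integral_eq_integral\<close>)
  have sets_N [simp, measurable_cong]: "sets N = sets borel" by (simp add: N_def)
  have "(\<integral>\<^sup>+ t. ennreal (exp (- e * t\<^sup>2) * (norm (quad_ext h t))\<^sup>2) \<partial>lborel)
      = (\<integral>\<^sup>+ t. ennreal ((norm (quad_ext h t))\<^sup>2) \<partial>N)"
    unfolding N_def by (subst nn_integral_density) (auto simp: ennreal_mult')
  also have "\<dots> \<le> (\<integral>\<^sup>+ r. ennreal ((norm (h r))\<^sup>2) * ennreal pi \<partial>lborel)"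
    unfolding quad_ext_def
  proof (rule TTstar_bound[OF N _ h])
    show "sigma_finite_measure (lborel :: real measure)" by (rule lborel.sigma_finite_measure_axioms)
    show "(\<lambda>(w, x). iexp (w * x\<^sup>2)) \<in> borel_measurable (N \<Otimes>\<^sub>M lborel)" by measurable
    fix r assume "h r \<noteq> 0"
    hence r: "r \<ge> 1" using supp[of r] by fastforce
    have k: "(LINT t|N. iexp (t * r\<^sup>2) * cnj (iexp (t * s\<^sup>2))) = complex_of_real (gauss_hat e (r\<^sup>2 - s\<^sup>2))" for s
    proof -
      have "(LINT t|N. iexp (t * r\<^sup>2) * cnj (iexp (t * s\<^sup>2)))
          = (LINT t|lborel. complex_of_real (exp (- e * t\<^sup>2)) * iexp (t * (r\<^sup>2 - s\<^sup>2)))"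
        unfolding N_def by (subst integral_density)
          (auto simp: scaleR_conv_of_real exp_cnj exp_add[symmetric] algebra_simps)
      thus ?thesis using gaussian_fourier[OF e, of "r\<^sup>2 - s\<^sup>2"] by (simp add: gauss_hat_def)
    qed
    have "(\<integral>\<^sup>+ s. indicator {s. h s \<noteq> 0} s * ennreal (norm (LINT t|N. iexp (t * r\<^sup>2) * cnj (iexp (t * s\<^sup>2)))) \<partial>lborel)
      \<le> (\<integral>\<^sup>+ s. ennreal (gauss_hat e (2 * (s - r))) \<partial>lborel)"
    proof (intro nn_integral_mono)
      fix s
      show "indicator {s. h s \<noteq> 0} s * ennreal (norm (LINT t|N. iexp (t * r\<^sup>2) * cnj (iexp (t * s\<^sup>2))))
         \<le> ennreal (gauss_hat e (2 * (s - r)))"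
      proof (cases "h s = 0")
        case False
        hence s: "s \<ge> 1" using supp[of s] by fastforce
        have "\<bar>2 * (s - r)\<bar> \<le> (r + s) * \<bar>s - r\<bar>"
          unfolding abs_mult using r s by (intro mult_right_mono) auto
        also have "\<dots> = \<bar>r\<^sup>2 - s\<^sup>2\<bar>"
          using r s by (simp add: abs_mult abs_minus_commute power2_eq_square square_diff_square_factored)
        finally have "gauss_hat e (r\<^sup>2 - s\<^sup>2) \<le> gauss_hat e (2 * (s - r))" by (rule gauss_hat_mono[OF e])
        thus ?thesis unfolding k using e False by (simp add: ennreal_leI)
      qed simp
    qed
    also have "\<dots> = ennreal pi" by (subst nn_integral_gauss_hat) (use e in auto)
    finally show "(\<integral>\<^sup>+ s. indicator {s. h s \<noteq> 0} s * ennreal (norm (LINT t|N. iexp (t * r\<^sup>2) * cnj (iexp (t * s\<^sup>2)))) \<partial>lborel) \<le> ennreal pi" .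
  qed (auto simp: norm_mult)
  also have "\<dots> = ennreal pi * (\<integral>\<^sup>+ r. ennreal ((norm (h r))\<^sup>2) \<partial>lborel)"
    by (subst nn_integral_multc) (auto simp: mult.commute)
  finally show "(\<integral>\<^sup>+ t. ennreal (exp (- inverse (real (Suc n)) * t\<^sup>2) * (norm (quad_ext h t))\<^sup>2) \<partial>lborel)
     \<le> ennreal pi * (\<integral>\<^sup>+ r. ennreal ((norm (h r))\<^sup>2) \<partial>lborel)" by (simp add: e_def)
qed (use h in measurable)

lemma integrable_of_Lp:
  fixes h :: "real \<Rightarrow> complex"
  assumes p: "p \<ge> 1" and h [measurable]: "h \<in> borel_measurable borel" and supp: "\<And>r. r \<notin> {a..b} \<Longrightarrow> h r = 0"
    and fin: "(\<integral>\<^sup>+ r. ennreal (norm (h r) powr p) \<partial>lborel) < \<infinity>"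
  shows "integrable lborel h"
proof (rule integrableI_bounded)
  have "(\<integral>\<^sup>+ r. ennreal (norm (h r)) \<partial>lborel) \<le> (\<integral>\<^sup>+ r. indicator {a..b} r + ennreal (norm (h r) powr p) \<partial>lborel)"
  proof (intro nn_integral_mono)
    fix r
    have "norm (h r) \<le> 1 + norm (h r) powr p"
    proof (cases "norm (h r) \<le> 1")
      case False
      hence "norm (h r) powr 1 \<le> norm (h r) powr p" using p by (intro powr_mono) auto
      thus ?thesis using False by simp
    qed (simp add: add_increasing2)
    thus "ennreal (norm (h r)) \<le> indicator {a..b} r + ennreal (norm (h r) powr p)"
      using supp[of r] by (cases "r \<in> {a..b}") (auto simp: ennreal_1[symmetric] ennreal_plus[symmetric] simp del: ennreal_1 ennreal_plus intro!: ennreal_leI)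
  qed
  also have "\<dots> = emeasure lborel {a..b} + (\<integral>\<^sup>+ r. ennreal (norm (h r) powr p) \<partial>lborel)"
    by (subst nn_integral_add) auto
  also have "\<dots> < \<infinity>" using fin by (auto simp: emeasure_lborel_Icc_eq)
  finally show "(\<integral>\<^sup>+ r. ennreal (norm (h r)) \<partial>lborel) < \<infinity>" .
qed measurable

text \<open>The layer-cake formula: \<open>a powr b\<close> is b times this integral.\<close>

lemma nn_integral_powr_layer:
  fixes a b :: real
  assumes "a \<ge> 0" "b > 0"
  shows "(\<integral>\<^sup>+ l. indicator {0<..a} l * ennreal (l powr (b - 1)) \<partial>lborel) = ennreal (a powr b / b)"
proof -
  have "((\<lambda>x. x powr (b - 1)) has_integral (a powr (b - 1 + 1) / (b - 1 + 1))) {0..a}"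
    by (rule has_integral_powr_from_0) (use assms in auto)
  hence "(\<integral>\<^sup>+ l. ennreal (l powr (b - 1) * indicator {0..a} l) \<partial>lborel) = ennreal (a powr b / b)"
    using nn_integral_has_integral_lebesgue[of "{0..a}" "\<lambda>x. x powr (b - 1)"] assms by (simp add: mult.commute)
  also have "(\<integral>\<^sup>+ l. ennreal (l powr (b - 1) * indicator {0..a} l) \<partial>lborel)
     = (\<integral>\<^sup>+ l. indicator {0<..a} l * ennreal (l powr (b - 1)) \<partial>lborel)"
    by (intro nn_integral_cong_AE AE_I[of _ _ "{0}"]) (auto simp: indicator_def)
  finally show ?thesis .
qed

text \<open>Marcinkiewicz interpolation between the trivial bound from L^1 to L^\<infinity> and
  \<open>quad_ext_L2\<close>. For each level l the density is cut at a height \<open>s l\<close>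
  such that, when the L^p norm is at most 1, the part above the cut contributes at most l / 2 at
  every t; the part below is estimated in L^2.\<close>

lemma hausdorff_young_quad:
  fixes p :: real
  assumes p: "1 < p" "p \<le> 2"
  shows "\<exists>C>0. \<forall>h A. h \<in> borel_measurable borel \<longrightarrow> (\<forall>r. r \<notin> {1..2} \<longrightarrow> h r = 0) \<longrightarrow> A > 0 \<longrightarrow>
     (\<integral>\<^sup>+ r. ennreal (norm (h r) powr p) \<partial>lborel) \<le> ennreal (A powr p) \<longrightarrow>
     (\<integral>\<^sup>+ t. ennreal (norm (quad_ext h t) powr (p / (p - 1))) \<partial>lborel) \<le> ennreal (C * A powr (p / (p - 1)))"
proof (cases "p = 2")
  \<comment> \<open>At \<open>p = 2\<close> the interpolation constant would be infinite, but the
    claim is \<open>quad_ext_L2\<close> itself.\<close>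
  case True
  show ?thesis
  proof (intro exI[of _ pi] conjI allI impI pi_gt_zero)
    fix h :: "real \<Rightarrow> complex" and A :: real
    assume h [measurable]: "h \<in> borel_measurable borel" and supp: "\<forall>r. r \<notin> {1..2} \<longrightarrow> h r = (0::complex)" and A: "A > 0"
      and le: "(\<integral>\<^sup>+ r. ennreal (norm (h r) powr p) \<partial>lborel) \<le> ennreal (A powr p)"
    have "integrable lborel h" using integrable_of_Lp[of p h 1 2] p h supp le_less_trans[OF le ennreal_less_top] by auto
    from quad_ext_L2[OF this] have "(\<integral>\<^sup>+ t. ennreal ((norm (quad_ext h t))\<^sup>2) \<partial>lborel) \<le> ennreal pi * (\<integral>\<^sup>+ r. ennreal ((norm (h r))\<^sup>2) \<partial>lborel)"
      using supp by auto
    also have "\<dots> \<le> ennreal pi * ennreal (A powr 2)"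
      using le True by (intro mult_left_mono) auto
    finally show "(\<integral>\<^sup>+ t. ennreal (norm (quad_ext h t) powr (p / (p - 1))) \<partial>lborel) \<le> ennreal (pi * A powr (p / (p - 1)))"
      using True by (simp add: ennreal_mult')
  qed
next
  case False
  hence p2: "p < 2" using p by simp
  define q where "q = p / (p - 1)"
  have q: "q > 2" "(p - 1) * (q - 2) = 2 - p" "(p - 1) * (q - 1) = 1" "p - 1 > 0" "q - 1 > 0"
    using p p2 by (auto simp: q_def field_simps)
  \<comment> \<open>The factor q is from the layer-cake formula, 4 pi from the L^2 bound at level l
    / 2, and the rest from integrating \<open>l powr (q - 3)\<close> up to
    \<open>2 * norm (h r) powr (1 - p)\<close>.\<close>
  define C where "C = q * (4 * pi * 2 powr (q - 2) / (q - 2))"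
  have C: "C > 0" using q by (simp add: C_def)
  have key: "(\<integral>\<^sup>+ t. ennreal (norm (quad_ext h t) powr q) \<partial>lborel) \<le> ennreal C"
    if h [measurable]: "h \<in> borel_measurable borel" and supp: "\<And>r. r \<notin> {1..2} \<Longrightarrow> h r = (0::complex)"
      and le: "(\<integral>\<^sup>+ r. ennreal (norm (h r) powr p) \<partial>lborel) \<le> 1" for h :: "real \<Rightarrow> complex"
  proof -
    have hint: "integrable lborel h" using integrable_of_Lp[of p h 1 2] p h supp le_less_trans[OF le ennreal_one_less_top] by auto
    \<comment> \<open>The cut solves \<open>s l powr (1 - p) = l / 2\<close>.\<close>
    define s where "s l = (l / 2) powr (- 1 / (p - 1))" for l :: real
    have "- 1 / (p - 1) * (1 - p) = 1" using q by (simp add: field_simps)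
    hence s_powr: "s l powr (1 - p) = l / 2" if "l > 0" for l
      using that unfolding s_def powr_powr by simp
    have [measurable]: "s \<in> borel_measurable borel" unfolding s_def by measurable
    define lo where "lo l r = (if norm (h r) \<le> s l then h r else 0)" for l r
    have lom: "(\<lambda>(x, r). lo x r) \<in> borel_measurable (borel \<Otimes>\<^sub>M borel)"
      unfolding lo_def by measurable
    have [measurable]: "(\<lambda>r. lo l r) \<in> borel_measurable borel" for l unfolding lo_def by measurable
    have [measurable]: "(\<lambda>x. quad_ext (lo (f x)) (g x)) \<in> borel_measurable M"
      if [measurable]: "f \<in> borel_measurable M" "g \<in> borel_measurable M" for f g and M :: "'m measure"
    proof (rule quad_ext_measurable)
      show "(\<lambda>(x, r). lo (f x) r) \<in> borel_measurable (M \<Otimes>\<^sub>M borel)" unfolding lo_def by measurable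
    qed fact
    have lo_int: "integrable lborel (lo l)" for l
      by (rule Bochner_Integration.integrable_bound[OF hint]) (auto simp: lo_def)
    have [measurable]: "quad_ext h \<in> borel_measurable borel" by measurable
    have hi: "norm (quad_ext h t - quad_ext (lo l) t) \<le> l / 2" if l: "l > 0" for l t
    proof -
      have sl: "s l > 0" using l by (simp add: s_def)
      have ml: "integrable lborel (\<lambda>r. u r * iexp (t * r\<^sup>2))" if u: "integrable lborel u" for u :: "real \<Rightarrow> complex"
      proof -
        have [measurable]: "u \<in> borel_measurable borel" using u by auto
        show ?thesis by (rule Bochner_Integration.integrable_bound[OF u]) (auto simp: norm_mult)
      qed
      have "quad_ext h t - quad_ext (lo l) t = (LINT r|lborel. (h r - lo l r) * iexp (t * r\<^sup>2))"
        unfolding quad_ext_def left_diff_distrib by (intro Bochner_Integration.integral_diff[symmetric] ml hint lo_int)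
      hence "ennreal (norm (quad_ext h t - quad_ext (lo l) t)) \<le> (\<integral>\<^sup>+ r. norm ((h r - lo l r) * iexp (t * r\<^sup>2)) \<partial>lborel)"
        by (simp only:) (intro integral_norm_bound_ennreal ml Bochner_Integration.integrable_diff hint lo_int)
      also have "\<dots> \<le> (\<integral>\<^sup>+ r. ennreal (s l powr (1 - p)) * ennreal (norm (h r) powr p) \<partial>lborel)"
      proof (intro nn_integral_mono)
        fix r
        have "norm (h r) \<le> s l powr (1 - p) * norm (h r) powr p" if "norm (h r) > s l"
        proof -
          have "norm (h r) powr (1 - p) \<le> s l powr (1 - p)"
            using that p sl by (intro powr_mono2') auto
          hence "norm (h r) powr (1 - p) * norm (h r) powr p \<le> s l powr (1 - p) * norm (h r) powr p"
            by (intro mult_right_mono) auto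
          moreover have "norm (h r) powr (1 - p) * norm (h r) powr p = norm (h r)"
            using that sl by (subst powr_add[symmetric]) auto
          ultimately show ?thesis by simp
        qed
        thus "ennreal (norm ((h r - lo l r) * iexp (t * r\<^sup>2))) \<le> ennreal (s l powr (1 - p)) * ennreal (norm (h r) powr p)"
          by (auto simp: lo_def norm_mult ennreal_mult'[symmetric] intro!: ennreal_leI)
      qed
      also have "\<dots> = ennreal (s l powr (1 - p)) * (\<integral>\<^sup>+ r. ennreal (norm (h r) powr p) \<partial>lborel)"
        by (rule nn_integral_cmult) measurable
      also have "\<dots> \<le> ennreal (s l powr (1 - p)) * 1" by (intro mult_left_mono le) auto
      also have "s l powr (1 - p) = l / 2"
        using l by (rule s_powr)
      finally show ?thesis using l by (simp add: ennreal_le_iff)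
    qed
    have "(\<integral>\<^sup>+ t. ennreal (norm (quad_ext h t) powr q) \<partial>lborel)
        = (\<integral>\<^sup>+ t. ennreal q * (\<integral>\<^sup>+ l. indicator {0<..norm (quad_ext h t)} l * ennreal (l powr (q - 1)) \<partial>lborel) \<partial>lborel)"
      using q by (subst nn_integral_powr_layer) (auto simp: ennreal_mult'[symmetric])
    \<comment> \<open>Where l is at most \<open>norm (quad_ext h t)\<close>, the low part has
      modulus at least l / 2, and \<open>l powr (q - 1)\<close> is traded for
      \<open>4 * l powr (q - 3)\<close> times its square.\<close>
    also have "\<dots> \<le> (\<integral>\<^sup>+ t. ennreal q * (\<integral>\<^sup>+ l. indicator {0<..} l * ennreal (4 * l powr (q - 3) * (norm (quad_ext (lo l) t))\<^sup>2) \<partial>lborel) \<partial>lborel)"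
    proof (intro nn_integral_mono mult_left_mono)
      fix t l :: real
      show "indicator {0<..norm (quad_ext h t)} l * ennreal (l powr (q - 1))
          \<le> indicator {0<..} l * ennreal (4 * l powr (q - 3) * (norm (quad_ext (lo l) t))\<^sup>2)"
      proof (cases "0 < l \<and> l \<le> norm (quad_ext h t)")
        case True
        hence "l / 2 \<le> norm (quad_ext (lo l) t)"
          using hi[of l t] norm_triangle_ineq2[of "quad_ext h t" "quad_ext (lo l) t"] by linarith
        hence "(l / 2)\<^sup>2 \<le> (norm (quad_ext (lo l) t))\<^sup>2" using True by (intro power_mono) auto
        hence "l powr (q - 3) * l\<^sup>2 \<le> l powr (q - 3) * (4 * (norm (quad_ext (lo l) t))\<^sup>2)"
          by (intro mult_left_mono) (auto simp: power_divide)
        moreover have "l powr (q - 3) * l\<^sup>2 = l powr (q - 1)"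
          using True by (simp add: powr_numeral[symmetric] powr_add[symmetric] del: powr_numeral)
        ultimately have "l powr (q - 1) \<le> l powr (q - 3) * (4 * (norm (quad_ext (lo l) t))\<^sup>2)"
          by (simp only:)
        thus ?thesis using True by (auto intro!: ennreal_leI simp: mult_ac)
      qed (auto simp: indicator_def)
    qed auto
    also have "\<dots> = ennreal q * (\<integral>\<^sup>+ t. \<integral>\<^sup>+ l. indicator {0<..} l * ennreal (4 * l powr (q - 3) * (norm (quad_ext (lo l) t))\<^sup>2) \<partial>lborel \<partial>lborel)"
      by (rule nn_integral_cmult) measurable
    also have "(\<integral>\<^sup>+ t. \<integral>\<^sup>+ l. indicator {0<..} l * ennreal (4 * l powr (q - 3) * (norm (quad_ext (lo l) t))\<^sup>2) \<partial>lborel \<partial>lborel)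
       = (\<integral>\<^sup>+ l. \<integral>\<^sup>+ t. indicator {0<..} l * ennreal (4 * l powr (q - 3) * (norm (quad_ext (lo l) t))\<^sup>2) \<partial>lborel \<partial>lborel)"
      by (rule lborel_pair.Fubini') measurable
    also have "\<dots> \<le> (\<integral>\<^sup>+ l. \<integral>\<^sup>+ r. indicator {0<..} l * ennreal (4 * l powr (q - 3)) * ennreal pi * ennreal ((norm (lo l r))\<^sup>2) \<partial>lborel \<partial>lborel)"
    proof (rule nn_integral_mono)
      fix l :: real
      have "(\<integral>\<^sup>+ t. indicator {0<..} l * ennreal (4 * l powr (q - 3) * (norm (quad_ext (lo l) t))\<^sup>2) \<partial>lborel)
        = indicator {0<..} l * ennreal (4 * l powr (q - 3)) * (\<integral>\<^sup>+ t. ennreal ((norm (quad_ext (lo l) t))\<^sup>2) \<partial>lborel)"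
        by (subst nn_integral_cmult[symmetric]) (auto simp: ennreal_mult' mult_ac)
      also have "\<dots> \<le> indicator {0<..} l * ennreal (4 * l powr (q - 3)) * (ennreal pi * (\<integral>\<^sup>+ r. ennreal ((norm (lo l r))\<^sup>2) \<partial>lborel))"
        by (intro mult_left_mono quad_ext_L2 lo_int) (auto simp: lo_def supp)
      also have "\<dots> = (\<integral>\<^sup>+ r. indicator {0<..} l * ennreal (4 * l powr (q - 3)) * ennreal pi * ennreal ((norm (lo l r))\<^sup>2) \<partial>lborel)"
        by (subst nn_integral_cmult) (auto simp: mult_ac)
      finally show "(\<integral>\<^sup>+ t. indicator {0<..} l * ennreal (4 * l powr (q - 3) * (norm (quad_ext (lo l) t))\<^sup>2) \<partial>lborel) \<le> \<dots>" .
    qed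
    also have "\<dots> = (\<integral>\<^sup>+ r. \<integral>\<^sup>+ l. indicator {0<..} l * ennreal (4 * l powr (q - 3)) * ennreal pi * ennreal ((norm (lo l r))\<^sup>2) \<partial>lborel \<partial>lborel)"
      unfolding lo_def by (rule lborel_pair.Fubini') measurable
    also have "\<dots> \<le> (\<integral>\<^sup>+ r. ennreal (4 * pi * 2 powr (q - 2) / (q - 2)) * ennreal (norm (h r) powr p) \<partial>lborel)"
    proof (intro nn_integral_mono)
      fix r :: real
      show "(\<integral>\<^sup>+ l. indicator {0<..} l * ennreal (4 * l powr (q - 3)) * ennreal pi * ennreal ((norm (lo l r))\<^sup>2) \<partial>lborel)
         \<le> ennreal (4 * pi * 2 powr (q - 2) / (q - 2)) * ennreal (norm (h r) powr p)"
      proof (cases "h r = 0")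
        case False
        \<comment> \<open>For fixed r the low part can be nonzero only at levels l up to c.\<close>
        define c where "c = 2 * norm (h r) powr (1 - p)"
        have c: "c > 0" using False by (simp add: c_def)
        have iff: "norm (h r) \<le> s l \<Longrightarrow> l \<le> c" if "l > 0" for l
        proof -
          assume "norm (h r) \<le> s l"
          hence "s l powr (1 - p) \<le> norm (h r) powr (1 - p)" using p False by (intro powr_mono2') auto
          moreover have "s l powr (1 - p) = l / 2" using that by (rule s_powr)
          ultimately show "l \<le> c" by (simp add: c_def)
        qed
        have "(\<integral>\<^sup>+ l. indicator {0<..} l * ennreal (4 * l powr (q - 3)) * ennreal pi * ennreal ((norm (lo l r))\<^sup>2) \<partial>lborel)
          \<le> (\<integral>\<^sup>+ l. ennreal (4 * pi * (norm (h r))\<^sup>2) * (indicator {0<..c} l * ennreal (l powr (q - 2 - 1))) \<partial>lborel)"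
          by (intro nn_integral_mono) (auto simp: lo_def indicator_def ennreal_mult'[symmetric] mult_ac dest: iff)
        also have "\<dots> = ennreal (4 * pi * (norm (h r))\<^sup>2) * ennreal (c powr (q - 2) / (q - 2))"
          using nn_integral_powr_layer[of c "q - 2"] c q by (subst nn_integral_cmult) auto
        also have "\<dots> = ennreal (4 * pi * (norm (h r))\<^sup>2 * (c powr (q - 2) / (q - 2)))"
          by (rule ennreal_mult'[symmetric]) (use q in auto)
        also have "c powr (q - 2) = 2 powr (q - 2) * norm (h r) powr (p - 2)"
        proof -
          have "(1 - p) * (q - 2) = p - 2" using q(2) by (simp add: algebra_simps)
          thus ?thesis by (simp add: c_def powr_mult powr_powr)
        qed
        also have "4 * pi * (norm (h r))\<^sup>2 * (2 powr (q - 2) * norm (h r) powr (p - 2) / (q - 2))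
           = 4 * pi * 2 powr (q - 2) / (q - 2) * (norm (h r) powr 2 * norm (h r) powr (p - 2))"
          by simp
        also have "norm (h r) powr 2 * norm (h r) powr (p - 2) = norm (h r) powr p"
          by (simp only: powr_add[symmetric]) simp
        finally show ?thesis using q by (simp add: ennreal_mult'[symmetric] mult_ac)
      next
        case True
        hence "lo l r = 0" for l by (simp add: lo_def)
        thus ?thesis by simp
      qed
    qed
    also have "\<dots> = ennreal (4 * pi * 2 powr (q - 2) / (q - 2)) * (\<integral>\<^sup>+ r. ennreal (norm (h r) powr p) \<partial>lborel)"
      by (rule nn_integral_cmult) measurable
    also have "\<dots> \<le> ennreal (4 * pi * 2 powr (q - 2) / (q - 2)) * 1"
      by (intro mult_left_mono le) auto
    finally show ?thesis unfolding C_def using q by (subst ennreal_mult) (auto simp: mult_left_mono)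
  qed
  show ?thesis
  proof (intro exI[of _ C] conjI allI impI C)
    fix h :: "real \<Rightarrow> complex" and A :: real
    assume h [measurable]: "h \<in> borel_measurable borel" and supp: "\<forall>r. r \<notin> {1..2} \<longrightarrow> h r = (0::complex)" and A: "A > 0"
      and le: "(\<integral>\<^sup>+ r. ennreal (norm (h r) powr p) \<partial>lborel) \<le> ennreal (A powr p)"
    \<comment> \<open>By homogeneity it suffices to treat h / A, whose L^p norm is at most
      1.\<close>
    define h' where "h' r = h r / complex_of_real A" for r
    have [measurable]: "h' \<in> borel_measurable borel" unfolding h'_def by measurable
    have "(\<integral>\<^sup>+ r. ennreal (norm (h' r) powr p) \<partial>lborel) = (\<integral>\<^sup>+ r. ennreal (norm (h r) powr p) * ennreal (1 / A powr p) \<partial>lborel)"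
      using A by (intro nn_integral_cong) (auto simp: h'_def norm_divide powr_divide ennreal_mult'[symmetric])
    also have "\<dots> = (\<integral>\<^sup>+ r. ennreal (norm (h r) powr p) \<partial>lborel) * ennreal (1 / A powr p)"
      by (rule nn_integral_multc) measurable
    also have "\<dots> \<le> ennreal (A powr p) * ennreal (1 / A powr p)" by (intro mult_right_mono le) auto
    also have "\<dots> = 1" using A by (simp add: ennreal_mult'[symmetric])
    finally have "(\<integral>\<^sup>+ t. ennreal (norm (quad_ext h' t) powr q) \<partial>lborel) \<le> ennreal C"
      by (intro key) (use supp in \<open>auto simp: h'_def\<close>)
    moreover have "quad_ext h t = complex_of_real A * quad_ext h' t" for t
      using A unfolding quad_ext_def h'_def
      by (subst integral_mult_right_zero[symmetric]) simp
    hence "(\<integral>\<^sup>+ t. ennreal (norm (quad_ext h t) powr q) \<partial>lborel) = (\<integral>\<^sup>+ t. ennreal (A powr q) * ennreal (norm (quad_ext h' t) powr q) \<partial>lborel)"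
      using A by (auto simp: norm_mult powr_mult ennreal_mult'[symmetric])
    moreover have "\<dots> = ennreal (A powr q) * (\<integral>\<^sup>+ t. ennreal (norm (quad_ext h' t) powr q) \<partial>lborel)"
      by (rule nn_integral_cmult) (unfold h'_def, measurable)
    ultimately show "(\<integral>\<^sup>+ t. ennreal (norm (quad_ext h t) powr (p / (p - 1))) \<partial>lborel) \<le> ennreal (C * A powr (p / (p - 1)))"
      using C by (simp add: q_def[symmetric] ennreal_mult mult.commute[of "ennreal C"] mult_left_mono)
  qed
qed

section \<open>Orthogonality of products: the L^4 estimate with loss R^\<eta>\<close>

text \<open>The factor 1/2 is the Jacobian; the substitution is made one variable at a time.\<close>

lemma nn_integral_sum_diff:
  fixes f :: "real \<Rightarrow> real \<Rightarrow> ennreal"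
  assumes f [measurable]: "(\<lambda>(a, b). f a b) \<in> borel_measurable (lborel \<Otimes>\<^sub>M lborel)"
  shows "(\<integral>\<^sup>+ r. \<integral>\<^sup>+ s. f (r + s) (r - s) \<partial>lborel \<partial>lborel) = ennreal (1/2) * (\<integral>\<^sup>+ a. \<integral>\<^sup>+ b. f a b \<partial>lborel \<partial>lborel)"
proof -
  have f' [measurable]: "(\<lambda>x. f (u x) (v x)) \<in> borel_measurable M"
    if "u \<in> borel_measurable M" "v \<in> borel_measurable M" for u v and M :: "'m measure"
    using measurable_compose[OF _ f, of "\<lambda>x. (u x, v x)" M] that by simp
  have "(\<integral>\<^sup>+ r. \<integral>\<^sup>+ s. f (r + s) (r - s) \<partial>lborel \<partial>lborel) = (\<integral>\<^sup>+ s. \<integral>\<^sup>+ r. f (r + s) (r - s) \<partial>lborel \<partial>lborel)"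
    by (rule lborel_pair.Fubini'[symmetric]) measurable
  also have "\<dots> = (\<integral>\<^sup>+ s. \<integral>\<^sup>+ b. f (2 * s + b) b \<partial>lborel \<partial>lborel)"
  proof (rule nn_integral_cong)
    fix s :: real
    show "(\<integral>\<^sup>+ r. f (r + s) (r - s) \<partial>lborel) = (\<integral>\<^sup>+ b. f (2 * s + b) b \<partial>lborel)"
      by (subst nn_integral_real_affine[where c = 1 and t = s]) (auto simp: algebra_simps)
  qed
  also have "\<dots> = (\<integral>\<^sup>+ b. \<integral>\<^sup>+ s. f (2 * s + b) b \<partial>lborel \<partial>lborel)"
    by (rule lborel_pair.Fubini'[symmetric]) measurable
  also have "\<dots> = (\<integral>\<^sup>+ b. ennreal (1/2) * (\<integral>\<^sup>+ a. f a b \<partial>lborel) \<partial>lborel)"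
  proof (rule nn_integral_cong)
    fix b :: real
    show "(\<integral>\<^sup>+ s. f (2 * s + b) b \<partial>lborel) = ennreal (1/2) * (\<integral>\<^sup>+ a. f a b \<partial>lborel)"
      by (subst nn_integral_real_affine[where c = "1/2" and t = "- b / 2"]) (auto simp: algebra_simps)
  qed
  also have "\<dots> = ennreal (1/2) * (\<integral>\<^sup>+ b. \<integral>\<^sup>+ a. f a b \<partial>lborel \<partial>lborel)"
    by (rule nn_integral_cmult) measurable
  also have "(\<integral>\<^sup>+ b. \<integral>\<^sup>+ a. f a b \<partial>lborel \<partial>lborel) = (\<integral>\<^sup>+ a. \<integral>\<^sup>+ b. f a b \<partial>lborel \<partial>lborel)"
    by (rule lborel_pair.Fubini') measurable
  finally show ?thesis .
qed

text \<open>In \<open>quad_kernel_le_B\<close> this lets exponential decay absorb the large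
  prefactors R and 1 / sqrt e.\<close>

lemma abs_mult_exp_neg_sq_le: "(y::real) * exp (- y\<^sup>2) \<le> 1"
proof -
  have "0 \<le> (y - 1 / 2)\<^sup>2" by simp
  hence "y \<le> 1 + y\<^sup>2" unfolding power2_diff by (simp add: power_divide)
  also have "\<dots> \<le> exp (y\<^sup>2)" by (rule exp_ge_add_one_self)
  finally show ?thesis by (simp add: exp_minus field_simps)
qed

text \<open>
  The kernel of the \<open>T T\<^sup>*\<close> argument for squares of \<open>quad_ext\<close>, at the frequency pairs \<open>(r, s)\<close> and
  \<open>(r', s')\<close> in the coordinates \<open>A = r + s\<close>, \<open>B = r - s\<close>, \<open>a = r' + s'\<close>, \<open>b = r' - s'\<close>: the first factor
  comes from integrating in \<open>t\<close> against a Gaussian weight, the second from \<open>\<bar>\<rho>\<bar> \<lesssim> R\<close>.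
\<close>

definition quad_kernel :: "real \<Rightarrow> real \<Rightarrow> real \<Rightarrow> real \<Rightarrow> real \<Rightarrow> real \<Rightarrow> ennreal" where
  "quad_kernel e R A B a b = indicator {2..4} a * indicator {-1..1} b *
     ennreal (gauss_hat e ((A\<^sup>2 + B\<^sup>2 - a\<^sup>2 - b\<^sup>2) / 2) * gauss_hat (1 / R\<^sup>2) (A - a))"

context
  fixes e R A B :: real
  assumes e: "e > 0" and R: "R \<ge> 1" and A: "A \<ge> 2" "A \<le> 4" and B: "\<bar>B\<bar> \<le> 1"
begin

text \<open>For fixed b the argument vanishes in a at
  \<open>c = sqrt (A\<^sup>2 + B\<^sup>2 - b\<^sup>2)\<close>, and it factors as (a + c) / 2 times
  the distance to c, where \<open>a \<ge> 2\<close> makes the first factor at least 1.\<close>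

lemma quad_kernel_a_bound:
  assumes a: "2 \<le> a" and b: "\<bar>b\<bar> \<le> 1"
  shows "gauss_hat e ((A\<^sup>2 + B\<^sup>2 - a\<^sup>2 - b\<^sup>2) / 2) \<le> gauss_hat e (1 * (a - sqrt (A\<^sup>2 + B\<^sup>2 - b\<^sup>2)))"
proof (rule gauss_hat_mono[OF e])
  define c where "c = sqrt (A\<^sup>2 + B\<^sup>2 - b\<^sup>2)"
  have "b\<^sup>2 \<le> 1" using b by (simp add: abs_square_le_1)
  moreover have "4 \<le> A\<^sup>2" using power_mono[of 2 A 2] A by simp
  ultimately have nn: "0 \<le> A\<^sup>2 + B\<^sup>2 - b\<^sup>2" using zero_le_power2[of B] by linarith
  have c2: "c\<^sup>2 = A\<^sup>2 + B\<^sup>2 - b\<^sup>2" unfolding c_def using nn by (rule real_sqrt_pow2)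
  have c0: "c \<ge> 0" unfolding c_def using nn by (rule real_sqrt_ge_zero)
  have "1 * \<bar>a - c\<bar> \<le> (a + c) / 2 * \<bar>a - c\<bar>" using a c0 by (intro mult_right_mono) auto
  also have "\<dots> = \<bar>(c\<^sup>2 - a\<^sup>2) / 2\<bar>"
    using a c0 by (simp add: power2_eq_square square_diff_square_factored abs_mult abs_minus_commute)
  finally show "\<bar>1 * (a - sqrt (A\<^sup>2 + B\<^sup>2 - b\<^sup>2))\<bar> \<le> \<bar>(A\<^sup>2 + B\<^sup>2 - a\<^sup>2 - b\<^sup>2) / 2\<bar>"
    unfolding c2 by (simp add: c_def algebra_simps)
qed

lemma sqrt_pi_div_inverse_R_squared: "1 / R\<^sup>2 > 0" "sqrt (pi / (1 / R\<^sup>2)) = sqrt pi * R"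
  using R by (auto simp: real_sqrt_mult)

text \<open>The second Gaussian is replaced by its peak \<open>sqrt pi * R\<close>, the first is
  integrated in a with mass 2 pi, and b ranges over an interval of length 2.\<close>

lemma quad_kernel_le_R:
  "(\<integral>\<^sup>+ a. \<integral>\<^sup>+ b. quad_kernel e R A B a b \<partial>lborel \<partial>lborel) \<le> ennreal (4 * pi * sqrt pi * R)"
proof -
  define c where "c b = sqrt (A\<^sup>2 + B\<^sup>2 - b\<^sup>2)" for b
  have [measurable]: "c \<in> borel_measurable borel" unfolding c_def by measurable
  have "(\<integral>\<^sup>+ a. \<integral>\<^sup>+ b. quad_kernel e R A B a b \<partial>lborel \<partial>lborel) \<le>
      (\<integral>\<^sup>+ a. \<integral>\<^sup>+ b. indicator {-1..1} b * ennreal (sqrt pi * R) * ennreal (gauss_hat e (1 * (a - c b))) \<partial>lborel \<partial>lborel)"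
  proof (intro nn_integral_mono)
    fix a b
    show "quad_kernel e R A B a b \<le> indicator {-1..1} b * ennreal (sqrt pi * R) * ennreal (gauss_hat e (1 * (a - c b)))"
    proof (cases "a \<in> {2..4} \<and> b \<in> {-1..1}")
      case True
      have "gauss_hat e ((A\<^sup>2 + B\<^sup>2 - a\<^sup>2 - b\<^sup>2) / 2) * gauss_hat (1 / R\<^sup>2) (A - a) \<le> gauss_hat e (1 * (a - c b)) * (sqrt pi * R)"
        using True e sqrt_pi_div_inverse_R_squared gauss_hat_le[OF sqrt_pi_div_inverse_R_squared(1), of "A - a"] unfolding c_def
        by (intro mult_mono quad_kernel_a_bound) auto
      thus ?thesis using True R e by (auto simp: quad_kernel_def ennreal_mult'[symmetric] mult_ac intro!: ennreal_leI)
    qed (auto simp: quad_kernel_def indicator_def)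
  qed
  also have "\<dots> = (\<integral>\<^sup>+ b. \<integral>\<^sup>+ a. indicator {-1..1} b * ennreal (sqrt pi * R) * ennreal (gauss_hat e (1 * (a - c b))) \<partial>lborel \<partial>lborel)"
    by (rule lborel_pair.Fubini'[symmetric]) measurable
  also have "\<dots> = (\<integral>\<^sup>+ (b::real). indicator {-1..1} b * (ennreal (sqrt pi * R) * ennreal (2 * pi)) \<partial>lborel)"
    by (subst nn_integral_cmult, measurable) (subst nn_integral_gauss_hat, use e in \<open>auto simp: mult_ac\<close>)
  also have "\<dots> = 2 * (ennreal (sqrt pi * R) * ennreal (2 * pi))"
    by (subst nn_integral_multc) auto
  also have "2 * (ennreal (sqrt pi * R) * ennreal (2 * pi)) = ennreal 2 * (ennreal (sqrt pi * R) * ennreal (2 * pi))"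
    by simp
  also have "\<dots> = ennreal (2 * (sqrt pi * R * (2 * pi)))"
    by (simp only: ennreal_mult'[symmetric] zero_le_numeral pi_ge_zero mult_nonneg_nonneg real_sqrt_ge_zero order_trans[OF zero_le_one R])
  also have "2 * (sqrt pi * R * (2 * pi)) = 4 * pi * sqrt pi * R" by simp
  finally show ?thesis .
qed

text \<open>For fixed a the argument vanishes at b = c and b = -c, hence two Gaussians; away from b
  = 0 it is at least \<open>\<bar>B\<bar> / 4\<close> times the distance of
  \<open>\<bar>b\<bar>\<close> to c. If \<open>A\<^sup>2 + B\<^sup>2 < a\<^sup>2\<close> there is no
  zero; the \<open>max\<close> then puts c at 0, and the argument is only larger.\<close>

lemma quad_kernel_far:
  assumes b: "\<bar>B\<bar> / 2 \<le> \<bar>b\<bar>" and c: "c = sqrt (max 0 (A\<^sup>2 + B\<^sup>2 - a\<^sup>2))"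
  shows "gauss_hat e ((A\<^sup>2 + B\<^sup>2 - a\<^sup>2 - b\<^sup>2) / 2) \<le> gauss_hat e (\<bar>B\<bar> / 4 * (b - c)) + gauss_hat e (\<bar>B\<bar> / 4 * (b - (- c)))"
proof -
  have c0: "c \<ge> 0" by (simp add: c)
  have c2: "c\<^sup>2 = max 0 (A\<^sup>2 + B\<^sup>2 - a\<^sup>2)" by (simp add: c)
  have *: "\<bar>B\<bar> / 4 * \<bar>\<bar>b\<bar> - c\<bar> \<le> \<bar>(A\<^sup>2 + B\<^sup>2 - a\<^sup>2 - b\<^sup>2) / 2\<bar>"
  proof -
    have "\<bar>B\<bar> / 2 * \<bar>\<bar>b\<bar> - c\<bar> \<le> (\<bar>b\<bar> + c) * \<bar>\<bar>b\<bar> - c\<bar>" using b c0 by (intro mult_right_mono) auto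
    also have "\<dots> = \<bar>c\<^sup>2 - b\<^sup>2\<bar>"
    proof -
      have "\<bar>c\<^sup>2 - b\<^sup>2\<bar> = \<bar>(\<bar>b\<bar> + c) * (\<bar>b\<bar> - c)\<bar>"
        by (subst abs_minus_commute) (simp add: power2_eq_square algebra_simps)
      thus ?thesis using c0 by (simp add: abs_mult)
    qed
    also have "\<dots> \<le> \<bar>A\<^sup>2 + B\<^sup>2 - a\<^sup>2 - b\<^sup>2\<bar>" unfolding c2 by (auto simp: max_def)
    finally show ?thesis by simp
  qed
  show ?thesis
  proof (cases "b \<ge> 0")
    case True
    hence "gauss_hat e ((A\<^sup>2 + B\<^sup>2 - a\<^sup>2 - b\<^sup>2) / 2) \<le> gauss_hat e (\<bar>B\<bar> / 4 * (b - c))"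
      using * by (intro gauss_hat_mono[OF e]) (auto simp: abs_mult)
    thus ?thesis using e by (simp add: add_increasing2)
  next
    case False
    hence "\<bar>\<bar>b\<bar> - c\<bar> = \<bar>b - (- c)\<bar>" by simp
    hence "gauss_hat e ((A\<^sup>2 + B\<^sup>2 - a\<^sup>2 - b\<^sup>2) / 2) \<le> gauss_hat e (\<bar>B\<bar> / 4 * (b - (- c)))"
      using * by (intro gauss_hat_mono[OF e]) (auto simp: abs_mult)
    thus ?thesis using e by (simp add: add_increasing)
  qed
qed

text \<open>Where \<open>\<bar>b\<bar> \<ge> \<bar>B\<bar> / 2\<close>, the first factor is
  integrable in b at cost \<open>1 / \<bar>B\<bar>\<close>. For smaller b, either
  \<open>\<bar>A - a\<bar> \<ge> B\<^sup>2 / 16\<close> and the second factor is exponentially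
  small, or the argument of the first factor is at least \<open>B\<^sup>2 / 8\<close> and the first
  is small; the other factor is then integrated in a, and b runs over an interval of length
  \<open>\<bar>B\<bar>\<close>.\<close>

lemma quad_kernel_le_B:
  assumes B0: "B \<noteq> 0"
  shows "(\<integral>\<^sup>+ a. \<integral>\<^sup>+ b. quad_kernel e R A B a b \<partial>lborel \<partial>lborel) \<le> ennreal ((32 * pi\<^sup>2 + 96 * pi * sqrt pi) / \<bar>B\<bar>)"
proof -
  define \<beta> where "\<beta> = \<bar>B\<bar>"
  have \<beta>: "0 < \<beta>" "\<beta> \<le> 1" using B0 B by (auto simp: \<beta>_def)
  define \<delta> where "\<delta> = 1 / R\<^sup>2"
  have \<delta>: "\<delta> > 0" "sqrt (pi / \<delta>) = sqrt pi * R" using sqrt_pi_div_inverse_R_squared by (auto simp: \<delta>_def)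
  define c where "c b = sqrt (A\<^sup>2 + B\<^sup>2 - b\<^sup>2)" for b
  define c' where "c' a = sqrt (max 0 (A\<^sup>2 + B\<^sup>2 - a\<^sup>2))" for a
  have [measurable]: "c \<in> borel_measurable borel" "c' \<in> borel_measurable borel" unfolding c_def c'_def by measurable
  define U1 where "U1 a b = ennreal (gauss_hat \<delta> (1 * (a - A))) * (ennreal (gauss_hat e (\<beta> / 4 * (b - c' a))) + ennreal (gauss_hat e (\<beta> / 4 * (b - (- c' a)))))" for a b
  \<comment> \<open>\<open>k2\<close> is the value of the second Gaussian at distance
    \<open>\<beta>\<^sup>2 / 16\<close>, \<open>k3\<close> that of the first at
    \<open>\<beta>\<^sup>2 / 8\<close>.\<close>
  define k2 where "k2 = sqrt pi * R * exp (- (R * \<beta>\<^sup>2 / 32)\<^sup>2)"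
  define k3 where "k3 = sqrt (pi / e) * exp (- (\<beta>\<^sup>2 / (16 * sqrt e))\<^sup>2)"
  have k: "k2 \<ge> 0" "k3 \<ge> 0" using R e by (auto simp: k2_def k3_def)
  define U2 where "U2 a b = indicator {-(\<beta>/2)..\<beta>/2} b * ennreal k2 * ennreal (gauss_hat e (1 * (a - c b)))" for a b
  define U3 where "U3 a b = ennreal (gauss_hat \<delta> (1 * (a - A))) * (indicator {-(\<beta>/2)..\<beta>/2} b * ennreal k3)" for a b
  have [measurable]: "(\<lambda>(a,b). U1 a b) \<in> borel_measurable (borel \<Otimes>\<^sub>M borel)" "(\<lambda>(a,b). U2 a b) \<in> borel_measurable (borel \<Otimes>\<^sub>M borel)"
     "(\<lambda>(a,b). U3 a b) \<in> borel_measurable (borel \<Otimes>\<^sub>M borel)"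
    unfolding U1_def U2_def U3_def by measurable
  have gs': "gauss_hat \<delta> (A - a) = gauss_hat \<delta> (a - A)" for a by (simp add: gauss_hat_def power2_commute)
  have gs: "gauss_hat \<delta> (A - a) = gauss_hat \<delta> (1 * (a - A))" for a by (simp add: gauss_hat_def power2_commute)
  have "(\<integral>\<^sup>+ a. \<integral>\<^sup>+ b. quad_kernel e R A B a b \<partial>lborel \<partial>lborel) \<le> (\<integral>\<^sup>+ a. \<integral>\<^sup>+ b. U1 a b + U2 a b + U3 a b \<partial>lborel \<partial>lborel)"
  proof (intro nn_integral_mono)
    fix a b
    show "quad_kernel e R A B a b \<le> U1 a b + U2 a b + U3 a b"
    proof (cases "a \<in> {2..4} \<and> b \<in> {-1..1}")
      case ab: True
      consider "\<beta> / 2 \<le> \<bar>b\<bar>" | "\<bar>b\<bar> \<le> \<beta> / 2" "\<beta>\<^sup>2 / 16 \<le> \<bar>A - a\<bar>" | "\<bar>b\<bar> \<le> \<beta> / 2" "\<bar>A - a\<bar> \<le> \<beta>\<^sup>2 / 16" by linarith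
      thus ?thesis
      proof cases
        case 1
        have "quad_kernel e R A B a b \<le> U1 a b"
          using quad_kernel_far[of b "c' a" a] 1 ab e \<delta>
          by (auto simp: quad_kernel_def U1_def gs' \<beta>_def c'_def \<delta>_def[symmetric] ennreal_plus[symmetric] ennreal_mult'[symmetric]
              mult.commute[of "gauss_hat \<delta> _"] simp del: ennreal_plus intro!: ennreal_leI mult_right_mono)
        thus ?thesis by (simp add: add_increasing2 add.assoc)
      next
        case 2
        have "(\<beta>\<^sup>2 / 16)\<^sup>2 \<le> (A - a)\<^sup>2" using 2 by (subst abs_le_square_iff[symmetric]) auto
        hence "R\<^sup>2 / 4 * (\<beta>\<^sup>2 / 16)\<^sup>2 \<le> R\<^sup>2 / 4 * (A - a)\<^sup>2" by (intro mult_left_mono) auto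
        hence "gauss_hat \<delta> (A - a) \<le> k2"
          unfolding gauss_hat_def \<delta>(2) k2_def using R by (intro mult_left_mono) (auto simp: \<delta>_def power_divide power_mult_distrib mult_ac)
        hence "gauss_hat e ((A\<^sup>2 + B\<^sup>2 - a\<^sup>2 - b\<^sup>2) / 2) * gauss_hat \<delta> (A - a) \<le> gauss_hat e (1 * (a - c b)) * k2"
          using ab e \<delta> unfolding c_def by (intro mult_mono quad_kernel_a_bound) auto
        hence "quad_kernel e R A B a b \<le> U2 a b"
          using ab 2 k e by (auto simp: quad_kernel_def U2_def \<delta>_def[symmetric] ennreal_mult'[symmetric] mult.commute[of k2] indicator_def intro!: ennreal_leI)
        thus ?thesis by (simp add: add_increasing2 add_increasing)
      next
        case 3
        have "\<bar>A\<^sup>2 - a\<^sup>2\<bar> = \<bar>A - a\<bar> * (A + a)" using A ab by (simp add: power2_eq_square square_diff_square_factored abs_mult)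
        also have "\<dots> \<le> \<beta>\<^sup>2 / 16 * 8" using 3 A ab by (intro mult_mono) auto
        finally have 4: "\<bar>A\<^sup>2 - a\<^sup>2\<bar> \<le> \<beta>\<^sup>2 / 2" by simp
        have "b\<^sup>2 \<le> (\<beta> / 2)\<^sup>2" using 3 \<beta> by (subst abs_le_square_iff[symmetric]) auto
        hence "b\<^sup>2 \<le> \<beta>\<^sup>2 / 4" by (simp add: power_divide)
        moreover have "B\<^sup>2 = \<beta>\<^sup>2" by (simp add: \<beta>_def)
        moreover have "- (\<beta>\<^sup>2 / 2) \<le> A\<^sup>2 - a\<^sup>2" using 4 abs_ge_minus_self[of "A\<^sup>2 - a\<^sup>2"] by linarith
        ultimately have "\<beta>\<^sup>2 / 8 \<le> (A\<^sup>2 + B\<^sup>2 - a\<^sup>2 - b\<^sup>2) / 2" by (simp add: field_simps)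
        hence "(\<beta>\<^sup>2 / 8)\<^sup>2 \<le> ((A\<^sup>2 + B\<^sup>2 - a\<^sup>2 - b\<^sup>2) / 2)\<^sup>2" by (intro power_mono) auto
        hence "1 / (4 * e) * (\<beta>\<^sup>2 / 8)\<^sup>2 \<le> 1 / (4 * e) * ((A\<^sup>2 + B\<^sup>2 - a\<^sup>2 - b\<^sup>2) / 2)\<^sup>2" using e by (intro mult_left_mono) auto
        moreover have "1 / (4 * e) * (\<beta>\<^sup>2 / 8)\<^sup>2 = (\<beta>\<^sup>2 / (16 * sqrt e))\<^sup>2" using e by (simp add: power_divide power_mult_distrib)
        ultimately have "gauss_hat e ((A\<^sup>2 + B\<^sup>2 - a\<^sup>2 - b\<^sup>2) / 2) \<le> k3"
          unfolding gauss_hat_def k3_def using e by (intro mult_left_mono) auto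
        hence "gauss_hat e ((A\<^sup>2 + B\<^sup>2 - a\<^sup>2 - b\<^sup>2) / 2) * gauss_hat \<delta> (A - a) \<le> k3 * gauss_hat \<delta> (1 * (a - A))"
          unfolding gs using \<delta> by (intro mult_right_mono) auto
        hence "quad_kernel e R A B a b \<le> U3 a b"
          using ab 3 k e \<delta> by (auto simp: quad_kernel_def U3_def \<delta>_def[symmetric] ennreal_mult'[symmetric] mult.commute[of k3] indicator_def intro!: ennreal_leI)
        thus ?thesis by (simp add: add_increasing)
      qed
    qed (auto simp: quad_kernel_def indicator_def)
  qed
  also have "\<dots> = (\<integral>\<^sup>+ a. \<integral>\<^sup>+ b. U1 a b \<partial>lborel \<partial>lborel) + (\<integral>\<^sup>+ a. \<integral>\<^sup>+ b. U2 a b \<partial>lborel \<partial>lborel) + (\<integral>\<^sup>+ a. \<integral>\<^sup>+ b. U3 a b \<partial>lborel \<partial>lborel)"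
  proof -
    have "(\<integral>\<^sup>+ a. \<integral>\<^sup>+ b. U1 a b + U2 a b + U3 a b \<partial>lborel \<partial>lborel)
        = (\<integral>\<^sup>+ a. (\<integral>\<^sup>+ b. U1 a b \<partial>lborel) + (\<integral>\<^sup>+ b. U2 a b \<partial>lborel) + (\<integral>\<^sup>+ b. U3 a b \<partial>lborel) \<partial>lborel)"
      by (intro nn_integral_cong) (simp add: nn_integral_add)
    thus ?thesis by (simp add: nn_integral_add)
  qed
  also have "(\<integral>\<^sup>+ a. \<integral>\<^sup>+ b. U1 a b \<partial>lborel \<partial>lborel) = ennreal (32 * pi\<^sup>2 / \<beta>)"
  proof -
    have "(\<integral>\<^sup>+ a. \<integral>\<^sup>+ b. U1 a b \<partial>lborel \<partial>lborel) = (\<integral>\<^sup>+ a. ennreal (gauss_hat \<delta> (1 * (a - A))) * ennreal (16 * pi / \<beta>) \<partial>lborel)"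
    proof (rule nn_integral_cong)
      fix a
      have g: "(\<integral>\<^sup>+ b. ennreal (gauss_hat e (\<beta> / 4 * (b - x))) \<partial>lborel) = ennreal (2 * pi / (\<beta> / 4))" for x
        by (rule nn_integral_gauss_hat) (use \<beta> e in auto)
      have "(\<integral>\<^sup>+ b. U1 a b \<partial>lborel) = ennreal (gauss_hat \<delta> (1 * (a - A))) *
          (\<integral>\<^sup>+ b. ennreal (gauss_hat e (\<beta> / 4 * (b - c' a))) + ennreal (gauss_hat e (\<beta> / 4 * (b - (- c' a)))) \<partial>lborel)"
        unfolding U1_def by (rule nn_integral_cmult) measurable
      also have "(\<integral>\<^sup>+ b. ennreal (gauss_hat e (\<beta> / 4 * (b - c' a))) + ennreal (gauss_hat e (\<beta> / 4 * (b - (- c' a)))) \<partial>lborel)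
         = ennreal (2 * pi / (\<beta> / 4)) + ennreal (2 * pi / (\<beta> / 4))"
        by (subst nn_integral_add, measurable) (simp only: g)
      also have "ennreal (2 * pi / (\<beta> / 4)) + ennreal (2 * pi / (\<beta> / 4)) = ennreal (16 * pi / \<beta>)"
        using \<beta> by (subst ennreal_plus[symmetric]) auto
      finally show "(\<integral>\<^sup>+ b. U1 a b \<partial>lborel) = ennreal (gauss_hat \<delta> (1 * (a - A))) * ennreal (16 * pi / \<beta>)" .
    qed
    also have "\<dots> = ennreal (2 * pi / 1) * ennreal (16 * pi / \<beta>)"
      by (subst nn_integral_multc, measurable) (subst nn_integral_gauss_hat, use \<delta> in auto)
    also have "\<dots> = ennreal (32 * pi\<^sup>2 / \<beta>)" using \<beta> by (subst ennreal_mult'[symmetric]) (auto simp: power2_eq_square)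
    finally show ?thesis .
  qed
  also have "(\<integral>\<^sup>+ a. \<integral>\<^sup>+ b. U2 a b \<partial>lborel \<partial>lborel) = ennreal (\<beta> * k2 * (2 * pi))"
  proof -
    have "(\<integral>\<^sup>+ a. \<integral>\<^sup>+ b. U2 a b \<partial>lborel \<partial>lborel) = (\<integral>\<^sup>+ b. \<integral>\<^sup>+ a. U2 a b \<partial>lborel \<partial>lborel)"
      by (rule lborel_pair.Fubini'[symmetric]) measurable
    also have "\<dots> = (\<integral>\<^sup>+ (b::real). indicator {-(\<beta>/2)..\<beta>/2} b * (ennreal k2 * ennreal (2 * pi)) \<partial>lborel)"
      unfolding U2_def
      by (subst nn_integral_cmult, measurable) (subst nn_integral_gauss_hat, use e in \<open>auto simp: mult_ac\<close>)
    also have "\<dots> = ennreal \<beta> * (ennreal k2 * ennreal (2 * pi))"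
      using \<beta> by (subst nn_integral_multc) auto
    finally show ?thesis using \<beta> k by (simp add: ennreal_mult' mult_ac)
  qed
  also have "(\<integral>\<^sup>+ a. \<integral>\<^sup>+ b. U3 a b \<partial>lborel \<partial>lborel) = ennreal (2 * pi * (\<beta> * k3))"
  proof -
    have "(\<integral>\<^sup>+ a. \<integral>\<^sup>+ b. U3 a b \<partial>lborel \<partial>lborel) = (\<integral>\<^sup>+ a. ennreal (gauss_hat \<delta> (1 * (a - A))) * (ennreal \<beta> * ennreal k3) \<partial>lborel)"
      unfolding U3_def using \<beta>
      by (subst nn_integral_cmult, measurable) (subst nn_integral_multc, auto)
    also have "\<dots> = ennreal (2 * pi / 1) * (ennreal \<beta> * ennreal k3)"
      by (subst nn_integral_multc, measurable) (subst nn_integral_gauss_hat, use \<delta> in auto)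
    finally show ?thesis using \<beta> k by (simp add: ennreal_mult')
  qed
  also have "ennreal (32 * pi\<^sup>2 / \<beta>) + ennreal (\<beta> * k2 * (2 * pi)) + ennreal (2 * pi * (\<beta> * k3)) = ennreal (32 * pi\<^sup>2 / \<beta> + \<beta> * k2 * (2 * pi) + 2 * pi * (\<beta> * k3))"
    using \<beta> k by (simp add: ennreal_plus)
  \<comment> \<open>Both small terms are a multiple of 1 / \<beta> times
    \<open>y * exp (- y\<^sup>2)\<close>, with \<open>y = R * \<beta>\<^sup>2 / 32\<close> and
    \<open>y = \<beta>\<^sup>2 / (16 * sqrt e)\<close>. The bound is therefore uniform in R and e;
    96 is 64 + 32.\<close>
  also have "\<dots> \<le> ennreal ((32 * pi\<^sup>2 + 96 * pi * sqrt pi) / \<beta>)"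
  proof (rule ennreal_leI)
    have "\<beta> * k2 = 32 * sqrt pi / \<beta> * (R * \<beta>\<^sup>2 / 32 * exp (- (R * \<beta>\<^sup>2 / 32)\<^sup>2))"
      using \<beta> by (simp add: k2_def power2_eq_square)
    also have "\<dots> \<le> 32 * sqrt pi / \<beta> * 1" using \<beta> by (intro mult_left_mono abs_mult_exp_neg_sq_le) auto
    finally have "\<beta> * k2 * (2 * pi) \<le> 32 * sqrt pi / \<beta> * (2 * pi)" by (intro mult_right_mono) auto
    hence 1: "\<beta> * k2 * (2 * pi) \<le> 64 * (pi * sqrt pi) / \<beta>" by (simp add: mult_ac)
    have "\<beta> * k3 = 16 * sqrt pi / \<beta> * (\<beta>\<^sup>2 / (16 * sqrt e) * exp (- (\<beta>\<^sup>2 / (16 * sqrt e))\<^sup>2))"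
      using \<beta> by (simp add: k3_def power2_eq_square real_sqrt_divide)
    also have "\<dots> \<le> 16 * sqrt pi / \<beta> * 1" using \<beta> by (intro mult_left_mono abs_mult_exp_neg_sq_le) auto
    finally have "2 * pi * (\<beta> * k3) \<le> 2 * pi * (16 * sqrt pi / \<beta>)" by (intro mult_left_mono) auto
    hence 2: "2 * pi * (\<beta> * k3) \<le> 32 * (pi * sqrt pi) / \<beta>" by simp
    have "(32 * pi\<^sup>2 + 96 * pi * sqrt pi) / \<beta> = 32 * pi\<^sup>2 / \<beta> + 64 * (pi * sqrt pi) / \<beta> + 32 * (pi * sqrt pi) / \<beta>"
      by (simp add: add_divide_distrib)
    thus "32 * pi\<^sup>2 / \<beta> + \<beta> * k2 * (2 * pi) + 2 * pi * (\<beta> * k3) \<le> (32 * pi\<^sup>2 + 96 * pi * sqrt pi) / \<beta>"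
      using 1 2 by linarith
  qed
  finally show ?thesis by (simp add: \<beta>_def)
qed

end

lemma pair_integral_mult:
  fixes f g :: "_ \<Rightarrow> complex"
  assumes "sigma_finite_measure M1" "sigma_finite_measure M2" and f: "integrable M1 f" and g: "integrable M2 g"
  shows "integrable (M1 \<Otimes>\<^sub>M M2) (\<lambda>z. f (fst z) * g (snd z))"
    and "(LINT z|(M1 \<Otimes>\<^sub>M M2). f (fst z) * g (snd z)) = (LINT x|M1. f x) * (LINT y|M2. g y)"
proof -
  interpret M1: sigma_finite_measure M1 by fact
  interpret M2: sigma_finite_measure M2 by fact
  interpret pair_sigma_finite M1 M2 by unfold_locales
  have [measurable]: "f \<in> borel_measurable M1" "g \<in> borel_measurable M2" using f g by auto
  show int: "integrable (M1 \<Otimes>\<^sub>M M2) (\<lambda>z. f (fst z) * g (snd z))"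
  proof (rule integrableI_bounded)
    have "(\<integral>\<^sup>+ z. ennreal (norm (f (fst z) * g (snd z))) \<partial>(M1 \<Otimes>\<^sub>M M2)) = (\<integral>\<^sup>+ x. \<integral>\<^sup>+ y. ennreal (norm (f x)) * ennreal (norm (g y)) \<partial>M2 \<partial>M1)"
      by (subst M2.nn_integral_fst[symmetric]) (auto simp: norm_mult ennreal_mult)
    also have "\<dots> = (\<integral>\<^sup>+ x. ennreal (norm (f x)) \<partial>M1) * (\<integral>\<^sup>+ x. ennreal (norm (g x)) \<partial>M2)"
      by (simp add: nn_integral_cmult nn_integral_multc)
    also have "\<dots> < \<infinity>" using f g by (simp add: integrable_iff_bounded ennreal_mult_less_top)
    finally show "(\<integral>\<^sup>+ z. ennreal (norm (f (fst z) * g (snd z))) \<partial>(M1 \<Otimes>\<^sub>M M2)) < \<infinity>" .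
  qed measurable
  show "(LINT z|(M1 \<Otimes>\<^sub>M M2). f (fst z) * g (snd z)) = (LINT x|M1. f x) * (LINT y|M2. g y)"
    using integral_fst'[OF int] by simp
qed

lemma nn_integral_powr_singular:
  fixes \<eta> :: real
  assumes \<eta>: "0 < \<eta>"
  shows "(\<integral>\<^sup>+ s. indicator {-1..1} (s - r) * ennreal (\<bar>r - s\<bar> powr (\<eta> - 1)) \<partial>lborel) \<le> ennreal (2 / \<eta>)"
proof -
  have "(\<integral>\<^sup>+ s. indicator {-1..1} (s - r) * ennreal (\<bar>r - s\<bar> powr (\<eta> - 1)) \<partial>lborel)
      = (\<integral>\<^sup>+ l. indicator {-1..1} l * ennreal (\<bar>l\<bar> powr (\<eta> - 1)) \<partial>lborel)"
    by (subst nn_integral_real_affine[where c = 1 and t = r]) auto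
  also have "\<dots> \<le> (\<integral>\<^sup>+ l. indicator {0<..1} l * ennreal (l powr (\<eta> - 1)) + indicator {0<..1} (- l) * ennreal ((- l) powr (\<eta> - 1)) \<partial>lborel)"
  proof (intro nn_integral_mono)
    fix l :: real
    show "indicator {-1..1} l * ennreal (\<bar>l\<bar> powr (\<eta> - 1)) \<le> indicator {0<..1} l * ennreal (l powr (\<eta> - 1)) + indicator {0<..1} (- l) * ennreal ((- l) powr (\<eta> - 1))"
      by (cases "l = 0"; cases "l > 0") (auto simp: indicator_def)
  qed
  also have "\<dots> = (\<integral>\<^sup>+ l. indicator {0<..1} l * ennreal (l powr (\<eta> - 1)) \<partial>lborel) + (\<integral>\<^sup>+ l. indicator {0<..1} (- l) * ennreal ((- l) powr (\<eta> - 1)) \<partial>lborel)"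
    by (rule nn_integral_add) measurable
  also have "(\<integral>\<^sup>+ l. indicator {0<..1} (- l) * ennreal ((- l) powr (\<eta> - 1)) \<partial>lborel) = (\<integral>\<^sup>+ l. indicator {0<..1} l * ennreal (l powr (\<eta> - 1)) \<partial>lborel)"
    by (subst nn_integral_real_affine[where c = "-1" and t = 0]) auto
  also have "(\<integral>\<^sup>+ l. indicator {0<..1} l * ennreal (l powr (\<eta> - 1)) \<partial>lborel) = ennreal (1 / \<eta>)"
    using nn_integral_powr_layer[of 1 \<eta>] \<eta> by simp
  also have "ennreal (1 / \<eta>) + ennreal (1 / \<eta>) = ennreal (2 / \<eta>)"
    using \<eta> by (subst ennreal_plus[symmetric]) auto
  finally show ?thesis .
qed

text \<open>A minimum is at most any weighted geometric mean. With
  \<open>\<beta> = \<bar>r - s\<bar>\<close> the non-integrable 1 / \<beta> becomes the locally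
  integrable \<open>\<beta> powr (\<eta> - 1)\<close>, for \<eta> > 0, at the price
  \<open>R powr \<eta>\<close>.\<close>

lemma min_le_powr_interpolate:
  fixes R \<beta> \<eta> :: real
  assumes "R > 0" "\<beta> > 0" "0 \<le> \<eta>" "\<eta> \<le> 1"
  shows "min R (1 / \<beta>) \<le> R powr \<eta> * \<beta> powr (\<eta> - 1)"
proof -
  define m where "m = min R (1 / \<beta>)"
  have m: "m > 0" "m \<le> R" "m \<le> 1 / \<beta>" using assms by (auto simp: m_def)
  have "m = m powr \<eta> * m powr (1 - \<eta>)" using m by (simp add: powr_add[symmetric])
  also have "\<dots> \<le> R powr \<eta> * (1 / \<beta>) powr (1 - \<eta>)"
    using m assms by (intro mult_mono powr_mono2) auto
  also have "(1 / \<beta>) powr (1 - \<eta>) = \<beta> powr (\<eta> - 1)"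
    using assms powr_minus_divide[of \<beta> "1 - \<eta>"] by (simp add: powr_divide)
  finally show ?thesis by (simp add: m_def)
qed

text \<open>The phase of a product of two copies of the integrand: w is the pair (t, \<rho>) and z
  the pair of frequencies (r, s).\<close>

definition quad_phase :: "real \<times> real \<Rightarrow> real \<times> real \<Rightarrow> complex" where
  "quad_phase w z = iexp (fst w * ((fst z)\<^sup>2 + (snd z)\<^sup>2) + snd w * (fst z + snd z))"

lemma iexp_mult_cnj: "iexp a * cnj (iexp b) = iexp (a - b)"
  by (simp add: exp_cnj exp_add[symmetric] algebra_simps)

lemma gaussian_weight_2:
  fixes e \<delta> :: real
  assumes e: "e > 0" and \<delta>: "\<delta> > 0"
  defines "N \<equiv> density (lborel \<Otimes>\<^sub>M lborel) (\<lambda>w. ennreal (exp (- e * (fst w)\<^sup>2) * exp (- \<delta> * (snd w)\<^sup>2)))"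
  shows "finite_measure N"
    and "(LINT w|N. quad_phase w z * cnj (quad_phase w z')) =
       complex_of_real (gauss_hat e ((fst z)\<^sup>2 + (snd z)\<^sup>2 - ((fst z')\<^sup>2 + (snd z')\<^sup>2)) * gauss_hat \<delta> (fst z + snd z - (fst z' + snd z')))"
proof -
  have lb: "sigma_finite_measure (lborel :: real measure)" by (rule lborel.sigma_finite_measure_axioms)
  have "emeasure N (space N) = (\<integral>\<^sup>+ w. ennreal (exp (- e * (fst w)\<^sup>2) * exp (- \<delta> * (snd w)\<^sup>2)) * indicator (space N) w \<partial>(lborel \<Otimes>\<^sub>M lborel))"
    unfolding N_def space_density by (rule emeasure_density[OF _ sets.top]) measurable
  also have "\<dots> = (\<integral>\<^sup>+ w. ennreal (exp (- e * (fst w)\<^sup>2)) * ennreal (exp (- \<delta> * (snd w)\<^sup>2)) \<partial>(lborel \<Otimes>\<^sub>M lborel))"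
    unfolding N_def by (intro nn_integral_cong) (auto simp: ennreal_mult)
  also have "\<dots> = (\<integral>\<^sup>+ t. \<integral>\<^sup>+ x. ennreal (exp (- e * t\<^sup>2)) * ennreal (exp (- \<delta> * x\<^sup>2)) \<partial>lborel \<partial>lborel)"
    by (subst lborel.nn_integral_fst[symmetric]) auto
  also have "\<dots> = ennreal (sqrt (pi / e)) * ennreal (sqrt (pi / \<delta>))"
    using gaussian_integrable[OF e] gaussian_integrable[OF \<delta>]
    by (simp add: nn_integral_cmult nn_integral_multc nn_integral_eq_integral)
  finally show "finite_measure N" by (intro finite_measureI) (simp add: ennreal_mult_eq_top_iff)
  define a where "a = (fst z)\<^sup>2 + (snd z)\<^sup>2 - ((fst z')\<^sup>2 + (snd z')\<^sup>2)"
  define b where "b = fst z + snd z - (fst z' + snd z')"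
  have g: "integrable lborel (\<lambda>t. complex_of_real (exp (- c * t\<^sup>2)) * iexp (t * y))" if "c > 0" for c y :: real
  proof (rule Bochner_Integration.integrable_bound[OF gaussian_integrable(1)[OF that]])
    show "(\<lambda>t. complex_of_real (exp (- c * t\<^sup>2)) * iexp (t * y)) \<in> borel_measurable lborel" by measurable
  qed (auto simp: norm_mult)
  have "quad_phase w z * cnj (quad_phase w z') = iexp (fst w * a) * iexp (snd w * b)" for w
    unfolding quad_phase_def iexp_mult_cnj exp_add[symmetric]
    by (rule arg_cong[where f = exp]) (simp add: a_def b_def algebra_simps)
  hence "(LINT w|N. quad_phase w z * cnj (quad_phase w z')) = (LINT w|N. iexp (fst w * a) * iexp (snd w * b))" by simp
  also have "\<dots> = (LINT w|(lborel \<Otimes>\<^sub>M lborel). (complex_of_real (exp (- e * (fst w)\<^sup>2)) * iexp (fst w * a)) * (complex_of_real (exp (- \<delta> * (snd w)\<^sup>2)) * iexp (snd w * b)))"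
    unfolding N_def by (subst integral_density) (auto simp: scaleR_conv_of_real mult_ac)
  also have "\<dots> = complex_of_real (gauss_hat e a) * complex_of_real (gauss_hat \<delta> b)"
    unfolding pair_integral_mult(2)[OF lb lb g[OF e] g[OF \<delta>]] gaussian_fourier[OF e] gaussian_fourier[OF \<delta>] gauss_hat_def ..
  finally show "(LINT w|N. quad_phase w z * cnj (quad_phase w z')) = complex_of_real (gauss_hat e a * gauss_hat \<delta> b)" by simp
qed

text \<open>Sum and difference coordinates lead to \<open>quad_kernel\<close>. The diagonal has its
  own clause because \<open>1 / \<bar>r - s\<bar>\<close> is 0 there by convention, and the minimum
  with it.\<close>

lemma quad_kernel_bound:
  fixes e R r s :: real
  assumes e: "e > 0" and R: "R \<ge> 1" and r: "r \<in> {1..2}" and s: "s \<in> {1..2}"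
  shows "(\<integral>\<^sup>+ z. indicator ({1..2} \<times> {1..2}) z * ennreal (gauss_hat e (r\<^sup>2 + s\<^sup>2 - ((fst z)\<^sup>2 + (snd z)\<^sup>2)) * gauss_hat (1 / R\<^sup>2) (r + s - (fst z + snd z))) \<partial>(lborel \<Otimes>\<^sub>M lborel))
     \<le> (if r = s then ennreal ((32 * pi\<^sup>2 + 96 * pi * sqrt pi) * R) else ennreal ((32 * pi\<^sup>2 + 96 * pi * sqrt pi) * min R (1 / \<bar>r - s\<bar>)))"
    (is "?I \<le> _")
proof -
  define A where "A = r + s"
  define B where "B = r - s"
  have AB: "A \<ge> 2" "A \<le> 4" "\<bar>B\<bar> \<le> 1" using r s by (auto simp: A_def B_def)
  have AB2: "r\<^sup>2 + s\<^sup>2 = (A\<^sup>2 + B\<^sup>2) / 2" by (simp add: A_def B_def power2_eq_square field_simps)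
  let ?q = "quad_kernel e R A B"
  have [measurable]: "(\<lambda>(a, b). ?q a b) \<in> borel_measurable (lborel \<Otimes>\<^sub>M lborel)"
    unfolding quad_kernel_def by measurable
  have "?I = (\<integral>\<^sup>+ x. \<integral>\<^sup>+ y. indicator ({1..2} \<times> {1..2}) (x, y) * ennreal (gauss_hat e (r\<^sup>2 + s\<^sup>2 - (x\<^sup>2 + y\<^sup>2)) * gauss_hat (1 / R\<^sup>2) (r + s - (x + y))) \<partial>lborel \<partial>lborel)"
    by (subst lborel.nn_integral_fst[symmetric]) auto
  also have "\<dots> \<le> (\<integral>\<^sup>+ x. \<integral>\<^sup>+ y. ?q (x + y) (x - y) \<partial>lborel \<partial>lborel)"
  proof (intro nn_integral_mono)
    fix x y :: real
    have eq: "r\<^sup>2 + s\<^sup>2 - (x\<^sup>2 + y\<^sup>2) = (A\<^sup>2 + B\<^sup>2 - (x + y)\<^sup>2 - (x - y)\<^sup>2) / 2"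
      unfolding AB2 by (simp add: power2_eq_square field_simps)
    show "indicator ({1..2} \<times> {1..2}) (x, y) * ennreal (gauss_hat e (r\<^sup>2 + s\<^sup>2 - (x\<^sup>2 + y\<^sup>2)) * gauss_hat (1 / R\<^sup>2) (r + s - (x + y))) \<le> ?q (x + y) (x - y)"
      unfolding eq by (auto simp: quad_kernel_def indicator_def A_def[symmetric])
  qed
  also have "\<dots> = ennreal (1/2) * (\<integral>\<^sup>+ a. \<integral>\<^sup>+ b. ?q a b \<partial>lborel \<partial>lborel)"
    by (rule nn_integral_sum_diff) measurable
  also have "\<dots> \<le> 1 * (\<integral>\<^sup>+ a. \<integral>\<^sup>+ b. ?q a b \<partial>lborel \<partial>lborel)"
    by (intro mult_right_mono, subst ennreal_le_1) auto
  finally have *: "?I \<le> (\<integral>\<^sup>+ a. \<integral>\<^sup>+ b. ?q a b \<partial>lborel \<partial>lborel)" by simp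
  let ?C = "32 * pi\<^sup>2 + 96 * pi * sqrt pi"
  have C: "?C \<ge> 0" by (intro add_nonneg_nonneg) auto
  have "(\<integral>\<^sup>+ a. \<integral>\<^sup>+ b. ?q a b \<partial>lborel \<partial>lborel) \<le> ennreal (4 * pi * sqrt pi * R)"
    using quad_kernel_le_R[OF e R AB] .
  also have "\<dots> \<le> ennreal (?C * R)"
    using R by (intro ennreal_leI mult_right_mono) (auto intro!: add_increasing)
  finally have 1: "?I \<le> ennreal (?C * R)" using * by (rule order_trans[rotated])
  show ?thesis
  proof (cases "r = s")
    case False
    hence "(\<integral>\<^sup>+ a. \<integral>\<^sup>+ b. ?q a b \<partial>lborel \<partial>lborel) \<le> ennreal (?C / \<bar>B\<bar>)"
      by (intro quad_kernel_le_B[OF e R AB]) (simp add: B_def)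
    hence "?I \<le> ennreal (?C * (1 / \<bar>r - s\<bar>))" using * by (simp add: B_def)
    thus ?thesis using 1 False by (simp add: min_def)
  qed (use 1 in simp)
qed

text \<open>The square of the extension is the integral of \<open>g r * g s\<close> against
  \<open>quad_phase\<close>, so its fourth power is an instance of \<open>TTstar_bound\<close> over
  the pairs (t, \<rho>). The Gaussian weight in t is removed in the limit; the one in \<rho> keeps
  the width R.\<close>

lemma quad_ext_L4:
  fixes \<eta> :: real
  assumes \<eta>: "0 < \<eta>" "\<eta> \<le> 1"
  shows "\<exists>C>0. \<forall>R\<ge>1. \<forall>g. integrable lborel g \<longrightarrow> (\<forall>r. r \<notin> {1..2} \<longrightarrow> g r = 0) \<longrightarrow>
     (\<integral>\<^sup>+ \<rho>. \<integral>\<^sup>+ t. indicator {-2 * R..2 * R} \<rho> * ennreal (norm (quad_ext (\<lambda>r. g r * iexp (\<rho> * r)) t) ^ 4) \<partial>lborel \<partial>lborel)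
       \<le> ennreal (C * R powr \<eta>) * (\<integral>\<^sup>+ r. ennreal (norm (g r) ^ 4) \<partial>lborel)"
proof -
  define C0 where "C0 = 32 * pi\<^sup>2 + 96 * pi * sqrt pi"
  have C0: "C0 > 0" by (auto simp: C0_def intro!: add_pos_pos)
  \<comment> \<open>\<open>exp 4\<close> undoes the weight
    \<open>exp (- \<rho>\<^sup>2 / R\<^sup>2)\<close> for
    \<open>\<bar>\<rho>\<bar> \<le> 2 * R\<close>; 2 / \<eta> is the mass of the singular kernel on
    [-1, 1].\<close>
  define C where "C = exp 4 * (C0 * (2 / \<eta>))"
  have C: "C > 0" using C0 \<eta> by (simp add: C_def)
  show ?thesis
  proof (intro exI[of _ C] conjI C allI impI)
    fix R :: real and g :: "real \<Rightarrow> complex"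
    assume R: "R \<ge> 1" and g: "integrable lborel g" and "\<forall>r. r \<notin> {1..2} \<longrightarrow> g r = 0"
    hence supp: "\<And>r. r \<notin> {1..2} \<Longrightarrow> g r = 0" by blast
    have [measurable]: "g \<in> borel_measurable borel" using g by auto
    have lb: "sigma_finite_measure (lborel :: real measure)" by (rule lborel.sigma_finite_measure_axioms)
    define \<delta> where "\<delta> = 1 / R\<^sup>2"
    have \<delta>: "\<delta> > 0" using R by (simp add: \<delta>_def)
    define F where "F w = norm (quad_ext (\<lambda>r. g r * iexp (snd w * r)) (fst w)) ^ 4" for w
    have F0 [simp]: "F w \<ge> 0" for w by (simp add: F_def)
    have Fm: "F \<in> borel_measurable (borel \<Otimes>\<^sub>M borel)"
      unfolding F_def by measurable
    have [measurable]: "F \<in> borel_measurable (lborel \<Otimes>\<^sub>M lborel)" using Fm by (simp cong: measurable_cong_sets)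
    define h where "h z = g (fst z) * g (snd z)" for z
    have hint: "integrable (lborel \<Otimes>\<^sub>M lborel) h" unfolding h_def by (rule pair_integral_mult(1)[OF lb lb g g])
    \<comment> \<open>\<open>0 powr (\<eta> - 1)\<close> is 0, so the diagonal needs a value of its
      own; being null, it disappears when \<open>Bf\<close> is integrated.\<close>
    define Bf where "Bf z = (if fst z = snd z then ennreal (C0 * R) else ennreal (C0 * (R powr \<eta> * \<bar>fst z - snd z\<bar> powr (\<eta> - 1))))" for z :: "real \<times> real"
    have [measurable]: "Bf \<in> borel_measurable (lborel \<Otimes>\<^sub>M lborel)" unfolding Bf_def by measurable
    have hF: "(norm (LINT z|(lborel \<Otimes>\<^sub>M lborel). h z * quad_phase w z))\<^sup>2 = F w" for w
    proof -
      let ?u = "\<lambda>r. g r * iexp (snd w * r) * iexp (fst w * r\<^sup>2)"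
      have u: "integrable lborel ?u"
        by (rule Bochner_Integration.integrable_bound[OF g]) (auto simp: norm_mult)
      have "h z * quad_phase w z = ?u (fst z) * ?u (snd z)" for z
        by (simp add: h_def quad_phase_def exp_add[symmetric] algebra_simps)
      hence "(LINT z|(lborel \<Otimes>\<^sub>M lborel). h z * quad_phase w z) = (LINT z|(lborel \<Otimes>\<^sub>M lborel). ?u (fst z) * ?u (snd z))" by simp
      also have "\<dots> = quad_ext (\<lambda>r. g r * iexp (snd w * r)) (fst w) * quad_ext (\<lambda>r. g r * iexp (snd w * r)) (fst w)"
        unfolding pair_integral_mult(2)[OF lb lb u u] quad_ext_def ..
      finally show ?thesis by (simp add: F_def norm_mult power2_eq_square power4_eq_xxxx mult.assoc)
    qed
    have weighted: "(\<integral>\<^sup>+ w. ennreal (exp (- e * (fst w)\<^sup>2) * (exp (- \<delta> * (snd w)\<^sup>2) * F w)) \<partial>(lborel \<Otimes>\<^sub>M lborel))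
        \<le> (\<integral>\<^sup>+ z. ennreal ((norm (h z))\<^sup>2) * Bf z \<partial>(lborel \<Otimes>\<^sub>M lborel))" if e: "e > 0" for e
    proof -
      define N where "N = density (lborel \<Otimes>\<^sub>M lborel) (\<lambda>w. ennreal (exp (- e * (fst w)\<^sup>2) * exp (- \<delta> * (snd w)\<^sup>2)))"
      note N = gaussian_weight_2[OF e \<delta>, folded N_def]
      have sN [measurable_cong]: "sets N = sets (lborel \<Otimes>\<^sub>M lborel)" by (simp add: N_def)
      have "(\<integral>\<^sup>+ w. ennreal (exp (- e * (fst w)\<^sup>2) * (exp (- \<delta> * (snd w)\<^sup>2) * F w)) \<partial>(lborel \<Otimes>\<^sub>M lborel))
         = (\<integral>\<^sup>+ w. ennreal ((norm (LINT z|(lborel \<Otimes>\<^sub>M lborel). h z * quad_phase w z))\<^sup>2) \<partial>N)"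
        unfolding N_def hF by (subst nn_integral_density) (auto simp: ennreal_mult' mult_ac)
      also have "\<dots> \<le> (\<integral>\<^sup>+ z. ennreal ((norm (h z))\<^sup>2) * Bf z \<partial>(lborel \<Otimes>\<^sub>M lborel))"
      proof (rule TTstar_bound[OF N(1) _ hint])
        show "sigma_finite_measure (lborel \<Otimes>\<^sub>M lborel :: (real \<times> real) measure)"
          by (rule lborel_pair.sigma_finite_measure_axioms)
        show "(\<lambda>(w, x). quad_phase w x) \<in> borel_measurable (N \<Otimes>\<^sub>M (lborel \<Otimes>\<^sub>M lborel))"
          unfolding quad_phase_def by measurable
        fix z :: "real \<times> real" assume "h z \<noteq> 0"
        hence z: "fst z \<in> {1..2}" "snd z \<in> {1..2}" using supp unfolding h_def by (metis mult_eq_0_iff)+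
        have "(\<integral>\<^sup>+ y. indicator {y. h y \<noteq> 0} y * ennreal (norm (LINT w|N. quad_phase w z * cnj (quad_phase w y))) \<partial>(lborel \<Otimes>\<^sub>M lborel))
          \<le> (\<integral>\<^sup>+ y. indicator ({1..2} \<times> {1..2}) y * ennreal (gauss_hat e ((fst z)\<^sup>2 + (snd z)\<^sup>2 - ((fst y)\<^sup>2 + (snd y)\<^sup>2)) * gauss_hat (1 / R\<^sup>2) (fst z + snd z - (fst y + snd y))) \<partial>(lborel \<Otimes>\<^sub>M lborel))"
        proof (intro nn_integral_mono mult_mono)
          fix y :: "real \<times> real"
          have "y \<in> {1..2} \<times> {1..2}" if "h y \<noteq> 0" using that supp unfolding h_def by (metis mem_Times_iff mult_eq_0_iff)
          thus "(indicator {y. h y \<noteq> 0} y :: ennreal) \<le> indicator ({1..2} \<times> {1..2}) y" by (auto simp: indicator_def)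
          show "ennreal (norm (LINT w|N. quad_phase w z * cnj (quad_phase w y)))
             \<le> ennreal (gauss_hat e ((fst z)\<^sup>2 + (snd z)\<^sup>2 - ((fst y)\<^sup>2 + (snd y)\<^sup>2)) * gauss_hat (1 / R\<^sup>2) (fst z + snd z - (fst y + snd y)))"
            unfolding N(2) using e \<delta> by (simp only: norm_of_real \<delta>_def[symmetric]) (simp add: abs_mult)
        qed auto
        also have "\<dots> \<le> (if fst z = snd z then ennreal (C0 * R) else ennreal (C0 * min R (1 / \<bar>fst z - snd z\<bar>)))"
          using quad_kernel_bound[OF e R z] by (simp only: C0_def)
        also have "\<dots> \<le> Bf z"
          using min_le_powr_interpolate[of R "\<bar>fst z - snd z\<bar>" \<eta>] R \<eta> C0 by (auto simp: Bf_def intro!: ennreal_leI mult_left_mono)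
        finally show "(\<integral>\<^sup>+ y. indicator {y. h y \<noteq> 0} y * ennreal (norm (LINT w|N. quad_phase w z * cnj (quad_phase w y))) \<partial>(lborel \<Otimes>\<^sub>M lborel)) \<le> Bf z" .
      qed (auto simp: quad_phase_def)
      finally show ?thesis .
    qed
    \<comment> \<open>A second use of Schur's test:
      \<open>\<bar>g r\<bar>\<^sup>2 * \<bar>g s\<bar>\<^sup>2\<close> is at most half the sum of
      the fourth powers, and the kernel \<open>K\<close> has row integrals at most 2 /
      \<eta>.\<close>
    have rhs: "(\<integral>\<^sup>+ z. ennreal ((norm (h z))\<^sup>2) * Bf z \<partial>(lborel \<Otimes>\<^sub>M lborel)) \<le> ennreal (C0 * R powr \<eta> * (2 / \<eta>)) * (\<integral>\<^sup>+ r. ennreal (norm (g r) ^ 4) \<partial>lborel)"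
    proof -
      define K where "K r s = indicator {-1..1} (s - r) * ennreal (\<bar>r - s\<bar> powr (\<eta> - 1))" for r s :: real
      have Kc: "K r s = K s r" for r s by (auto simp: K_def indicator_def abs_minus_commute)
      have [measurable]: "(\<lambda>(r, s). K r s) \<in> borel_measurable (borel \<Otimes>\<^sub>M borel)" unfolding K_def by measurable
      let ?c = "ennreal (C0 * R powr \<eta>)"
      have "(\<integral>\<^sup>+ z. ennreal ((norm (h z))\<^sup>2) * Bf z \<partial>(lborel \<Otimes>\<^sub>M lborel)) = (\<integral>\<^sup>+ r. \<integral>\<^sup>+ s. ennreal ((norm (h (r, s)))\<^sup>2) * Bf (r, s) \<partial>lborel \<partial>lborel)"
        unfolding h_def by (subst lborel.nn_integral_fst[symmetric]) auto
      also have "\<dots> \<le> (\<integral>\<^sup>+ r. \<integral>\<^sup>+ s. ?c * (ennreal (norm (g r) ^ 4 / 2) * K r s + ennreal (norm (g s) ^ 4 / 2) * K s r) \<partial>lborel \<partial>lborel)"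
      proof (rule nn_integral_mono, rule nn_integral_mono_AE)
        fix r :: real
        have "AE s in lborel. s \<noteq> r" by (rule AE_lborel_singleton)
        thus "AE s in lborel. ennreal ((norm (h (r, s)))\<^sup>2) * Bf (r, s) \<le> ?c * (ennreal (norm (g r) ^ 4 / 2) * K r s + ennreal (norm (g s) ^ 4 / 2) * K s r)"
        proof eventually_elim
          case (elim s)
          show ?case
          proof (cases "h (r, s) = 0")
            case False
            hence rs: "r \<in> {1..2}" "s \<in> {1..2}" using supp unfolding h_def by (metis fst_conv snd_conv mult_eq_0_iff)+
            hence K: "K r s = ennreal (\<bar>r - s\<bar> powr (\<eta> - 1))" by (auto simp: K_def)
            have "(norm (h (r, s)))\<^sup>2 \<le> norm (g r) ^ 4 / 2 + norm (g s) ^ 4 / 2"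
              using sum_squares_bound[of "(norm (g r))\<^sup>2" "(norm (g s))\<^sup>2"]
              by (simp add: h_def norm_mult power_mult_distrib power_mult[symmetric])
            hence "ennreal ((norm (h (r, s)))\<^sup>2) * (?c * K r s) \<le> ennreal (norm (g r) ^ 4 / 2 + norm (g s) ^ 4 / 2) * (?c * K r s)"
              by (intro mult_right_mono ennreal_leI) auto
            moreover have "Bf (r, s) = ?c * K r s" using elim C0 by (auto simp: Bf_def K ennreal_mult'[symmetric] mult_ac)
            ultimately show ?thesis by (simp add: Kc[of s r] distrib_left distrib_right ennreal_plus mult_ac)
          qed simp
        qed
      qed
      also have "\<dots> = (\<integral>\<^sup>+ r. ?c * (\<integral>\<^sup>+ s. ennreal (norm (g r) ^ 4 / 2) * K r s + ennreal (norm (g s) ^ 4 / 2) * K s r \<partial>lborel) \<partial>lborel)"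
        by (intro nn_integral_cong nn_integral_cmult) measurable
      also have "\<dots> = ?c * (\<integral>\<^sup>+ r. \<integral>\<^sup>+ s. ennreal (norm (g r) ^ 4 / 2) * K r s + ennreal (norm (g s) ^ 4 / 2) * K s r \<partial>lborel \<partial>lborel)"
        by (rule nn_integral_cmult) measurable
      also have "\<dots> \<le> ?c * ((\<integral>\<^sup>+ r. ennreal (norm (g r) ^ 4) \<partial>lborel) * ennreal (2 / \<eta>))"
      proof (rule mult_left_mono)
      have "(\<integral>\<^sup>+ r. \<integral>\<^sup>+ s. ennreal (norm (g r) ^ 4 / 2) * K r s + ennreal (norm (g s) ^ 4 / 2) * K s r \<partial>lborel \<partial>lborel)
         = (\<integral>\<^sup>+ r. (\<integral>\<^sup>+ s. ennreal (norm (g r) ^ 4 / 2) * K r s \<partial>lborel) + (\<integral>\<^sup>+ s. ennreal (norm (g s) ^ 4 / 2) * K s r \<partial>lborel) \<partial>lborel)"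
        by (intro nn_integral_cong nn_integral_add) measurable
      also have "\<dots> = (\<integral>\<^sup>+ r. \<integral>\<^sup>+ s. ennreal (norm (g r) ^ 4 / 2) * K r s \<partial>lborel \<partial>lborel) + (\<integral>\<^sup>+ r. \<integral>\<^sup>+ s. ennreal (norm (g s) ^ 4 / 2) * K s r \<partial>lborel \<partial>lborel)"
        by (rule nn_integral_add) measurable
      also have "(\<integral>\<^sup>+ r. \<integral>\<^sup>+ s. ennreal (norm (g s) ^ 4 / 2) * K s r \<partial>lborel \<partial>lborel) = (\<integral>\<^sup>+ s. \<integral>\<^sup>+ r. ennreal (norm (g s) ^ 4 / 2) * K s r \<partial>lborel \<partial>lborel)"
        by (rule lborel_pair.Fubini') measurable
      also have "(\<integral>\<^sup>+ r. \<integral>\<^sup>+ s. ennreal (norm (g r) ^ 4 / 2) * K r s \<partial>lborel \<partial>lborel) + (\<integral>\<^sup>+ r. \<integral>\<^sup>+ s. ennreal (norm (g r) ^ 4 / 2) * K r s \<partial>lborel \<partial>lborel)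
         = (\<integral>\<^sup>+ r. ennreal (norm (g r) ^ 4) * (\<integral>\<^sup>+ s. K r s \<partial>lborel) \<partial>lborel)"
        by (subst nn_integral_add[symmetric], measurable, intro nn_integral_cong, simp add: nn_integral_cmult distrib_right[symmetric] ennreal_plus[symmetric] del: ennreal_plus)
      also have "\<dots> \<le> (\<integral>\<^sup>+ r. ennreal (norm (g r) ^ 4) * ennreal (2 / \<eta>) \<partial>lborel)"
        unfolding K_def by (intro nn_integral_mono mult_left_mono nn_integral_powr_singular \<eta>) auto
      also have "\<dots> = (\<integral>\<^sup>+ r. ennreal (norm (g r) ^ 4) \<partial>lborel) * ennreal (2 / \<eta>)" by (rule nn_integral_multc) measurable
      finally show "(\<integral>\<^sup>+ r. \<integral>\<^sup>+ s. ennreal (norm (g r) ^ 4 / 2) * K r s + ennreal (norm (g s) ^ 4 / 2) * K s r \<partial>lborel \<partial>lborel)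
          \<le> (\<integral>\<^sup>+ r. ennreal (norm (g r) ^ 4) \<partial>lborel) * ennreal (2 / \<eta>)" .
      qed simp
      also have "\<dots> = ennreal (C0 * R powr \<eta> * (2 / \<eta>)) * (\<integral>\<^sup>+ r. ennreal (norm (g r) ^ 4) \<partial>lborel)"
        using C0 by (subst ennreal_mult'[of "C0 * R powr \<eta>"]) (auto simp: mult_ac)
      finally show ?thesis .
    qed
    have lim: "(\<integral>\<^sup>+ w. ennreal (exp (- \<delta> * (snd w)\<^sup>2) * F w) \<partial>(lborel \<Otimes>\<^sub>M lborel))
        \<le> (\<integral>\<^sup>+ z. ennreal ((norm (h z))\<^sup>2) * Bf z \<partial>(lborel \<Otimes>\<^sub>M lborel))"
    proof (rule nn_integral_le_of_weights_tendsto_1[where w = "\<lambda>n w. exp (- inverse (real (Suc n)) * (fst w)\<^sup>2)"])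
      show "(\<lambda>n. exp (- inverse (real (Suc n)) * (fst w)\<^sup>2)) \<longlonglongrightarrow> 1" for w :: "real \<times> real"
      proof -
        have "(\<lambda>n. exp (- inverse (real (Suc n)) * (fst w)\<^sup>2)) \<longlonglongrightarrow> exp (- 0 * (fst w)\<^sup>2)"
          by (intro tendsto_intros LIMSEQ_inverse_real_of_nat)
        thus ?thesis by simp
      qed
      show "(\<integral>\<^sup>+ w. ennreal (exp (- inverse (real (Suc n)) * (fst w)\<^sup>2) * (exp (- \<delta> * (snd w)\<^sup>2) * F w)) \<partial>(lborel \<Otimes>\<^sub>M lborel))
        \<le> (\<integral>\<^sup>+ z. ennreal ((norm (h z))\<^sup>2) * Bf z \<partial>(lborel \<Otimes>\<^sub>M lborel))" for n
        by (rule weighted) simp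
    qed measurable
    have "(\<integral>\<^sup>+ \<rho>. \<integral>\<^sup>+ t. indicator {-2 * R..2 * R} \<rho> * ennreal (norm (quad_ext (\<lambda>r. g r * iexp (\<rho> * r)) t) ^ 4) \<partial>lborel \<partial>lborel)
      \<le> (\<integral>\<^sup>+ \<rho>. \<integral>\<^sup>+ t. ennreal (exp 4) * ennreal (exp (- \<delta> * \<rho>\<^sup>2) * F (t, \<rho>)) \<partial>lborel \<partial>lborel)"
    proof (intro nn_integral_mono)
      fix \<rho> t :: real
      show "indicator {-2 * R..2 * R} \<rho> * ennreal (norm (quad_ext (\<lambda>r. g r * iexp (\<rho> * r)) t) ^ 4) \<le> ennreal (exp 4) * ennreal (exp (- \<delta> * \<rho>\<^sup>2) * F (t, \<rho>))"
      proof (cases "\<rho> \<in> {-2 * R..2 * R}")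
        case True
        hence "\<rho>\<^sup>2 \<le> (2 * R)\<^sup>2" by (subst abs_le_square_iff[symmetric]) auto
        hence "\<delta> * \<rho>\<^sup>2 \<le> 4" using R by (simp add: \<delta>_def field_simps power2_eq_square)
        hence "1 \<le> exp 4 * exp (- \<delta> * \<rho>\<^sup>2)" by (simp add: exp_add[symmetric])
        hence "1 * F (t, \<rho>) \<le> exp 4 * exp (- \<delta> * \<rho>\<^sup>2) * F (t, \<rho>)" by (intro mult_right_mono) (auto simp: F_def)
        hence "F (t, \<rho>) \<le> exp 4 * (exp (- \<delta> * \<rho>\<^sup>2) * F (t, \<rho>))" by (simp add: mult.assoc)
        hence "ennreal (F (t, \<rho>)) \<le> ennreal (exp 4) * ennreal (exp (- \<delta> * \<rho>\<^sup>2) * F (t, \<rho>))"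
          by (subst ennreal_mult'[symmetric]) (auto intro!: ennreal_leI)
        thus ?thesis using True by (simp add: F_def)
      qed simp
    qed
    also have "\<dots> = (\<integral>\<^sup>+ t. \<integral>\<^sup>+ \<rho>. ennreal (exp 4) * ennreal (exp (- \<delta> * \<rho>\<^sup>2) * F (t, \<rho>)) \<partial>lborel \<partial>lborel)"
      by (rule lborel_pair.Fubini') measurable
    also have "\<dots> = (\<integral>\<^sup>+ w. ennreal (exp 4) * ennreal (exp (- \<delta> * (snd w)\<^sup>2) * F w) \<partial>(lborel \<Otimes>\<^sub>M lborel))"
      by (subst lborel.nn_integral_fst[symmetric]) auto
    also have "\<dots> = ennreal (exp 4) * (\<integral>\<^sup>+ w. ennreal (exp (- \<delta> * (snd w)\<^sup>2) * F w) \<partial>(lborel \<Otimes>\<^sub>M lborel))"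
      by (rule nn_integral_cmult) measurable
    also have "\<dots> \<le> ennreal (exp 4) * (ennreal (C0 * R powr \<eta> * (2 / \<eta>)) * (\<integral>\<^sup>+ r. ennreal (norm (g r) ^ 4) \<partial>lborel))"
      by (intro mult_left_mono order_trans[OF lim rhs]) auto
    also have "\<dots> = ennreal (C * R powr \<eta>) * (\<integral>\<^sup>+ r. ennreal (norm (g r) ^ 4) \<partial>lborel)"
    proof -
      have "C * R powr \<eta> = exp 4 * (C0 * R powr \<eta> * (2 / \<eta>))" by (simp add: C_def)
      thus ?thesis by (simp only: ennreal_mult'[OF exp_ge_zero] mult.assoc)
    qed
    finally show "(\<integral>\<^sup>+ \<rho>. \<integral>\<^sup>+ t. indicator {-2 * R..2 * R} \<rho> * ennreal (norm (quad_ext (\<lambda>r. g r * iexp (\<rho> * r)) t) ^ 4) \<partial>lborel \<partial>lborel)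
       \<le> ennreal (C * R powr \<eta>) * (\<integral>\<^sup>+ r. ennreal (norm (g r) ^ 4) \<partial>lborel)" .
  qed
qed

section \<open>Interpolation on annuli for functions of given height and support\<close>

text \<open>The interval has length 1, so exponents may be lowered; splitting at height A instead of
  using Hoelder's inequality costs the factor 2.\<close>

lemma Lp_lower:
  fixes g :: "real \<Rightarrow> complex"
  assumes s: "1 \<le> s" "s \<le> p" and A: "A > 0" and [measurable]: "g \<in> borel_measurable borel"
    and supp: "\<And>r. r \<notin> {1..2} \<Longrightarrow> g r = 0"
    and le: "(\<integral>\<^sup>+ r. ennreal (norm (g r) powr p) \<partial>lborel) \<le> ennreal (A powr p)"
  shows "(\<integral>\<^sup>+ r. ennreal (norm (g r) powr s) \<partial>lborel) \<le> ennreal ((2 * A) powr s)"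
proof -
  have "(\<integral>\<^sup>+ r. ennreal (norm (g r) powr s) \<partial>lborel) \<le> (\<integral>\<^sup>+ r. ennreal (A powr s) * indicator {1..2} r + ennreal (A powr (s - p)) * ennreal (norm (g r) powr p) \<partial>lborel)"
  proof (intro nn_integral_mono)
    fix r
    show "ennreal (norm (g r) powr s) \<le> ennreal (A powr s) * indicator {1..2} r + ennreal (A powr (s - p)) * ennreal (norm (g r) powr p)"
    proof (cases "norm (g r) \<le> A")
      case True
      thus ?thesis using supp[of r] s
        by (cases "r \<in> {1..2}") (auto intro!: add_increasing2 ennreal_leI powr_mono2)
    next
      case False
      have "norm (g r) powr s = norm (g r) powr (s - p) * norm (g r) powr p" by (simp add: powr_add[symmetric])
      also have "\<dots> \<le> A powr (s - p) * norm (g r) powr p"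
        using False A s by (intro mult_right_mono powr_mono2') auto
      finally show ?thesis by (simp add: add_increasing ennreal_mult'[symmetric] ennreal_leI)
    qed
  qed
  also have "\<dots> = ennreal (A powr s) + ennreal (A powr (s - p)) * (\<integral>\<^sup>+ r. ennreal (norm (g r) powr p) \<partial>lborel)"
    by (simp add: nn_integral_add nn_integral_cmult)
  also have "\<dots> \<le> ennreal (A powr s) + ennreal (A powr (s - p)) * ennreal (A powr p)"
    by (intro add_left_mono mult_left_mono le) auto
  also have "\<dots> = ennreal (2 * A powr s)"
    by (simp add: ennreal_mult'[symmetric] powr_add[symmetric] ennreal_plus[symmetric] del: ennreal_plus)
  also have "\<dots> \<le> ennreal ((2 * A) powr s)"
    using s A powr_mono[of 1 s 2] by (intro ennreal_leI) (auto simp: powr_mult intro!: mult_right_mono)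
  finally show ?thesis .
qed

lemma Lp_bounded_supp:
  fixes g :: "real \<Rightarrow> complex"
  assumes s: "s > 0" and [measurable]: "g \<in> borel_measurable borel" and le: "\<And>r. norm (g r) \<le> l"
    and m: "emeasure lborel {r. g r \<noteq> 0} \<le> ennreal m"
  shows "(\<integral>\<^sup>+ r. ennreal (norm (g r) powr s) \<partial>lborel) \<le> ennreal (l powr s * m)"
proof -
  have "(\<integral>\<^sup>+ r. ennreal (norm (g r) powr s) \<partial>lborel) \<le> (\<integral>\<^sup>+ r. ennreal (l powr s) * indicator {r. g r \<noteq> 0} r \<partial>lborel)"
    using le s by (intro nn_integral_mono) (auto simp: indicator_def intro!: ennreal_leI powr_mono2)
  also have "\<dots> = ennreal (l powr s) * emeasure lborel {r. g r \<noteq> 0}"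
    by (rule nn_integral_cmult_indicator) measurable
  also have "\<dots> \<le> ennreal (l powr s) * ennreal m" by (intro mult_left_mono m) auto
  finally show ?thesis by (simp add: ennreal_mult')
qed

text \<open>The form in which Hausdorff--Young is applied: h is g times a kernel bounded by c, and
  the constant does not depend on that kernel.\<close>

lemma hausdorff_young_mult:
  fixes q :: real
  assumes q: "q \<ge> 2"
  shows "\<exists>C>0. \<forall>g h c A. g \<in> borel_measurable borel \<longrightarrow> h \<in> borel_measurable borel \<longrightarrow>
     (\<forall>r. norm (h r) \<le> c * norm (g r)) \<longrightarrow> (\<forall>r. r \<notin> {1..2} \<longrightarrow> g r = 0) \<longrightarrow> c > 0 \<longrightarrow> A > 0 \<longrightarrow>
     (\<integral>\<^sup>+ r. ennreal (norm (g r :: complex) powr (q / (q - 1))) \<partial>lborel) \<le> ennreal (A powr (q / (q - 1))) \<longrightarrow>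
     (\<integral>\<^sup>+ t. ennreal (norm (quad_ext h t) powr q) \<partial>lborel) \<le> ennreal (C * (c * A) powr q)"
proof -
  define p where "p = q / (q - 1)"
  have p: "1 < p" "p \<le> 2" "p / (p - 1) = q" using q by (auto simp: p_def field_simps)
  obtain C where C: "C > 0" and HY: "\<And>h A. h \<in> borel_measurable borel \<Longrightarrow> (\<forall>r. r \<notin> {1..2} \<longrightarrow> h r = 0) \<Longrightarrow> A > 0 \<Longrightarrow>
     (\<integral>\<^sup>+ r. ennreal (norm (h r) powr p) \<partial>lborel) \<le> ennreal (A powr p) \<Longrightarrow>
     (\<integral>\<^sup>+ t. ennreal (norm (quad_ext h t) powr q) \<partial>lborel) \<le> ennreal (C * A powr q)"
    using hausdorff_young_quad[OF p(1,2)] unfolding p(3) by blast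
  show ?thesis
  proof (intro exI[of _ C] conjI C allI impI, rule HY)
    fix g h :: "real \<Rightarrow> complex" and c A :: real
    assume [measurable]: "g \<in> borel_measurable borel" "h \<in> borel_measurable borel"
      and hg: "\<forall>r. norm (h r) \<le> c * norm (g r)" and supp: "\<forall>r. r \<notin> {1..2} \<longrightarrow> g r = 0" and c: "c > 0" and A: "A > 0"
      and le: "(\<integral>\<^sup>+ r. ennreal (norm (g r) powr (q / (q - 1))) \<partial>lborel) \<le> ennreal (A powr (q / (q - 1)))"
    show "h \<in> borel_measurable borel" by fact
    show "\<forall>r. r \<notin> {1..2} \<longrightarrow> h r = 0" using hg supp by (metis mult_zero_right norm_le_zero_iff norm_zero)
    show "c * A > 0" using c A by simp
    have "(\<integral>\<^sup>+ r. ennreal (norm (h r) powr p) \<partial>lborel) \<le> (\<integral>\<^sup>+ r. ennreal (c powr p) * ennreal (norm (g r) powr p) \<partial>lborel)"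
    proof (intro nn_integral_mono)
      fix r
      have "norm (h r) powr p \<le> (c * norm (g r)) powr p" using hg p by (intro powr_mono2) auto
      thus "ennreal (norm (h r) powr p) \<le> ennreal (c powr p) * ennreal (norm (g r) powr p)"
        using c by (auto simp: powr_mult ennreal_mult'[symmetric] intro!: ennreal_leI)
    qed
    also have "\<dots> = ennreal (c powr p) * (\<integral>\<^sup>+ r. ennreal (norm (g r) powr p) \<partial>lborel)"
      by (rule nn_integral_cmult) measurable
    also have "\<dots> \<le> ennreal (c powr p) * ennreal (A powr p)"
      using le by (intro mult_left_mono) (auto simp: p_def)
    finally show "(\<integral>\<^sup>+ r. ennreal (norm (h r) powr p) \<partial>lborel) \<le> ennreal ((c * A) powr p)"
      using c A by (simp add: powr_mult ennreal_mult')
  qed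
qed

text \<open>Hoelder's inequality through the weighted arithmetic-geometric mean: pointwise,
  \<open>(F\<^sup>2 / X2) powr x * (F ^ 4 / X4) powr y\<close> is at most
  \<open>x * (F\<^sup>2 / X2) + y * (F ^ 4 / X4)\<close>, whose integral is at most x + y = 1. The
  remaining power b is paid by the supremum S.\<close>

lemma Lq_interpolation:
  fixes F :: "'a \<Rightarrow> real"
  assumes [measurable]: "F \<in> borel_measurable M" and F0: "\<And>z. F z \<ge> 0" and FS: "\<And>z. F z \<le> S"
    and X2: "(\<integral>\<^sup>+ z. ennreal (F z ^ 2) \<partial>M) \<le> ennreal X2" "X2 > 0"
    and X4: "(\<integral>\<^sup>+ z. ennreal (F z ^ 4) \<partial>M) \<le> ennreal X4" "X4 > 0"
    and e: "b \<ge> 0" "x \<ge> 0" "y \<ge> 0" "x + y = 1"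
  shows "(\<integral>\<^sup>+ z. ennreal (F z powr (b + 2 * x + 4 * y)) \<partial>M) \<le> ennreal (S powr b * (X2 powr x * X4 powr y))"
proof -
  let ?K = "S powr b * (X2 powr x * X4 powr y)"
  have "(\<integral>\<^sup>+ z. ennreal (F z powr (b + 2 * x + 4 * y)) \<partial>M) \<le>
     (\<integral>\<^sup>+ z. ennreal ?K * (ennreal (x / X2) * ennreal (F z ^ 2) + ennreal (y / X4) * ennreal (F z ^ 4)) \<partial>M)"
  proof (intro nn_integral_mono)
    fix z
    have "F z powr (b + 2 * x + 4 * y) \<le> ?K * (x / X2 * F z ^ 2 + y / X4 * F z ^ 4)"
    proof (cases "F z = 0")
      case False
      hence pos: "F z > 0" using F0[of z] by simp
      have "F z powr (b + 2 * x + 4 * y) = F z powr b * ((F z ^ 2) powr x * (F z ^ 4) powr y)"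
        using pos by (simp add: powr_add powr_powr powr_numeral[symmetric] del: powr_numeral)
      also have "\<dots> \<le> S powr b * ((F z ^ 2) powr x * (F z ^ 4) powr y)"
        using e F0 FS by (intro mult_right_mono powr_mono2) auto
      also have "\<dots> = ?K * ((F z ^ 2 / X2) powr x * (F z ^ 4 / X4) powr y)"
        using X2 X4 pos by (simp add: powr_divide)
      also have "\<dots> \<le> ?K * (x * (F z ^ 2 / X2) + y * (F z ^ 4 / X4))"
        using X2 X4 pos e by (intro mult_left_mono Youngs_inequality_0) auto
      finally show ?thesis by simp
    qed (use e X2 X4 in auto)
    thus "ennreal (F z powr (b + 2 * x + 4 * y)) \<le> ennreal ?K * (ennreal (x / X2) * ennreal (F z ^ 2) + ennreal (y / X4) * ennreal (F z ^ 4))"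
      using e X2 X4 by (simp add: ennreal_mult'[symmetric] ennreal_plus[symmetric] ennreal_leI del: ennreal_plus)
  qed
  also have "\<dots> = ennreal ?K * (ennreal (x / X2) * (\<integral>\<^sup>+ z. ennreal (F z ^ 2) \<partial>M) + ennreal (y / X4) * (\<integral>\<^sup>+ z. ennreal (F z ^ 4) \<partial>M))"
    by (simp add: nn_integral_cmult nn_integral_add)
  also have "\<dots> \<le> ennreal ?K * (ennreal (x / X2) * ennreal X2 + ennreal (y / X4) * ennreal X4)"
    by (intro mult_left_mono add_mono X2 X4) auto
  also have "ennreal (x / X2) * ennreal X2 + ennreal (y / X4) * ennreal X4 = 1"
    using e X2 X4 by (simp add: ennreal_mult'[symmetric] ennreal_plus[symmetric] del: ennreal_plus)
  finally show ?thesis by simp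
qed

text \<open>The Jacobian of polar coordinates is left out: it is comparable to a constant on the
  annulus and enters later as the factor \<open>R ^ (d - 1)\<close>.\<close>

definition annulus_int :: "real \<Rightarrow> real \<Rightarrow> (real \<Rightarrow> real \<Rightarrow> complex) \<Rightarrow> ennreal" where
  "annulus_int q R T = (\<integral>\<^sup>+ \<rho>. \<integral>\<^sup>+ t. indicator {R..2 * R} \<rho> * ennreal (norm (T \<rho> t) powr q) \<partial>lborel \<partial>lborel)"

lemma annulus_int_le_fixed:
  assumes "R > 0" "B \<ge> 0" "\<And>\<rho>. \<rho> \<in> {R..2 * R} \<Longrightarrow> (\<integral>\<^sup>+ t. ennreal (norm (T \<rho> t) powr q) \<partial>lborel) \<le> ennreal B"
  shows "annulus_int q R T \<le> ennreal (R * B)"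
proof -
  have "annulus_int q R T \<le> (\<integral>\<^sup>+ \<rho>. ennreal B * indicator {R..2 * R} \<rho> \<partial>lborel)"
    unfolding annulus_int_def
  proof (rule nn_integral_mono)
    fix \<rho>
    show "(\<integral>\<^sup>+ t. indicator {R..2 * R} \<rho> * ennreal (norm (T \<rho> t) powr q) \<partial>lborel) \<le> ennreal B * indicator {R..2 * R} \<rho>"
      using assms(3)[of \<rho>] by (cases "\<rho> \<in> {R..2 * R}") auto
  qed
  also have "\<dots> = ennreal (R * B)"
    using assms by (subst nn_integral_cmult_indicator) (auto simp: ennreal_mult'[symmetric] mult.commute)
  finally show ?thesis .
qed

lemma powr_add_le:
  fixes x y q :: real
  assumes "x \<ge> 0" "y \<ge> 0" "q \<ge> 0"
  shows "(x + y) powr q \<le> 2 powr q * (x powr q + y powr q)"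
proof -
  have "(x + y) powr q \<le> (2 * max x y) powr q" using assms by (intro powr_mono2) auto
  also have "\<dots> = 2 powr q * max x y powr q" using assms by (simp add: powr_mult)
  also have "max x y powr q \<le> x powr q + y powr q" by (auto simp: max_def)
  finally show ?thesis by simp
qed

lemma annulus_int_add:
  assumes q: "q \<ge> 0" and c: "c \<ge> 0"
    and [measurable]: "(\<lambda>(\<rho>, t). T1 \<rho> t) \<in> borel_measurable (borel \<Otimes>\<^sub>M borel)" "(\<lambda>(\<rho>, t). T2 \<rho> t) \<in> borel_measurable (borel \<Otimes>\<^sub>M borel)"
    and le: "\<And>\<rho> t. \<rho> \<in> {R..2 * R} \<Longrightarrow> norm (T \<rho> t) \<le> c * (norm (T1 \<rho> t) + norm (T2 \<rho> t))"
  shows "annulus_int q R T \<le> ennreal ((2 * c) powr q) * (annulus_int q R T1 + annulus_int q R T2)"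
proof -
  have "annulus_int q R T \<le> (\<integral>\<^sup>+ \<rho>. \<integral>\<^sup>+ t. ennreal ((2 * c) powr q) * (indicator {R..2 * R} \<rho> * ennreal (norm (T1 \<rho> t) powr q) + indicator {R..2 * R} \<rho> * ennreal (norm (T2 \<rho> t) powr q)) \<partial>lborel \<partial>lborel)"
    unfolding annulus_int_def
  proof (intro nn_integral_mono)
    fix \<rho> t
    have "norm (T \<rho> t) powr q \<le> (2 * c) powr q * (norm (T1 \<rho> t) powr q + norm (T2 \<rho> t) powr q)" if "\<rho> \<in> {R..2 * R}"
    proof -
      have "norm (T \<rho> t) powr q \<le> (c * (norm (T1 \<rho> t) + norm (T2 \<rho> t))) powr q"
        using le[OF that] q by (intro powr_mono2) auto
      also have "\<dots> = c powr q * (norm (T1 \<rho> t) + norm (T2 \<rho> t)) powr q" using c by (simp add: powr_mult)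
      also have "\<dots> \<le> c powr q * (2 powr q * (norm (T1 \<rho> t) powr q + norm (T2 \<rho> t) powr q))"
        using q by (intro mult_left_mono powr_add_le) auto
      also have "\<dots> = (2 * c) powr q * (norm (T1 \<rho> t) powr q + norm (T2 \<rho> t) powr q)"
        using c by (simp add: powr_mult)
      finally show ?thesis .
    qed
    thus "indicator {R..2 * R} \<rho> * ennreal (norm (T \<rho> t) powr q) \<le> ennreal ((2 * c) powr q) * (indicator {R..2 * R} \<rho> * ennreal (norm (T1 \<rho> t) powr q) + indicator {R..2 * R} \<rho> * ennreal (norm (T2 \<rho> t) powr q))"
      by (cases "\<rho> \<in> {R..2 * R}") (auto simp: ennreal_mult'[symmetric] ennreal_plus[symmetric] simp del: ennreal_plus intro!: ennreal_leI)
  qed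
  also have "\<dots> = (\<integral>\<^sup>+ \<rho>. ennreal ((2 * c) powr q) * ((\<integral>\<^sup>+ t. indicator {R..2 * R} \<rho> * ennreal (norm (T1 \<rho> t) powr q) \<partial>lborel) + (\<integral>\<^sup>+ t. indicator {R..2 * R} \<rho> * ennreal (norm (T2 \<rho> t) powr q) \<partial>lborel)) \<partial>lborel)"
    by (intro nn_integral_cong) (simp add: nn_integral_cmult nn_integral_add)
  also have "\<dots> = ennreal ((2 * c) powr q) * (annulus_int q R T1 + annulus_int q R T2)"
    unfolding annulus_int_def by (subst nn_integral_cmult, measurable) (subst nn_integral_add, auto)
  finally show ?thesis .
qed

lemma norm_quad_ext_le:
  assumes "integrable lborel h"
  shows "ennreal (norm (quad_ext h t)) \<le> (\<integral>\<^sup>+ r. ennreal (norm (h r)) \<partial>lborel)"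
proof -
  have "integrable lborel (\<lambda>r. h r * iexp (t * r\<^sup>2))"
    by (rule Bochner_Integration.integrable_bound[OF assms]) (use assms in \<open>auto simp: norm_mult\<close>)
  from integral_norm_bound_ennreal[OF this] show ?thesis
    by (simp add: quad_ext_def norm_mult)
qed

text \<open>The sup norm is at most l m, the integral of the square at most a multiple of R l^2 m,
  and that of the fourth power at most a multiple of \<open>R powr \<eta>\<close> times l^4 m. Taken
  to the powers b, x, y, the exponents of l add up to q and those of m to b + 1. The sign \<sigma>
  distinguishes the two waves of the kernel asymptotics.\<close>

lemma quad_wave_bounds:
  fixes q b x y \<eta> :: real
  assumes e: "b \<ge> 0" "x \<ge> 0" "y \<ge> 0" "x + y = 1" and q: "q = b + 2 * x + 4 * y" and \<eta>: "0 < \<eta>" "\<eta> \<le> 1"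
    and \<sigma>: "\<sigma> \<in> {1, -1::real}"
  shows "\<exists>C>0. \<forall>R\<ge>1. \<forall>g l m. g \<in> borel_measurable borel \<longrightarrow> (\<forall>r. r \<notin> {1..2} \<longrightarrow> g r = 0) \<longrightarrow> (\<forall>r. norm (g r) \<le> l) \<longrightarrow> l > 0 \<longrightarrow> m > 0 \<longrightarrow>
     emeasure lborel {r. g r \<noteq> 0} \<le> ennreal m \<longrightarrow>
     annulus_int q R (\<lambda>\<rho> t. quad_ext (\<lambda>r. g r * iexp (\<sigma> * \<rho> * r)) t) \<le> ennreal (C * R powr (x + \<eta> * y) * (l powr q * m powr (b + 1)))"
proof -
  obtain C4 where C4: "C4 > 0" and L4: "\<And>R g. R \<ge> 1 \<Longrightarrow> integrable lborel g \<Longrightarrow> (\<forall>r. r \<notin> {1..2} \<longrightarrow> g r = 0) \<Longrightarrow>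
     (\<integral>\<^sup>+ \<rho>. \<integral>\<^sup>+ t. indicator {-2 * R..2 * R} \<rho> * ennreal (norm (quad_ext (\<lambda>r. g r * iexp (\<rho> * r)) t) ^ 4) \<partial>lborel \<partial>lborel)
       \<le> ennreal (C4 * R powr \<eta>) * (\<integral>\<^sup>+ r. ennreal (norm (g r) ^ 4) \<partial>lborel)"
    using quad_ext_L4[OF \<eta>] by blast
  define C where "C = pi powr x * C4 powr y"
  have C: "C > 0" using C4 by (simp add: C_def)
  show ?thesis
  proof (intro exI[of _ C] conjI C allI impI)
    fix R l m :: real and g :: "real \<Rightarrow> complex"
    assume R: "R \<ge> 1" and [measurable]: "g \<in> borel_measurable borel" and supp: "\<forall>r. r \<notin> {1..2} \<longrightarrow> g r = 0" and gl: "\<forall>r. norm (g r) \<le> l"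
      and l: "l > 0" and m: "m > 0" and mm: "emeasure lborel {r. g r \<noteq> 0} \<le> ennreal m"
    have g1: "(\<integral>\<^sup>+ r. ennreal (norm (g r)) \<partial>lborel) \<le> ennreal (l * m)"
      using Lp_bounded_supp[of 1 g l m] gl mm l by simp
    have g2: "(\<integral>\<^sup>+ r. ennreal ((norm (g r))\<^sup>2) \<partial>lborel) \<le> ennreal (l\<^sup>2 * m)"
      using Lp_bounded_supp[of 2 g l m] gl mm l by simp
    have g4: "(\<integral>\<^sup>+ r. ennreal ((norm (g r)) ^ 4) \<partial>lborel) \<le> ennreal (l ^ 4 * m)"
      using Lp_bounded_supp[of 4 g l m] gl mm l by simp
    have gint: "integrable lborel g"
      using g1 by (intro integrableI_bounded) (auto intro: le_less_trans)
    define Q where "Q \<rho> t = quad_ext (\<lambda>r. g r * iexp (\<sigma> * \<rho> * r)) t" for \<rho> t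
    have gi: "integrable lborel (\<lambda>r. g r * iexp (\<sigma> * \<rho> * r))" for \<rho>
      by (rule Bochner_Integration.integrable_bound[OF gint]) (auto simp: norm_mult)
    have [measurable]: "(\<lambda>(\<rho>, t). Q \<rho> t) \<in> borel_measurable (borel \<Otimes>\<^sub>M borel)" unfolding Q_def by measurable
    define F where "F z = indicator {R..2 * R} (fst z) * norm (Q (fst z) (snd z))" for z
    have [measurable]: "F \<in> borel_measurable (lborel \<Otimes>\<^sub>M lborel)" unfolding F_def by measurable
    have Fint: "(\<integral>\<^sup>+ z. ennreal (F z powr s) \<partial>(lborel \<Otimes>\<^sub>M lborel)) = annulus_int s R Q" for s
    proof -
      have "(\<integral>\<^sup>+ z. ennreal (F z powr s) \<partial>(lborel \<Otimes>\<^sub>M lborel)) = (\<integral>\<^sup>+ \<rho>. \<integral>\<^sup>+ t. ennreal (F (\<rho>, t) powr s) \<partial>lborel \<partial>lborel)"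
        by (rule lborel.nn_integral_fst[symmetric]) measurable
      thus ?thesis unfolding annulus_int_def by (auto simp: F_def indicator_def intro!: nn_integral_cong)
    qed
    have "annulus_int 2 R Q \<le> ennreal (R * (pi * (l\<^sup>2 * m)))"
    proof (rule annulus_int_le_fixed)
      fix \<rho>
      have "(\<integral>\<^sup>+ t. ennreal (norm (Q \<rho> t) powr 2) \<partial>lborel) \<le> ennreal pi * (\<integral>\<^sup>+ r. ennreal ((norm (g r * iexp (\<sigma> * \<rho> * r)))\<^sup>2) \<partial>lborel)"
        using quad_ext_L2[OF gi, of \<rho>] supp by (simp add: Q_def)
      also have "\<dots> \<le> ennreal pi * ennreal (l\<^sup>2 * m)"
        using g2 by (intro mult_left_mono) (auto simp: norm_mult)
      finally show "(\<integral>\<^sup>+ t. ennreal (norm (Q \<rho> t) powr 2) \<partial>lborel) \<le> ennreal (pi * (l\<^sup>2 * m))" by (simp add: ennreal_mult')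
    qed (use R m in auto)
    hence X2: "(\<integral>\<^sup>+ z. ennreal (F z ^ 2) \<partial>(lborel \<Otimes>\<^sub>M lborel)) \<le> ennreal (R * (pi * (l\<^sup>2 * m)))"
      unfolding Fint[symmetric] by (simp add: F_def)
    define D where "D \<rho> = (\<integral>\<^sup>+ t. indicator {-2 * R..2 * R} \<rho> * ennreal (norm (quad_ext (\<lambda>r. g r * iexp (\<rho> * r)) t) ^ 4) \<partial>lborel)" for \<rho>
    have [measurable]: "D \<in> borel_measurable borel" unfolding D_def by measurable
    have "annulus_int 4 R Q \<le> (\<integral>\<^sup>+ \<rho>. D (\<sigma> * \<rho>) \<partial>lborel)"
      unfolding annulus_int_def D_def Q_def
      by (intro nn_integral_mono) (use \<sigma> R in \<open>auto simp: indicator_def\<close>)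
    also have "\<dots> = (\<integral>\<^sup>+ \<rho>. D \<rho> \<partial>lborel)"
      using \<sigma> nn_integral_real_affine[of D "-1" 0] by auto
    also have "\<dots> \<le> ennreal (C4 * R powr \<eta>) * (\<integral>\<^sup>+ r. ennreal (norm (g r) ^ 4) \<partial>lborel)"
      unfolding D_def using L4[OF R gint supp] .
    also have "\<dots> \<le> ennreal (C4 * R powr \<eta>) * ennreal (l ^ 4 * m)" by (intro mult_left_mono g4) auto
    also have "\<dots> = ennreal (C4 * R powr \<eta> * (l ^ 4 * m))" using C4 by (simp add: ennreal_mult')
    finally have X4: "(\<integral>\<^sup>+ z. ennreal (F z ^ 4) \<partial>(lborel \<Otimes>\<^sub>M lborel)) \<le> ennreal (C4 * R powr \<eta> * (l ^ 4 * m))"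
      unfolding Fint[symmetric] by (simp add: F_def)
    have FS: "F z \<le> l * m" for z
    proof -
      have "ennreal (norm (Q (fst z) (snd z))) \<le> ennreal (l * m)"
        using norm_quad_ext_le[OF gi, of "fst z" "snd z"] g1 by (simp add: Q_def norm_mult)
      hence "norm (Q (fst z) (snd z)) \<le> l * m" using l m by (simp add: ennreal_le_iff)
      thus ?thesis using l m by (auto simp: F_def indicator_def)
    qed
    have "annulus_int q R Q \<le> ennreal ((l * m) powr b * ((R * (pi * (l\<^sup>2 * m))) powr x * (C4 * R powr \<eta> * (l ^ 4 * m)) powr y))"
      unfolding Fint[symmetric] q
      by (rule Lq_interpolation[OF _ _ FS X2 _ X4 _ e]) (use R l m C4 in \<open>auto simp: F_def\<close>)
    also have "(l * m) powr b * ((R * (pi * (l\<^sup>2 * m))) powr x * (C4 * R powr \<eta> * (l ^ 4 * m)) powr y)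
       = C * R powr (x + \<eta> * y) * (l powr q * m powr (b + 1))"
    proof -
      have "(l\<^sup>2) powr x = l powr (2 * x)" "(l ^ 4) powr y = l powr (4 * y)"
        using l by (simp_all add: powr_powr powr_numeral[symmetric] del: powr_numeral)
      moreover have "m powr (b + 1) = m powr b * m powr x * m powr y"
        using e by (simp add: powr_add[symmetric] add.assoc)
      ultimately show ?thesis
        using R l m C4 by (simp add: powr_mult powr_powr C_def q powr_add mult_ac)
    qed
    finally show "annulus_int q R (\<lambda>\<rho> t. quad_ext (\<lambda>r. g r * iexp (\<sigma> * \<rho> * r)) t) \<le> ennreal (C * R powr (x + \<eta> * y) * (l powr q * m powr (b + 1)))"
      by (simp add: Q_def)
  qed
qed

section \<open>Summation of countably many pieces in L^q\<close>

text \<open>This stands in for Minkowski's inequality. If S is the sum on the right, every term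
  obeys \<open>w i * a i \<le> S powr (1 / q)\<close>; dividing by the weights and summing gives the
  claim. The weights are later paid for by part of a geometric gain.\<close>

lemma powr_le_weighted_sum:
  fixes a w :: "'i \<Rightarrow> real"
  assumes a: "\<And>i. a i \<ge> 0" and w: "\<And>i. w i > 0" and W: "(\<integral>\<^sup>+ i. ennreal (1 / w i) \<partial>count_space UNIV) \<le> ennreal W" "W > 0"
    and s: "s \<ge> 0" "ennreal s \<le> (\<integral>\<^sup>+ i. ennreal (a i) \<partial>count_space UNIV)" and q: "q > 0"
  shows "ennreal (s powr q) \<le> ennreal (W powr q) * (\<integral>\<^sup>+ i. ennreal ((w i * a i) powr q) \<partial>count_space UNIV)"
proof (cases "(\<integral>\<^sup>+ i. ennreal ((w i * a i) powr q) \<partial>count_space UNIV) = \<infinity>")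
  case True
  thus ?thesis using W by (simp add: ennreal_mult_top)
next
  case False
  then obtain S where S: "S \<ge> 0" "(\<integral>\<^sup>+ i. ennreal ((w i * a i) powr q) \<partial>count_space UNIV) = ennreal S"
    by (metis ennreal_cases infinity_ennreal_def)
  have "ennreal (a i) \<le> ennreal (S powr (1 / q)) * ennreal (1 / w i)" for i
  proof -
    have "ennreal ((w i * a i) powr q) \<le> ennreal S"
      unfolding S(2)[symmetric] by (rule nn_integral_ge_point) simp
    hence "(w i * a i) powr q \<le> S" using S by (simp add: ennreal_le_iff)
    hence "((w i * a i) powr q) powr (1 / q) \<le> S powr (1 / q)" using q by (intro powr_mono2) auto
    hence "w i * a i \<le> S powr (1 / q)" using q a[of i] w[of i] by (simp add: powr_powr)
    hence "a i \<le> S powr (1 / q) * (1 / w i)" using w[of i] by (simp add: field_simps)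
    thus ?thesis by (simp add: ennreal_mult'[symmetric] ennreal_leI)
  qed
  hence "(\<integral>\<^sup>+ i. ennreal (a i) \<partial>count_space UNIV) \<le> (\<integral>\<^sup>+ i. ennreal (S powr (1 / q)) * ennreal (1 / w i) \<partial>count_space UNIV)"
    by (intro nn_integral_mono)
  also have "\<dots> = ennreal (S powr (1 / q)) * (\<integral>\<^sup>+ i. ennreal (1 / w i) \<partial>count_space UNIV)"
    by (rule nn_integral_cmult) simp
  also have "\<dots> \<le> ennreal (S powr (1 / q)) * ennreal W" by (intro mult_left_mono W) auto
  finally have "ennreal s \<le> ennreal (S powr (1 / q) * W)" using s(2) by (simp add: ennreal_mult')
  hence "s \<le> S powr (1 / q) * W" using W by (simp add: ennreal_le_iff)
  hence "s powr q \<le> (S powr (1 / q) * W) powr q" using s q by (intro powr_mono2) auto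
  also have "\<dots> = W powr q * S" using S W q by (simp add: powr_mult powr_powr)
  finally show ?thesis unfolding S(2) by (simp add: ennreal_mult'[symmetric] ennreal_leI)
qed

lemma integrable_mult_iexp:
  fixes h :: "real \<Rightarrow> complex"
  assumes "integrable lborel h" "f \<in> borel_measurable borel"
  shows "integrable lborel (\<lambda>r. h r * iexp (f r))"
proof (rule Bochner_Integration.integrable_bound[OF assms(1)])
  have [measurable]: "h \<in> borel_measurable borel" "f \<in> borel_measurable borel" using assms by auto
  show "(\<lambda>r. h r * iexp (f r)) \<in> borel_measurable lborel" by measurable
qed (auto simp: norm_mult)

text \<open>Dominated convergence. In the applications the pieces are restrictions of h to disjoint
  sets, so the partial sums are dominated by h itself.\<close>

lemma quad_ext_norm_le_suminf:
  fixes h :: "real \<Rightarrow> complex" and hk :: "nat \<Rightarrow> real \<Rightarrow> complex"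
  assumes h: "integrable lborel h" and hk: "\<And>k. integrable lborel (hk k)"
    and lim: "\<And>r. (\<lambda>n. \<Sum>k<n. hk k r) \<longlonglongrightarrow> h r" and dom: "\<And>n r. norm (\<Sum>k<n. hk k r) \<le> norm (h r)"
  shows "ennreal (norm (quad_ext h t)) \<le> (\<integral>\<^sup>+ k. ennreal (norm (quad_ext (hk k) t)) \<partial>count_space UNIV)"
proof -
  have hke: "integrable lborel (\<lambda>r. hk k r * iexp (t * r\<^sup>2))" for k
    by (rule integrable_mult_iexp[OF hk]) measurable
  have [measurable]: "h \<in> borel_measurable borel" "hk k \<in> borel_measurable borel" for k using h hk by auto
  have "(\<lambda>n. LINT r|lborel. (\<Sum>k<n. hk k r) * iexp (t * r\<^sup>2)) \<longlonglongrightarrow> quad_ext h t"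
    unfolding quad_ext_def
  proof (rule integral_dominated_convergence[where w = "\<lambda>r. norm (h r)"])
    show "AE r in lborel. (\<lambda>n. (\<Sum>k<n. hk k r) * iexp (t * r\<^sup>2)) \<longlonglongrightarrow> h r * iexp (t * r\<^sup>2)"
      by (intro AE_I2 tendsto_mult lim tendsto_const)
    show "AE r in lborel. norm ((\<Sum>k<n. hk k r) * iexp (t * r\<^sup>2)) \<le> norm (h r)" for n
      using dom by (intro AE_I2) (simp add: norm_mult)
  qed (use h in auto)
  also have "(\<lambda>n. LINT r|lborel. (\<Sum>k<n. hk k r) * iexp (t * r\<^sup>2)) = (\<lambda>n. \<Sum>k<n. quad_ext (hk k) t)"
    unfolding sum_distrib_right quad_ext_def by (subst Bochner_Integration.integral_sum) (use hke in auto)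
  finally have "(\<lambda>n. norm (\<Sum>k<n. quad_ext (hk k) t)) \<longlonglongrightarrow> norm (quad_ext h t)" by (rule tendsto_norm)
  hence "(\<lambda>n. ennreal (norm (\<Sum>k<n. quad_ext (hk k) t))) \<longlonglongrightarrow> ennreal (norm (quad_ext h t))" by (rule tendsto_ennrealI)
  moreover have "ennreal (norm (\<Sum>k<n. quad_ext (hk k) t)) \<le> (\<Sum>k. ennreal (norm (quad_ext (hk k) t)))" for n
  proof -
    have "ennreal (norm (\<Sum>k<n. quad_ext (hk k) t)) \<le> ennreal (\<Sum>k<n. norm (quad_ext (hk k) t))"
      by (intro ennreal_leI norm_sum)
    also have "\<dots> = (\<Sum>k<n. ennreal (norm (quad_ext (hk k) t)))" by (rule sum_ennreal[symmetric]) simp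
    also have "\<dots> \<le> (\<Sum>k. ennreal (norm (quad_ext (hk k) t)))" by (rule sum_le_suminf) auto
    finally show ?thesis .
  qed
  ultimately have "ennreal (norm (quad_ext h t)) \<le> (\<Sum>k. ennreal (norm (quad_ext (hk k) t)))"
    by (rule LIMSEQ_le_const2[OF _ exI, OF _ allI, OF _ impI])
  thus ?thesis by (simp add: nn_integral_count_space_nat)
qed

lemma nn_integral_geometric:
  assumes "0 < x" "x < 1"
  shows "(\<integral>\<^sup>+ k. ennreal (x ^ k) \<partial>count_space UNIV) = ennreal (1 / (1 - x))"
proof -
  have "(\<integral>\<^sup>+ k. ennreal (x ^ k) \<partial>count_space UNIV) = (\<Sum>k. ennreal (x ^ k))" by (rule nn_integral_count_space_nat)
  also have "\<dots> = ennreal (\<Sum>k. x ^ k)" using assms by (intro suminf_ennreal2) auto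
  finally show ?thesis using assms by (simp add: suminf_geometric)
qed

lemma annulus_int_le_suminf:
  fixes T :: "real \<Rightarrow> real \<Rightarrow> complex" and Tk :: "nat \<Rightarrow> real \<Rightarrow> real \<Rightarrow> complex"
  assumes [measurable]: "\<And>k. (\<lambda>(\<rho>, t). Tk k \<rho> t) \<in> borel_measurable (borel \<Otimes>\<^sub>M borel)"
    and w: "\<And>k. w k > 0" and W: "(\<integral>\<^sup>+ i. ennreal (1 / w i) \<partial>count_space UNIV) \<le> ennreal W" "W > 0" and q: "q > 0"
    and le: "\<And>\<rho> t. \<rho> \<in> {R..2 * R} \<Longrightarrow> ennreal (norm (T \<rho> t)) \<le> (\<integral>\<^sup>+ k. ennreal (norm (Tk k \<rho> t)) \<partial>count_space UNIV)"
  shows "annulus_int q R T \<le> ennreal (W powr q) * (\<Sum>k. ennreal (w k powr q) * annulus_int q R (Tk k))"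
proof -
  have "annulus_int q R T \<le> (\<integral>\<^sup>+ \<rho>. \<integral>\<^sup>+ t. ennreal (W powr q) * (\<Sum>k. ennreal (w k powr q) * (indicator {R..2 * R} \<rho> * ennreal (norm (Tk k \<rho> t) powr q))) \<partial>lborel \<partial>lborel)"
    unfolding annulus_int_def
  proof (intro nn_integral_mono)
    fix \<rho> t
    show "indicator {R..2 * R} \<rho> * ennreal (norm (T \<rho> t) powr q) \<le> ennreal (W powr q) * (\<Sum>k. ennreal (w k powr q) * (indicator {R..2 * R} \<rho> * ennreal (norm (Tk k \<rho> t) powr q)))"
    proof (cases "\<rho> \<in> {R..2 * R}")
      case True
      have "ennreal (norm (T \<rho> t) powr q) \<le> ennreal (W powr q) * (\<integral>\<^sup>+ k. ennreal ((w k * norm (Tk k \<rho> t)) powr q) \<partial>count_space UNIV)"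
        by (rule powr_le_weighted_sum[OF _ w W _ le[OF True] q]) auto
      also have "(\<integral>\<^sup>+ k. ennreal ((w k * norm (Tk k \<rho> t)) powr q) \<partial>count_space UNIV) = (\<Sum>k. ennreal (w k powr q) * ennreal (norm (Tk k \<rho> t) powr q))"
        by (simp add: nn_integral_count_space_nat powr_mult less_imp_le[OF w] ennreal_mult')
      finally show ?thesis using True by simp
    qed simp
  qed
  also have "\<dots> = (\<integral>\<^sup>+ \<rho>. ennreal (W powr q) * (\<Sum>k. ennreal (w k powr q) * (\<integral>\<^sup>+ t. indicator {R..2 * R} \<rho> * ennreal (norm (Tk k \<rho> t) powr q) \<partial>lborel)) \<partial>lborel)"
    by (intro nn_integral_cong) (simp add: nn_integral_cmult nn_integral_suminf)
  also have "\<dots> = ennreal (W powr q) * (\<Sum>k. ennreal (w k powr q) * annulus_int q R (Tk k))"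
    unfolding annulus_int_def by (subst nn_integral_cmult, measurable) (simp add: nn_integral_cmult nn_integral_suminf)
  finally show ?thesis .
qed

section \<open>Radial kernels with oscillatory asymptotics\<close>

text \<open>The estimates use only these bounds for the Fourier transform of the sphere: boundedness
  near 0, decay at infinity, and the leading oscillation of amplitude a. One constant K serves all
  of them.\<close>

locale radial_kernel =
  fixes \<kappa> :: "real \<Rightarrow> real" and d :: nat and K :: real and a :: complex
  assumes d: "d \<ge> 2" and \<kappa>_measurable [measurable]: "\<kappa> \<in> borel_measurable borel" and K: "K > 0"
    and \<kappa>_bounded: "s \<ge> 0 \<Longrightarrow> \<bar>\<kappa> s\<bar> \<le> K"
    and \<kappa>_decay: "s > 0 \<Longrightarrow> \<bar>\<kappa> s\<bar> \<le> K * s powr (- ((real d - 1) / 2))"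
    and \<kappa>_asymp: "s \<ge> 1 \<Longrightarrow> \<bar>\<kappa> s - s powr (- ((real d - 1) / 2)) * Re (a * iexp s)\<bar> \<le> K * s powr (- ((real d + 1) / 2))"
begin

text \<open>With \<open>g r = r ^ (d - 1) * F r\<close> and the kernel of the sphere, this is the
  extension of the function with radial profile F at any point (t, x) with
  \<open>norm x = \<rho>\<close>; the identity is \<open>extension_op_radial\<close>.\<close>

definition T :: "(real \<Rightarrow> complex) \<Rightarrow> real \<Rightarrow> real \<Rightarrow> complex" where
  "T g \<rho> t = quad_ext (\<lambda>r. g r * complex_of_real (\<kappa> (\<rho> * r))) t"

lemma T_measurable:
  assumes [measurable]: "g \<in> borel_measurable borel"
  shows "(\<lambda>(\<rho>, t). T g \<rho> t) \<in> borel_measurable (borel \<Otimes>\<^sub>M borel)"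
  unfolding T_def by measurable

text \<open>Hausdorff--Young in t at each fixed \<rho>, where the kernel is at most K times the
  minimum; the integral over \<rho> costs the length R of the annulus. Oscillation in \<rho> is not
  exploited.\<close>

lemma T_hausdorff_young:
  assumes q: "q \<ge> 2"
  shows "\<exists>C>0. \<forall>R>0. \<forall>g A. g \<in> borel_measurable borel \<longrightarrow> (\<forall>r. r \<notin> {1..2} \<longrightarrow> g r = 0) \<longrightarrow> A > 0 \<longrightarrow>
     (\<integral>\<^sup>+ r. ennreal (norm (g r) powr (q / (q - 1))) \<partial>lborel) \<le> ennreal (A powr (q / (q - 1))) \<longrightarrow>
     annulus_int q R (T g) \<le> ennreal (C * (R * min 1 (R powr (- ((real d - 1) / 2))) powr q * A powr q))"
proof -
  obtain C where C: "C > 0" and HY: "\<And>g h c A. g \<in> borel_measurable borel \<Longrightarrow> h \<in> borel_measurable borel \<Longrightarrow>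
     (\<forall>r. norm (h r) \<le> c * norm (g r)) \<Longrightarrow> (\<forall>r. r \<notin> {1..2} \<longrightarrow> g r = 0) \<Longrightarrow> c > 0 \<Longrightarrow> A > 0 \<Longrightarrow>
     (\<integral>\<^sup>+ r. ennreal (norm (g r :: complex) powr (q / (q - 1))) \<partial>lborel) \<le> ennreal (A powr (q / (q - 1))) \<Longrightarrow>
     (\<integral>\<^sup>+ t. ennreal (norm (quad_ext h t) powr q) \<partial>lborel) \<le> ennreal (C * (c * A) powr q)"
    using hausdorff_young_mult[OF q] by blast
  define C' where "C' = C * K powr q"
  have C': "C' > 0" using C K by (simp add: C'_def)
  show ?thesis
  proof (intro exI[of _ C'] conjI C' allI impI)
    fix R A :: real and g :: "real \<Rightarrow> complex"
    assume R: "R > 0" and [measurable]: "g \<in> borel_measurable borel" and supp: "\<forall>r. r \<notin> {1..2} \<longrightarrow> g r = 0" and A: "A > 0"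
      and le: "(\<integral>\<^sup>+ r. ennreal (norm (g r) powr (q / (q - 1))) \<partial>lborel) \<le> ennreal (A powr (q / (q - 1)))"
    define \<mu> where "\<mu> = min 1 (R powr (- ((real d - 1) / 2)))"
    have \<mu>: "\<mu> > 0" using R by (simp add: \<mu>_def)
    have "annulus_int q R (T g) \<le> ennreal (R * (C * (K * \<mu> * A) powr q))"
    proof (rule annulus_int_le_fixed)
      fix \<rho> assume \<rho>: "\<rho> \<in> {R..2 * R}"
      show "(\<integral>\<^sup>+ t. ennreal (norm (T g \<rho> t) powr q) \<partial>lborel) \<le> ennreal (C * (K * \<mu> * A) powr q)"
        unfolding T_def
      proof (rule HY[where g = g])
        show "\<forall>r. norm (g r * complex_of_real (\<kappa> (\<rho> * r))) \<le> K * \<mu> * norm (g r)"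
        proof
          fix r
          show "norm (g r * complex_of_real (\<kappa> (\<rho> * r))) \<le> K * \<mu> * norm (g r)"
          proof (cases "r \<in> {1..2}")
            case True
            have "R * 1 \<le> \<rho> * r" using True \<rho> R by (intro mult_mono) auto
            hence "(\<rho> * r) powr (- ((real d - 1) / 2)) \<le> R powr (- ((real d - 1) / 2))"
              using R d by (intro powr_mono2') auto
            moreover have "\<rho> * r > 0" using True \<rho> R by auto
            ultimately have "\<bar>\<kappa> (\<rho> * r)\<bar> \<le> K * \<mu>"
              using \<kappa>_bounded[of "\<rho> * r"] \<kappa>_decay[of "\<rho> * r"] K
              by (auto simp: \<mu>_def min_def intro: order_trans[OF _ mult_left_mono])
            thus ?thesis by (simp add: norm_mult mult.commute[of _ "norm (g r)"] mult_left_mono)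
          qed (use supp in auto)
        qed
      qed (use supp K \<mu> A le in auto)
    qed (use R C in auto)
    also have "R * (C * (K * \<mu> * A) powr q) = C' * (R * \<mu> powr q * A powr q)"
      using K \<mu> A by (simp add: powr_mult C'_def)
    finally show "annulus_int q R (T g) \<le> ennreal (C' * (R * min 1 (R powr (- ((real d - 1) / 2))) powr q * A powr q))"
      by (simp add: \<mu>_def)
  qed
qed

end

lemma quad_ext_lincomb:
  assumes "integrable lborel f" "integrable lborel g"
  shows "quad_ext (\<lambda>r. u * f r + v * g r) t = u * quad_ext f t + v * quad_ext g t"
proof -
  have "integrable lborel (\<lambda>r. f r * iexp (t * r\<^sup>2))" "integrable lborel (\<lambda>r. g r * iexp (t * r\<^sup>2))"
    by (rule integrable_mult_iexp[OF assms(1)], measurable) (rule integrable_mult_iexp[OF assms(2)], measurable)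
  thus ?thesis
    unfolding quad_ext_def by (simp add: distrib_right mult.assoc)
qed

context radial_kernel
begin

text \<open>Here u is a reciprocal exponent: \<open>l * m powr u\<close> bounds the L^(1/u) norm of
  g. The last four conditions say, in order, that the exponents of the proof satisfy b \<ge> 0, y
  \<ge> 0, x \<ge> 0 and E < 0. For R \<le> 1 Hausdorff--Young suffices; for R > 1 the kernel is
  split into two waves and a remainder.\<close>

lemma T_restricted:
  fixes q u :: real
  assumes q: "q \<ge> 2" and u: "1 / q \<le> u" "u + 1 / q \<le> 1" "3 / q + u \<ge> 1" "u + (2 * real d + 1) / q < real d"
  shows "\<exists>C>0. \<exists>\<delta>>0. \<forall>R>0. \<forall>g l m. g \<in> borel_measurable borel \<longrightarrow> (\<forall>r. r \<notin> {1..2} \<longrightarrow> g r = 0) \<longrightarrow> (\<forall>r. norm (g r) \<le> l) \<longrightarrow>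
     l > 0 \<longrightarrow> m > 0 \<longrightarrow> m \<le> 1 \<longrightarrow> emeasure lborel {r. g r \<noteq> 0} \<le> ennreal m \<longrightarrow>
     annulus_int q R (T g) \<le> ennreal (C * (R powr (1 - real d) * min R (1 / R) powr \<delta> * (l * m powr u) powr q))"
proof -
  define \<gamma> where "\<gamma> = (real d - 1) / 2"
  have \<gamma>: "\<gamma> > 0" "\<gamma> + 1 = (real d + 1) / 2" using d by (auto simp: \<gamma>_def field_simps)
  \<comment> \<open>Solves \<open>b + 1 = q * u\<close> (the power of m), \<open>x + y = 1\<close>
    and \<open>b + 2 * x + 4 * y = q\<close>.\<close>
  define b where "b = q * u - 1"
  define x where "x = (3 + q * u - q) / 2"
  define y where "y = 1 - x"
  have qu: "q * (1 / q) = 1" using q by simp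
  have e: "b \<ge> 0" "x \<ge> 0" "y \<ge> 0" "x + y = 1" "q = b + 2 * x + 4 * y"
    using q u by (auto simp: b_def x_def y_def field_simps)
  \<comment> \<open>The power of R in the main part relative to \<open>R powr (1 - real d)\<close>,
    before the loss in the L^4 bound.\<close>
  define E where "E = (real d - 1) - \<gamma> * q + x"
  have E: "E < 0"
  proof -
    have "q * (u + (2 * real d + 1) / q) < q * real d" using u q by (intro mult_strict_left_mono) auto
    moreover have "q * ((2 * real d + 1) / q) = 2 * real d + 1" using q by simp
    ultimately have "q * u + 2 * real d + 1 < q * real d" unfolding distrib_left[of q u] by linarith
    thus ?thesis by (simp add: E_def \<gamma>_def x_def field_simps)
  qed
  \<comment> \<open>At most half of the room -E goes into the loss
    \<open>R powr (\<eta> * y)\<close>; what is left covers the gain \<delta>.\<close>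
  define \<eta> where "\<eta> = min 1 (- E / 2)"
  have \<eta>: "0 < \<eta>" "\<eta> \<le> 1" using E by (auto simp: \<eta>_def)
  define \<delta> where "\<delta> = \<eta>"
  have \<delta>: "\<delta> > 0" "\<delta> \<le> 1" "E + \<eta> * y \<le> - \<delta>" 
  proof -
    have "\<eta> * y \<le> \<eta> * 1" using \<eta> e by (intro mult_left_mono) auto
    thus "E + \<eta> * y \<le> - \<delta>" by (auto simp: \<delta>_def \<eta>_def)
  qed (use \<eta> in \<open>auto simp: \<delta>_def\<close>)
  obtain C1 where C1: "C1 > 0" and HYT: "\<And>R g A. R > 0 \<Longrightarrow> g \<in> borel_measurable borel \<Longrightarrow> (\<forall>r. r \<notin> {1..2} \<longrightarrow> g r = 0) \<Longrightarrow> A > 0 \<Longrightarrow>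
     (\<integral>\<^sup>+ r. ennreal (norm (g r) powr (q / (q - 1))) \<partial>lborel) \<le> ennreal (A powr (q / (q - 1))) \<Longrightarrow>
     annulus_int q R (T g) \<le> ennreal (C1 * (R * min 1 (R powr (- ((real d - 1) / 2))) powr q * A powr q))"
    using T_hausdorff_young[OF q] by blast
  obtain C2 where C2: "C2 > 0" and HY: "\<And>g h c A. g \<in> borel_measurable borel \<Longrightarrow> h \<in> borel_measurable borel \<Longrightarrow>
     (\<forall>r. norm (h r) \<le> c * norm (g r)) \<Longrightarrow> (\<forall>r. r \<notin> {1..2} \<longrightarrow> g r = 0) \<Longrightarrow> c > 0 \<Longrightarrow> A > 0 \<Longrightarrow>
     (\<integral>\<^sup>+ r. ennreal (norm (g r :: complex) powr (q / (q - 1))) \<partial>lborel) \<le> ennreal (A powr (q / (q - 1))) \<Longrightarrow>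
     (\<integral>\<^sup>+ t. ennreal (norm (quad_ext h t) powr q) \<partial>lborel) \<le> ennreal (C2 * (c * A) powr q)"
    using hausdorff_young_mult[OF q] by blast
  obtain C3 where C3: "C3 > 0" and W3: "\<And>R g l m. R \<ge> 1 \<Longrightarrow> g \<in> borel_measurable borel \<Longrightarrow> (\<forall>r. r \<notin> {1..2} \<longrightarrow> g r = 0) \<Longrightarrow> (\<forall>r. norm (g r) \<le> l) \<Longrightarrow> l > 0 \<Longrightarrow> m > 0 \<Longrightarrow>
     emeasure lborel {r. g r \<noteq> 0} \<le> ennreal m \<Longrightarrow>
     annulus_int q R (\<lambda>\<rho> t. quad_ext (\<lambda>r. g r * iexp (1 * \<rho> * r)) t) \<le> ennreal (C3 * R powr (x + \<eta> * y) * (l powr q * m powr (b + 1)))"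
    using quad_wave_bounds[OF e \<eta>, of 1] by blast
  obtain C4 where C4: "C4 > 0" and W4: "\<And>R g l m. R \<ge> 1 \<Longrightarrow> g \<in> borel_measurable borel \<Longrightarrow> (\<forall>r. r \<notin> {1..2} \<longrightarrow> g r = 0) \<Longrightarrow> (\<forall>r. norm (g r) \<le> l) \<Longrightarrow> l > 0 \<Longrightarrow> m > 0 \<Longrightarrow>
     emeasure lborel {r. g r \<noteq> 0} \<le> ennreal m \<Longrightarrow>
     annulus_int q R (\<lambda>\<rho> t. quad_ext (\<lambda>r. g r * iexp (-1 * \<rho> * r)) t) \<le> ennreal (C4 * R powr (x + \<eta> * y) * (l powr q * m powr (b + 1)))"
    using quad_wave_bounds[OF e \<eta>, of "-1"] by blast
  define CM where "CM = (2 * norm a) powr q * (C3 + C4)"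
  define CE where "CE = C2 * K powr q"
  define C where "C = C1 + 2 powr q * (CM + CE)"
  have CM: "CM \<ge> 0" "CE > 0" using C2 C3 C4 K by (auto simp: CM_def CE_def)
  have "2 powr q * (CM + CE) \<ge> 0" using CM by auto
  hence C: "C > 0" "C1 \<le> C" "2 powr q * (CM + CE) \<le> C" using C1 unfolding C_def by auto
  show ?thesis
  proof (rule exI[of _ C], rule conjI[OF C(1)], rule exI[of _ \<delta>], rule conjI[OF \<delta>(1)], intro allI impI)
    fix R l m :: real and g :: "real \<Rightarrow> complex"
    assume R: "R > 0" and gm [measurable]: "g \<in> borel_measurable borel" and supp: "\<forall>r. r \<notin> {1..2} \<longrightarrow> g r = 0" and gl: "\<forall>r. norm (g r) \<le> l"
      and l: "l > 0" and m: "m > 0" "m \<le> 1" and mm: "emeasure lborel {r. g r \<noteq> 0} \<le> ennreal m"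
    define A where "A = l * m powr u"
    have A: "A > 0" using l m by (simp add: A_def)
    have q': "(q - 1) / q \<ge> u" using u q by (simp add: field_simps)
    \<comment> \<open>A also bounds the norm with exponent q / (q - 1), because u is at most the
      reciprocal of that exponent and m \<le> 1.\<close>
    have gA: "(\<integral>\<^sup>+ r. ennreal (norm (g r) powr (q / (q - 1))) \<partial>lborel) \<le> ennreal (A powr (q / (q - 1)))"
    proof -
      have "(\<integral>\<^sup>+ r. ennreal (norm (g r) powr (q / (q - 1))) \<partial>lborel) \<le> ennreal (l powr (q / (q - 1)) * m)"
        using q gl mm by (intro Lp_bounded_supp) auto
      also have "l powr (q / (q - 1)) * m = (l * m powr ((q - 1) / q)) powr (q / (q - 1))"
        using q l m by (simp add: powr_mult powr_powr)
      also have "\<dots> \<le> A powr (q / (q - 1))"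
        unfolding A_def using q q' l m by (intro powr_mono2 mult_left_mono powr_mono') auto
      finally show ?thesis by (simp add: ennreal_leI)
    qed
    show "annulus_int q R (T g) \<le> ennreal (C * (R powr (1 - real d) * min R (1 / R) powr \<delta> * (l * m powr u) powr q))"
    proof (cases "R \<le> 1")
      case True
      have *: "R * min 1 (R powr (- ((real d - 1) / 2))) powr q \<le> R powr (1 - real d) * min R (1 / R) powr \<delta>"
      proof -
        have "min 1 (R powr (- ((real d - 1) / 2))) powr q \<le> 1 powr q" using q R by (intro powr_mono2) auto
        hence "R * min 1 (R powr (- ((real d - 1) / 2))) powr q \<le> R powr 1 * 1" using R by (intro mult_mono) auto
        also have "\<dots> \<le> R powr (1 - real d + \<delta>)" unfolding mult_1_right using R True \<delta> d by (intro powr_mono') auto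
        also have "\<dots> = R powr (1 - real d) * min R (1 / R) powr \<delta>"
        proof -
          have "R * R \<le> 1" using R True by (intro mult_le_one) auto
          hence "min R (1 / R) = R" using R by (simp add: field_simps)
          thus ?thesis using R by (simp add: powr_add)
        qed
        finally show ?thesis .
      qed
      have "annulus_int q R (T g) \<le> ennreal (C1 * (R * min 1 (R powr (- ((real d - 1) / 2))) powr q * A powr q))"
        by (rule HYT[OF R gm supp A gA])
      also have "\<dots> \<le> ennreal (C * (R powr (1 - real d) * min R (1 / R) powr \<delta> * A powr q))"
        by (intro ennreal_leI mult_mono[OF C(2)] mult_right_mono *) (use C1 C R in auto)
      finally show ?thesis by (simp add: A_def)
    next
      case False
      hence R1: "R \<ge> 1" by simp
      have gint: "integrable lborel g"
      proof (rule integrableI_bounded)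
        have "(\<integral>\<^sup>+ r. ennreal (norm (g r)) \<partial>lborel) \<le> ennreal (l * m)"
          using Lp_bounded_supp[of 1 g l m] gl mm l by simp
        thus "(\<integral>\<^sup>+ r. ennreal (norm (g r)) \<partial>lborel) < \<infinity>" by (auto intro: le_less_trans)
      qed measurable
      define err where "err s = \<kappa> s - s powr (- ((real d - 1) / 2)) * Re (a * iexp s)" for s
      have [measurable]: "err \<in> borel_measurable borel" unfolding err_def by measurable
      define Er where "Er \<rho> t = quad_ext (\<lambda>r. g r * complex_of_real (err (\<rho> * r))) t" for \<rho> t
      define M where "M \<rho> t = T g \<rho> t - Er \<rho> t" for \<rho> t
      \<comment> \<open>The decay of the leading term factors as
        \<open>\<rho> powr (- \<gamma>) * r powr (- \<gamma>)\<close>; the second factor is absorbed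
        into the density, which stays below g as r \<ge> 1.\<close>
      define g' where "g' r = g r * complex_of_real (r powr (- \<gamma>))" for r
      have g'm [measurable]: "g' \<in> borel_measurable borel" unfolding g'_def by measurable
      define Q1 where "Q1 \<rho> t = quad_ext (\<lambda>r. g' r * iexp (1 * \<rho> * r)) t" for \<rho> t
      define Q2 where "Q2 \<rho> t = quad_ext (\<lambda>r. g' r * iexp (-1 * \<rho> * r)) t" for \<rho> t
      have [measurable]: "(\<lambda>(\<rho>, t). Er \<rho> t) \<in> borel_measurable (borel \<Otimes>\<^sub>M borel)" "(\<lambda>(\<rho>, t). Q1 \<rho> t) \<in> borel_measurable (borel \<Otimes>\<^sub>M borel)"
         "(\<lambda>(\<rho>, t). Q2 \<rho> t) \<in> borel_measurable (borel \<Otimes>\<^sub>M borel)"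
        unfolding Er_def Q1_def Q2_def by measurable
      have [measurable]: "(\<lambda>(\<rho>, t). M \<rho> t) \<in> borel_measurable (borel \<Otimes>\<^sub>M borel)"
        unfolding M_def T_def by measurable
      have g'g: "norm (g' r) \<le> norm (g r)" for r
      proof (cases "r \<in> {1..2}")
        case True
        hence "r powr (- \<gamma>) \<le> 1 powr (- \<gamma>)" using \<gamma> by (intro powr_mono2') auto
        thus ?thesis by (simp add: g'_def norm_mult mult_left_le)
      qed (use supp in \<open>simp add: g'_def\<close>)
      have g'int: "integrable lborel g'"
        by (rule Bochner_Integration.integrable_bound[OF gint]) (use g'g in auto)
      have err_bd: "norm (g r * complex_of_real (err (\<rho> * r))) \<le> K * R powr (- (\<gamma> + 1)) * norm (g r)" if "\<rho> \<in> {R..2 * R}" for \<rho> r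
      proof (cases "r \<in> {1..2}")
        case True
        have \<rho>r: "R * 1 \<le> \<rho> * r" using True that R by (intro mult_mono) auto
        have "\<bar>err (\<rho> * r)\<bar> \<le> K * (\<rho> * r) powr (- (\<gamma> + 1))"
          unfolding err_def \<gamma>(2) using \<kappa>_asymp[of "\<rho> * r"] \<rho>r R1 by simp
        also have "\<dots> \<le> K * R powr (- (\<gamma> + 1))"
          using \<rho>r R K \<gamma> by (intro mult_left_mono powr_mono2') auto
        finally show ?thesis by (simp add: norm_mult mult.commute[of _ "norm (g r)"] mult_left_mono)
      qed (use supp in simp)
      have Er: "annulus_int q R Er \<le> ennreal (CE * (R powr (1 - (\<gamma> + 1) * q) * A powr q))"
      proof -
        have "annulus_int q R Er \<le> ennreal (R * (C2 * (K * R powr (- (\<gamma> + 1)) * A) powr q))"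
          unfolding Er_def
          by (rule annulus_int_le_fixed[OF R _ HY[OF gm _ _ supp _ A gA]]) (use err_bd C2 K R in \<open>auto simp: mult_nonneg_nonneg\<close>)
        also have "R * (C2 * (K * R powr (- (\<gamma> + 1)) * A) powr q) = CE * (R powr (1 - (\<gamma> + 1) * q) * A powr q)"
        proof -
          have "R powr (1 - (\<gamma> + 1) * q) = R * (R powr (- (\<gamma> + 1))) powr q"
            using R powr_add[of R 1 "- (\<gamma> + 1) * q"] by (simp add: powr_powr algebra_simps)
          thus ?thesis using K R A by (simp add: powr_mult CE_def)
        qed
        finally show ?thesis .
      qed
      have M: "norm (M \<rho> t) \<le> R powr (- \<gamma>) * norm a * (norm (Q1 \<rho> t) + norm (Q2 \<rho> t))" if \<rho>: "\<rho> \<in> {R..2 * R}" for \<rho> t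
      proof -
        have \<rho>0: "\<rho> > 0" using \<rho> R by auto
        have int: "integrable lborel (\<lambda>r. g r * complex_of_real (err (\<rho> * r)))"
        proof (rule Bochner_Integration.integrable_bound)
          show "integrable lborel (\<lambda>r. K * R powr (- (\<gamma> + 1)) * norm (g r))" using gint by simp
          show "AE r in lborel. norm (g r * complex_of_real (err (\<rho> * r))) \<le> norm (K * R powr (- (\<gamma> + 1)) * norm (g r))"
            using err_bd[OF \<rho>] K by (intro AE_I2) (auto simp: abs_mult)
        qed measurable
        have int1: "integrable lborel (\<lambda>r. g' r * iexp (1 * \<rho> * r))" "integrable lborel (\<lambda>r. g' r * iexp (-1 * \<rho> * r))"
          by (rule integrable_mult_iexp[OF g'int], measurable)+
        define c where "c = complex_of_real (\<rho> powr (- \<gamma>)) / 2"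
        have int2: "integrable lborel (\<lambda>r. c * a * (g' r * iexp (1 * \<rho> * r)) + c * cnj a * (g' r * iexp (-1 * \<rho> * r)))"
          using int1 by (intro Bochner_Integration.integrable_add integrable_mult_right) auto
        have "g r * complex_of_real (\<kappa> (\<rho> * r)) = 1 * (c * a * (g' r * iexp (1 * \<rho> * r)) + c * cnj a * (g' r * iexp (-1 * \<rho> * r))) + 1 * (g r * complex_of_real (err (\<rho> * r)))" for r
        proof (cases "r \<in> {1..2}")
          case True
          have ReX: "complex_of_real (Re z) = (z + cnj z) / 2" for z by (simp add: complex_add_cnj)
          have pw: "(\<rho> * r) powr (- \<gamma>) = \<rho> powr (- \<gamma>) * r powr (- \<gamma>)" using True \<rho>0 by (simp add: powr_mult)
          have "complex_of_real (Re (a * iexp (\<rho> * r))) = (a * iexp (\<rho> * r) + cnj (a * iexp (\<rho> * r))) / 2"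
            by (rule ReX)
          also have "cnj (a * iexp (\<rho> * r)) = cnj a * iexp (- 1 * \<rho> * r)" by (simp add: exp_cnj)
          finally have re: "complex_of_real (Re (a * iexp (\<rho> * r))) = (a * iexp (\<rho> * r) + cnj a * iexp (- 1 * \<rho> * r)) / 2" .
          have "\<kappa> (\<rho> * r) = \<rho> powr (- \<gamma>) * r powr (- \<gamma>) * Re (a * iexp (\<rho> * r)) + err (\<rho> * r)" by (simp only: err_def \<gamma>_def[symmetric] pw)
          hence "complex_of_real (\<kappa> (\<rho> * r)) = complex_of_real (\<rho> powr (- \<gamma>)) * complex_of_real (r powr (- \<gamma>)) * complex_of_real (Re (a * iexp (\<rho> * r))) + complex_of_real (err (\<rho> * r))"
            by simp
          note this[unfolded re]
          thus ?thesis by (simp add: c_def g'_def add_divide_distrib algebra_simps)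
        qed (use supp in \<open>simp add: g'_def\<close>)
        hence "T g \<rho> t = quad_ext (\<lambda>r. 1 * (c * a * (g' r * iexp (1 * \<rho> * r)) + c * cnj a * (g' r * iexp (-1 * \<rho> * r))) + 1 * (g r * complex_of_real (err (\<rho> * r)))) t"
          unfolding T_def by (intro arg_cong2[where f = quad_ext] ext) auto
        also have "\<dots> = 1 * (c * a * Q1 \<rho> t + c * cnj a * Q2 \<rho> t) + 1 * Er \<rho> t"
          unfolding quad_ext_lincomb[OF int2 int] quad_ext_lincomb[OF int1] Q1_def Q2_def Er_def ..
        finally have "M \<rho> t = c * a * Q1 \<rho> t + c * cnj a * Q2 \<rho> t" by (simp add: M_def)
        hence "norm (M \<rho> t) \<le> norm c * norm a * norm (Q1 \<rho> t) + norm c * norm a * norm (Q2 \<rho> t)"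
          using norm_triangle_ineq[of "c * a * Q1 \<rho> t" "c * cnj a * Q2 \<rho> t"] by (simp add: norm_mult)
        also have "\<dots> = norm c * (norm a * (norm (Q1 \<rho> t) + norm (Q2 \<rho> t)))" by (simp add: algebra_simps)
        also have "\<dots> \<le> R powr (- \<gamma>) * (norm a * (norm (Q1 \<rho> t) + norm (Q2 \<rho> t)))"
        proof (intro mult_right_mono)
          have "\<rho> powr (- \<gamma>) \<le> R powr (- \<gamma>)" using \<rho> R \<gamma> by (intro powr_mono2') auto
          moreover have "0 \<le> R powr (- \<gamma>)" by simp
          ultimately have "\<rho> powr (- \<gamma>) \<le> R powr (- \<gamma>) * 2" by linarith
          thus "norm c \<le> R powr (- \<gamma>)" unfolding c_def by (simp add: norm_divide) 
        qed auto
        finally show ?thesis by (simp add: mult.assoc)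
      qed
      have g'l: "\<forall>r. norm (g' r) \<le> l" using g'g gl order_trans by blast
      have g's: "\<forall>r. r \<notin> {1..2} \<longrightarrow> g' r = 0" using supp by (simp add: g'_def)
      have "emeasure lborel {r. g' r \<noteq> 0} \<le> emeasure lborel {r. g r \<noteq> 0}"
        by (intro emeasure_mono) (auto simp: g'_def)
      hence g'mm: "emeasure lborel {r. g' r \<noteq> 0} \<le> ennreal m" using mm by (rule order_trans)
      have lm: "l powr q * m powr (b + 1) = A powr q" using l m by (simp add: A_def b_def powr_mult powr_powr mult.commute)
      have MM: "annulus_int q R M \<le> ennreal (CM * (R powr (- \<gamma> * q + (x + \<eta> * y)) * A powr q))"
      proof -
        have "annulus_int q R M \<le> ennreal ((2 * (R powr (- \<gamma>) * norm a)) powr q) * (annulus_int q R Q1 + annulus_int q R Q2)"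
          by (rule annulus_int_add[OF _ _ _ _ M]) (use q in auto)
        also have "\<dots> \<le> ennreal ((2 * (R powr (- \<gamma>) * norm a)) powr q) * (ennreal (C3 * R powr (x + \<eta> * y) * A powr q) + ennreal (C4 * R powr (x + \<eta> * y) * A powr q))"
          using W3[OF R1 g'm g's g'l l m(1) g'mm] W4[OF R1 g'm g's g'l l m(1) g'mm] unfolding Q1_def Q2_def lm
          by (intro mult_left_mono add_mono) auto
        also have "\<dots> = ennreal ((2 * (R powr (- \<gamma>) * norm a)) powr q * (C3 * R powr (x + \<eta> * y) * A powr q + C4 * R powr (x + \<eta> * y) * A powr q))"
          using C3 C4 by (simp add: ennreal_mult'[symmetric] ennreal_plus[symmetric] del: ennreal_plus)
        also have "(2 * (R powr (- \<gamma>) * norm a)) powr q = (2 * norm a) powr q * R powr (- \<gamma> * q)"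
          by (simp add: powr_mult powr_powr mult_ac)
        also have "(2 * norm a) powr q * R powr (- \<gamma> * q) * (C3 * R powr (x + \<eta> * y) * A powr q + C4 * R powr (x + \<eta> * y) * A powr q)
           = CM * (R powr (- \<gamma> * q + (x + \<eta> * y)) * A powr q)"
          unfolding CM_def powr_add by (simp add: algebra_simps)
        finally show ?thesis .
      qed
      have "annulus_int q R (T g) \<le> ennreal ((2 * 1) powr q) * (annulus_int q R M + annulus_int q R Er)"
      proof (rule annulus_int_add)
        show "norm (T g \<rho> t) \<le> 1 * (norm (M \<rho> t) + norm (Er \<rho> t))" for \<rho> t
          using norm_triangle_ineq[of "M \<rho> t" "Er \<rho> t"] by (simp add: M_def)
      qed (use q in auto)
      also have "\<dots> \<le> ennreal (2 powr q) * (ennreal (CM * (R powr (1 - real d - \<delta>) * A powr q)) + ennreal (CE * (R powr (1 - real d - \<delta>) * A powr q)))"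
      proof -
        have "- \<gamma> * q + (x + \<eta> * y) \<le> 1 - real d - \<delta>" using \<delta>(3) by (simp add: E_def)
        hence 1: "annulus_int q R M \<le> ennreal (CM * (R powr (1 - real d - \<delta>) * A powr q))"
          by (intro order_trans[OF MM] ennreal_leI mult_left_mono mult_right_mono powr_mono) (use R1 CM in auto)
        \<comment> \<open>The remainder has one more power of decay: q \<ge> 2 gives (\<gamma> + 1)
          q \<ge> d + 1, so Hausdorff--Young is enough for it.\<close>
        have "(real d + 1) / 2 * 2 \<le> (real d + 1) / 2 * q" using q by (intro mult_left_mono) auto
        hence "1 - (\<gamma> + 1) * q \<le> 1 - real d - \<delta>" unfolding \<gamma>(2) using \<delta>(2) by simp
        hence 2: "annulus_int q R Er \<le> ennreal (CE * (R powr (1 - real d - \<delta>) * A powr q))"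
          by (intro order_trans[OF Er] ennreal_leI mult_left_mono mult_right_mono powr_mono) (use R1 CM in auto)
        show ?thesis using add_mono[OF 1 2] by (simp add: mult_left_mono)
      qed
      also have "\<dots> = ennreal (2 powr q * (CM + CE) * (R powr (1 - real d - \<delta>) * A powr q))"
        using CM by (simp add: ennreal_mult'[symmetric] ennreal_plus[symmetric] algebra_simps del: ennreal_plus)
      also have "\<dots> \<le> ennreal (C * (R powr (1 - real d - \<delta>) * A powr q))"
        by (intro ennreal_leI mult_right_mono C) auto
      also have "R powr (1 - real d - \<delta>) = R powr (1 - real d) * min R (1 / R) powr \<delta>"
      proof -
        have "1 / R \<le> 1" "1 / R \<le> R" using R1 by (auto simp: field_simps intro: order_trans[OF R1])
        hence "min R (1 / R) = 1 / R" by simp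
        thus ?thesis using R by (simp add: powr_diff powr_divide)
      qed
      finally show ?thesis by (simp add: A_def)
    qed
  qed
qed


text \<open>Decomposition into level sets. Since 1 / p < u, the level of height 2^k A and measure
  about 2^(-p k) contributes a factor 2^(-k \<mu>) with \<open>\<mu> = p * u - 1 > 0\<close>, so the
  levels can be summed without interpolating between two endpoints.\<close>

lemma T_strong_of_restricted:
  fixes p q u B C :: real
  assumes p: "p \<ge> 1" and q: "q > 0" and u: "1 / p < u" and C: "C > 0" and B: "B \<ge> 0"
    and restr: "\<And>g l m. g \<in> borel_measurable borel \<Longrightarrow> (\<forall>r. r \<notin> {1..2} \<longrightarrow> g r = 0) \<Longrightarrow> (\<forall>r. norm (g r) \<le> l) \<Longrightarrow>
     l > 0 \<Longrightarrow> m > 0 \<Longrightarrow> m \<le> 1 \<Longrightarrow> emeasure lborel {r. g r \<noteq> 0} \<le> ennreal m \<Longrightarrow>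
     annulus_int q R (T g) \<le> ennreal (C * (B * (l * m powr u) powr q))"
    and gm [measurable]: "g \<in> borel_measurable borel" and supp: "\<forall>r. r \<notin> {1..2} \<longrightarrow> g r = 0" and A: "A > 0"
    and le: "(\<integral>\<^sup>+ r. ennreal (norm (g r) powr p) \<partial>lborel) \<le> ennreal (A powr p)" and R: "R > 0"
  shows "annulus_int q R (T g) \<le> ennreal (C * (1 / (1 - 2 powr (- ((p * u - 1) / 2)))) powr q * 2 powr (p * u * q) / (1 - 2 powr (- ((p * u - 1) / 2) * q)) * (B * A powr q))"
proof -
  define \<mu> where "\<mu> = p * u - 1"
  have \<mu>: "\<mu> > 0" using u p by (simp add: \<mu>_def field_simps)
  define x where "x = (2::real) powr (- (\<mu> / 2))"
  have x: "0 < x" "x < 1" using \<mu> powr_less_mono[of "- (\<mu> / 2)" 0 2] by (auto simp: x_def)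
  define W where "W = 1 / (1 - x)"
  have W: "W > 0" using x by (simp add: W_def)
  \<comment> \<open>The weights use up half of the decay \<open>2 powr (- (real k * \<mu>))\<close>;
    the other half makes the series converge.\<close>
  define w where "w k = 2 powr (real k * (\<mu> / 2))" for k :: nat
  have w: "w k > 0" for k by (simp add: w_def)
  have xk: "x ^ k = 1 / w k" for k
    by (simp add: x_def w_def powr_realpow[symmetric] powr_powr powr_minus_divide[symmetric] mult.commute)
  have wW: "(\<integral>\<^sup>+ k. ennreal (1 / w k) \<partial>count_space UNIV) \<le> ennreal W"
    using nn_integral_geometric[OF x] by (simp add: xk W_def)
  \<comment> \<open>Level 0 collects all values up to A; its support is controlled only by the
    interval [1, 2]. Level k > 0 has values above \<open>2 ^ (k - 1) * A\<close>, so Chebyshev's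
    inequality bounds its support by \<open>2 powr (p * (1 - real k))\<close>.\<close>
  define gk where "gk k r = (if norm (g r) \<le> 2 ^ k * A \<and> (k = 0 \<or> 2 ^ (k - 1) * A < norm (g r)) then g r else 0)" for k :: nat and r
  have gkm [measurable]: "gk k \<in> borel_measurable borel" for k unfolding gk_def by measurable
  have part: "(\<Sum>k<Suc n. gk k r) = (if norm (g r) \<le> 2 ^ n * A then g r else 0)" for n r
  proof (induction n)
    case (Suc n)
    have "(2::real) ^ n * A \<le> 2 ^ Suc n * A" using A by simp
    hence "norm (g r) \<le> 2 ^ Suc n * A" if "norm (g r) \<le> 2 ^ n * A" using that by linarith
    thus ?case unfolding sum.lessThan_Suc[of _ "Suc n"] Suc by (cases "norm (g r) \<le> 2 ^ n * A") (simp_all add: gk_def)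
  qed (simp add: gk_def)
  \<comment> \<open>The restricted estimate asks for m \<le> 1, which the Chebyshev value exceeds at
    k = 0.\<close>
  define m where "m k = min 1 (2 powr (p * (1 - real k)))" for k :: nat
  have m: "m k > 0" "m k \<le> 1" for k by (auto simp: m_def)
  have gkl: "\<forall>r. norm (gk k r) \<le> 2 ^ k * A" for k using A by (auto simp: gk_def)
  have gks: "\<forall>r. r \<notin> {1..2} \<longrightarrow> gk k r = 0" for k using supp by (auto simp: gk_def)
  have gkmm: "emeasure lborel {r. gk k r \<noteq> 0} \<le> ennreal (m k)" for k
  proof -
    have "emeasure lborel {r. gk k r \<noteq> 0} \<le> emeasure lborel {1..2::real}"
      using gks[of k] by (intro emeasure_mono) (blast, simp)
    hence 1: "emeasure lborel {r. gk k r \<noteq> 0} \<le> ennreal 1" by simp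
    have 2: "emeasure lborel {r. gk k r \<noteq> 0} \<le> ennreal (2 powr (p * (1 - real k)))" if k: "k \<noteq> 0"
    proof -
      define c where "c = 2 ^ (k - 1) * A"
      have c: "c > 0" using A by (simp add: c_def)
      have "emeasure lborel {r. gk k r \<noteq> 0} = (\<integral>\<^sup>+ r. indicator {r. gk k r \<noteq> 0} r \<partial>lborel)" by simp
      also have "\<dots> \<le> (\<integral>\<^sup>+ r. ennreal (c powr (- p)) * ennreal (norm (g r) powr p) \<partial>lborel)"
      proof (intro nn_integral_mono)
        fix r
        have "1 \<le> c powr (- p) * norm (g r) powr p" if "gk k r \<noteq> 0"
        proof -
          have "c < norm (g r)" using that k by (auto simp: gk_def c_def split: if_splits)
          hence "c powr (- p) * c powr p \<le> c powr (- p) * norm (g r) powr p"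
            using c p by (intro mult_left_mono powr_mono2) auto
          thus ?thesis using c by (simp add: powr_add[symmetric])
        qed
        thus "indicator {r. gk k r \<noteq> 0} r \<le> ennreal (c powr (- p)) * ennreal (norm (g r) powr p)"
          by (auto simp: indicator_def ennreal_mult'[symmetric] ennreal_1[symmetric] simp del: ennreal_1 intro!: ennreal_leI)
      qed
      also have "\<dots> = ennreal (c powr (- p)) * (\<integral>\<^sup>+ r. ennreal (norm (g r) powr p) \<partial>lborel)"
        by (rule nn_integral_cmult) measurable
      also have "\<dots> \<le> ennreal (c powr (- p)) * ennreal (A powr p)" by (intro mult_left_mono le) auto
      also have "\<dots> = ennreal (c powr (- p) * A powr p)" by (simp add: ennreal_mult')
      also have "c powr (- p) * A powr p = 2 powr (p * (1 - real k))"
      proof -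
        have "c = 2 powr (real k - 1) * A" unfolding c_def using k by (subst powr_realpow[symmetric]) (auto simp: of_nat_diff)
        hence "c powr (- p) = 2 powr ((real k - 1) * (- p)) * A powr (- p)" using A by (simp add: powr_mult powr_powr)
        moreover have "A powr (- p) * A powr p = 1" using A by (simp add: powr_add[symmetric])
        moreover have "(real k - 1) * (- p) = p * (1 - real k)" by (simp add: algebra_simps)
        ultimately show ?thesis by (simp only: mult.assoc mult_1_right)
      qed
      finally show ?thesis .
    qed
    show ?thesis
    proof (cases "k = 0")
      case True
      moreover have "1 \<le> 2 powr p" using p by (intro ge_one_powr_ge_zero) auto
      ultimately show ?thesis using 1 by (simp add: m_def)
    qed (use 1 2 in \<open>auto simp: m_def min_def\<close>)
  qed
  have Tgk: "annulus_int q R (T (gk k)) \<le> ennreal (C * (B * (A * 2 powr (p * u) * 2 powr (- (real k * \<mu>))) powr q))" for k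
  proof -
    have "annulus_int q R (T (gk k)) \<le> ennreal (C * (B * (2 ^ k * A * m k powr u) powr q))"
      by (rule restr[OF gkm gks gkl _ m gkmm]) (use A in auto)
    also have "\<dots> \<le> ennreal (C * (B * (A * 2 powr (p * u) * 2 powr (- (real k * \<mu>))) powr q))"
    proof (intro ennreal_leI mult_left_mono powr_mono2)
      have u0: "u > 0" using u p by (smt (verit) divide_pos_pos)
      have "m k powr u \<le> (2 powr (p * (1 - real k))) powr u" using m[of k] u0 by (intro powr_mono2) (auto simp: m_def)
      also have "\<dots> = 2 powr (p * (1 - real k) * u)" by (simp add: powr_powr)
      finally have "2 ^ k * A * m k powr u \<le> 2 powr (real k) * A * 2 powr (p * (1 - real k) * u)"
        using A by (simp add: powr_realpow)
      also have "\<dots> = A * (2 powr (real k) * 2 powr (p * (1 - real k) * u))" by simp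
      also have "2 powr (real k) * 2 powr (p * (1 - real k) * u) = 2 powr (p * u) * 2 powr (- (real k * \<mu>))"
        unfolding powr_add[symmetric] \<mu>_def by (rule arg_cong[where f = "\<lambda>z. 2 powr z"]) (simp add: algebra_simps)
      finally show "2 ^ k * A * m k powr u \<le> A * 2 powr (p * u) * 2 powr (- (real k * \<mu>))" by simp
    qed (use A C B q in auto)
    finally show ?thesis .
  qed
  have gint: "integrable lborel g"
    using integrable_of_Lp[OF p gm, of 1 2] supp le_less_trans[OF le ennreal_less_top] by auto
  have "annulus_int q R (T g) \<le> ennreal (W powr q) * (\<Sum>k. ennreal (w k powr q) * annulus_int q R (T (gk k)))"
  proof (rule annulus_int_le_suminf[OF T_measurable[OF gkm] w wW W q])
    fix \<rho> t assume \<rho>: "\<rho> \<in> {R..2 * R}"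
    show "ennreal (norm (T g \<rho> t)) \<le> (\<integral>\<^sup>+ k. ennreal (norm (T (gk k) \<rho> t)) \<partial>count_space UNIV)"
      unfolding T_def
    proof (rule quad_ext_norm_le_suminf)
      have bd: "integrable lborel (\<lambda>r. f r * complex_of_real (\<kappa> (\<rho> * r)))"
        if f [measurable]: "f \<in> borel_measurable borel" and fg: "\<And>r. norm (f r) \<le> norm (g r)" for f :: "real \<Rightarrow> complex"
      proof (rule Bochner_Integration.integrable_bound)
        show "integrable lborel (\<lambda>r. K * norm (g r))" using gint by simp
        show "AE r in lborel. norm (f r * complex_of_real (\<kappa> (\<rho> * r))) \<le> norm (K * norm (g r))"
        proof (intro AE_I2)
          fix r
          show "norm (f r * complex_of_real (\<kappa> (\<rho> * r))) \<le> norm (K * norm (g r))"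
          proof (cases "r \<in> {1..2}")
            case True
            hence "\<bar>\<kappa> (\<rho> * r)\<bar> \<le> K" using \<rho> R by (intro \<kappa>_bounded) auto
            hence "norm (f r) * \<bar>\<kappa> (\<rho> * r)\<bar> \<le> norm (g r) * K" by (intro mult_mono fg) auto
            thus ?thesis using K by (simp add: norm_mult mult.commute)
          next
            case False
            hence "f r = 0" using supp fg[of r] by simp
            thus ?thesis by simp
          qed
        qed
      qed measurable
      show "integrable lborel (\<lambda>r. g r * complex_of_real (\<kappa> (\<rho> * r)))" by (rule bd) auto
      show "integrable lborel (\<lambda>r. gk k r * complex_of_real (\<kappa> (\<rho> * r)))" for k by (rule bd) (auto simp: gk_def)
      fix r
      have "filterlim (\<lambda>n. 2 ^ n :: real) at_top sequentially" by real_asymp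
      hence "\<forall>\<^sub>F n in sequentially. norm (g r) / A \<le> 2 ^ n" unfolding filterlim_at_top by blast
      hence "\<forall>\<^sub>F n in sequentially. (\<Sum>k<Suc n. gk k r) = g r"
        unfolding part by eventually_elim (use A in \<open>simp add: field_simps\<close>)
      hence "(\<lambda>n. \<Sum>k<Suc n. gk k r) \<longlonglongrightarrow> g r" by (rule tendsto_eventually)
      hence "(\<lambda>n. \<Sum>k<n. gk k r) \<longlonglongrightarrow> g r" by (rule LIMSEQ_imp_Suc)
      thus "(\<lambda>n. \<Sum>k<n. gk k r * complex_of_real (\<kappa> (\<rho> * r))) \<longlonglongrightarrow> g r * complex_of_real (\<kappa> (\<rho> * r))"
        unfolding sum_distrib_right[symmetric] by (intro tendsto_mult tendsto_const)
      fix n :: nat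
      have "norm (\<Sum>k<n. gk k r) \<le> norm (g r)" by (cases n) (auto simp: part simp del: sum.lessThan_Suc)
      thus "norm (\<Sum>k<n. gk k r * complex_of_real (\<kappa> (\<rho> * r))) \<le> norm (g r * complex_of_real (\<kappa> (\<rho> * r)))"
        unfolding sum_distrib_right[symmetric] norm_mult by (intro mult_right_mono) auto
    qed
  qed
  also have "\<dots> \<le> ennreal (W powr q) * (\<Sum>k. ennreal (C * (B * (A powr q * 2 powr (p * u * q)))) * ennreal ((x powr q) ^ k))"
  proof (intro mult_left_mono suminf_le)
    fix k
    have "ennreal (w k powr q) * annulus_int q R (T (gk k)) \<le> ennreal (w k powr q) * ennreal (C * (B * (A * 2 powr (p * u) * 2 powr (- (real k * \<mu>))) powr q))"
      by (intro mult_left_mono Tgk) auto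
    also have "\<dots> = ennreal (w k powr q * (C * (B * (A * 2 powr (p * u) * 2 powr (- (real k * \<mu>))) powr q)))" by (simp add: ennreal_mult')
    also have "w k powr q * (C * (B * (A * 2 powr (p * u) * 2 powr (- (real k * \<mu>))) powr q)) = C * (B * (A powr q * 2 powr (p * u * q))) * (x powr q) ^ k"
    proof -
      have "w k powr q * (2 powr (- (real k * \<mu>))) powr q = (x powr q) ^ k"
        by (simp add: w_def x_def powr_powr powr_realpow[symmetric] powr_add[symmetric] algebra_simps)
      thus ?thesis using A by (simp add: powr_mult powr_powr mult_ac)
    qed
    finally show "ennreal (w k powr q) * annulus_int q R (T (gk k)) \<le> ennreal (C * (B * (A powr q * 2 powr (p * u * q)))) * ennreal ((x powr q) ^ k)"
      using C B by (simp add: ennreal_mult')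
  qed auto
  also have "(\<Sum>k. ennreal (C * (B * (A powr q * 2 powr (p * u * q)))) * ennreal ((x powr q) ^ k)) = ennreal (C * (B * (A powr q * 2 powr (p * u * q)))) * ennreal (1 / (1 - x powr q))"
  proof -
    have "x powr q < 1" using x q powr_less_mono2[of q x 1] by simp
    hence "(\<Sum>k. ennreal ((x powr q) ^ k)) = ennreal (1 / (1 - x powr q))"
      using x by (subst nn_integral_count_space_nat[symmetric]) (rule nn_integral_geometric, auto)
    thus ?thesis by (simp only: ennreal_suminf_cmult)
  qed
  also have "ennreal (W powr q) * (ennreal (C * (B * (A powr q * 2 powr (p * u * q)))) * ennreal (1 / (1 - x powr q))) = ennreal (W powr q * (C * (B * (A powr q * 2 powr (p * u * q)) * (1 / (1 - x powr q)))))"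
    using C B by (simp add: ennreal_mult'[symmetric])
  also have "W powr q * (C * (B * (A powr q * 2 powr (p * u * q)) * (1 / (1 - x powr q)))) = C * (1 / (1 - x)) powr q * 2 powr (p * u * q) / (1 - x powr q) * (B * A powr q)"
    by (simp add: W_def)
  finally show ?thesis by (simp add: x_def \<mu>_def powr_powr)
qed

text \<open>For large q the decay of the kernel alone is strong enough; otherwise the restricted
  bound is applied with a u strictly above 1 / p and the level sets are summed.\<close>

lemma T_local_estimate:
  fixes p q :: real
  assumes p: "p \<ge> 1" and q: "q > 2 * (real d + 1) / real d" and pq: "1 / p + 1 / q \<le> 1" "1 / p + (2 * real d + 1) / q < real d"
  shows "\<exists>C>0. \<exists>\<delta>>0. \<forall>R>0. \<forall>g A. g \<in> borel_measurable borel \<longrightarrow> (\<forall>r. r \<notin> {1..2} \<longrightarrow> g r = 0) \<longrightarrow> A > 0 \<longrightarrow>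
     (\<integral>\<^sup>+ r. ennreal (norm (g r) powr p) \<partial>lborel) \<le> ennreal (A powr p) \<longrightarrow>
     annulus_int q R (T g) \<le> ennreal (C * (R powr (1 - real d) * min R (1 / R) powr \<delta> * A powr q))"
proof -
  have "2 * (real d + 1) / real d > 2" using d by (simp add: field_simps)
  hence q2: "q > 2" using q by linarith
  show ?thesis
  proof (cases "q > 2 * real d / (real d - 1)")
    case True
    define \<gamma> where "\<gamma> = (real d - 1) / 2"
    define \<delta> where "\<delta> = min (real d) (\<gamma> * q - real d)"
    \<comment> \<open>This is exactly the threshold at which the Hausdorff--Young power
      \<open>R powr (1 - \<gamma> * q)\<close> beats \<open>R powr (1 - real d)\<close>.\<close>
    have "\<gamma> * q > real d" using True d by (simp add: \<gamma>_def field_simps)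
    hence \<delta>: "\<delta> > 0" "\<delta> \<le> real d" "\<delta> \<le> \<gamma> * q - real d" using d by (auto simp: \<delta>_def)
    obtain C1 where C1: "C1 > 0" and HYT: "\<And>R g A. R > 0 \<Longrightarrow> g \<in> borel_measurable borel \<Longrightarrow> (\<forall>r. r \<notin> {1..2} \<longrightarrow> g r = 0) \<Longrightarrow> A > 0 \<Longrightarrow>
     (\<integral>\<^sup>+ r. ennreal (norm (g r) powr (q / (q - 1))) \<partial>lborel) \<le> ennreal (A powr (q / (q - 1))) \<Longrightarrow>
     annulus_int q R (T g) \<le> ennreal (C1 * (R * min 1 (R powr (- ((real d - 1) / 2))) powr q * A powr q))"
      using T_hausdorff_young[of q] q2 by fastforce
    define C where "C = C1 * 2 powr q"
    have C: "C > 0" using C1 by (simp add: C_def)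
    have q': "1 \<le> q / (q - 1)" "q / (q - 1) \<le> p" using q2 pq p by (auto simp: field_simps)
    show ?thesis
    proof (rule exI[of _ C], rule conjI[OF C(1)], rule exI[of _ \<delta>], rule conjI[OF \<delta>(1)], intro allI impI)
      fix R A :: real and g :: "real \<Rightarrow> complex"
      assume R: "R > 0" and gm [measurable]: "g \<in> borel_measurable borel" and supp: "\<forall>r. r \<notin> {1..2} \<longrightarrow> g r = 0" and A: "A > 0"
        and le: "(\<integral>\<^sup>+ r. ennreal (norm (g r) powr p) \<partial>lborel) \<le> ennreal (A powr p)"
      have *: "R * min 1 (R powr (- \<gamma>)) powr q \<le> R powr (1 - real d) * min R (1 / R) powr \<delta>"
      proof (cases "R \<le> 1")
        case True
        have "min 1 (R powr (- \<gamma>)) powr q \<le> 1 powr q" using q2 R by (intro powr_mono2) auto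
        hence "R * min 1 (R powr (- \<gamma>)) powr q \<le> R powr 1 * 1" using R by (intro mult_mono) auto
        also have "\<dots> \<le> R powr (1 - real d + \<delta>)" unfolding mult_1_right using R True \<delta> d by (intro powr_mono') auto
        also have "\<dots> = R powr (1 - real d) * min R (1 / R) powr \<delta>"
        proof -
          have "R * R \<le> 1" using R True by (intro mult_le_one) auto
          hence "min R (1 / R) = R" using R by (simp add: field_simps)
          thus ?thesis using R by (simp add: powr_add)
        qed
        finally show ?thesis .
      next
        case False
        hence R1: "R \<ge> 1" by simp
        have "min 1 (R powr (- \<gamma>)) powr q \<le> (R powr (- \<gamma>)) powr q" using q2 R by (intro powr_mono2) auto
        hence "R * min 1 (R powr (- \<gamma>)) powr q \<le> R powr 1 * (R powr (- \<gamma>)) powr q" using R by (intro mult_mono) auto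
        also have "\<dots> = R powr (1 - \<gamma> * q)" unfolding powr_powr powr_add[symmetric] by simp
        also have "\<dots> \<le> R powr (1 - real d - \<delta>)" using R1 \<delta> by (intro powr_mono) auto
        also have "\<dots> = R powr (1 - real d) * min R (1 / R) powr \<delta>"
        proof -
          have "1 / R \<le> 1" "1 / R \<le> R" using R1 by (auto simp: field_simps intro: order_trans[OF R1])
          hence "min R (1 / R) = 1 / R" by simp
          thus ?thesis using R by (simp add: powr_diff powr_divide)
        qed
        finally show ?thesis .
      qed
      have "annulus_int q R (T g) \<le> ennreal (C1 * (R * min 1 (R powr (- ((real d - 1) / 2))) powr q * (2 * A) powr q))"
        by (rule HYT[OF R gm supp _ Lp_lower[OF q' A gm _ le]]) (use A supp in auto)
      also have "C1 * (R * min 1 (R powr (- ((real d - 1) / 2))) powr q * (2 * A) powr q) = C * (R * min 1 (R powr (- \<gamma>)) powr q * A powr q)"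
        using A by (simp add: C_def powr_mult \<gamma>_def)
      also have "\<dots> \<le> C * (R powr (1 - real d) * min R (1 / R) powr \<delta> * A powr q)"
        using C by (intro mult_left_mono mult_right_mono *) auto
      finally show "annulus_int q R (T g) \<le> ennreal (C * (R powr (1 - real d) * min R (1 / R) powr \<delta> * A powr q))"
        by (simp add: ennreal_leI)
    qed
  next
    case False
    define L where "L = real d - (2 * real d + 1) / q"
    \<comment> \<open>Any u strictly between the two bounds would do. That 1 / q < L is equivalent
      to \<open>q > 2 * (real d + 1) / real d\<close>: here the lower bound on q in the theorem is
      used in full.\<close>
    define u where "u = (max (1 / p) (1 / q) + L) / 2"
    have "1 / q < L" unfolding L_def using q q2 d by (simp add: field_simps)
    moreover have "1 / p < L" using pq by (simp add: L_def)
    ultimately have "1 / p < u" "1 / q < u" "u < L" by (auto simp: u_def)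
    hence u1: "1 / p < u" "1 / q < u" "u < real d - (2 * real d + 1) / q" by (auto simp: L_def)
    have qd: "real d - 1 \<le> 2 * real d / q" using False q2 d by (simp add: field_simps)
    have "(2 * real d + 1) / q = 2 * real d / q + 1 / q" by (simp add: add_divide_distrib)
    hence u2: "u + 1 / q \<le> 1" using u1 qd by linarith
    \<comment> \<open>From d \<ge> 2 follows q \<le> 4 in this case, so the exponent x of the L^2
      bound is nonnegative.\<close>
    have "2 * real d / (real d - 1) \<le> 4" using d by (simp add: field_simps)
    hence "q \<le> 4" using False by linarith
    hence "1 / 4 \<le> 1 / q" using q2 by (simp add: field_simps)
    moreover have "3 / q = 1 / q + 1 / q + 1 / q" by (simp add: add_divide_distrib[symmetric])
    ultimately have u3: "3 / q + u \<ge> 1" using u1 by linarith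
    have u4: "u + (2 * real d + 1) / q < real d" using u1 by linarith
    obtain C \<delta> where C: "C > 0" and \<delta>: "\<delta> > 0" and restr: "\<forall>R>0. \<forall>g l m. g \<in> borel_measurable borel \<longrightarrow> (\<forall>r. r \<notin> {1..2} \<longrightarrow> g r = 0) \<longrightarrow> (\<forall>r. norm (g r) \<le> l) \<longrightarrow>
     l > 0 \<longrightarrow> m > 0 \<longrightarrow> m \<le> 1 \<longrightarrow> emeasure lborel {r. g r \<noteq> 0} \<le> ennreal m \<longrightarrow>
     annulus_int q R (T g) \<le> ennreal (C * (R powr (1 - real d) * min R (1 / R) powr \<delta> * (l * m powr u) powr q))"
      using T_restricted[OF less_imp_le[OF q2] less_imp_le[OF u1(2)] u2 u3 u4] by (elim exE conjE) (rule that)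
    define C' where "C' = C * (1 / (1 - 2 powr (- ((p * u - 1) / 2)))) powr q * 2 powr (p * u * q) / (1 - 2 powr (- ((p * u - 1) / 2) * q))"
    have \<mu>: "p * u - 1 > 0" using u1 p by (simp add: field_simps)
    have "2 powr (- ((p * u - 1) / 2)) < 2 powr (0::real)" "2 powr (- ((p * u - 1) / 2) * q) < 2 powr (0::real)"
      using \<mu> q2 by (intro powr_less_mono; simp)+
    hence C': "C' > 0" using C by (auto simp: C'_def intro!: divide_pos_pos mult_pos_pos)
    show ?thesis
    proof (rule exI[of _ C'], rule conjI[OF C'(1)], rule exI[of _ \<delta>], rule conjI[OF \<delta>(1)], intro allI impI)
      fix R A :: real and g :: "real \<Rightarrow> complex"
      assume R: "R > 0" and gm: "g \<in> borel_measurable borel" and supp: "\<forall>r. r \<notin> {1..2} \<longrightarrow> g r = 0" and A: "A > 0"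
        and le: "(\<integral>\<^sup>+ r. ennreal (norm (g r) powr p) \<partial>lborel) \<le> ennreal (A powr p)"
      show "annulus_int q R (T g) \<le> ennreal (C' * (R powr (1 - real d) * min R (1 / R) powr \<delta> * A powr q))"
        unfolding C'_def
        by (rule T_strong_of_restricted[OF p _ u1(1) C _ restr[rule_format, OF R] gm supp A le R]) (use q2 in auto)
    qed
  qed
qed

end

section \<open>The Fourier transform of the sphere\<close>

text \<open>By Vitali's covering theorem an open set is a countable disjoint union of balls up to a
  null set, and the preimage of a ball under an orthogonal map is a ball of the same radius. One
  inequality suffices, since it also applies to the inverse.\<close>

lemma emeasure_vimage_isometry_ge:
  fixes f :: "'a::euclidean_space \<Rightarrow> 'a"
  assumes f: "orthogonal_transformation f" and U: "open U"
  shows "emeasure lborel U \<le> emeasure lborel (f -` U)"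
proof -
  define K where "K = {(a :: 'a, r :: real). r > 0 \<and> ball a r \<subseteq> U}"
  have "\<exists>i. i \<in> K \<and> x \<in> ball (fst i) (snd i) \<and> snd i < d" if x: "x \<in> U" and d: "0 < d" for x and d :: real
  proof -
    obtain e where e: "e > 0" "ball x e \<subseteq> U" using U x open_contains_ball by blast
    have "(x, min e (d / 2)) \<in> K" using e d by (auto simp: K_def)
    thus ?thesis using d e by (intro exI[of _ "(x, min e (d / 2))"]) auto
  qed
  then obtain C where C: "countable C" "C \<subseteq> K" "pairwise (\<lambda>i j. disjnt (ball (fst i) (snd i)) (ball (fst j) (snd j))) C"
     "negligible (U - (\<Union>i\<in>C. ball (fst i) (snd i)))"
    using Vitali_covering_theorem_balls[of U K fst snd] by blast
  have dis: "disjoint_family_on (\<lambda>i. ball (fst i) (snd i)) C"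
    using C(3) by (auto simp: disjoint_family_on_def pairwise_def disjnt_def)
  have dis': "disjoint_family_on (\<lambda>i. f -` ball (fst i) (snd i)) C"
    using dis unfolding disjoint_family_on_def by blast
  have CU: "(\<Union>i\<in>C. ball (fst i) (snd i)) \<subseteq> U" proof (rule UN_least)
    fix i assume "i \<in> C"
    hence "i \<in> K" using C(2) by blast
    thus "ball (fst i) (snd i) \<subseteq> U" by (simp add: K_def case_prod_beta)
  qed
  have oC: "open (\<Union>i\<in>C. ball (fst i) (snd i))" by auto
  have null: "U - (\<Union>i\<in>C. ball (fst i) (snd i)) \<in> null_sets lborel"
  proof -
    have "U - (\<Union>i\<in>C. ball (fst i) (snd i)) \<in> null_sets lebesgue" using C(4) by (simp add: negligible_iff_null_sets)
    moreover have "U - (\<Union>i\<in>C. ball (fst i) (snd i)) \<in> sets borel" using U oC by auto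
    ultimately show ?thesis by (simp add: null_sets_def)
  qed
  obtain g where g: "orthogonal_transformation g" "\<And>x. g (f x) = x" "\<And>x. f (g x) = x"
    using orthogonal_transformation_bij[OF f] orthogonal_transformation_inv[OF f]
    by (metis bij_inv_eq_iff)
  have gball: "f -` ball a r = ball (g a) r" for a r
  proof -
    have "dist (g a) x = dist a (f x)" for x
      using f g(1,3) by (metis g(2) orthogonal_transformation_isometry)
    thus ?thesis by auto
  qed
  have "emeasure lborel U = emeasure lborel ((\<Union>i\<in>C. ball (fst i) (snd i)) \<union> (U - (\<Union>i\<in>C. ball (fst i) (snd i))))"
    using CU by (intro arg_cong2[where f = emeasure] refl) blast
  also have "\<dots> = emeasure lborel (\<Union>i\<in>C. ball (fst i) (snd i))"
    using null oC by (intro emeasure_Un_null_set) auto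
  also have "\<dots> = (\<integral>\<^sup>+ i. emeasure lborel (ball (fst i) (snd i)) \<partial>count_space C)"
    by (rule emeasure_UN_countable[OF _ C(1) dis]) auto
  also have "\<dots> = (\<integral>\<^sup>+ i. emeasure lborel (ball (g (fst i)) (snd i)) \<partial>count_space C)"
    using C(2) by (intro nn_integral_cong) (auto simp: K_def emeasure_ball)
  also have "\<dots> = emeasure lborel (\<Union>i\<in>C. ball (g (fst i)) (snd i))"
    unfolding gball[symmetric]
    by (rule emeasure_UN_countable[OF _ C(1) dis', symmetric]) (simp add: gball)
  also have "\<dots> \<le> emeasure lborel (f -` U)"
  proof (rule emeasure_mono)
    show "(\<Union>i\<in>C. ball (g (fst i)) (snd i)) \<subseteq> f -` U" unfolding gball[symmetric] using CU by auto
    have "continuous_on UNIV f" using f orthogonal_transformation_linear linear_continuous_on linear_linear by blast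
    thus "f -` U \<in> sets lborel" using U by (simp add: open_vimage)
  qed
  finally show ?thesis .
qed

lemma lborel_distr_orthogonal:
  fixes f :: "'a::euclidean_space \<Rightarrow> 'a"
  assumes f: "orthogonal_transformation f"
  shows "distr lborel borel f = lborel"
proof (rule lborel_eqI[symmetric])
  have cont: "continuous_on UNIV f" using f orthogonal_transformation_linear linear_continuous_on linear_linear by blast
  hence [measurable]: "f \<in> borel_measurable borel" by (rule borel_measurable_continuous_onI)
  obtain g where g: "orthogonal_transformation g" "\<And>x. g (f x) = x" "\<And>x. f (g x) = x"
    using orthogonal_transformation_bij[OF f] orthogonal_transformation_inv[OF f]
    by (metis bij_inv_eq_iff)
  fix l u :: 'a
  assume lu: "\<And>b. b \<in> Basis \<Longrightarrow> l \<bullet> b \<le> u \<bullet> b"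
  have "emeasure lborel (f -` box l u) = emeasure lborel (box l u)"
  proof (rule antisym)
    have "emeasure lborel (f -` box l u) \<le> emeasure lborel (g -` (f -` box l u))"
      by (rule emeasure_vimage_isometry_ge[OF g(1)]) (use cont in \<open>auto intro: open_vimage\<close>)
    also have "g -` (f -` box l u) = box l u" using g by auto
    finally show "emeasure lborel (f -` box l u) \<le> emeasure lborel (box l u)" .
    show "emeasure lborel (box l u) \<le> emeasure lborel (f -` box l u)"
      by (rule emeasure_vimage_isometry_ge[OF f]) auto
  qed
  thus "emeasure (distr lborel borel f) (box l u) = (\<Prod>b\<in>Basis. (u - l) \<bullet> b)"
    using lu by (subst emeasure_distr) (auto simp: emeasure_lborel_box)
qed simp

text \<open>Fubini in the product representation of \<open>lborel\<close>: the section of the ball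
  at height u along e is a ball of one dimension less and radius
  \<open>sqrt (R\<^sup>2 - u\<^sup>2)\<close>.\<close>

lemma nn_integral_cball_slice:
  fixes e :: "'a::euclidean_space" and g :: "real \<Rightarrow> ennreal"
  assumes e: "e \<in> Basis" and [measurable]: "g \<in> borel_measurable borel" and R: "R > 0"
  shows "(\<integral>\<^sup>+ x. indicator (cball 0 R) x * g (x \<bullet> e) \<partial>lborel)
    = (\<integral>\<^sup>+ u. indicator {-R..R} u * g u * ennreal (unit_ball_vol (real (DIM('a) - 1)) * sqrt (R\<^sup>2 - u\<^sup>2) ^ (DIM('a) - 1)) \<partial>lborel)"
proof -
  interpret product_sigma_finite "\<lambda>_ :: 'a. lborel :: real measure" by standard
  define B where "B = Basis - {e}"
  have B: "Basis = insert e B" "e \<notin> B" "finite B" "card B = DIM('a) - 1" using e by (auto simp: B_def)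
  define P where "P A = Pi\<^sub>M A (\<lambda>_ :: 'a. lborel :: real measure)" for A
  have "(\<integral>\<^sup>+ x. indicator (cball 0 R) x * g (x \<bullet> e) \<partial>lborel)
     = (\<integral>\<^sup>+ f. indicator (cball 0 R) (\<Sum>b\<in>Basis. f b *\<^sub>R b) * g ((\<Sum>b\<in>Basis. f b *\<^sub>R b) \<bullet> e) \<partial>P Basis)"
  proof -
    have "(\<lambda>x::'a. indicator (cball 0 R) x * g (x \<bullet> e)) \<in> borel_measurable borel"
      by (intro borel_measurable_times_ennreal borel_measurable_indicator measurable_compose[OF _ assms(2)]) auto
    thus ?thesis unfolding P_def by (subst lborel_eq, subst nn_integral_distr) auto
  qed
  also have "\<dots> = (\<integral>\<^sup>+ f. indicator {f. sqrt (\<Sum>b\<in>Basis. (f b)\<^sup>2) \<le> R} f * g (f e) \<partial>P Basis)"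
  proof (intro nn_integral_cong)
    fix f :: "'a \<Rightarrow> real"
    have "norm (\<Sum>b\<in>Basis. f b *\<^sub>R b) = sqrt (\<Sum>b\<in>Basis. (f b)\<^sup>2)"
      using euclidean_dist_l2[of 0 "\<Sum>b\<in>Basis. f b *\<^sub>R b"] by (simp add: L2_set_def)
    thus "indicator (cball 0 R) (\<Sum>b\<in>Basis. f b *\<^sub>R b) * g ((\<Sum>b\<in>Basis. f b *\<^sub>R b) \<bullet> e) = indicator {f. sqrt (\<Sum>b\<in>Basis. (f b)\<^sup>2) \<le> R} f * g (f e)"
      using e by (auto simp: indicator_def)
  qed
  also have "\<dots> = (\<integral>\<^sup>+ u. \<integral>\<^sup>+ f. indicator {f. sqrt (\<Sum>b\<in>insert e B. (f b)\<^sup>2) \<le> R} (f(e := u)) * g ((f(e := u)) e) \<partial>P B \<partial>lborel)"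
    unfolding P_def B(1) using B(2,3) by (subst product_nn_integral_insert_rev) auto
  also have "\<dots> = (\<integral>\<^sup>+ u. indicator {-R..R} u * g u * ennreal (unit_ball_vol (real (DIM('a) - 1)) * sqrt (R\<^sup>2 - u\<^sup>2) ^ (DIM('a) - 1)) \<partial>lborel)"
  proof (intro nn_integral_cong_AE)
    \<comment> \<open>At u = R and u = -R the section degenerates to a point; these two heights are
      discarded.\<close>
    have "AE u in lborel. u \<notin> {-R, R}" by (intro AE_not_in countable_imp_null_set_lborel) auto
    thus "AE u in lborel. (\<integral>\<^sup>+ f. indicator {f. sqrt (\<Sum>b\<in>insert e B. (f b)\<^sup>2) \<le> R} (f(e := u)) * g ((f(e := u)) e) \<partial>P B)
      = indicator {-R..R} u * g u * ennreal (unit_ball_vol (real (DIM('a) - 1)) * sqrt (R\<^sup>2 - u\<^sup>2) ^ (DIM('a) - 1))"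
    proof eventually_elim
      case (elim u)
      have sm: "(\<Sum>b\<in>insert e B. ((f(e := u)) b)\<^sup>2) = u\<^sup>2 + (\<Sum>b\<in>B. (f b)\<^sup>2)" for f
        using B(2,3) by (simp add: sum.insert) (intro sum.cong, auto)
      show ?case
      proof (cases "\<bar>u\<bar> < R")
        case True
        hence uR: "u\<^sup>2 < R\<^sup>2" using power_strict_mono[of "\<bar>u\<bar>" R 2] by simp
        have "(\<integral>\<^sup>+ f. indicator {f. sqrt (\<Sum>b\<in>insert e B. (f b)\<^sup>2) \<le> R} (f(e := u)) * g ((f(e := u)) e) \<partial>P B)
            = (\<integral>\<^sup>+ f. g u * indicator ({f. sqrt (\<Sum>b\<in>B. (f b)\<^sup>2) \<le> sqrt (R\<^sup>2 - u\<^sup>2)} \<inter> space (P B)) f \<partial>P B)"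
        proof (intro nn_integral_cong)
          fix f assume f: "f \<in> space (P B)"
          have "sqrt (u\<^sup>2 + (\<Sum>b\<in>B. (f b)\<^sup>2)) \<le> R \<longleftrightarrow> sqrt (\<Sum>b\<in>B. (f b)\<^sup>2) \<le> sqrt (R\<^sup>2 - u\<^sup>2)"
            using R by (subst real_sqrt_le_iff') (auto simp: sum_nonneg add_nonneg_nonneg)
          thus "indicator {f. sqrt (\<Sum>b\<in>insert e B. (f b)\<^sup>2) \<le> R} (f(e := u)) * g ((f(e := u)) e) = g u * indicator ({f. sqrt (\<Sum>b\<in>B. (f b)\<^sup>2) \<le> sqrt (R\<^sup>2 - u\<^sup>2)} \<inter> space (P B)) f"
            using f sm[of f] by (auto simp: indicator_def)
        qed
        also have "\<dots> = g u * emeasure (P B) ({f. sqrt (\<Sum>b\<in>B. (f b)\<^sup>2) \<le> sqrt (R\<^sup>2 - u\<^sup>2)} \<inter> space (P B))"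
          unfolding P_def by (subst nn_integral_cmult_indicator) auto
        also have "\<dots> = g u * ennreal (unit_ball_vol (real (card B)) * sqrt (R\<^sup>2 - u\<^sup>2) ^ card B)"
          unfolding P_def using uR B(3) by (subst emeasure_cball_aux) auto
        finally show ?thesis using True B(4) by (simp add: indicator_def abs_less_iff)
      next
        case False
        hence "\<bar>u\<bar> > R" using elim R by auto
        hence "R\<^sup>2 < u\<^sup>2" using R by (metis abs_ge_zero less_imp_le power2_abs power_strict_mono pos2)
        hence "\<not> sqrt (u\<^sup>2 + (\<Sum>b\<in>B. (f b)\<^sup>2)) \<le> R" for f
          using R sum_nonneg[of B "\<lambda>b. (f b)\<^sup>2"] by (subst real_sqrt_le_iff') (auto simp: sum_nonneg not_le intro: less_le_trans)
        hence "(\<integral>\<^sup>+ f. indicator {f. sqrt (\<Sum>b\<in>insert e B. (f b)\<^sup>2) \<le> R} (f(e := u)) * g ((f(e := u)) e) \<partial>P B) = (\<integral>\<^sup>+ f. 0 \<partial>P B)"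
          by (intro nn_integral_cong) (simp only: indicator_def mem_Collect_eq sm, simp)
        thus ?thesis using \<open>\<bar>u\<bar> > R\<close> by (auto simp: indicator_def)
      qed
    qed
  qed
  finally show ?thesis .
qed

section \<open>Asymptotics of a perturbed harmonic oscillator\<close>

text \<open>\<open>f s + C / s\<close> is nonincreasing and \<open>f s - C / s\<close>
  nondecreasing, so the supremum of the latter lies between the two at every s.\<close>

lemma derivative_decay_imp_limit:
  fixes f f' :: "real \<Rightarrow> real"
  assumes "\<And>s. s \<ge> 1 \<Longrightarrow> (f has_real_derivative f' s) (at s)" "\<And>s. s \<ge> 1 \<Longrightarrow> \<bar>f' s\<bar> \<le> C / s\<^sup>2"
  shows "\<exists>L. \<forall>s\<ge>1. \<bar>f s - L\<bar> \<le> C / s"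
proof -
  have C: "C \<ge> 0" using assms(2)[of 1] by simp
  have g: "f t + C / t \<le> f s + C / s" if "1 \<le> s" "s \<le> t" for s t
  proof (rule DERIV_nonpos_imp_nonincreasing[OF that(2)])
    fix x assume x: "s \<le> x" "x \<le> t"
    have "((\<lambda>s. f s + C / s) has_real_derivative (f' x - C / x\<^sup>2)) (at x)"
      using x that by (auto intro!: derivative_eq_intros assms(1) simp: power2_eq_square)
    moreover have "f' x - C / x\<^sup>2 \<le> 0" using assms(2)[of x] x that by linarith
    ultimately show "\<exists>y. ((\<lambda>s. f s + C / s) has_real_derivative y) (at x) \<and> y \<le> 0" by blast
  qed
  have h: "f s - C / s \<le> f t - C / t" if "1 \<le> s" "s \<le> t" for s t
  proof (rule DERIV_nonneg_imp_nondecreasing[OF that(2)])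
    fix x assume x: "s \<le> x" "x \<le> t"
    have "((\<lambda>s. f s - C / s) has_real_derivative (f' x + C / x\<^sup>2)) (at x)"
      using x that by (auto intro!: derivative_eq_intros assms(1) simp: power2_eq_square)
    moreover have "f' x + C / x\<^sup>2 \<ge> 0" using assms(2)[of x] x that by linarith
    ultimately show "\<exists>y. ((\<lambda>s. f s - C / s) has_real_derivative y) (at x) \<and> 0 \<le> y" by blast
  qed
  have hg: "f s - C / s \<le> f t + C / t" if "1 \<le> s" "1 \<le> t" for s t
  proof (cases "s \<le> t")
    case True
    have "C / t \<ge> 0" using C that by simp
    thus ?thesis using h[OF that(1) True] by linarith
  next
    case False
    have "C / s \<ge> 0" using C that by simp
    thus ?thesis using g[of t s] that False by linarith
  qed
  define L where "L = (SUP s\<in>{1..}. f s - C / s)"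
  have bdd: "bdd_above ((\<lambda>s. f s - C / s) ` {1..})" using hg[of _ 1] by (intro bdd_aboveI2) auto
  have "f s - C / s \<le> L" if "s \<ge> 1" for s unfolding L_def using that by (intro cSUP_upper bdd) auto
  moreover have "L \<le> f s + C / s" if "s \<ge> 1" for s unfolding L_def using that by (intro cSUP_least hg) auto
  ultimately have "\<forall>s\<ge>1. \<bar>f s - L\<bar> \<le> C / s" by (auto simp: abs_le_iff algebra_simps)
  thus ?thesis by blast
qed

text \<open>The energy \<open>y\<^sup>2 + (y')\<^sup>2\<close> stays bounded because c / s^2 is
  integrable at infinity. The pair \<open>f1\<close>, \<open>f2\<close> undoes the free rotation of
  (y, y'), so its derivatives are O(1 / s^2) and it converges; the limits are the real and imaginary
  parts of a. The asymptotics concern y' because the sphere is the derivative of the ball.\<close>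

lemma perturbed_oscillator_asymptotics:
  fixes y y' :: "real \<Rightarrow> real"
  assumes y: "\<And>s. s \<ge> 1 \<Longrightarrow> (y has_real_derivative y' s) (at s)"
    and y': "\<And>s. s \<ge> 1 \<Longrightarrow> (y' has_real_derivative (c / s\<^sup>2 * y s - y s)) (at s)"
  shows "\<exists>K a. K > 0 \<and> (\<forall>s\<ge>1. \<bar>y s\<bar> \<le> K \<and> \<bar>y' s\<bar> \<le> K \<and> \<bar>y' s - Re (a * iexp s)\<bar> \<le> K / s)"
proof -
  define E where "E s = (y s)\<^sup>2 + (y' s)\<^sup>2" for s
  have E0: "E s \<ge> 0" for s by (simp add: E_def)
  have E: "E s \<le> E 1 * exp \<bar>c\<bar>" if s: "s \<ge> 1" for s
  proof -
    \<comment> \<open>\<open>exp (\<bar>c\<bar> / s)\<close> is an integrating factor: its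
      logarithmic derivative \<open>- \<bar>c\<bar> / s\<^sup>2\<close> compensates the growth rate
      of E.\<close>
    have "E s * exp (\<bar>c\<bar> / s) \<le> E 1 * exp (\<bar>c\<bar> / 1)"
    proof (rule DERIV_nonpos_imp_nonincreasing[OF s])
      fix x :: real assume x: "1 \<le> x" "x \<le> s"
      define D where "D = 2 * y' x * (c / x\<^sup>2 * y x)"
      have "(E has_real_derivative D) (at x)"
        unfolding E_def[abs_def] D_def
        by (rule derivative_eq_intros y y' x refl)+ (simp add: algebra_simps)
      moreover have "((\<lambda>s. exp (\<bar>c\<bar> / s)) has_real_derivative (exp (\<bar>c\<bar> / x) * (- \<bar>c\<bar> / x\<^sup>2))) (at x)"
        using x by (auto intro!: derivative_eq_intros simp: power2_eq_square)
      ultimately have "((\<lambda>s. E s * exp (\<bar>c\<bar> / s)) has_real_derivative (D * exp (\<bar>c\<bar> / x) + exp (\<bar>c\<bar> / x) * (- \<bar>c\<bar> / x\<^sup>2) * E x)) (at x)"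
        by (rule DERIV_mult)
      moreover have "D * exp (\<bar>c\<bar> / x) + exp (\<bar>c\<bar> / x) * (- \<bar>c\<bar> / x\<^sup>2) * E x \<le> 0"
      proof -
        have "D \<le> \<bar>c\<bar> / x\<^sup>2 * (2 * \<bar>y' x\<bar> * \<bar>y x\<bar>)"
          unfolding D_def by (rule order_trans[OF abs_ge_self]) (simp add: abs_mult mult_ac)
        also have "\<dots> \<le> \<bar>c\<bar> / x\<^sup>2 * E x"
          using sum_squares_bound[of "\<bar>y' x\<bar>" "\<bar>y x\<bar>"] by (intro mult_left_mono) (auto simp: E_def)
        finally have "D - \<bar>c\<bar> / x\<^sup>2 * E x \<le> 0" by simp
        hence "exp (\<bar>c\<bar> / x) * (D - \<bar>c\<bar> / x\<^sup>2 * E x) \<le> 0" by (intro mult_nonneg_nonpos) auto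
        thus ?thesis by (simp add: algebra_simps)
      qed
      ultimately show "\<exists>v. ((\<lambda>s. E s * exp (\<bar>c\<bar> / s)) has_real_derivative v) (at x) \<and> v \<le> 0" by blast
    qed
    moreover have "E s * 1 \<le> E s * exp (\<bar>c\<bar> / s)" using E0 s by (intro mult_left_mono) auto
    ultimately show ?thesis by simp
  qed
  define K0 where "K0 = sqrt (E 1 * exp \<bar>c\<bar>)"
  have K0: "K0 \<ge> 0" unfolding K0_def using E0[of 1] by simp
  have bd: "\<bar>y s\<bar> \<le> K0" "\<bar>y' s\<bar> \<le> K0" if "s \<ge> 1" for s
  proof -
    have "(y s)\<^sup>2 \<le> E 1 * exp \<bar>c\<bar>" "(y' s)\<^sup>2 \<le> E 1 * exp \<bar>c\<bar>" using E[OF that] by (auto simp: E_def intro: order_trans[rotated])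
    thus "\<bar>y s\<bar> \<le> K0" "\<bar>y' s\<bar> \<le> K0" unfolding K0_def by (metis real_sqrt_abs real_sqrt_le_iff)+
  qed
  define C where "C = \<bar>c\<bar> * K0"
  have C: "C \<ge> 0" using K0 by (simp add: C_def)
  have sm: "\<bar>c / s\<^sup>2 * y s * v\<bar> \<le> C / s\<^sup>2" if "s \<ge> 1" "\<bar>v\<bar> \<le> 1" for s v
  proof -
    have "\<bar>c / s\<^sup>2 * y s * v\<bar> = \<bar>c\<bar> / s\<^sup>2 * (\<bar>y s\<bar> * \<bar>v\<bar>)" by (simp add: abs_mult)
    also have "\<dots> \<le> \<bar>c\<bar> / s\<^sup>2 * (K0 * 1)" using bd that K0 by (intro mult_left_mono mult_mono) auto
    finally show ?thesis by (simp add: C_def)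
  qed
  define f1 where "f1 s = y' s * cos s + y s * sin s" for s
  define f2 where "f2 s = y s * cos s - y' s * sin s" for s
  have "\<exists>L. \<forall>s\<ge>1. \<bar>f1 s - L\<bar> \<le> C / s"
  proof (rule derivative_decay_imp_limit)
    show "(f1 has_real_derivative (c / s\<^sup>2 * y s * cos s)) (at s)" if "s \<ge> 1" for s
      unfolding f1_def[abs_def] by (rule derivative_eq_intros y y' that refl)+ (simp add: algebra_simps)
  qed (use sm in auto)
  then obtain L1 where L1: "\<And>s. s \<ge> 1 \<Longrightarrow> \<bar>f1 s - L1\<bar> \<le> C / s" by blast
  have "\<exists>L. \<forall>s\<ge>1. \<bar>f2 s - L\<bar> \<le> C / s"
  proof (rule derivative_decay_imp_limit)
    show "(f2 has_real_derivative (c / s\<^sup>2 * y s * (- sin s))) (at s)" if "s \<ge> 1" for s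
      unfolding f2_def[abs_def] by (rule derivative_eq_intros y y' that refl)+ (simp add: algebra_simps)
    show "\<bar>c / s\<^sup>2 * y s * (- sin s)\<bar> \<le> C / s\<^sup>2" if "s \<ge> 1" for s using that by (rule sm) simp
  qed
  then obtain L2 where L2: "\<And>s. s \<ge> 1 \<Longrightarrow> \<bar>f2 s - L2\<bar> \<le> C / s" by blast
  define K where "K = 2 * C + K0 + 1"
  show ?thesis
  proof (intro exI[of _ K] exI[of _ "Complex L1 L2"] conjI allI impI)
    show "K > 0" using C K0 by (simp add: K_def)
    fix s :: real assume s: "s \<ge> 1"
    show "\<bar>y s\<bar> \<le> K" "\<bar>y' s\<bar> \<le> K" using bd[OF s] C by (auto simp: K_def)
    have "y' s = f1 s * cos s - f2 s * sin s"
    proof -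
      have "f1 s * cos s - f2 s * sin s = y' s * ((sin s)\<^sup>2 + (cos s)\<^sup>2)" 
        unfolding f1_def f2_def by algebra
      thus ?thesis by simp
    qed
    moreover have "Re (Complex L1 L2 * iexp s) = L1 * cos s - L2 * sin s" by (simp add: exp_Euler cos_of_real sin_of_real)
    ultimately have "y' s - Re (Complex L1 L2 * iexp s) = (f1 s - L1) * cos s - (f2 s - L2) * sin s" by (simp add: algebra_simps)
    hence "\<bar>y' s - Re (Complex L1 L2 * iexp s)\<bar> \<le> \<bar>f1 s - L1\<bar> * \<bar>cos s\<bar> + \<bar>f2 s - L2\<bar> * \<bar>sin s\<bar>"
      by (simp add: abs_mult[symmetric] abs_triangle_ineq4)
    also have "\<dots> \<le> C / s * 1 + C / s * 1" using L1[OF s] L2[OF s] C s by (intro add_mono mult_mono) auto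
    also have "\<dots> \<le> K / s" using s C K0 by (simp add: K_def field_simps)
    finally show "\<bar>y' s - Re (Complex L1 L2 * iexp s)\<bar> \<le> K / s" .
  qed
qed

section \<open>Fourier transforms of the ball and the sphere\<close>

text \<open>The volume of the section at height u of the unit ball of dimension d.\<close>

definition slice_weight :: "nat \<Rightarrow> real \<Rightarrow> real" where
  "slice_weight d u = unit_ball_vol (real (d - 1)) * sqrt (1 - u\<^sup>2) ^ (d - 1)"

text \<open>\<open>ball_wave d s\<close> is the Fourier transform of the unit ball of dimension \<open>d\<close> at distance
  \<open>s\<close> from the origin, and \<open>sphere_wave d\<close> that of its boundary sphere:
  \<open>d/dr (r\<^sup>d ball_wave d (\<rho> r)) = r\<^sup>d\<^sup>-\<^sup>1 sphere_wave d (\<rho> r)\<close>.\<close>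

definition ball_wave :: "nat \<Rightarrow> real \<Rightarrow> real" where
  "ball_wave d s = integral {-1..1} (\<lambda>u. slice_weight d u * cos (s * u))"

definition ball_wave' :: "nat \<Rightarrow> real \<Rightarrow> real" where
  "ball_wave' d s = integral {-1..1} (\<lambda>u. - (slice_weight d u * u * sin (s * u)))"

definition ball_wave'' :: "nat \<Rightarrow> real \<Rightarrow> real" where
  "ball_wave'' d s = integral {-1..1} (\<lambda>u. - (slice_weight d u * u * u * cos (s * u)))"

definition sphere_wave :: "nat \<Rightarrow> real \<Rightarrow> real" where
  "sphere_wave d s = real d * ball_wave d s + s * ball_wave' d s"

lemma slice_weight_nonneg: "\<bar>u\<bar> \<le> 1 \<Longrightarrow> slice_weight d u \<ge> 0"
  by (simp add: slice_weight_def abs_square_le_1)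

lemma continuous_slice_weight [continuous_intros]:
  "continuous_on A f \<Longrightarrow> continuous_on A (\<lambda>x. slice_weight d (f x))"
  unfolding slice_weight_def by (intro continuous_intros)

lemma slice_weight_measurable [measurable]: "slice_weight d \<in> borel_measurable borel"
  by (intro borel_measurable_continuous_onI continuous_intros)

lemma ball_wave_deriv: "(ball_wave d has_real_derivative ball_wave' d s) (at s within A)"
proof -
  have "((\<lambda>s. integral (cbox (-1) 1) (\<lambda>u. slice_weight d u * cos (s * u))) has_field_derivative
     integral (cbox (-1) 1) (\<lambda>u. - (slice_weight d u * u * sin (s * u)))) (at s within UNIV)"
    by (rule leibniz_rule_field_derivative)
       (auto intro!: derivative_eq_intros integrable_continuous_real continuous_intros simp: case_prod_beta)
  thus ?thesis unfolding ball_wave_def[abs_def] ball_wave'_def cbox_interval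
    using has_field_derivative_subset by blast
qed

lemma ball_wave'_deriv: "(ball_wave' d has_real_derivative ball_wave'' d s) (at s within A)"
proof -
  have "((\<lambda>s. integral (cbox (-1) 1) (\<lambda>u. - (slice_weight d u * u * sin (s * u)))) has_field_derivative
     integral (cbox (-1) 1) (\<lambda>u. - (slice_weight d u * u * u * cos (s * u)))) (at s within UNIV)"
    by (rule leibniz_rule_field_derivative)
       (auto intro!: derivative_eq_intros integrable_continuous_real continuous_intros simp: case_prod_beta)
  thus ?thesis unfolding ball_wave'_def[abs_def] ball_wave''_def cbox_interval
    using has_field_derivative_subset by blast
qed

lemma ball_wave_continuous: "continuous_on A (ball_wave d)" "continuous_on A (ball_wave' d)" "continuous_on A (sphere_wave d)"
proof -
  show 1: "continuous_on A (ball_wave d)" "continuous_on A (ball_wave' d)"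
    using ball_wave_deriv ball_wave'_deriv by (auto intro!: DERIV_continuous_on)
  show "continuous_on A (sphere_wave d)"
    unfolding sphere_wave_def[abs_def] by (intro continuous_intros 1)
qed

text \<open>The left-hand side is the integral of the derivative of G, which vanishes at both
  endpoints. This is the equation satisfied by \<open>s powr (- d / 2)\<close> times the Bessel
  function of order d / 2.\<close>

lemma ball_wave_ode:
  assumes d: "d \<ge> 1"
  shows "s * ball_wave'' d s + (real d + 1) * ball_wave' d s + s * ball_wave d s = 0"
proof -
  define G where "G u = unit_ball_vol (real (d - 1)) * sqrt (1 - u\<^sup>2) ^ (d + 1) * sin (s * u)" for u
  define g where "g u = s * (- (slice_weight d u * u * u * cos (s * u))) + (real d + 1) * (- (slice_weight d u * u * sin (s * u))) + s * (slice_weight d u * cos (s * u))" for u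
  have "(g has_integral (G 1 - G (-1))) {-1..1}"
  \<comment> \<open>The square root is not differentiable at 1 and -1, so derivatives are taken only
    inside the interval.\<close>
  proof (rule fundamental_theorem_of_calculus_interior)
    show "continuous_on {-1..1} G" unfolding G_def by (intro continuous_intros)
    fix u :: real assume u: "u \<in> {-1<..<1}"
    have "\<bar>u\<bar> < 1" using u by auto
    hence u2: "1 - u\<^sup>2 > 0" by (simp add: abs_square_less_1)
    define r where "r = sqrt (1 - u\<^sup>2)"
    have r: "r > 0" "r\<^sup>2 = 1 - u\<^sup>2" using u2 by (auto simp: r_def)
    obtain k where k: "d = Suc k" using d by (cases d) auto
    have dr: "((\<lambda>u. sqrt (1 - u\<^sup>2)) has_real_derivative (- u / r)) (at u)"
      using u2 by (auto intro!: derivative_eq_intros simp: r_def field_simps)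
    have gen: "((\<lambda>u. b * Q u ^ (d + 1) * sin (s * u)) has_real_derivative (b * ((real d + 1) * Q u ^ d * D) * sin (s * u) + b * Q u ^ (d + 1) * (s * cos (s * u)))) (at u)"
      if "(Q has_real_derivative D) (at u)" for Q D and b :: real
    proof -
      have P: "((\<lambda>u. Q u ^ (d + 1)) has_real_derivative ((real d + 1) * Q u ^ d * D)) (at u)"
        using DERIV_power[OF that, of "d + 1"] by (simp add: mult_ac add_ac)
      have S: "((\<lambda>u. sin (s * u)) has_real_derivative (s * cos (s * u))) (at u)"
        by (auto intro!: derivative_eq_intros)
      show ?thesis using DERIV_mult[OF DERIV_cmult[OF P, of b] S] by (simp add: mult_ac add_ac)
    qed
    let ?b = "unit_ball_vol (real (d - 1))"
    have "(G has_real_derivative (?b * ((real d + 1) * r ^ d * (- u / r)) * sin (s * u) + ?b * r ^ (d + 1) * (s * cos (s * u)))) (at u)"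
      unfolding G_def[abs_def] using gen[OF dr] by (simp only: r_def)
    also have "?b * ((real d + 1) * r ^ d * (- u / r)) * sin (s * u) + ?b * r ^ (d + 1) * (s * cos (s * u)) = g u"
    proof -
      have w: "slice_weight d u = ?b * r ^ k" by (simp add: slice_weight_def r_def k)
      have "g u = ?b * r ^ k * (s * (1 - u\<^sup>2) * cos (s * u) - (real d + 1) * u * sin (s * u))"
        unfolding g_def w by (simp add: algebra_simps power2_eq_square)
      also have "1 - u\<^sup>2 = r * r" using r by (simp add: power2_eq_square)
      also have "?b * r ^ k * (s * (r * r) * cos (s * u) - (real d + 1) * u * sin (s * u))
         = ?b * (- ((real d + 1) * u * r ^ k)) * sin (s * u) + ?b * r ^ (d + 1) * (s * cos (s * u))"
        by (simp add: k algebra_simps)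
      also have "- ((real d + 1) * u * r ^ k) = (real d + 1) * r ^ d * (- u / r)" using r(1) by (simp add: k)
      finally show ?thesis by simp
    qed
    finally show "(G has_vector_derivative g u) (at u)" by (simp add: has_real_derivative_iff_has_vector_derivative)
  qed simp
  moreover have "G 1 - G (-1) = 0" by (simp add: G_def)
  ultimately have "integral {-1..1} g = 0" by (simp add: integral_unique)
  moreover have "integral {-1..1} g = s * ball_wave'' d s + (real d + 1) * ball_wave' d s + s * ball_wave d s"
  proof (rule integral_unique)
    have i: "((\<lambda>u. f u) has_integral integral {-1..1} f) {-1..1}" if "continuous_on {-1..1} f" for f :: "real \<Rightarrow> real"
      using that integrable_continuous_real by (intro integrable_integral)
    show "(g has_integral s * ball_wave'' d s + (real d + 1) * ball_wave' d s + s * ball_wave d s) {-1..1}"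
      unfolding g_def[abs_def] ball_wave_def ball_wave'_def ball_wave''_def
      by (intro has_integral_add has_integral_mult_right i continuous_intros)
  qed
  ultimately show ?thesis by simp
qed

text \<open>Multiplying the ball transform by \<open>s powr \<nu>\<close> removes the first-order
  term of \<open>ball_wave_ode\<close> and leaves y'' = (c / s^2 - 1) y. Then
  \<open>s powr (\<nu> - 1) * sphere_wave d s\<close> equals
  \<open>y' s + (real d - \<nu>) * y s / s\<close>, whose second term is smaller by one power of
  s.\<close>

lemma sphere_wave_radial_kernel:
  assumes d: "d \<ge> 2"
  shows "\<exists>K a. radial_kernel (sphere_wave d) d K a"
proof -
  define \<nu> where "\<nu> = (real d + 1) / 2"
  have \<nu>: "\<nu> > 1" "2 * \<nu> = real d + 1" using d by (auto simp: \<nu>_def)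
  define c where "c = \<nu> * (\<nu> - 1)"
  define y where "y s = s powr \<nu> * ball_wave d s" for s
  define y' where "y' s = \<nu> * s powr (\<nu> - 1) * ball_wave d s + s powr \<nu> * ball_wave' d s" for s
  have "\<exists>K a. K > 0 \<and> (\<forall>s\<ge>1. \<bar>y s\<bar> \<le> K \<and> \<bar>y' s\<bar> \<le> K \<and> \<bar>y' s - Re (a * iexp s)\<bar> \<le> K / s)"
  proof (rule perturbed_oscillator_asymptotics)
    fix s :: real assume s: "s \<ge> 1"
    show "(y has_real_derivative y' s) (at s)"
      unfolding y_def[abs_def] y'_def using s
      by (auto intro!: derivative_eq_intros ball_wave_deriv)
    have "(y' has_real_derivative (\<nu> * ((\<nu> - 1) * s powr (\<nu> - 1 - 1)) * ball_wave d s + \<nu> * s powr (\<nu> - 1) * ball_wave' d s + (\<nu> * s powr (\<nu> - 1) * ball_wave' d s + s powr \<nu> * ball_wave'' d s))) (at s)"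
      unfolding y'_def[abs_def] using s
      by (auto intro!: derivative_eq_intros ball_wave_deriv ball_wave'_deriv)
    also have "\<nu> * ((\<nu> - 1) * s powr (\<nu> - 1 - 1)) * ball_wave d s + \<nu> * s powr (\<nu> - 1) * ball_wave' d s + (\<nu> * s powr (\<nu> - 1) * ball_wave' d s + s powr \<nu> * ball_wave'' d s)
       = c / s\<^sup>2 * y s - y s"
    proof -
      define P where "P = s powr \<nu>"
      have p: "s powr (\<nu> - 1) = P / s" "s powr (\<nu> - 1 - 1) = P / s\<^sup>2"
        using s by (auto simp: P_def powr_diff power2_eq_square)
      have "s * ball_wave'' d s = - (2 * \<nu> * ball_wave' d s) - s * ball_wave d s"
        using ball_wave_ode[of d s] d \<nu>(2) by simp
      hence w: "ball_wave'' d s = - (2 * \<nu> * ball_wave' d s / s) - ball_wave d s"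
        using s by (simp add: field_simps)
      show ?thesis unfolding p w c_def y_def P_def[symmetric] using s
        by (simp add: field_simps power2_eq_square)
    qed
    finally show "(y' has_real_derivative c / s\<^sup>2 * y s - y s) (at s)" .
  qed
  then obtain K0 a where K0: "K0 > 0" and bd: "\<And>s. s \<ge> 1 \<Longrightarrow> \<bar>y s\<bar> \<le> K0" "\<And>s. s \<ge> 1 \<Longrightarrow> \<bar>y' s\<bar> \<le> K0"
     "\<And>s. s \<ge> 1 \<Longrightarrow> \<bar>y' s - Re (a * iexp s)\<bar> \<le> K0 / s" by blast
  have rep: "s powr (\<nu> - 1) * sphere_wave d s = y' s + (real d - \<nu>) * y s / s" if s: "s \<ge> 1" for s
  proof -
    have p: "s powr (\<nu> - 1) = s powr \<nu> / s" using s by (auto simp: powr_diff)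
    show ?thesis unfolding y_def y'_def sphere_wave_def p using s by (simp add: field_simps)
  qed
  have \<nu>1: "\<nu> - 1 = (real d - 1) / 2" by (simp add: \<nu>_def field_simps)
  have sh: "s powr (- (\<nu> - 1)) * (s powr (\<nu> - 1) * x) = x" if "s > 0" for s x :: real
  proof -
    have "s powr (- (\<nu> - 1)) * s powr (\<nu> - 1) = 1" using that by (simp only: powr_add[symmetric]) simp
    thus ?thesis by (simp only: mult.assoc[symmetric] mult_1_left)
  qed
  \<comment> \<open>The oscillator estimates start at s = 1; on [0, 1] continuity gives the
    bound.\<close>
  have "compact (sphere_wave d ` {0..1})" by (intro compact_continuous_image ball_wave_continuous) auto
  then obtain K1 where K1: "\<And>s. s \<in> {0..1} \<Longrightarrow> \<bar>sphere_wave d s\<bar> \<le> K1"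
    using compact_imp_bounded bounded_iff by (metis imageI real_norm_def)
  have K1': "K1 \<ge> 0" using K1[of 0] by simp
  define K2 where "K2 = K0 + \<bar>real d - \<nu>\<bar> * K0"
  have K2: "K2 \<ge> 0" using K0 by (simp add: K2_def)
  define K where "K = K2 + K1 + 1"
  have K: "K > 0" "K2 \<le> K" "K1 \<le> K" using K1' K2 by (auto simp: K_def)
  have corr: "\<bar>(real d - \<nu>) * y s / s\<bar> \<le> \<bar>real d - \<nu>\<bar> * K0 / s" if "s \<ge> 1" for s
    using bd(1)[OF that] that by (auto simp: abs_mult intro!: divide_right_mono mult_left_mono)
  have big: "\<bar>sphere_wave d s\<bar> \<le> K * s powr (- (\<nu> - 1))" if s: "s \<ge> 1" for s
  proof -
    have "\<bar>real d - \<nu>\<bar> * K0 / s \<le> \<bar>real d - \<nu>\<bar> * K0 / 1" using s K0 by (intro divide_left_mono) auto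
    hence "\<bar>s powr (\<nu> - 1) * sphere_wave d s\<bar> \<le> K"
      unfolding rep[OF s] using bd(2)[OF s] corr[OF s] K(2) unfolding K2_def by linarith
    hence "s powr (- (\<nu> - 1)) * \<bar>s powr (\<nu> - 1) * sphere_wave d s\<bar> \<le> s powr (- (\<nu> - 1)) * K" by (intro mult_left_mono) auto
    also have "s powr (- (\<nu> - 1)) * \<bar>s powr (\<nu> - 1) * sphere_wave d s\<bar> = \<bar>sphere_wave d s\<bar>"
    proof -
      have "s powr (- (\<nu> - 1)) * \<bar>s powr (\<nu> - 1) * sphere_wave d s\<bar> = \<bar>s powr (- (\<nu> - 1)) * (s powr (\<nu> - 1) * sphere_wave d s)\<bar>"
        by (simp only: abs_mult abs_of_nonneg[OF powr_ge_zero])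
      thus ?thesis using s by (subst (asm) sh) auto
    qed
    finally show ?thesis by (simp add: mult.commute)
  qed
  have "radial_kernel (sphere_wave d) d K a"
  proof
    show "d \<ge> 2" "K > 0" by fact+
    show "sphere_wave d \<in> borel_measurable borel" by (intro borel_measurable_continuous_onI ball_wave_continuous)
    fix s :: real
    show "\<bar>sphere_wave d s\<bar> \<le> K" if "s \<ge> 0"
    proof (cases "s \<le> 1")
      case True
      thus ?thesis using K1[of s] that K by auto
    next
      case False
      hence "s powr (- (\<nu> - 1)) \<le> 1 powr (- (\<nu> - 1))" using \<nu> by (intro powr_mono2') auto
      hence "K * s powr (- (\<nu> - 1)) \<le> K * 1" using K by (intro mult_left_mono) auto
      thus ?thesis using big[of s] False by simp
    qed
    show "\<bar>sphere_wave d s\<bar> \<le> K * s powr (- ((real d - 1) / 2))" if "s > 0"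
    proof (cases "s \<le> 1")
      case True
      hence "1 powr (- (\<nu> - 1)) \<le> s powr (- (\<nu> - 1))" using \<nu> that by (intro powr_mono2') auto
      hence "K * 1 \<le> K * s powr (- (\<nu> - 1))" using K by (intro mult_left_mono) auto
      moreover have "\<bar>sphere_wave d s\<bar> \<le> K1" using K1[of s] True that by simp
      ultimately have "\<bar>sphere_wave d s\<bar> \<le> K * s powr (- (\<nu> - 1))" using K(3) by linarith
      thus ?thesis by (simp only: \<nu>1)
    qed (use big[of s] \<nu>1 in auto)
    show "\<bar>sphere_wave d s - s powr (- ((real d - 1) / 2)) * Re (a * iexp s)\<bar> \<le> K * s powr (- ((real d + 1) / 2))" if s: "s \<ge> 1"
    proof -
      have "\<bar>s powr (\<nu> - 1) * sphere_wave d s - Re (a * iexp s)\<bar> \<le> K0 / s + \<bar>real d - \<nu>\<bar> * K0 / s"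
        unfolding rep[OF s] using bd(3)[OF s] corr[OF s] by linarith
      also have "\<dots> = K2 / s" by (simp add: K2_def add_divide_distrib)
      also have "\<dots> \<le> K / s" using s K by (intro divide_right_mono) auto
      finally have "s powr (- (\<nu> - 1)) * \<bar>s powr (\<nu> - 1) * sphere_wave d s - Re (a * iexp s)\<bar> \<le> s powr (- (\<nu> - 1)) * (K / s)"
        by (intro mult_left_mono) auto
      also have "s powr (- (\<nu> - 1)) * \<bar>s powr (\<nu> - 1) * sphere_wave d s - Re (a * iexp s)\<bar> = \<bar>sphere_wave d s - s powr (- (\<nu> - 1)) * Re (a * iexp s)\<bar>"
      proof -
        have "s powr (- (\<nu> - 1)) * (s powr (\<nu> - 1) * sphere_wave d s - Re (a * iexp s)) = sphere_wave d s - s powr (- (\<nu> - 1)) * Re (a * iexp s)"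
          unfolding right_diff_distrib using s by (subst sh) auto
        moreover have "s powr (- (\<nu> - 1)) * \<bar>x\<bar> = \<bar>s powr (- (\<nu> - 1)) * x\<bar>" for x
          by (simp only: abs_mult abs_of_nonneg[OF powr_ge_zero])
        ultimately show ?thesis by (simp only:)
      qed
      also have "s powr (- (\<nu> - 1)) * (K / s) = K * s powr (- ((real d + 1) / 2))"
      proof -
        have "s powr (- \<nu>) = s powr (- (\<nu> - 1) + - 1)" by simp
        also have "\<dots> = s powr (- (\<nu> - 1)) / s" using s by (simp only: powr_add) (simp add: powr_minus_divide)
        finally show ?thesis by (simp add: \<nu>_def)
      qed
      finally show ?thesis unfolding \<nu>1 .
    qed
  qed
  thus ?thesis by blast
qed

section \<open>Polar coordinates by differentiating integrals over balls\<close>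

text \<open>The measures are compared on half-lines: for a > 0 the left one gives the integral over
  the ball of radius a, which is H a, and the right one gives H a by the fundamental theorem of
  calculus. Nonnegativity of h comes from monotonicity of H, that is, from w being a
  density.\<close>

lemma distr_norm_density:
  fixes w :: "'a::euclidean_space \<Rightarrow> real" and h H :: "real \<Rightarrow> real"
  assumes [measurable]: "w \<in> borel_measurable borel" "h \<in> borel_measurable borel"
    and w: "\<And>R. R > 0 \<Longrightarrow> (\<integral>\<^sup>+ x. indicator (cball 0 R) x * ennreal (w x) \<partial>lborel) = ennreal (H R)"
    and H0: "H 0 = 0" "\<And>R. R > 0 \<Longrightarrow> H R \<ge> 0" and H: "\<And>r. (H has_real_derivative h r) (at r)" and h0: "h 0 \<ge> 0"
  shows "distr (density lborel (\<lambda>x. ennreal (w x))) lborel norm = density lborel (\<lambda>r. indicator {0<..} r * ennreal (h r))"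
    and "r \<ge> 0 \<Longrightarrow> h r \<ge> 0"
proof -
  have mono: "mono_on {0<..} H"
  proof (rule mono_onI)
    fix r s :: real assume rs: "r \<in> {0<..}" "s \<in> {0<..}" "r \<le> s"
    have "ennreal (H r) \<le> ennreal (H s)"
      using rs by (subst (1 2) w[symmetric]) (auto simp: indicator_def intro!: nn_integral_mono)
    thus "H r \<le> H s" using rs H0 by (simp add: ennreal_le_iff)
  qed
  have hn: "h r \<ge> 0" if "r \<ge> 0" for r
  proof (cases "r = 0")
    case False
    thus ?thesis using mono_on_imp_deriv_nonneg[OF mono H, of r] that by (simp add: interior_open)
  qed (use h0 in simp)
  have L: "emeasure (distr (density lborel (\<lambda>x. ennreal (w x))) lborel norm) {..a} = (if a > 0 then ennreal (H a) else 0)" for a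
  proof -
    have "emeasure (distr (density lborel (\<lambda>x. ennreal (w x))) lborel norm) {..a} = (\<integral>\<^sup>+ x. ennreal (w x) * indicator (norm -` {..a}) x \<partial>lborel)"
    proof -
      have "norm -` {..a} \<in> sets (lborel :: 'a measure)"
        using measurable_sets[of norm lborel lborel "{..a}"] by simp
      thus ?thesis by (subst emeasure_distr) (auto simp: emeasure_density)
    qed
    also have "\<dots> = (if a > 0 then ennreal (H a) else 0)"
    proof (cases "a > 0")
      case True
      thus ?thesis using w[OF True] by (simp add: indicator_def mult.commute cong: nn_integral_cong)
    next
      case False
      have "(\<integral>\<^sup>+ x. ennreal (w x) * indicator (norm -` {..a}) x \<partial>lborel) = (\<integral>\<^sup>+ x. 0 \<partial>(lborel :: 'a measure))"
      proof (rule nn_integral_cong_AE)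
        have "AE x in lborel. x \<noteq> (0 :: 'a)" by (rule AE_lborel_singleton)
        thus "AE x in lborel. ennreal (w x) * indicator (norm -` {..a}) x = 0"
        proof eventually_elim
          case (elim x)
          hence "\<not> norm x \<le> a" using False zero_less_norm_iff[of x] by linarith
          thus ?case by simp
        qed
      qed
      thus ?thesis using False by simp
    qed
    finally show ?thesis .
  qed
  have R: "emeasure (density lborel (\<lambda>r. indicator {0<..} r * ennreal (h r))) {..a} = (if a > 0 then ennreal (H a) else 0)" for a
  proof (cases "a > 0")
    case True
    have "emeasure (density lborel (\<lambda>r. indicator {0<..} r * ennreal (h r))) {..a} = (\<integral>\<^sup>+ r. ennreal (h r) * indicator {0..a} r \<partial>lborel)"
      by (subst emeasure_density, simp, simp, intro nn_integral_cong_AE, rule AE_mp[OF AE_lborel_singleton[of 0]]) (auto simp: indicator_def)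
    also have "\<dots> = ennreal (H a - H 0)"
      using True hn H by (intro nn_integral_FTC_Icc) (auto intro: has_field_derivative_at_within simp: has_real_derivative_iff_has_vector_derivative[symmetric])
    finally show ?thesis using True H0 by simp
  next
    case False
    have "emeasure (density lborel (\<lambda>r. indicator {0<..} r * ennreal (h r))) {..a} = (\<integral>\<^sup>+ r. 0 \<partial>(lborel :: real measure))"
      by (subst emeasure_density, simp, simp, intro nn_integral_cong) (use False in \<open>auto simp: indicator_def\<close>)
    thus ?thesis using False by simp
  qed
  show "h r \<ge> 0" if "r \<ge> 0" using that by (rule hn)
  show "distr (density lborel (\<lambda>x. ennreal (w x))) lborel norm = density lborel (\<lambda>r. indicator {0<..} r * ennreal (h r))"
  proof (rule measure_eqI_generator_eq[where E = "range (\<lambda>a::real. {..a})" and \<Omega> = UNIV and A = "\<lambda>n. {..real n}"])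
    show "Int_stable (range (\<lambda>a::real. {..a}))" by (auto simp: Int_stable_def)
    show "sets (distr (density lborel (\<lambda>x. ennreal (w x))) lborel norm) = sigma_sets UNIV (range atMost)"
       "sets (density lborel (\<lambda>r. indicator {0<..} r * ennreal (h r))) = sigma_sets UNIV (range atMost)"
      by (simp_all add: borel_eq_atMost)
    show "(\<Union>i. {..real i}) = UNIV" by (auto simp: real_arch_simple)
    show "emeasure (distr (density lborel (\<lambda>x. ennreal (w x))) lborel norm) {..real i} \<noteq> \<infinity>" for i unfolding L by simp
  qed (use L R in auto)
qed

text \<open>The constant \<alpha> keeps the integrand nonnegative, so that it is a density;
  \<open>radial_fourier\<close> subtracts it again. A rotation taking a coordinate axis to the
  direction of x reduces the integral to slices.\<close>

lemma nn_integral_cball_cos: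
  fixes x :: "real ^ 'd"
  assumes d: "2 \<le> CARD('d)" and ab: "\<bar>\<beta>\<bar> \<le> \<alpha>" and R: "R > 0"
  shows "(\<integral>\<^sup>+ y. indicator (cball 0 R) y * ennreal (\<alpha> + \<beta> * cos (x \<bullet> y)) \<partial>lborel)
     = ennreal (R ^ CARD('d) * (\<alpha> * ball_wave CARD('d) 0 + \<beta> * ball_wave CARD('d) (norm x * R)))"
    and "\<alpha> * ball_wave CARD('d) 0 + \<beta> * ball_wave CARD('d) s \<ge> 0"
proof -
  let ?d = "CARD('d)"
  have pos: "\<alpha> + \<beta> * cos t \<ge> 0" for t
  proof -
    have "\<bar>\<beta> * cos t\<bar> \<le> \<bar>\<beta>\<bar> * 1" unfolding abs_mult by (intro mult_left_mono) auto
    thus ?thesis using ab by linarith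
  qed
  have int: "((\<lambda>v. slice_weight ?d v * (\<alpha> + \<beta> * cos (s * v))) has_integral (\<alpha> * ball_wave ?d 0 + \<beta> * ball_wave ?d s)) {-1..1}" for s
  proof -
    have i: "(f has_integral integral {-1..1} f) {-1..1}" if "continuous_on {-1..1} f" for f :: "real \<Rightarrow> real"
      using that integrable_continuous_real by (intro integrable_integral)
    have "((\<lambda>v. \<alpha> * (slice_weight ?d v * cos (0 * v)) + \<beta> * (slice_weight ?d v * cos (s * v))) has_integral (\<alpha> * ball_wave ?d 0 + \<beta> * ball_wave ?d s)) {-1..1}"
      unfolding ball_wave_def by (intro has_integral_add has_integral_mult_right i continuous_intros)
    thus ?thesis by (rule has_integral_eq[rotated]) (simp add: algebra_simps)
  qed
  show "\<alpha> * ball_wave ?d 0 + \<beta> * ball_wave ?d s \<ge> 0"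
    by (rule has_integral_nonneg[OF int]) (auto intro!: mult_nonneg_nonneg slice_weight_nonneg pos)
  obtain k :: 'd where True by simp
  define e :: "real ^ 'd" where "e = axis k 1"
  have e: "e \<in> Basis" "norm e = 1" by (auto simp: e_def norm_axis_1)
  obtain f where f: "orthogonal_transformation f" "f (norm x *\<^sub>R e) = x"
    using orthogonal_transformation_exists[of "norm x *\<^sub>R e" x] e by (auto simp del: norm_axis_1)
  have fm [measurable]: "f \<in> borel_measurable borel"
    using f orthogonal_transformation_linear linear_continuous_on linear_linear by (blast intro: borel_measurable_continuous_onI)
  define g where "g u = ennreal (\<alpha> + \<beta> * cos (norm x * u))" for u
  have [measurable]: "g \<in> borel_measurable borel" unfolding g_def by measurable
  have cb [measurable]: "cball (0 :: real ^ 'd) R \<in> sets borel" by auto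
  have "(\<integral>\<^sup>+ y. indicator (cball 0 R) y * ennreal (\<alpha> + \<beta> * cos (x \<bullet> y)) \<partial>lborel)
     = (\<integral>\<^sup>+ y. indicator (cball 0 R) y * ennreal (\<alpha> + \<beta> * cos (x \<bullet> y)) \<partial>distr lborel borel f)"
    by (simp only: lborel_distr_orthogonal[OF f(1)])
  also have "\<dots> = (\<integral>\<^sup>+ y. indicator (cball 0 R) (f y) * ennreal (\<alpha> + \<beta> * cos (x \<bullet> f y)) \<partial>lborel)"
    by (rule nn_integral_distr) measurable
  also have "\<dots> = (\<integral>\<^sup>+ y. indicator (cball 0 R) y * g (y \<bullet> e) \<partial>lborel)"
  proof (intro nn_integral_cong)
    fix y
    have "x \<bullet> f y = norm x * (y \<bullet> e)"
    proof -
      have "x \<bullet> f y = f (norm x *\<^sub>R e) \<bullet> f y" by (simp add: f(2))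
      also have "\<dots> = (norm x *\<^sub>R e) \<bullet> y" using f(1) by (simp add: orthogonal_transformation_def)
      finally show ?thesis by (simp add: inner_commute)
    qed
    moreover have "norm (f y) = norm y" using f(1) by (simp add: orthogonal_transformation_norm)
    ultimately show "indicator (cball 0 R) (f y) * ennreal (\<alpha> + \<beta> * cos (x \<bullet> f y)) = indicator (cball 0 R) y * g (y \<bullet> e)"
      by (simp add: g_def indicator_def)
  qed
  also have "\<dots> = (\<integral>\<^sup>+ u. indicator {-R..R} u * g u * ennreal (unit_ball_vol (real (?d - 1)) * sqrt (R\<^sup>2 - u\<^sup>2) ^ (?d - 1)) \<partial>lborel)"
    using nn_integral_cball_slice[OF e(1) _ R, of g] by simp
  also have "\<dots> = ennreal \<bar>R\<bar> * (\<integral>\<^sup>+ v. indicator {-R..R} (0 + R * v) * g (0 + R * v) * ennreal (unit_ball_vol (real (?d - 1)) * sqrt (R\<^sup>2 - (0 + R * v)\<^sup>2) ^ (?d - 1)) \<partial>lborel)"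
    by (rule nn_integral_real_affine) (use R in auto)
  also have "\<dots> = ennreal R * (\<integral>\<^sup>+ v. ennreal (R ^ (?d - 1)) * ennreal (indicator {-1..1} v * (slice_weight ?d v * (\<alpha> + \<beta> * cos (norm x * R * v)))) \<partial>lborel)"
  proof -
    have "indicator {-R..R} (0 + R * v) * g (0 + R * v) * ennreal (unit_ball_vol (real (?d - 1)) * sqrt (R\<^sup>2 - (0 + R * v)\<^sup>2) ^ (?d - 1))
       = ennreal (R ^ (?d - 1)) * ennreal (indicator {-1..1} v * (slice_weight ?d v * (\<alpha> + \<beta> * cos (norm x * R * v))))" for v
    proof (cases "v \<in> {-1..1}")
      case True
      have "R * v \<le> R * 1" "R * (-1) \<le> R * v" using True R by (intro mult_left_mono; simp)+
      hence m: "R * v \<in> {-R..R}" by simp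
      have "R\<^sup>2 - (R * v)\<^sup>2 = R\<^sup>2 * (1 - v\<^sup>2)" by (simp add: power_mult_distrib algebra_simps)
      hence sq: "sqrt (R\<^sup>2 - (R * v)\<^sup>2) = R * sqrt (1 - v\<^sup>2)" using R by (simp add: real_sqrt_mult)
      have "ennreal (R ^ (?d - 1)) * ennreal (slice_weight ?d v * (\<alpha> + \<beta> * cos (norm x * R * v))) = ennreal (\<alpha> + \<beta> * cos (norm x * (R * v))) * ennreal (R ^ (?d - 1) * slice_weight ?d v)"
        using R pos by (simp add: ennreal_mult'[symmetric] mult_ac)
      thus ?thesis using m True by (simp add: g_def sq[unfolded power_mult_distrib] slice_weight_def power_mult_distrib mult_ac)
    next
      case False
      have "R * v \<notin> {-R..R}"
      proof
        assume "R * v \<in> {-R..R}"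
        hence "R * v \<le> R * 1" "R * (-1) \<le> R * v" by auto
        hence "v \<le> 1" "-1 \<le> v" using R by (simp_all only: mult_le_cancel_left_pos)
        thus False using False by simp
      qed
      thus ?thesis using False by simp
    qed
    thus ?thesis using R by simp
  qed
  also have "\<dots> = ennreal R * (ennreal (R ^ (?d - 1)) * (\<integral>\<^sup>+ v. ennreal (indicator {-1..1} v * (slice_weight ?d v * (\<alpha> + \<beta> * cos (norm x * R * v)))) \<partial>lborel))"
    by (subst nn_integral_cmult) auto
  also have "(\<integral>\<^sup>+ v. ennreal (indicator {-1..1} v * (slice_weight ?d v * (\<alpha> + \<beta> * cos (norm x * R * v)))) \<partial>lborel) = ennreal (\<alpha> * ball_wave ?d 0 + \<beta> * ball_wave ?d (norm x * R))"
    by (rule nn_integral_has_integral_lebesgue[OF _ int]) (auto intro!: mult_nonneg_nonneg slice_weight_nonneg pos)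
  also have "ennreal R * (ennreal (R ^ (?d - 1)) * ennreal (\<alpha> * ball_wave ?d 0 + \<beta> * ball_wave ?d (norm x * R))) = ennreal (R * (R ^ (?d - 1) * (\<alpha> * ball_wave ?d 0 + \<beta> * ball_wave ?d (norm x * R))))"
    using R by (simp add: ennreal_mult')
  also have "R * (R ^ (?d - 1) * (\<alpha> * ball_wave ?d 0 + \<beta> * ball_wave ?d (norm x * R))) = R ^ ?d * (\<alpha> * ball_wave ?d 0 + \<beta> * ball_wave ?d (norm x * R))"
    using d by (cases ?d) auto
  finally show "(\<integral>\<^sup>+ y. indicator (cball 0 R) y * ennreal (\<alpha> + \<beta> * cos (x \<bullet> y)) \<partial>lborel)
     = ennreal (R ^ ?d * (\<alpha> * ball_wave ?d 0 + \<beta> * ball_wave ?d (norm x * R)))" .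
qed

lemma distr_norm_cos:
  fixes x :: "real ^ 'd"
  assumes d: "2 \<le> CARD('d)" and ab: "\<bar>\<beta>\<bar> \<le> \<alpha>"
  shows "distr (density lborel (\<lambda>y. ennreal (\<alpha> + \<beta> * cos (x \<bullet> y)))) lborel norm
    = density lborel (\<lambda>r. indicator {0<..} r * ennreal (r ^ (CARD('d) - 1) * (\<alpha> * (real CARD('d) * ball_wave CARD('d) 0) + \<beta> * sphere_wave CARD('d) (norm x * r))))" (is ?A)
    and "r \<ge> 0 \<Longrightarrow> r ^ (CARD('d) - 1) * (\<alpha> * (real CARD('d) * ball_wave CARD('d) 0) + \<beta> * sphere_wave CARD('d) (norm x * r)) \<ge> 0" (is "_ \<Longrightarrow> ?B")
proof -
  let ?d = "CARD('d)"
  let ?h = "\<lambda>r. r ^ (?d - 1) * (\<alpha> * (real ?d * ball_wave ?d 0) + \<beta> * sphere_wave ?d (norm x * r))"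
  let ?H = "\<lambda>R. R ^ ?d * (\<alpha> * ball_wave ?d 0 + \<beta> * ball_wave ?d (norm x * R))"
  have 1: "(\<lambda>y. \<alpha> + \<beta> * cos (x \<bullet> y)) \<in> borel_measurable borel" by measurable
  have 2: "?h \<in> borel_measurable borel"
    by (intro borel_measurable_continuous_onI continuous_intros continuous_on_compose2[OF ball_wave_continuous(3)[of UNIV]]) auto
  have 3: "(\<integral>\<^sup>+ y. indicator (cball 0 R) y * ennreal (\<alpha> + \<beta> * cos (x \<bullet> y)) \<partial>lborel) = ennreal (?H R)"
    if "R > 0" for R by (rule nn_integral_cball_cos(1)[OF d ab that])
  have 4: "?H 0 = 0" using d by simp
  have 5: "0 \<le> ?H R" if "R > 0" for R
    using that nn_integral_cball_cos(2)[OF d ab] by simp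
  have "0 < ?d - 1" using d by simp
  hence 6: "0 \<le> ?h 0" by (simp add: zero_power)
  have 7: "(?H has_real_derivative ?h r) (at r)" for r
  proof -
  obtain k where k: "?d = Suc k" using d by (cases ?d) auto
  have P: "((\<lambda>R. R ^ ?d) has_real_derivative (real ?d * r ^ k)) (at r)"
    using DERIV_pow[of ?d r] by (simp add: k)
  have "((\<lambda>R. ball_wave ?d (norm x * R)) has_real_derivative (ball_wave' ?d (norm x * r) * norm x)) (at r)"
    by (rule DERIV_chain2[where f = "ball_wave ?d" and g = "\<lambda>R. norm x * R", OF ball_wave_deriv]) (auto intro!: derivative_eq_intros)
  hence Q: "((\<lambda>R. \<alpha> * ball_wave ?d 0 + \<beta> * ball_wave ?d (norm x * R)) has_real_derivative (\<beta> * (ball_wave' ?d (norm x * r) * norm x))) (at r)"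
    by (auto intro!: derivative_eq_intros)
  show ?thesis
    using DERIV_mult[OF P Q] by (rule DERIV_cong) (simp add: k sphere_wave_def algebra_simps)
qed
  show ?A using distr_norm_density(1)[OF 1 2 3 4 5 7 6] .
  show ?B if "r \<ge> 0" using distr_norm_density(2)[OF 1 2 3 4 5 7 6 that] .
qed

text \<open>This is \<open>sphere_wave d 0\<close>: the area of the unit sphere is d times the
  volume of the ball.\<close>

definition sphere_area :: "nat \<Rightarrow> real" where
  "sphere_area d = real d * ball_wave d 0"

lemma distr_norm_lborel:
  assumes d: "2 \<le> CARD('d::finite)"
  shows "distr (lborel :: (real ^ 'd) measure) lborel norm = density lborel (\<lambda>r. indicator {0<..} r * ennreal (r ^ (CARD('d) - 1) * sphere_area CARD('d)))"
  using distr_norm_cos(1)[OF d, of 0 1 0] by (simp add: density_1 sphere_area_def)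

lemma sphere_area_pos:
  assumes d: "2 \<le> CARD('d::finite)"
  shows "sphere_area CARD('d) > 0"
proof -
  have "ennreal (ball_wave CARD('d) 0) = emeasure lborel (cball (0 :: real ^ 'd) 1)"
    using nn_integral_cball_cos(1)[OF d, of 0 1 1 "0 :: real ^ 'd"] by simp
  also have "\<dots> > 0" by (simp add: emeasure_cball)
  finally have "ball_wave CARD('d) 0 > 0" by (simp add: ennreal_less_zero_iff)
  thus ?thesis using d by (simp add: sphere_area_def)
qed

lemma nn_integral_radial:
  assumes d: "2 \<le> CARD('d::finite)" and [measurable]: "f \<in> borel_measurable borel"
  shows "(\<integral>\<^sup>+ y. f (norm (y :: real ^ 'd)) \<partial>lborel) = (\<integral>\<^sup>+ r. indicator {0<..} r * ennreal (r ^ (CARD('d) - 1) * sphere_area CARD('d)) * f r \<partial>lborel)"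
proof -
  have "(\<integral>\<^sup>+ y. f (norm (y :: real ^ 'd)) \<partial>lborel) = (\<integral>\<^sup>+ r. f r \<partial>distr (lborel :: (real ^ 'd) measure) lborel norm)"
    by (subst nn_integral_distr) auto
  thus ?thesis unfolding distr_norm_lborel[OF d] by (simp add: nn_integral_density)
qed

text \<open>The sine part is odd and integrates to 0. The cosine is written as (1 + cos) - 1, a
  difference of two nonnegative densities to which \<open>distr_norm_cos\<close> applies.\<close>

lemma radial_fourier:
  fixes x :: "real ^ 'd" and F :: "real \<Rightarrow> complex"
  assumes d: "2 \<le> CARD('d)" and Fm [measurable]: "F \<in> borel_measurable borel" and int: "integrable lborel (\<lambda>y :: real ^ 'd. F (norm y))"
  shows "(LINT y|lborel. F (norm y) * iexp (x \<bullet> y)) = (LINT r|lborel. indicator {0<..} r *\<^sub>R (complex_of_real (r ^ (CARD('d) - 1) * sphere_wave CARD('d) (norm x * r)) * F r))"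
proof -
  let ?d = "CARD('d)"
  have ic: "integrable lborel (\<lambda>y :: real ^ 'd. complex_of_real (cos (x \<bullet> y)) * F (norm y))"
    by (rule Bochner_Integration.integrable_bound[OF int]) (auto simp: norm_mult mult_left_le_one_le)
  have isn: "integrable lborel (\<lambda>y :: real ^ 'd. complex_of_real (sin (x \<bullet> y)) * F (norm y))"
    by (rule Bochner_Integration.integrable_bound[OF int]) (auto simp: norm_mult mult_left_le_one_le)
  have sin0: "(LINT y|lborel. complex_of_real (sin (x \<bullet> y)) * F (norm y)) = 0"
  proof -
    have "orthogonal_transformation (\<lambda>y :: real ^ 'd. - y)" by (simp add: orthogonal_transformation_def linear_iff)
    from lborel_distr_orthogonal[OF this] have "(LINT y|lborel. complex_of_real (sin (x \<bullet> y)) * F (norm y)) = (LINT y|distr lborel borel (\<lambda>y. - y). complex_of_real (sin (x \<bullet> y)) * F (norm y))" by simp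
    also have "\<dots> = (LINT y|lborel. complex_of_real (sin (x \<bullet> (- y))) * F (norm (- y)))"
      by (rule integral_distr) auto
    also have "\<dots> = - (LINT y|lborel. complex_of_real (sin (x \<bullet> y)) * F (norm y))" by simp
    finally show ?thesis by simp
  qed
  define h where "h \<alpha> \<beta> r = r ^ (?d - 1) * (\<alpha> * (real ?d * ball_wave ?d 0) + \<beta> * sphere_wave ?d (norm x * r))" for \<alpha> \<beta> r
  have [measurable]: "h \<alpha> \<beta> \<in> borel_measurable borel" for \<alpha> \<beta>
    unfolding h_def by (intro borel_measurable_continuous_onI continuous_intros continuous_on_compose2[OF ball_wave_continuous(3)[of UNIV]]) auto
  \<comment> \<open>The \<open>max 0\<close> makes the radial density nonnegative for all r, as
    integration against a density requires; \<open>hpos\<close> removes it for r > 0.\<close>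
  have gen: "integrable lborel (\<lambda>r. (indicator {0<..} r * max 0 (h \<alpha> \<beta> r)) *\<^sub>R F r)
     \<and> (LINT y|lborel. (\<alpha> + \<beta> * cos (x \<bullet> y)) *\<^sub>R F (norm y)) = (LINT r|lborel. (indicator {0<..} r * max 0 (h \<alpha> \<beta> r)) *\<^sub>R F r)"
    if ab: "\<bar>\<beta>\<bar> \<le> \<alpha>" for \<alpha> \<beta>
  proof -
    have pos: "\<alpha> + \<beta> * cos t \<ge> 0" for t
    proof -
      have "\<bar>\<beta> * cos t\<bar> \<le> \<bar>\<beta>\<bar> * 1" unfolding abs_mult by (intro mult_left_mono) auto
      thus ?thesis using ab by linarith
    qed
    have "integrable lborel (\<lambda>y :: real ^ 'd. \<alpha> *\<^sub>R F (norm y) + \<beta> *\<^sub>R (complex_of_real (cos (x \<bullet> y)) * F (norm y)))"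
      using ic int by (intro Bochner_Integration.integrable_add integrable_scaleR_right) auto
    hence i: "integrable lborel (\<lambda>y :: real ^ 'd. (\<alpha> + \<beta> * cos (x \<bullet> y)) *\<^sub>R F (norm y))"
      by (simp add: scaleR_conv_of_real algebra_simps)
    define D where "D = distr (density lborel (\<lambda>y. ennreal (\<alpha> + \<beta> * cos (x \<bullet> y)))) lborel norm"
    have "D = density lborel (\<lambda>r. indicator {0<..} r * ennreal (h \<alpha> \<beta> r))"
      unfolding D_def h_def by (rule distr_norm_cos(1)[OF d ab])
    also have "\<dots> = density lborel (\<lambda>r. ennreal (indicator {0<..} r * max 0 (h \<alpha> \<beta> r)))"
    proof (rule density_cong)
      show "AE r in lborel. indicator {0<..} r * ennreal (h \<alpha> \<beta> r) = ennreal (indicator {0<..} r * max 0 (h \<alpha> \<beta> r))"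
        by (intro AE_I2) (auto simp: indicator_def max_def ennreal_neg)
    qed measurable
    finally have D2: "D = density lborel (\<lambda>r. ennreal (indicator {0<..} r * max 0 (h \<alpha> \<beta> r)))" .
    have i1: "integrable D F"
      unfolding D_def using i pos by (subst integrable_distr_eq, simp, simp, subst integrable_density) auto
    have "(LINT r|D. F r) = (LINT y|lborel. (\<alpha> + \<beta> * cos (x \<bullet> y)) *\<^sub>R F (norm y))"
      unfolding D_def using pos by (subst integral_distr, simp, simp, subst integral_density) auto
    moreover have "(LINT r|D. F r) = (LINT r|lborel. (indicator {0<..} r * max 0 (h \<alpha> \<beta> r)) *\<^sub>R F r)"
      unfolding D2 by (subst integral_density) auto
    moreover have "integrable lborel (\<lambda>r. (indicator {0<..} r * max 0 (h \<alpha> \<beta> r)) *\<^sub>R F r)"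
      using i1 unfolding D2 by (subst (asm) integrable_density) auto
    ultimately show ?thesis by simp
  qed
  have hpos: "h 1 1 r \<ge> 0" "h 1 0 r \<ge> 0" if "r \<ge> 0" for r
    unfolding h_def by (rule distr_norm_cos(2)[OF d _ that]; simp)+
  have "(LINT y|lborel. F (norm y) * iexp (x \<bullet> y)) = (LINT y|lborel. complex_of_real (cos (x \<bullet> y)) * F (norm y) + \<i> * (complex_of_real (sin (x \<bullet> y)) * F (norm y)))"
    by (intro Bochner_Integration.integral_cong) (auto simp: exp_Euler cos_of_real sin_of_real algebra_simps)
  also have "\<dots> = (LINT y|lborel. complex_of_real (cos (x \<bullet> y)) * F (norm y))"
    using ic isn sin0 by simp
  also have "\<dots> = (LINT y|lborel. (1 + 1 * cos (x \<bullet> y)) *\<^sub>R F (norm y) - (1 + 0 * cos (x \<bullet> y)) *\<^sub>R F (norm y))"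
    by (intro Bochner_Integration.integral_cong) (auto simp: scaleR_conv_of_real algebra_simps)
  also have "\<dots> = (LINT y|lborel. (1 + 1 * cos (x \<bullet> y)) *\<^sub>R F (norm y)) - (LINT y|lborel. (1 + 0 * cos (x \<bullet> y)) *\<^sub>R F (norm y))"
    using ic int by (intro Bochner_Integration.integral_diff) (auto simp: scaleR_conv_of_real distrib_right)
  also have "\<dots> = (LINT r|lborel. (indicator {0<..} r * max 0 (h 1 1 r)) *\<^sub>R F r - (indicator {0<..} r * max 0 (h 1 0 r)) *\<^sub>R F r)"
    using gen[of 1 1] gen[of 0 1] by (subst Bochner_Integration.integral_diff) auto
  also have "\<dots> = (LINT r|lborel. indicator {0<..} r *\<^sub>R (complex_of_real (r ^ (?d - 1) * sphere_wave ?d (norm x * r)) * F r))"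
  proof (rule integral_cong_AE)
    show "AE r in lborel. (indicator {0<..} r * max 0 (h 1 1 r)) *\<^sub>R F r - (indicator {0<..} r * max 0 (h 1 0 r)) *\<^sub>R F r
        = indicator {0<..} r *\<^sub>R (complex_of_real (r ^ (?d - 1) * sphere_wave ?d (norm x * r)) * F r)"
      using hpos by (intro AE_I2) (auto simp: indicator_def scaleR_conv_of_real h_def algebra_simps max_def)
    have [measurable]: "sphere_wave ?d \<in> borel_measurable borel" by (intro borel_measurable_continuous_onI ball_wave_continuous)
    show "(\<lambda>r. indicator {0<..} r *\<^sub>R (complex_of_real (r ^ (?d - 1) * sphere_wave ?d (norm x * r)) * F r)) \<in> borel_measurable lborel" by measurable
  qed measurable
  finally show ?thesis .
qed

section \<open>Radial profiles on the paraboloid\<close>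

lemma AE_norm_notin_null:
  assumes d: "2 \<le> CARD('d::finite)" and N: "N \<in> null_sets (lborel :: real measure)"
  shows "AE y in (lborel :: (real ^ 'd) measure). norm y \<notin> N"
proof -
  have [measurable]: "N \<in> sets borel" using N by auto
  have "(\<integral>\<^sup>+ y. indicator N (norm (y :: real ^ 'd)) \<partial>lborel) = (\<integral>\<^sup>+ r. indicator {0<..} r * ennreal (r ^ (CARD('d) - 1) * sphere_area CARD('d)) * indicator N r \<partial>lborel)"
    by (rule nn_integral_radial[OF d]) measurable
  also have "\<dots> = (\<integral>\<^sup>+ r. 0 \<partial>(lborel :: real measure))"
    by (intro nn_integral_cong_AE) (use AE_not_in[OF N] in eventually_elim, simp)
  also have "\<dots> = 0" by simp
  finally have "AE y in (lborel :: (real ^ 'd) measure). indicator N (norm y) = (0 :: ennreal)"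
    by (subst (asm) nn_integral_0_iff_AE) auto
  thus ?thesis by eventually_elim (auto simp: indicator_def split: if_splits)
qed

text \<open>The radial density is positive on r > 0, so the norm does not hide a set of positive
  measure there; radii r < 0 are invisible to it, hence the restriction on N.\<close>

lemma null_sets_of_AE_norm_notin:
  assumes d: "2 \<le> CARD('d::finite)" and N [measurable]: "N \<in> sets borel" "N \<subseteq> {0<..}"
    and ae: "AE y in (lborel :: (real ^ 'd) measure). norm y \<notin> N"
  shows "N \<in> null_sets (lborel :: real measure)"
proof -
  have "(\<integral>\<^sup>+ r. indicator {0<..} r * ennreal (r ^ (CARD('d) - 1) * sphere_area CARD('d)) * indicator N r \<partial>lborel)
     = (\<integral>\<^sup>+ y. indicator N (norm (y :: real ^ 'd)) \<partial>lborel)"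
    by (rule nn_integral_radial[OF d, symmetric]) measurable
  also have "\<dots> = (\<integral>\<^sup>+ y. 0 \<partial>(lborel :: (real ^ 'd) measure))"
    by (intro nn_integral_cong_AE) (use ae in eventually_elim, simp)
  also have "\<dots> = 0" by simp
  finally have "AE r in lborel. indicator {0<..} r * ennreal (r ^ (CARD('d) - 1) * sphere_area CARD('d)) * indicator N r = 0"
    by (subst (asm) nn_integral_0_iff_AE) auto
  hence "AE r in lborel. r \<notin> N"
  proof eventually_elim
    case (elim r)
    show ?case
    proof
      assume r: "r \<in> N"
      hence "r > 0" using N by auto
      hence "r ^ (CARD('d) - 1) * sphere_area CARD('d) > 0" using sphere_area_pos[OF d] by simp
      thus False using elim r \<open>r > 0\<close> by (simp add: indicator_def ennreal_eq_0_iff)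
    qed
  qed
  thus ?thesis by (simp add: AE_iff_null_sets)
qed

text \<open>Inner approximation: an \<open>F\<^sub>\<sigma>\<close> set has an \<open>F\<^sub>\<sigma>\<close> image under the norm, because the norm maps
  compact sets to compact sets.\<close>

lemma sets_lebesgue_of_norm_vimage:
  assumes d: "2 \<le> CARD('d::finite)" and A: "{y :: real ^ 'd. norm y \<in> A} \<in> sets lebesgue"
  shows "A \<inter> {0<..} \<in> sets lebesgue"
proof -
  have inner: "\<exists>B T. B \<in> sets borel \<and> B \<subseteq> A' \<and> T \<in> null_sets lebesgue \<and> {y :: real ^ 'd. norm y \<in> A'} \<subseteq> {y. norm y \<in> B} \<union> T"
    if A': "{y :: real ^ 'd. norm y \<in> A'} \<in> sets lebesgue" for A'
  proof -
    obtain C T where C: "fsigma C" "T \<in> null_sets lebesgue" "C \<union> T = {y :: real ^ 'd. norm y \<in> A'}"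
      using lebesgue_set_almost_fsigma[OF A'] by metis
    from C(1) obtain F :: "nat \<Rightarrow> (real ^ 'd) set" where F: "\<And>n. closed (F n)" "C = (\<Union>n. F n)"
      by (cases rule: fsigma.cases) auto
    have cpt: "compact (norm ` (F n \<inter> cball 0 (real m)))" for n m
      by (intro compact_continuous_image continuous_intros closed_Int_compact F) auto
    define B where "B = (\<Union>n. \<Union>m. norm ` (F n \<inter> cball 0 (real m)))"
    have b: "norm ` (F n \<inter> cball 0 (real m)) \<in> sets borel" for n m
      by (rule borel_closed[OF compact_imp_closed[OF cpt]])
    have "(\<Union>m. norm ` (F n \<inter> cball 0 (real m))) \<in> sets borel" for n
      by (rule sets.countable_nat_UN) (use b in blast)
    hence "B \<in> sets borel" unfolding B_def by (intro sets.countable_nat_UN) blast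
    moreover have BC: "B = norm ` C"
    proof -
      have "(\<Union>m. cball (0 :: real ^ 'd) (real m)) = UNIV" by (auto simp: real_arch_simple)
      hence Fn: "F n = (\<Union>m. F n \<inter> cball 0 (real m))" for n by blast
      have "norm ` F n = (\<Union>m. norm ` (F n \<inter> cball 0 (real m)))" for n
        using arg_cong[OF Fn[of n], of "image norm"] by (simp only: image_UN)
      thus ?thesis unfolding B_def F(2) image_UN by (simp only:)
    qed
    moreover have "B \<subseteq> A'" unfolding BC using C(3) by auto
    moreover have "{y :: real ^ 'd. norm y \<in> A'} \<subseteq> {y. norm y \<in> B} \<union> T" unfolding BC C(3)[symmetric] by auto
    ultimately show ?thesis using C(2) by blast
  qed
  obtain B1 T1 where 1: "B1 \<in> sets borel" "B1 \<subseteq> A" "T1 \<in> null_sets lebesgue" "{y :: real ^ 'd. norm y \<in> A} \<subseteq> {y. norm y \<in> B1} \<union> T1"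
    using inner[OF A] by blast
  have "{y :: real ^ 'd. norm y \<in> - A} = - {y. norm y \<in> A}" by auto
  hence "{y :: real ^ 'd. norm y \<in> - A} \<in> sets lebesgue" using sets.compl_sets[OF A] by (simp add: Compl_eq_Diff_UNIV)
  from inner[OF this] obtain B2 T2 where 2: "B2 \<in> sets borel" "B2 \<subseteq> - A" "T2 \<in> null_sets lebesgue" "{y :: real ^ 'd. norm y \<in> - A} \<subseteq> {y. norm y \<in> B2} \<union> T2"
    by blast
  \<comment> \<open>The positive radii left undecided by the inner approximations of A and of its
    complement; their preimage is null, so D is null.\<close>
  define D where "D = {0<..} - B1 - B2"
  have D [measurable]: "D \<in> sets borel" "D \<subseteq> {0<..}" using 1 2 by (auto simp: D_def)
  have sub: "{y :: real ^ 'd. norm y \<in> D} \<subseteq> T1 \<union> T2" using 1(4) 2(4) by (auto simp: D_def)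
  have "AE y in (lebesgue :: (real ^ 'd) measure). y \<notin> T1 \<union> T2" using 1(3) 2(3) by (intro AE_not_in null_sets.Un)
  hence "AE y in (lborel :: (real ^ 'd) measure). y \<notin> T1 \<union> T2" by (simp only: AE_completion_iff)
  hence "AE y in (lborel :: (real ^ 'd) measure). norm y \<notin> D" by eventually_elim (use sub in auto)
  hence "D \<in> null_sets lborel" by (rule null_sets_of_AE_norm_notin[OF d D])
  moreover have "A \<inter> {0<..} = (B1 \<inter> {0<..}) \<union> (A \<inter> D)" using 1(2) 2(2) by (auto simp: D_def)
  ultimately show ?thesis using 1(1) by (intro sets_completionI[of _ "B1 \<inter> {0<..}" "A \<inter> D" D]) auto
qed

lemma completion_ex_borel_measurable_complex:
  fixes g :: "'a \<Rightarrow> complex"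
  assumes g: "g \<in> borel_measurable (completion M)"
  shows "\<exists>g'\<in>borel_measurable M. (AE x in M. g x = g' x)"
proof -
  have "(\<lambda>x. Re (g x)) \<in> borel_measurable (completion M)" "(\<lambda>x. Im (g x)) \<in> borel_measurable (completion M)"
    using g by auto
  from this[THEN completion_ex_borel_measurable_real] obtain a b where
    [measurable]: "a \<in> borel_measurable M" "b \<in> borel_measurable M" and ae: "AE x in M. Re (g x) = a x" "AE x in M. Im (g x) = b x" by blast
  show ?thesis
  proof (rule bexI)
    show "(\<lambda>x. Complex (a x) (b x)) \<in> borel_measurable M" unfolding Complex_eq by measurable
    show "AE x in M. g x = Complex (a x) (b x)"
      using ae by eventually_elim (simp add: complex_eq_iff)
  qed
qed

abbreviation lift :: "real ^ 'd \<Rightarrow> real \<times> (real ^ 'd)" where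
  "lift y \<equiv> ((norm y)\<^sup>2, y)"

lemma lift_paraboloid: "lift y \<in> paraboloid"
  by (simp add: paraboloid_def)

lemma lift_measurable: "lift \<in> lborel \<rightarrow>\<^sub>M restrict_space borel paraboloid"
  by (rule measurable_restrict_space2) (auto simp: paraboloid_def)

text \<open>Null sets of the image measure pull back to null sets, so \<open>lift\<close> remains
  measurable when both measures are completed.\<close>

lemma lift_measurable_lebesgue:
  assumes f: "f \<in> borel_measurable (paraboloid_measure :: (real \<times> (real ^ 'd)) measure)"
  shows "(\<lambda>y. f (lift y)) \<in> borel_measurable lebesgue"
proof -
  let ?N = "distr lborel (restrict_space borel paraboloid) lift :: (real \<times> (real ^ 'd)) measure"
  have l: "lift \<in> lebesgue \<rightarrow>\<^sub>M ?N" using measurable_completion[OF lift_measurable] by simp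
  have "lift \<in> lebesgue \<rightarrow>\<^sub>M completion ?N"
  proof (rule completion.measurable_completion2[OF l], rule subsetI)
    fix A assume A: "A \<in> null_sets ?N"
    hence As: "A \<in> sets (restrict_space borel paraboloid)" by auto
    have 0: "emeasure lborel (lift -` A) = 0" using A emeasure_distr[OF lift_measurable As] by (auto simp: null_sets_def)
    have s: "lift -` A \<in> sets lborel" using measurable_sets[OF lift_measurable As] by simp
    have "emeasure (distr lebesgue ?N lift) A = emeasure lebesgue (lift -` A)"
      using l As by (subst emeasure_distr) auto
    also have "\<dots> = 0" using 0 s by (subst emeasure_completion) auto
    finally show "A \<in> null_sets (distr lebesgue ?N lift)" using As by (auto simp: null_sets_def)
  qed
  thus ?thesis using f unfolding paraboloid_measure_def by (rule measurable_compose)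
qed

text \<open>For d \<ge> 2 a rotation of determinant 1 takes a fixed axis to any direction, so f is
  determined by its values \<open>F1\<close> on one ray. The ray is a null set and measurability
  there is not inherited by restriction; it comes from \<open>sets_lebesgue_of_norm_vimage\<close>.
  A change on a null set then makes the profile Borel.\<close>

lemma radial_profile_exists:
  fixes f :: "real \<times> (real ^ 'd) \<Rightarrow> complex"
  assumes d: "2 \<le> CARD('d)" and fm: "f \<in> borel_measurable paraboloid_measure" and sym: "cylindrically_symmetric f"
  shows "\<exists>F \<in> borel_measurable borel. AE y in lborel. f (lift y) = F (norm y)"
proof -
  obtain k :: 'd where True by simp
  define e :: "real ^ 'd" where "e = axis k 1"
  have e: "norm e = 1" by (simp add: e_def norm_axis_1)
  define F1 where "F1 r = f (r\<^sup>2, r *\<^sub>R e)" for r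
  have fF: "f (lift y) = F1 (norm y)" for y
  proof -
    have "norm (norm y *\<^sub>R e) = norm y" using e by simp
    from rotation_exists[OF d this]
    obtain g where g: "orthogonal_transformation g" "det (matrix g) = 1" "g (norm y *\<^sub>R e) = y" .
    have "rotation_matrix (matrix g)" using g by (simp add: rotation_matrix_def orthogonal_transformation_matrix)
    moreover have "matrix g *v (norm y *\<^sub>R e) = y" using g by (simp add: matrix_works orthogonal_transformation_linear)
    moreover have "((norm y)\<^sup>2, norm y *\<^sub>R e) \<in> paraboloid" using e by (simp add: paraboloid_def)
    ultimately show ?thesis using sym unfolding cylindrically_symmetric_def F1_def by metis
  qed
  define F2 where "F2 r = (if r > 0 then F1 r else 0)" for r
  have "F2 \<in> borel_measurable lebesgue"
    unfolding borel_measurable_lebesgue_preimage_borel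
  proof (intro allI impI)
    fix S :: "complex set" assume S: "S \<in> sets borel"
    have "{y :: real ^ 'd. norm y \<in> F1 -` S} = {y. f (lift y) \<in> S}" by (simp add: fF)
    also have "\<dots> \<in> sets lebesgue" using lebesgue_measurable_vimage_borel[OF lift_measurable_lebesgue[OF fm] S] .
    finally have "F1 -` S \<inter> {0<..} \<in> sets lebesgue" by (rule sets_lebesgue_of_norm_vimage[OF d])
    moreover have "{r. F2 r \<in> S} = (F1 -` S \<inter> {0<..}) \<union> (if 0 \<in> S then {..0} else {})"
      by (auto simp: F2_def split: if_splits)
    ultimately show "{r. F2 r \<in> S} \<in> sets lebesgue" by auto
  qed
  then obtain F where F: "F \<in> borel_measurable borel" "AE r in lborel. F2 r = F r"
    using completion_ex_borel_measurable_complex[of F2 lborel] by auto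
  then obtain N where N: "N \<in> null_sets lborel" "{r. F2 r \<noteq> F r} \<subseteq> N"
    by (auto simp: eventually_ae_filter)
  have "AE y in lborel. f (lift y) = F (norm y)"
    using AE_norm_notin_null[OF d N(1)] AE_lborel_singleton[of "0 :: real ^ 'd"]
  proof eventually_elim
    case (elim y)
    hence "F2 (norm y) = F (norm y)" using N(2) by blast
    thus ?case using elim by (simp add: fF F2_def)
  qed
  thus ?thesis using F(1) by blast
qed

lemma nn_integral_paraboloid:
  fixes f :: "real \<times> (real ^ 'd) \<Rightarrow> complex" and g :: "complex \<Rightarrow> ennreal"
  assumes d: "2 \<le> CARD('d)" and fm: "f \<in> borel_measurable paraboloid_measure" and [measurable]: "F \<in> borel_measurable borel"
    and ae: "AE y in lborel. f (lift y) = F (norm y)" and [measurable]: "g \<in> borel_measurable borel"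
  shows "(\<integral>\<^sup>+ z. g (f z) \<partial>paraboloid_measure) = (\<integral>\<^sup>+ r. indicator {0<..} r * ennreal (r ^ (CARD('d) - 1) * sphere_area CARD('d)) * g (F r) \<partial>lborel)"
proof -
  let ?N = "distr lborel (restrict_space borel paraboloid) lift :: (real \<times> (real ^ 'd)) measure"
  have "f \<in> borel_measurable (completion ?N)" using fm by (simp only: paraboloid_measure_def)
  hence "\<exists>f'\<in>borel_measurable ?N. AE z in ?N. f z = f' z" by (rule completion_ex_borel_measurable_complex)
  then obtain f' where f': "f' \<in> borel_measurable ?N" "AE z in ?N. f z = f' z" ..
  have "(\<integral>\<^sup>+ z. g (f z) \<partial>paraboloid_measure) = (\<integral>\<^sup>+ z. g (f z) \<partial>?N)"
    unfolding paraboloid_measure_def by (rule nn_integral_completion)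
  also have "\<dots> = (\<integral>\<^sup>+ z. g (f' z) \<partial>?N)"
    by (intro nn_integral_cong_AE) (use f'(2) in eventually_elim, simp)
  also have "\<dots> = (\<integral>\<^sup>+ y. g (f' (lift y)) \<partial>lborel)"
    using measurable_compose[OF f'(1) assms(5)] by (rule nn_integral_distr[OF lift_measurable])
  also have "\<dots> = (\<integral>\<^sup>+ y. g (F (norm y)) \<partial>(lborel :: (real ^ 'd) measure))"
    by (intro nn_integral_cong_AE) (use AE_distrD[OF lift_measurable f'(2)] ae in eventually_elim, simp)
  also have "\<dots> = (\<integral>\<^sup>+ r. indicator {0<..} r * ennreal (r ^ (CARD('d) - 1) * sphere_area CARD('d)) * g (F r) \<partial>lborel)"
    using measurable_compose[OF assms(3) assms(5)] by (rule nn_integral_radial[OF d])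
  finally show ?thesis .
qed

section \<open>Dyadic summation\<close>

text \<open>A two-sided geometric series, enumerated by \<open>int_decode\<close> with
  \<open>\<bar>int_decode n\<bar> \<ge> (n - 1) / 2\<close>. The bound is uniform in the shift c
  because translations permute the integers.\<close>

lemma int_decode_sum_bound:
  fixes c :: int
  assumes e: "e > 0"
  shows "(\<Sum>n. ennreal (2 powr (- e * \<bar>real_of_int (int_decode n + c)\<bar>))) \<le> ennreal (2 powr (e / 2) * (1 / (1 - 2 powr (- (e / 2)))))"
proof -
  define x where "x = (2::real) powr (- (e / 2))"
  have x: "0 < x" "x < 1" using e powr_less_mono[of "- (e / 2)" 0 2] by (auto simp: x_def)
  define h where "h j = ennreal (2 powr (- e * \<bar>real_of_int j\<bar>))" for j
  have "(\<Sum>n. h (int_decode n + c)) = (\<integral>\<^sup>+ n. h (int_decode n + c) \<partial>count_space UNIV)"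
    by (simp add: nn_integral_count_space_nat)
  also have "\<dots> = (\<integral>\<^sup>+ j. h (j + c) \<partial>count_space UNIV)"
    by (rule nn_integral_bij_count_space[OF bij_int_decode])
  also have "\<dots> = (\<integral>\<^sup>+ j. h j \<partial>count_space UNIV)"
    by (rule nn_integral_bij_count_space) (simp add: bij_betw_def inj_on_def surj_plus_right)
  also have "\<dots> = (\<integral>\<^sup>+ n. h (int_decode n) \<partial>count_space UNIV)"
    by (rule nn_integral_bij_count_space[OF bij_int_decode, symmetric])
  also have "\<dots> \<le> (\<integral>\<^sup>+ n. ennreal (2 powr (e / 2)) * ennreal (x ^ n) \<partial>count_space UNIV)"
  proof (intro nn_integral_mono)
    fix n :: nat
    have "(real n - 1) / 2 \<le> \<bar>real_of_int (int_decode n)\<bar>"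
      by (cases "even n") (auto simp: int_decode_def sum_decode_def elim!: evenE oddE)
    hence "- e * \<bar>real_of_int (int_decode n)\<bar> \<le> - e * ((real n - 1) / 2)" using e by simp
    hence "2 powr (- e * \<bar>real_of_int (int_decode n)\<bar>) \<le> 2 powr (- e * ((real n - 1) / 2))" by (intro powr_mono) auto
    also have "\<dots> = 2 powr (e / 2) * x ^ n"
      unfolding x_def by (simp add: powr_realpow[symmetric] powr_powr powr_add[symmetric] field_simps)
    finally show "h (int_decode n) \<le> ennreal (2 powr (e / 2)) * ennreal (x ^ n)"
      unfolding h_def by (simp add: ennreal_mult'[symmetric] ennreal_leI)
  qed
  also have "\<dots> = ennreal (2 powr (e / 2)) * (\<integral>\<^sup>+ n. ennreal (x ^ n) \<partial>count_space UNIV)"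
    by (rule nn_integral_cmult) simp
  also have "(\<integral>\<^sup>+ n. ennreal (x ^ n) \<partial>count_space UNIV) = ennreal (1 / (1 - x))"
    by (rule nn_integral_geometric[OF x])
  also have "ennreal (2 powr (e / 2)) * ennreal (1 / (1 - x)) = ennreal (2 powr (e / 2) * (1 / (1 - x)))"
    by (rule ennreal_mult'[symmetric]) simp
  finally show ?thesis by (simp only: h_def x_def)
qed

lemma dyadic_block:
  fixes r :: real
  assumes "r > 0"
  shows "r \<in> {2 powr real_of_int \<lfloor>log 2 r\<rfloor>..2 * 2 powr real_of_int \<lfloor>log 2 r\<rfloor>}"
proof -
  have "2 powr real_of_int \<lfloor>log 2 r\<rfloor> \<le> 2 powr log 2 r" by (intro powr_mono) auto
  moreover have "2 powr log 2 r \<le> 2 powr (real_of_int \<lfloor>log 2 r\<rfloor> + 1)" by (intro powr_mono) auto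
  ultimately show ?thesis using assms by (simp add: powr_add)
qed

text \<open>Covers functions of norm 0, for which the estimates with positive norm bounds are used
  with the bound tending to 0.\<close>

lemma ennreal_eq_0_of_le_powr:
  assumes "\<And>b. b > 0 \<Longrightarrow> X \<le> ennreal (c * b powr s)" "s > 0" "c > 0"
  shows "X = 0"
proof -
  have "X \<le> 0"
  proof (rule ennreal_le_epsilon)
    fix e :: real assume e: "e > 0"
    have "c * ((e / c) powr (1 / s)) powr s = e" using assms(2,3) e by (simp add: powr_powr)
    thus "X \<le> 0 + ennreal e" using assms(1)[of "(e / c) powr (1 / s)"] e assms(3) by simp
  qed
  thus ?thesis by simp
qed

section \<open>Rescaling to [1, 2] and sums over dyadic shells and annuli\<close>

context radial_kernel
begin

lemma T_scale:
  assumes M: "M > 0"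
  shows "T G \<rho> t = T (\<lambda>s. complex_of_real M * G (M * s)) (M * \<rho>) (M\<^sup>2 * t)"
proof -
  have "T G \<rho> t = \<bar>M\<bar> *\<^sub>R (LINT s|lborel. G (0 + M * s) * complex_of_real (\<kappa> (\<rho> * (0 + M * s))) * iexp (t * (0 + M * s)\<^sup>2))"
    unfolding T_def quad_ext_def by (rule lborel_integral_real_affine) (use M in simp)
  also have "\<dots> = (LINT s|lborel. \<bar>M\<bar> *\<^sub>R (G (0 + M * s) * complex_of_real (\<kappa> (\<rho> * (0 + M * s))) * iexp (t * (0 + M * s)\<^sup>2)))"
    by (rule integral_scaleR_right[symmetric])
  also have "\<dots> = T (\<lambda>s. complex_of_real M * G (M * s)) (M * \<rho>) (M\<^sup>2 * t)"
    unfolding T_def quad_ext_def using M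
    by (intro Bochner_Integration.integral_cong) (auto simp: scaleR_conv_of_real power_mult_distrib mult_ac)
  finally show ?thesis .
qed

text \<open>\<open>M ^ 3\<close> is the Jacobian of the map taking (\<rho>, t) to (M \<rho>, M^2
  t).\<close>

lemma annulus_int_scale:
  assumes M: "M > 0" and [measurable]: "G \<in> borel_measurable borel"
  shows "ennreal (M ^ 3) * annulus_int q R (T G) = annulus_int q (M * R) (T (\<lambda>s. complex_of_real M * G (M * s)))"
proof -
  define g where "g s = complex_of_real M * G (M * s)" for s
  have ge: "g = (\<lambda>s. complex_of_real M * G (M * s))" by (rule ext) (rule g_def)
  have gm: "g \<in> borel_measurable borel" unfolding g_def by measurable
  note [measurable] = T_measurable[OF gm]
  define D where "D \<sigma> = (\<integral>\<^sup>+ t. indicator {M * R..2 * (M * R)} \<sigma> * ennreal (norm (T g \<sigma> t) powr q) \<partial>lborel)" for \<sigma>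
  have [measurable]: "D \<in> borel_measurable borel" unfolding D_def by measurable
  have "D (M * \<rho>) = ennreal (M\<^sup>2) * (\<integral>\<^sup>+ t. indicator {R..2 * R} \<rho> * ennreal (norm (T G \<rho> t) powr q) \<partial>lborel)" for \<rho>
  proof -
    have "D (M * \<rho>) = ennreal \<bar>M\<^sup>2\<bar> * (\<integral>\<^sup>+ t. indicator {M * R..2 * (M * R)} (M * \<rho>) * ennreal (norm (T g (M * \<rho>) (0 + M\<^sup>2 * t)) powr q) \<partial>lborel)"
      unfolding D_def by (rule nn_integral_real_affine) (use M in \<open>measurable, auto\<close>)
    also have "indicator {M * R..2 * (M * R)} (M * \<rho>) = (indicator {R..2 * R} \<rho> :: ennreal)"
      using M by (auto simp: indicator_def)
    finally show ?thesis unfolding T_scale[OF M, of G] g_def by simp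
  qed
  hence "annulus_int q (M * R) (T g) = ennreal \<bar>M\<bar> * (\<integral>\<^sup>+ \<rho>. ennreal (M\<^sup>2) * (\<integral>\<^sup>+ t. indicator {R..2 * R} \<rho> * ennreal (norm (T G \<rho> t) powr q) \<partial>lborel) \<partial>lborel)"
    unfolding annulus_int_def D_def[symmetric] using M
    by (subst nn_integral_real_affine[where c = M and t = 0]) auto
  also have "\<dots> = ennreal M * (ennreal (M\<^sup>2) * annulus_int q R (T G))"
  proof -
    have [measurable]: "(\<lambda>(\<rho>, t). T G \<rho> t) \<in> borel_measurable (borel \<Otimes>\<^sub>M borel)" by (rule T_measurable) fact
    show ?thesis unfolding annulus_int_def using M by (subst nn_integral_cmult) auto
  qed
  also have "\<dots> = ennreal (M ^ 3) * annulus_int q R (T G)"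
    using M by (simp add: mult.assoc[symmetric] ennreal_mult'[symmetric] power2_eq_square power3_eq_cube)
  finally show ?thesis unfolding ge by (rule sym)
qed

abbreviation radial_density :: "(real \<Rightarrow> complex) \<Rightarrow> real \<Rightarrow> complex" where
  "radial_density F r \<equiv> complex_of_real (r ^ (d - 1)) * F r"

text \<open>Rescaling from [M, 2 M] to [1, 2]. In the power of M, the term d (1 - 1 / p) q comes
  from the norm of the rescaled density, and -(d + 2) from the Jacobian \<open>M ^ 3\<close>
  together with \<open>(M * R) powr (1 - real d)\<close>; it vanishes exactly on the scaling line.
  The local gain concentrates the estimate near M R = 1.\<close>

lemma T_dyadic_estimate:
  fixes p q :: real
  assumes p: "p \<ge> 1" and q: "q > 2 * (real d + 1) / real d" and pq: "1 / p + 1 / q \<le> 1" "1 / p + (2 * real d + 1) / q < real d"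
  shows "\<exists>C>0. \<exists>\<delta>>0. \<forall>M>0. \<forall>R>0. \<forall>F N. F \<in> borel_measurable borel \<longrightarrow> (\<forall>r. r \<notin> {M..2 * M} \<longrightarrow> F r = 0) \<longrightarrow> N \<ge> 0 \<longrightarrow>
     (\<integral>\<^sup>+ r. ennreal (r ^ (d - 1)) * ennreal (norm (F r) powr p) \<partial>lborel) \<le> ennreal N \<longrightarrow>
     ennreal (R ^ (d - 1)) * annulus_int q R (T (radial_density F))
       \<le> ennreal (C * (M powr (real d * (1 - 1 / p) * q - (real d + 2)) * min (M * R) (1 / (M * R)) powr \<delta>) * N powr (q / p))"
proof -
  obtain C0 \<delta> where C0: "C0 > 0" and \<delta>: "\<delta> > 0" and loc: "\<forall>R>0. \<forall>g A. g \<in> borel_measurable borel \<longrightarrow> (\<forall>r. r \<notin> {1..2} \<longrightarrow> g r = 0) \<longrightarrow> A > 0 \<longrightarrow>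
     (\<integral>\<^sup>+ r. ennreal (norm (g r) powr p) \<partial>lborel) \<le> ennreal (A powr p) \<longrightarrow>
     annulus_int q R (T g) \<le> ennreal (C0 * (R powr (1 - real d) * min R (1 / R) powr \<delta> * A powr q))"
    using T_local_estimate[OF assms] by (elim exE conjE) (rule that)
  have "2 * (real d + 1) / real d > 0" using d by simp
  hence q0: "q > 0" using q by linarith
  define C where "C = C0 * 2 powr (real (d - 1) * (p - 1) * (q / p))"
  have C: "C > 0" using C0 by (simp add: C_def)
  have main: "ennreal (R ^ (d - 1)) * annulus_int q R (T (radial_density F))
       \<le> ennreal (C * (M powr (real d * (1 - 1 / p) * q - (real d + 2)) * min (M * R) (1 / (M * R)) powr \<delta>) * N powr (q / p))"
    if M: "M > 0" and R: "R > 0" and Fm: "F \<in> borel_measurable borel" and supp: "\<forall>r. r \<notin> {M..2 * M} \<longrightarrow> F r = 0" and N: "N > 0"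
     and le: "(\<integral>\<^sup>+ r. ennreal (r ^ (d - 1)) * ennreal (norm (F r) powr p) \<partial>lborel) \<le> ennreal N" for M R F N
  proof -
    note [measurable] = Fm
    define G where "G = radial_density F"
    have [measurable]: "G \<in> borel_measurable borel" unfolding G_def by measurable
    define g where "g s = complex_of_real M * G (M * s)" for s
    have ge: "g = (\<lambda>s. complex_of_real M * G (M * s))" by (rule ext) (rule g_def)
    have gm: "g \<in> borel_measurable borel" unfolding g_def by measurable
    have gs: "\<forall>s. s \<notin> {1..2} \<longrightarrow> g s = 0"
    proof (intro allI impI)
      fix s :: real assume "s \<notin> {1..2}"
      hence "M * s \<notin> {M..2 * M}" using M by auto
      thus "g s = 0" using supp by (simp add: g_def G_def)
    qed
    \<comment> \<open>A bound for the p-th power of the norm of g: the density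
      \<open>r ^ (d - 1)\<close> to the power p exceeds the weight by r^((d - 1) (p - 1)), at most
      its value at 2 M, and the rescaling contributes M^(p - 1).\<close>
    define k where "k = 2 powr (real (d - 1) * (p - 1)) * M powr (real d * (p - 1)) * N"
    have k: "k > 0" using N M by (simp add: k_def)
    define A where "A = k powr (1 / p)"
    have A: "A > 0" "A powr p = k" using k p by (auto simp: A_def powr_powr)
    have "(\<integral>\<^sup>+ s. ennreal (norm (g s) powr p) \<partial>lborel) \<le> ennreal k"
    proof -
      have "ennreal (M powr p) * (\<integral>\<^sup>+ r. ennreal (norm (G r) powr p) \<partial>lborel) = ennreal (M powr p) * (ennreal \<bar>M\<bar> * (\<integral>\<^sup>+ s. ennreal (norm (G (0 + M * s)) powr p) \<partial>lborel))"
        by (subst nn_integral_real_affine[where c = M and t = 0]) (use M in auto)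
      also have "\<dots> = ennreal M * (\<integral>\<^sup>+ s. ennreal (M powr p) * ennreal (norm (G (M * s)) powr p) \<partial>lborel)"
        using M by (subst nn_integral_cmult) (auto simp: mult_ac)
      also have "(\<integral>\<^sup>+ s. ennreal (M powr p) * ennreal (norm (G (M * s)) powr p) \<partial>lborel) = (\<integral>\<^sup>+ s. ennreal (norm (g s) powr p) \<partial>lborel)"
        using M by (intro nn_integral_cong) (auto simp: g_def norm_mult powr_mult ennreal_mult')
      finally have 1: "ennreal M * (\<integral>\<^sup>+ s. ennreal (norm (g s) powr p) \<partial>lborel) = ennreal (M powr p) * (\<integral>\<^sup>+ r. ennreal (norm (G r) powr p) \<partial>lborel)" ..
      have "(\<integral>\<^sup>+ r. ennreal (norm (G r) powr p) \<partial>lborel) \<le> (\<integral>\<^sup>+ r. ennreal ((2 * M) powr (real (d - 1) * (p - 1))) * (ennreal (r ^ (d - 1)) * ennreal (norm (F r) powr p)) \<partial>lborel)"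
      proof (intro nn_integral_mono)
        fix r
        show "ennreal (norm (G r) powr p) \<le> ennreal ((2 * M) powr (real (d - 1) * (p - 1))) * (ennreal (r ^ (d - 1)) * ennreal (norm (F r) powr p))"
        proof (cases "r \<in> {M..2 * M}")
          case True
          hence r: "r > 0" using M by auto
          have rp: "r ^ (d - 1) = r powr real (d - 1)" using r by (simp add: powr_realpow)
          have "norm (G r) = r powr real (d - 1) * norm (F r)"
            using r by (simp add: G_def norm_mult norm_power powr_realpow)
          hence "norm (G r) powr p = (r powr real (d - 1)) powr p * norm (F r) powr p"
            by (simp add: powr_mult)
          also have "(r powr real (d - 1)) powr p = r powr (real (d - 1) * (p - 1)) * r ^ (d - 1)"
            unfolding rp powr_powr powr_add[symmetric] by (rule arg_cong[where f = "\<lambda>e. r powr e"]) (simp add: algebra_simps)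
          also have "r powr (real (d - 1) * (p - 1)) * r ^ (d - 1) * norm (F r) powr p \<le> (2 * M) powr (real (d - 1) * (p - 1)) * r ^ (d - 1) * norm (F r) powr p"
            using True r p by (intro mult_right_mono powr_mono2) auto
          finally show ?thesis using r by (simp add: ennreal_mult'[symmetric] mult.assoc ennreal_leI)
        qed (use supp in \<open>simp add: G_def\<close>)
      qed
      also have "\<dots> = ennreal ((2 * M) powr (real (d - 1) * (p - 1))) * (\<integral>\<^sup>+ r. ennreal (r ^ (d - 1)) * ennreal (norm (F r) powr p) \<partial>lborel)"
        by (rule nn_integral_cmult) measurable
      also have "\<dots> \<le> ennreal ((2 * M) powr (real (d - 1) * (p - 1))) * ennreal N" by (intro mult_left_mono le) auto
      finally have "ennreal M * (\<integral>\<^sup>+ s. ennreal (norm (g s) powr p) \<partial>lborel) \<le> ennreal (M powr p) * (ennreal ((2 * M) powr (real (d - 1) * (p - 1))) * ennreal N)"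
        unfolding 1 by (intro mult_left_mono) auto
      also have "\<dots> = ennreal (M * k)"
      proof -
        have rd: "real d = 1 + real (d - 1)" using d by simp
        have "1 + real d * (p - 1) = p + real (d - 1) * (p - 1)"
          unfolding rd distrib_right by (simp only: mult_1_left)
        hence "M * M powr (real d * (p - 1)) = M powr p * M powr (real (d - 1) * (p - 1))"
          using M powr_add[of M 1 "real d * (p - 1)"] by (simp add: powr_add[symmetric])
        hence "M * k = M powr p * ((2 * M) powr (real (d - 1) * (p - 1)) * N)" using M by (simp add: k_def powr_mult)
        thus ?thesis by (simp add: ennreal_mult')
      qed
      also have "\<dots> = ennreal M * ennreal k" using M by (simp add: ennreal_mult')
      finally have "ennreal (1 / M) * (ennreal M * (\<integral>\<^sup>+ s. ennreal (norm (g s) powr p) \<partial>lborel)) \<le> ennreal (1 / M) * (ennreal M * ennreal k)"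
        by (rule mult_left_mono) auto
      moreover have "ennreal (1 / M) * (ennreal M * X) = X" for X
        using M by (simp add: mult.assoc[symmetric] ennreal_mult'[symmetric])
      ultimately show ?thesis by (simp only:)
    qed
    hence "annulus_int q (M * R) (T g) \<le> ennreal (C0 * ((M * R) powr (1 - real d) * min (M * R) (1 / (M * R)) powr \<delta> * A powr q))"
      using loc[rule_format, of "M * R" g A] gm gs A M R by simp
    hence "ennreal (M ^ 3) * annulus_int q R (T G) \<le> ennreal (C0 * ((M * R) powr (1 - real d) * min (M * R) (1 / (M * R)) powr \<delta> * A powr q))"
      using annulus_int_scale[OF M, of G q R, folded ge] by simp
    hence "ennreal (R ^ (d - 1) / M ^ 3) * (ennreal (M ^ 3) * annulus_int q R (T G)) \<le> ennreal (R ^ (d - 1) / M ^ 3) * ennreal (C0 * ((M * R) powr (1 - real d) * min (M * R) (1 / (M * R)) powr \<delta> * A powr q))"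
      by (intro mult_left_mono) auto
    also have "ennreal (R ^ (d - 1) / M ^ 3) * (ennreal (M ^ 3) * annulus_int q R (T G)) = ennreal (R ^ (d - 1)) * annulus_int q R (T G)"
      using M R by (simp add: mult.assoc[symmetric] ennreal_mult'[symmetric])
    also have "ennreal (R ^ (d - 1) / M ^ 3) * ennreal (C0 * ((M * R) powr (1 - real d) * min (M * R) (1 / (M * R)) powr \<delta> * A powr q))
      = ennreal (R ^ (d - 1) / M ^ 3 * (C0 * ((M * R) powr (1 - real d) * min (M * R) (1 / (M * R)) powr \<delta> * A powr q)))"
      by (rule ennreal_mult'[symmetric]) (use M R in auto)
    also have "R ^ (d - 1) / M ^ 3 * (C0 * ((M * R) powr (1 - real d) * min (M * R) (1 / (M * R)) powr \<delta> * A powr q))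
      = C * (M powr (real d * (1 - 1 / p) * q - (real d + 2)) * min (M * R) (1 / (M * R)) powr \<delta>) * N powr (q / p)"
    proof -
      have e1: "A powr q = 2 powr (real (d - 1) * (p - 1) * (q / p)) * M powr (real d * (1 - 1 / p) * q) * N powr (q / p)"
      proof -
        have "A powr q = k powr (q / p)" by (simp add: A_def powr_powr)
        also have "\<dots> = 2 powr (real (d - 1) * (p - 1) * (q / p)) * M powr (real d * (p - 1) * (q / p)) * N powr (q / p)"
          using M N by (simp add: k_def powr_mult powr_powr)
        also have "real d * (p - 1) * (q / p) = real d * (1 - 1 / p) * q" using p by (simp add: field_simps)
        finally show ?thesis .
      qed
      have e2: "R ^ (d - 1) / M ^ 3 * (M * R) powr (1 - real d) = M powr (- (real d + 2))"
      proof -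
        have "R ^ (d - 1) = R powr (real d - 1)" using R d by (simp add: powr_realpow[symmetric] of_nat_diff)
        moreover have "R powr (1 - real d) * R powr (real d - 1) = 1" using R by (simp add: powr_add[symmetric])
        moreover have "M ^ 3 = M powr 3" using M by simp
        moreover have "M powr (1 - real d) / M powr 3 = M powr (- (real d + 2))"
          unfolding powr_diff[symmetric] by (rule arg_cong[where f = "\<lambda>e. M powr e"]) simp
        ultimately show ?thesis using M R by (simp add: powr_mult divide_inverse mult_ac)
      qed
      have e3: "M powr (- (real d + 2)) * M powr (real d * (1 - 1 / p) * q) = M powr (real d * (1 - 1 / p) * q - (real d + 2))"
        unfolding powr_add[symmetric] by (rule arg_cong[where f = "\<lambda>e. M powr e"]) simp
      have "R ^ (d - 1) / M ^ 3 * (C0 * ((M * R) powr (1 - real d) * min (M * R) (1 / (M * R)) powr \<delta> * A powr q))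
        = C0 * (R ^ (d - 1) / M ^ 3 * (M * R) powr (1 - real d)) * min (M * R) (1 / (M * R)) powr \<delta> * A powr q" by simp
      also have "\<dots> = C0 * 2 powr (real (d - 1) * (p - 1) * (q / p)) * ((M powr (- (real d + 2)) * M powr (real d * (1 - 1 / p) * q)) * min (M * R) (1 / (M * R)) powr \<delta>) * N powr (q / p)"
        unfolding e1 e2 by (simp only: mult_ac)
      finally show ?thesis unfolding e3 C_def .
    qed
    finally show ?thesis by (simp add: G_def)
  qed
  show ?thesis
  proof (rule exI[of _ C], rule conjI[OF C], rule exI[of _ \<delta>], rule conjI[OF \<delta>], intro allI impI)
    fix M R N :: real and F :: "real \<Rightarrow> complex"
    assume M: "M > 0" and R: "R > 0" and Fm: "F \<in> borel_measurable borel" and supp: "\<forall>r. r \<notin> {M..2 * M} \<longrightarrow> F r = 0" and N: "N \<ge> 0"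
     and le: "(\<integral>\<^sup>+ r. ennreal (r ^ (d - 1)) * ennreal (norm (F r) powr p) \<partial>lborel) \<le> ennreal N"
    let ?c = "C * (M powr (real d * (1 - 1 / p) * q - (real d + 2)) * min (M * R) (1 / (M * R)) powr \<delta>)"
    have "min (M * R) (1 / (M * R)) > 0" using M R by simp
    hence "min (M * R) (1 / (M * R)) powr \<delta> > 0"
      unfolding powr_gt_zero by (rule less_imp_neq[THEN not_sym])
    moreover have "M powr (real d * (1 - 1 / p) * q - (real d + 2)) > 0" using M by simp
    ultimately have c: "?c > 0" by (intro mult_pos_pos C)
    show "ennreal (R ^ (d - 1)) * annulus_int q R (T (radial_density F)) \<le> ennreal (?c * N powr (q / p))"
    proof (cases "N = 0")
      case True
      have z: "ennreal (R ^ (d - 1)) * annulus_int q R (T (radial_density F)) = 0"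
      proof (rule ennreal_eq_0_of_le_powr[where c = ?c and s = "q / p"])
        fix b :: real assume b: "b > 0"
        show "ennreal (R ^ (d - 1)) * annulus_int q R (T (radial_density F)) \<le> ennreal (?c * b powr (q / p))"
          by (rule main[OF M R Fm supp b]) (use le True in simp)
      qed (use c q0 p in auto)
      show ?thesis by (simp only: z zero_le)
    qed (use main[OF M R Fm supp _ le] N in auto)
  qed
qed

text \<open>The q-th power of the L^q norm in polar coordinates, without the factor
  \<open>sphere_area\<close>.\<close>

definition full_int :: "real \<Rightarrow> (real \<Rightarrow> real \<Rightarrow> complex) \<Rightarrow> ennreal" where
  "full_int q S = (\<integral>\<^sup>+ \<rho>. \<integral>\<^sup>+ t. indicator {0<..} \<rho> * ennreal (\<rho> ^ (d - 1)) * ennreal (norm (S \<rho> t) powr q) \<partial>lborel \<partial>lborel)"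

lemma full_int_le_dyadic:
  assumes [measurable]: "(\<lambda>(\<rho>, t). S \<rho> t) \<in> borel_measurable (borel \<Otimes>\<^sub>M borel)"
  shows "full_int q S \<le> ennreal (2 ^ (d - 1)) * (\<Sum>n. ennreal ((2 powr int_decode n) ^ (d - 1)) * annulus_int q (2 powr int_decode n) S)"
proof -
  define R where "R n = 2 powr real_of_int (int_decode n)" for n
  have "full_int q S \<le> (\<integral>\<^sup>+ \<rho>. \<integral>\<^sup>+ t. (\<Sum>n. ennreal ((2 * R n) ^ (d - 1)) * (indicator {R n..2 * R n} \<rho> * ennreal (norm (S \<rho> t) powr q))) \<partial>lborel \<partial>lborel)"
    unfolding full_int_def
  proof (intro nn_integral_mono)
    fix \<rho> t
    let ?f = "\<lambda>n. ennreal ((2 * R n) ^ (d - 1)) * (indicator {R n..2 * R n} \<rho> * ennreal (norm (S \<rho> t) powr q))"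
    show "indicator {0<..} \<rho> * ennreal (\<rho> ^ (d - 1)) * ennreal (norm (S \<rho> t) powr q) \<le> (\<Sum>n. ?f n)"
    proof (cases "\<rho> > 0")
      case True
      define n where "n = int_encode \<lfloor>log 2 \<rho>\<rfloor>"
      have \<rho>: "\<rho> \<in> {R n..2 * R n}" using dyadic_block[OF True] by (simp add: R_def n_def)
      hence "\<rho> ^ (d - 1) \<le> (2 * R n) ^ (d - 1)" using True by (intro power_mono) auto
      hence "indicator {0<..} \<rho> * ennreal (\<rho> ^ (d - 1)) * ennreal (norm (S \<rho> t) powr q) \<le> ?f n"
        using True \<rho> by (auto intro!: mult_right_mono ennreal_leI)
      also have "\<dots> = (\<Sum>i\<in>{n}. ?f i)" by simp
      also have "\<dots> \<le> (\<Sum>n. ?f n)" by (rule sum_le_suminf) auto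
      finally show ?thesis .
    qed simp
  qed
  also have "\<dots> = (\<Sum>n. ennreal ((2 * R n) ^ (d - 1)) * annulus_int q (R n) S)"
  proof -
    have "(\<integral>\<^sup>+ \<rho>. \<integral>\<^sup>+ t. (\<Sum>n. ennreal ((2 * R n) ^ (d - 1)) * (indicator {R n..2 * R n} \<rho> * ennreal (norm (S \<rho> t) powr q))) \<partial>lborel \<partial>lborel)
      = (\<integral>\<^sup>+ \<rho>. (\<Sum>n. ennreal ((2 * R n) ^ (d - 1)) * (\<integral>\<^sup>+ t. indicator {R n..2 * R n} \<rho> * ennreal (norm (S \<rho> t) powr q) \<partial>lborel)) \<partial>lborel)"
      by (intro nn_integral_cong) (simp add: nn_integral_suminf nn_integral_cmult)
    thus ?thesis unfolding annulus_int_def by (simp add: nn_integral_suminf nn_integral_cmult)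
  qed
  also have "\<dots> = ennreal (2 ^ (d - 1)) * (\<Sum>n. ennreal (R n ^ (d - 1)) * annulus_int q (R n) S)"
    by (subst ennreal_suminf_cmult[symmetric]) (simp add: power_mult_distrib ennreal_mult' mult.assoc)
  finally show ?thesis by (simp add: R_def)
qed

lemma min_dyadic_powr:
  fixes i j :: int
  shows "min (2 powr real_of_int i * 2 powr real_of_int j) (1 / (2 powr real_of_int i * 2 powr real_of_int j)) powr e = 2 powr (- e * \<bar>real_of_int (j + i)\<bar>)"
proof -
  have "2 powr real_of_int i * 2 powr real_of_int j = 2 powr real_of_int (j + i)" by (simp add: powr_add[symmetric] add.commute)
  moreover have "1 / 2 powr x = 2 powr (- x)" for x :: real by (rule powr_minus_divide[symmetric])
  moreover have "min (2 powr x) (2 powr (- x)) = 2 powr (- \<bar>x\<bar>)" for x :: real by (auto simp: min_def abs_if)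
  ultimately show ?thesis by (simp only: powr_powr) (simp add: mult.commute)
qed

text \<open>With M fixed, the gain turns the sum over dyadic R into a geometric series centred at R
  = 1 / M.\<close>

lemma T_single_annulus_estimate:
  fixes p q :: real and k :: int
  assumes p: "p \<ge> 1" and q: "q > 2 * (real d + 1) / real d" and pq: "1 / p + 1 / q \<le> 1" "1 / p + (2 * real d + 1) / q < real d"
  shows "\<exists>C>0. \<forall>F N. F \<in> borel_measurable borel \<longrightarrow> (\<forall>r. r \<notin> {2 powr k..2 * 2 powr k} \<longrightarrow> F r = 0) \<longrightarrow> N \<ge> 0 \<longrightarrow>
     (\<integral>\<^sup>+ r. ennreal (r ^ (d - 1)) * ennreal (norm (F r) powr p) \<partial>lborel) \<le> ennreal N \<longrightarrow>
     full_int q (T (radial_density F)) \<le> ennreal (C * N powr (q / p))"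
proof -
  obtain C0 \<delta> where C0: "C0 > 0" and \<delta>: "\<delta> > 0" and dy: "\<forall>M>0. \<forall>R>0. \<forall>F N. F \<in> borel_measurable borel \<longrightarrow> (\<forall>r. r \<notin> {M..2 * M} \<longrightarrow> F r = 0) \<longrightarrow> N \<ge> 0 \<longrightarrow>
     (\<integral>\<^sup>+ r. ennreal (r ^ (d - 1)) * ennreal (norm (F r) powr p) \<partial>lborel) \<le> ennreal N \<longrightarrow>
     ennreal (R ^ (d - 1)) * annulus_int q R (T (radial_density F))
       \<le> ennreal (C0 * (M powr (real d * (1 - 1 / p) * q - (real d + 2)) * min (M * R) (1 / (M * R)) powr \<delta>) * N powr (q / p))"
    using T_dyadic_estimate[OF assms] by (elim exE conjE) (rule that)
  define c where "c = C0 * (2 powr k) powr (real d * (1 - 1 / p) * q - (real d + 2))"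
  define W where "W = 2 powr (\<delta> / 2) * (1 / (1 - 2 powr (- (\<delta> / 2))))"
  have "2 powr (- (\<delta> / 2)) < 2 powr (0::real)" using \<delta> by (intro powr_less_mono) auto
  hence W: "W > 0" by (simp add: W_def)
  have c: "c > 0" using C0 by (simp add: c_def)
  show ?thesis
  proof (intro exI[of _ "2 ^ (d - 1) * (c * W)"] conjI allI impI)
    show "0 < 2 ^ (d - 1) * (c * W)" using c W by simp
    fix F :: "real \<Rightarrow> complex" and N :: real
    assume Fm [measurable]: "F \<in> borel_measurable borel" and supp: "\<forall>r. r \<notin> {2 powr k..2 * 2 powr k} \<longrightarrow> F r = 0" and N: "N \<ge> 0"
      and le: "(\<integral>\<^sup>+ r. ennreal (r ^ (d - 1)) * ennreal (norm (F r) powr p) \<partial>lborel) \<le> ennreal N"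
    have "full_int q (T (radial_density F)) \<le> ennreal (2 ^ (d - 1)) * (\<Sum>n. ennreal ((2 powr int_decode n) ^ (d - 1)) * annulus_int q (2 powr int_decode n) (T (radial_density F)))"
      by (rule full_int_le_dyadic[OF T_measurable]) measurable
    also have "\<dots> \<le> ennreal (2 ^ (d - 1)) * (\<Sum>n. ennreal (c * N powr (q / p)) * ennreal (2 powr (- \<delta> * \<bar>real_of_int (int_decode n + k)\<bar>)))"
    proof (intro mult_left_mono suminf_le)
      fix n
      have "ennreal ((2 powr int_decode n) ^ (d - 1)) * annulus_int q (2 powr int_decode n) (T (radial_density F))
        \<le> ennreal (C0 * ((2 powr k) powr (real d * (1 - 1 / p) * q - (real d + 2)) * min (2 powr k * 2 powr int_decode n) (1 / (2 powr k * 2 powr int_decode n)) powr \<delta>) * N powr (q / p))"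
        using dy[rule_format, of "2 powr k" "2 powr int_decode n" F N] supp N le Fm by simp
      also have "\<dots> = ennreal (c * N powr (q / p) * 2 powr (- \<delta> * \<bar>real_of_int (int_decode n + k)\<bar>))"
        unfolding min_dyadic_powr c_def by (simp add: mult_ac)
      finally show "ennreal ((2 powr int_decode n) ^ (d - 1)) * annulus_int q (2 powr int_decode n) (T (radial_density F))
        \<le> ennreal (c * N powr (q / p)) * ennreal (2 powr (- \<delta> * \<bar>real_of_int (int_decode n + k)\<bar>))"
        using c by (simp add: ennreal_mult')
    qed auto
    also have "(\<Sum>n. ennreal (c * N powr (q / p)) * ennreal (2 powr (- \<delta> * \<bar>real_of_int (int_decode n + k)\<bar>))) = ennreal (c * N powr (q / p)) * (\<Sum>n. ennreal (2 powr (- \<delta> * \<bar>real_of_int (int_decode n + k)\<bar>)))"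
      by (rule ennreal_suminf_cmult)
    also have "ennreal (2 ^ (d - 1)) * (ennreal (c * N powr (q / p)) * (\<Sum>n. ennreal (2 powr (- \<delta> * \<bar>real_of_int (int_decode n + k)\<bar>)))) \<le> ennreal (2 ^ (d - 1)) * (ennreal (c * N powr (q / p)) * ennreal W)"
      unfolding W_def by (intro mult_left_mono int_decode_sum_bound \<delta>) auto
    also have "\<dots> = ennreal (2 ^ (d - 1) * (c * W) * N powr (q / p))"
      using c W by (simp add: ennreal_mult'[symmetric] mult_ac)
    finally show "full_int q (T (radial_density F)) \<le> ennreal (2 ^ (d - 1) * (c * W) * N powr (q / p))" .
  qed
qed


text \<open>On the scaling line the shell estimates no longer depend on M except through the gain
  2^(-\<delta> |i + j|), for the shell of radius 2^i and the annulus of radius 2^j. Half of the gain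
  takes the sum over shells out of the L^q norm, the other half sums over annuli first; what remains
  is the sum of the norms to the power q / p, controlled because p \<le> q. The radius b makes the
  density integrable, and C does not depend on it.\<close>

lemma T_global_estimate:
  fixes p q :: real
  assumes p: "p \<ge> 1" and q: "q > 2 * (real d + 1) / real d" and pq: "1 / p + 1 / q \<le> 1" "1 / p + (2 * real d + 1) / q < real d"
    and scaling: "real d * (1 - 1 / p) * q = real d + 2" and ple: "p \<le> q"
  shows "\<exists>C>0. \<forall>F N b. F \<in> borel_measurable borel \<longrightarrow> (\<forall>r. r \<notin> {0<..b} \<longrightarrow> F r = 0) \<longrightarrow> N \<ge> 0 \<longrightarrow>
     (\<integral>\<^sup>+ r. ennreal (r ^ (d - 1)) * ennreal (norm (F r) powr p) \<partial>lborel) \<le> ennreal N \<longrightarrow>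
     full_int q (T (radial_density F)) \<le> ennreal (C * N powr (q / p))"
proof -
  have "2 * (real d + 1) / real d > 0" using d by simp
  hence q0: "q > 0" using q by linarith
  obtain C0 \<delta> where C0: "C0 > 0" and \<delta>: "\<delta> > 0" and dy: "\<forall>M>0. \<forall>R>0. \<forall>F N. F \<in> borel_measurable borel \<longrightarrow> (\<forall>r. r \<notin> {M..2 * M} \<longrightarrow> F r = 0) \<longrightarrow> N \<ge> 0 \<longrightarrow>
     (\<integral>\<^sup>+ r. ennreal (r ^ (d - 1)) * ennreal (norm (F r) powr p) \<partial>lborel) \<le> ennreal N \<longrightarrow>
     ennreal (R ^ (d - 1)) * annulus_int q R (T (radial_density F))
       \<le> ennreal (C0 * (M powr (real d * (1 - 1 / p) * q - (real d + 2)) * min (M * R) (1 / (M * R)) powr \<delta>) * N powr (q / p))"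
    using T_dyadic_estimate[OF p q pq] by (elim exE conjE) (rule that)
  \<comment> \<open>With this e the weights to the power q cost half of the exponent
    \<delta>.\<close>
  define e where "e = \<delta> / (2 * q)"
  have e: "e > 0" using \<delta> q0 by (simp add: e_def)
  have pos: "2 powr (x / 2) * (1 / (1 - 2 powr (- (x / 2)))) > 0" if "x > 0" for x :: real
    using that powr_less_mono[of "- (x / 2)" 0 2] by simp
  define W1 where "W1 = 2 powr (e / 2) * (1 / (1 - 2 powr (- (e / 2))))"
  define W2 where "W2 = 2 powr (\<delta> / 2 / 2) * (1 / (1 - 2 powr (- (\<delta> / 2 / 2))))"
  have W: "W1 > 0" "W2 > 0" using pos[OF e] pos[of "\<delta> / 2"] \<delta> by (auto simp: W1_def W2_def)
  define C where "C = 2 ^ (d - 1) * (W1 powr q * (C0 * W2))"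
  have C: "C > 0" using C0 W by (simp add: C_def)
  show ?thesis
  proof (rule exI[of _ C], rule conjI[OF C], intro allI impI)
    fix F :: "real \<Rightarrow> complex" and N b :: real
    assume Fm [measurable]: "F \<in> borel_measurable borel" and supp: "\<forall>r. r \<notin> {0<..b} \<longrightarrow> F r = 0" and N: "N \<ge> 0"
      and le: "(\<integral>\<^sup>+ r. ennreal (r ^ (d - 1)) * ennreal (norm (F r) powr p) \<partial>lborel) \<le> ennreal N"
    define cl where "cl r = int_encode \<lfloor>log 2 r\<rfloor>" for r :: real
    define Fi where "Fi i r = (if r > 0 \<and> cl r = i then F r else 0)" for i r
    have [measurable]: "cl \<in> borel \<rightarrow>\<^sub>M count_space UNIV" unfolding cl_def by measurable
    have Fim [measurable]: "Fi i \<in> borel_measurable borel" for i unfolding Fi_def by measurable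
    have Fis: "\<forall>r. r \<notin> {2 powr int_decode i..2 * 2 powr int_decode i} \<longrightarrow> Fi i r = 0" for i
    proof (intro allI impI)
      fix r :: real assume r: "r \<notin> {2 powr int_decode i..2 * 2 powr int_decode i}"
      show "Fi i r = 0"
      proof (rule ccontr)
        assume "Fi i r \<noteq> 0"
        hence "r > 0" "cl r = i" by (auto simp: Fi_def split: if_splits)
        thus False using dyadic_block[of r] r by (auto simp: cl_def)
      qed
    qed
    define X where "X i = (\<integral>\<^sup>+ r. ennreal (r ^ (d - 1)) * ennreal (norm (Fi i r) powr p) \<partial>lborel)" for i
    have sumX: "(\<Sum>i. X i) \<le> ennreal N"
    proof -
      have "(\<Sum>i. X i) = (\<integral>\<^sup>+ r. (\<Sum>i. ennreal (r ^ (d - 1)) * ennreal (norm (Fi i r) powr p)) \<partial>lborel)"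
        unfolding X_def by (rule nn_integral_suminf[symmetric]) measurable
      also have "\<dots> \<le> (\<integral>\<^sup>+ r. ennreal (r ^ (d - 1)) * ennreal (norm (F r) powr p) \<partial>lborel)"
      proof (intro nn_integral_mono)
        fix r :: real
        have "(\<lambda>i. if i = cl r then ennreal (r ^ (d - 1)) * ennreal (norm (Fi i r) powr p) else 0) sums (ennreal (r ^ (d - 1)) * ennreal (norm (Fi (cl r) r) powr p))"
          by (rule sums_single)
        moreover have "(\<lambda>i. if i = cl r then ennreal (r ^ (d - 1)) * ennreal (norm (Fi i r) powr p) else 0) = (\<lambda>i. ennreal (r ^ (d - 1)) * ennreal (norm (Fi i r) powr p))"
          using p by (auto simp: Fi_def fun_eq_iff)
        ultimately have "(\<Sum>i. ennreal (r ^ (d - 1)) * ennreal (norm (Fi i r) powr p)) = ennreal (r ^ (d - 1)) * ennreal (norm (Fi (cl r) r) powr p)"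
          by (simp add: sums_iff)
        thus "(\<Sum>i. ennreal (r ^ (d - 1)) * ennreal (norm (Fi i r) powr p)) \<le> ennreal (r ^ (d - 1)) * ennreal (norm (F r) powr p)"
          by (simp add: Fi_def)
      qed
      finally show ?thesis using le by (rule order_trans)
    qed
    have XN: "X i \<le> ennreal N" for i
    proof -
      have "X i = (\<Sum>j\<in>{i}. X j)" by simp
      also have "\<dots> \<le> (\<Sum>j. X j)" by (rule sum_le_suminf) auto
      finally show ?thesis using sumX by (rule order_trans)
    qed
    define Ni where "Ni i = enn2real (X i)" for i
    have Ni: "ennreal (Ni i) = X i" "Ni i \<ge> 0" for i
      using le_less_trans[OF XN ennreal_less_top] by (auto simp: Ni_def ennreal_enn2real)
    have NiN: "Ni i \<le> N" for i using XN[of i] N unfolding Ni(1)[symmetric] by (simp add: ennreal_le_iff)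
    \<comment> \<open>The inclusion of l^1 in l^(q/p): one power of each \<open>Ni i\<close> is
      summed, the remaining q / p - 1 powers are bounded by N.\<close>
    have sumN: "(\<Sum>i. ennreal (Ni i powr (q / p))) \<le> ennreal (N powr (q / p))"
    proof (cases "N = 0")
      case True
      hence "Ni i = 0" for i using NiN[of i] Ni(2)[of i] by simp
      thus ?thesis by simp
    next
      case False
      have qp: "q / p \<ge> 1" using ple p by simp
      have "(\<Sum>i. ennreal (Ni i powr (q / p))) \<le> (\<Sum>i. ennreal (N powr (q / p - 1)) * X i)"
      proof (intro suminf_le)
        fix i
        have "Ni i powr (q / p) \<le> N powr (q / p - 1) * Ni i"
        proof (cases "Ni i = 0")
          case False
          have "Ni i powr (q / p) = Ni i powr (q / p - 1) * Ni i powr 1" by (simp only: powr_add[symmetric]) simp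
          also have "\<dots> = Ni i powr (q / p - 1) * Ni i" using Ni(2)[of i] False by simp
          also have "\<dots> \<le> N powr (q / p - 1) * Ni i" using Ni NiN qp by (intro mult_right_mono powr_mono2) auto
          finally show ?thesis .
        qed simp
        thus "ennreal (Ni i powr (q / p)) \<le> ennreal (N powr (q / p - 1)) * X i"
          by (simp add: Ni(1)[symmetric] ennreal_mult'[symmetric] ennreal_leI)
      qed auto
      also have "\<dots> = ennreal (N powr (q / p - 1)) * (\<Sum>i. X i)" by (rule ennreal_suminf_cmult)
      also have "\<dots> \<le> ennreal (N powr (q / p - 1)) * ennreal N" by (intro mult_left_mono sumX) auto
      also have "\<dots> = ennreal (N powr (q / p - 1) * N)" by (rule ennreal_mult'[symmetric]) simp
      also have "N powr (q / p - 1) * N = N powr (q / p)"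
        using N False powr_add[of N "q / p - 1" 1] by simp
      finally show ?thesis .
    qed
    have Gint: "integrable lborel (radial_density F)"
    proof (rule integrableI_bounded)
      have "(\<integral>\<^sup>+ r. ennreal (norm (radial_density F r)) \<partial>lborel) \<le> (\<integral>\<^sup>+ r. ennreal (b ^ (d - 1)) * indicator {0..b} r + ennreal (r ^ (d - 1)) * ennreal (norm (F r) powr p) \<partial>lborel)"
      proof (intro nn_integral_mono)
        fix r :: real
        show "ennreal (norm (radial_density F r)) \<le> ennreal (b ^ (d - 1)) * indicator {0..b} r + ennreal (r ^ (d - 1)) * ennreal (norm (F r) powr p)"
        proof (cases "r \<in> {0<..b}")
          case True
          have "norm (F r) \<le> 1 + norm (F r) powr p"
          proof (cases "norm (F r) \<le> 1")
            case False
            hence "norm (F r) powr 1 \<le> norm (F r) powr p" using p by (intro powr_mono) auto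
            thus ?thesis using False by simp
          qed (simp add: add_increasing2)
          hence "r ^ (d - 1) * norm (F r) \<le> r ^ (d - 1) * (1 + norm (F r) powr p)" using True by (intro mult_left_mono) auto
          also have "\<dots> = r ^ (d - 1) + r ^ (d - 1) * norm (F r) powr p" by (simp add: distrib_left)
          also have "\<dots> \<le> b ^ (d - 1) + r ^ (d - 1) * norm (F r) powr p" using True by (intro add_right_mono power_mono) auto
          finally show ?thesis using True
            by (simp add: norm_mult norm_power ennreal_mult'[symmetric] ennreal_plus[symmetric] ennreal_leI del: ennreal_plus)
        qed (use supp in simp)
      qed
      also have "\<dots> = ennreal (b ^ (d - 1)) * emeasure lborel {0..b} + (\<integral>\<^sup>+ r. ennreal (r ^ (d - 1)) * ennreal (norm (F r) powr p) \<partial>lborel)"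
        by (subst nn_integral_add) (auto simp: nn_integral_cmult_indicator)
      also have "\<dots> < \<infinity>" using le_less_trans[OF le ennreal_less_top] by (auto simp: ennreal_mult_less_top emeasure_lborel_Icc_eq)
      finally show "(\<integral>\<^sup>+ r. ennreal (norm (radial_density F r)) \<partial>lborel) < \<infinity>" .
    qed measurable
    have key: "ennreal ((2 powr int_decode n) ^ (d - 1)) * annulus_int q (2 powr int_decode n) (T (radial_density F))
       \<le> ennreal (W1 powr q) * (\<Sum>i. ennreal (C0 * Ni i powr (q / p)) * ennreal (2 powr (- (\<delta> / 2) * \<bar>real_of_int (int_decode n + int_decode i)\<bar>)))" for n
    proof -
      define R where "R = 2 powr real_of_int (int_decode n)"
      have R: "R > 0" by (simp add: R_def)
      define w where "w i = 2 powr (e * \<bar>real_of_int (int_decode i + int_decode n)\<bar>)" for i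
      have w: "w i > 0" for i by (simp add: w_def)
      have "(\<integral>\<^sup>+ i. ennreal (1 / w i) \<partial>count_space UNIV) = (\<Sum>i. ennreal (2 powr (- e * \<bar>real_of_int (int_decode i + int_decode n)\<bar>)))"
        unfolding nn_integral_count_space_nat w_def by (simp only: powr_minus_divide[symmetric] mult_minus_left)
      hence wW: "(\<integral>\<^sup>+ i. ennreal (1 / w i) \<partial>count_space UNIV) \<le> ennreal W1"
        using int_decode_sum_bound[OF e, of "int_decode n"] by (simp only: W1_def)
      have rdm: "radial_density (Fi i) \<in> borel_measurable borel" for i by measurable
      have "annulus_int q R (T (radial_density F)) \<le> ennreal (W1 powr q) * (\<Sum>i. ennreal (w i powr q) * annulus_int q R (T (radial_density (Fi i))))"
      proof (rule annulus_int_le_suminf[OF T_measurable[OF rdm] w wW W(1) q0])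
        fix \<rho> t assume \<rho>: "\<rho> \<in> {R..2 * R}"
        have bd: "integrable lborel (\<lambda>r. f r * complex_of_real (\<kappa> (\<rho> * r)))"
          if f [measurable]: "f \<in> borel_measurable borel" and fg: "\<And>r. norm (f r) \<le> norm (radial_density F r)" for f :: "real \<Rightarrow> complex"
        proof (rule Bochner_Integration.integrable_bound)
          show "integrable lborel (\<lambda>r. K * norm (radial_density F r))" using Gint by simp
          show "AE r in lborel. norm (f r * complex_of_real (\<kappa> (\<rho> * r))) \<le> norm (K * norm (radial_density F r))"
          proof (intro AE_I2)
            fix r :: real
            show "norm (f r * complex_of_real (\<kappa> (\<rho> * r))) \<le> norm (K * norm (radial_density F r))"
            proof (cases "r \<in> {0<..b}")
              case True
              hence "\<bar>\<kappa> (\<rho> * r)\<bar> \<le> K" using \<rho> R by (intro \<kappa>_bounded) auto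
              hence "norm (f r) * \<bar>\<kappa> (\<rho> * r)\<bar> \<le> norm (radial_density F r) * K" by (intro mult_mono fg) auto
              moreover have "norm (K * norm (radial_density F r)) = norm (radial_density F r) * K" using K by (simp add: abs_mult)
              ultimately show ?thesis by (simp only: norm_mult norm_of_real)
            next
              case False
              hence "f r = 0" using supp fg[of r] by simp
              thus ?thesis by simp
            qed
          qed
        qed measurable
        have part: "(\<Sum>i<m. radial_density (Fi i) r) = (if r > 0 \<and> cl r < m then radial_density F r else 0)" for m r
        proof -
          have "(\<Sum>i<m. radial_density (Fi i) r) = (\<Sum>i<m. if i = cl r then (if r > 0 then radial_density F r else 0) else 0)"
            by (intro sum.cong) (auto simp: Fi_def)
          thus ?thesis by (simp add: sum.delta)
        qed
        show "ennreal (norm (T (radial_density F) \<rho> t)) \<le> (\<integral>\<^sup>+ i. ennreal (norm (T (radial_density (Fi i)) \<rho> t)) \<partial>count_space UNIV)"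
          unfolding T_def
        proof (rule quad_ext_norm_le_suminf)
          show "integrable lborel (\<lambda>r. radial_density F r * complex_of_real (\<kappa> (\<rho> * r)))" by (rule bd) auto
          show "integrable lborel (\<lambda>r. radial_density (Fi i) r * complex_of_real (\<kappa> (\<rho> * r)))" for i
            by (rule bd) (auto simp: Fi_def)
          fix r :: real
          have "\<forall>\<^sub>F m in sequentially. (\<Sum>i<m. radial_density (Fi i) r) = radial_density F r"
            using eventually_gt_at_top[of "cl r"]
          proof eventually_elim
            case (elim m)
            have "\<not> r > 0 \<Longrightarrow> F r = 0" using supp by auto
            thus ?case unfolding part using elim by auto
          qed
          hence "(\<lambda>m. \<Sum>i<m. radial_density (Fi i) r) \<longlonglongrightarrow> radial_density F r" by (rule tendsto_eventually)
          thus "(\<lambda>m. \<Sum>i<m. radial_density (Fi i) r * complex_of_real (\<kappa> (\<rho> * r))) \<longlonglongrightarrow> radial_density F r * complex_of_real (\<kappa> (\<rho> * r))"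
            unfolding sum_distrib_right[symmetric] by (intro tendsto_mult tendsto_const)
          fix m :: nat
          have "norm (\<Sum>i<m. radial_density (Fi i) r) \<le> norm (radial_density F r)" unfolding part by auto
          thus "norm (\<Sum>i<m. radial_density (Fi i) r * complex_of_real (\<kappa> (\<rho> * r))) \<le> norm (radial_density F r * complex_of_real (\<kappa> (\<rho> * r)))"
            unfolding sum_distrib_right[symmetric] norm_mult[of _ "complex_of_real (\<kappa> (\<rho> * r))"] by (intro mult_right_mono) auto
        qed
      qed
      hence "ennreal (R ^ (d - 1)) * annulus_int q R (T (radial_density F)) \<le> ennreal (R ^ (d - 1)) * (ennreal (W1 powr q) * (\<Sum>i. ennreal (w i powr q) * annulus_int q R (T (radial_density (Fi i)))))"
        by (rule mult_left_mono) simp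
      also have "\<dots> = ennreal (W1 powr q) * (\<Sum>i. ennreal (w i powr q) * (ennreal (R ^ (d - 1)) * annulus_int q R (T (radial_density (Fi i)))))"
      proof -
        have "ennreal (R ^ (d - 1)) * (\<Sum>i. ennreal (w i powr q) * annulus_int q R (T (radial_density (Fi i)))) = (\<Sum>i. ennreal (w i powr q) * (ennreal (R ^ (d - 1)) * annulus_int q R (T (radial_density (Fi i)))))"
          unfolding ennreal_suminf_cmult[symmetric] by (simp only: mult.left_commute)
        thus ?thesis by (simp only: mult.left_commute[of "ennreal (R ^ (d - 1))"])
      qed
      also have "\<dots> \<le> ennreal (W1 powr q) * (\<Sum>i. ennreal (C0 * Ni i powr (q / p)) * ennreal (2 powr (- (\<delta> / 2) * \<bar>real_of_int (int_decode n + int_decode i)\<bar>)))"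
      proof (intro mult_left_mono[of "suminf _"] suminf_le)
        fix i
        let ?s = "\<bar>real_of_int (int_decode n + int_decode i)\<bar>"
        have "ennreal (R ^ (d - 1)) * annulus_int q R (T (radial_density (Fi i)))
          \<le> ennreal (C0 * ((2 powr int_decode i) powr (real d * (1 - 1 / p) * q - (real d + 2)) * min (2 powr int_decode i * R) (1 / (2 powr int_decode i * R)) powr \<delta>) * Ni i powr (q / p))"
          by (rule dy[rule_format, OF _ R Fim _ Ni(2)]) (use Fis Ni(1)[of i] in \<open>auto simp: X_def\<close>)
        also have "C0 * ((2 powr int_decode i) powr (real d * (1 - 1 / p) * q - (real d + 2)) * min (2 powr int_decode i * R) (1 / (2 powr int_decode i * R)) powr \<delta>) * Ni i powr (q / p) = C0 * Ni i powr (q / p) * 2 powr (- \<delta> * ?s)"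
          unfolding R_def min_dyadic_powr scaling by simp
        finally have "ennreal (w i powr q) * (ennreal (R ^ (d - 1)) * annulus_int q R (T (radial_density (Fi i)))) \<le> ennreal (w i powr q) * ennreal (C0 * Ni i powr (q / p) * 2 powr (- \<delta> * ?s))"
          by (rule mult_left_mono) simp
        also have "\<dots> = ennreal (w i powr q * (C0 * Ni i powr (q / p) * 2 powr (- \<delta> * ?s)))" by (rule ennreal_mult'[symmetric]) simp
        also have "w i powr q * (C0 * Ni i powr (q / p) * 2 powr (- \<delta> * ?s)) = C0 * Ni i powr (q / p) * (w i powr q * 2 powr (- \<delta> * ?s))" by simp
        also have "w i powr q * 2 powr (- \<delta> * ?s) = 2 powr (- (\<delta> / 2) * ?s)"
        proof -
          have "e * ?s * q + - \<delta> * ?s = - (\<delta> / 2) * ?s" using q0 by (simp add: e_def field_simps)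
          thus ?thesis unfolding w_def powr_powr powr_add[symmetric] add.commute[of "int_decode i"] by (simp only:)
        qed
        also have "ennreal (C0 * Ni i powr (q / p) * 2 powr (- (\<delta> / 2) * ?s)) = ennreal (C0 * Ni i powr (q / p)) * ennreal (2 powr (- (\<delta> / 2) * ?s))"
          by (rule ennreal_mult') (use C0 in simp)
        finally show "ennreal (w i powr q) * (ennreal (R ^ (d - 1)) * annulus_int q R (T (radial_density (Fi i)))) \<le> ennreal (C0 * Ni i powr (q / p)) * ennreal (2 powr (- (\<delta> / 2) * ?s))" .
      qed auto
      finally show ?thesis by (simp only: R_def)
    qed
    have "full_int q (T (radial_density F)) \<le> ennreal (2 ^ (d - 1)) * (\<Sum>n. ennreal ((2 powr int_decode n) ^ (d - 1)) * annulus_int q (2 powr int_decode n) (T (radial_density F)))"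
      by (rule full_int_le_dyadic[OF T_measurable]) measurable
    also have "\<dots> \<le> ennreal (2 ^ (d - 1)) * (\<Sum>n. ennreal (W1 powr q) * (\<Sum>i. ennreal (C0 * Ni i powr (q / p)) * ennreal (2 powr (- (\<delta> / 2) * \<bar>real_of_int (int_decode n + int_decode i)\<bar>))))"
      by (intro mult_left_mono[of "suminf _"] suminf_le key) auto
    also have "(\<Sum>n. ennreal (W1 powr q) * (\<Sum>i. ennreal (C0 * Ni i powr (q / p)) * ennreal (2 powr (- (\<delta> / 2) * \<bar>real_of_int (int_decode n + int_decode i)\<bar>))))
       = ennreal (W1 powr q) * (\<Sum>i. ennreal (C0 * Ni i powr (q / p)) * (\<Sum>n. ennreal (2 powr (- (\<delta> / 2) * \<bar>real_of_int (int_decode n + int_decode i)\<bar>))))"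
    \<comment> \<open>The two sums are exchanged so that the sum over annuli is taken for a fixed
      shell.\<close>
    proof -
      define f where "f n i = ennreal (C0 * Ni i powr (q / p)) * ennreal (2 powr (- (\<delta> / 2) * \<bar>real_of_int (int_decode n + int_decode i)\<bar>))" for n i
      have "(\<Sum>n. \<Sum>i. f n i) = (\<integral>\<^sup>+ n. (\<Sum>i. f n i) \<partial>count_space UNIV)" by (rule nn_integral_count_space_nat[symmetric])
      also have "\<dots> = (\<Sum>i. \<integral>\<^sup>+ n. f n i \<partial>count_space UNIV)" by (rule nn_integral_suminf) simp
      also have "\<dots> = (\<Sum>i. \<Sum>n. f n i)" by (simp only: nn_integral_count_space_nat)
      finally show ?thesis unfolding ennreal_suminf_cmult f_def by (simp only:)
    qed
    also have "ennreal (2 ^ (d - 1)) * (ennreal (W1 powr q) * (\<Sum>i. ennreal (C0 * Ni i powr (q / p)) * (\<Sum>n. ennreal (2 powr (- (\<delta> / 2) * \<bar>real_of_int (int_decode n + int_decode i)\<bar>)))))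
       \<le> ennreal (2 ^ (d - 1)) * (ennreal (W1 powr q) * (\<Sum>i. ennreal (C0 * W2) * ennreal (Ni i powr (q / p))))"
    proof (rule mult_left_mono, rule mult_left_mono, rule suminf_le)
      fix i
      have "ennreal (C0 * Ni i powr (q / p)) * (\<Sum>n. ennreal (2 powr (- (\<delta> / 2) * \<bar>real_of_int (int_decode n + int_decode i)\<bar>))) \<le> ennreal (C0 * Ni i powr (q / p)) * ennreal W2"
        unfolding W2_def by (intro mult_left_mono int_decode_sum_bound) (use \<delta> in auto)
      also have "\<dots> = ennreal (C0 * W2) * ennreal (Ni i powr (q / p))" using C0 W by (simp add: ennreal_mult'[symmetric] mult_ac)
      finally show "ennreal (C0 * Ni i powr (q / p)) * (\<Sum>n. ennreal (2 powr (- (\<delta> / 2) * \<bar>real_of_int (int_decode n + int_decode i)\<bar>))) \<le> ennreal (C0 * W2) * ennreal (Ni i powr (q / p))" .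
    qed auto
    also have "\<dots> = ennreal (2 ^ (d - 1)) * (ennreal (W1 powr q) * (ennreal (C0 * W2) * (\<Sum>i. ennreal (Ni i powr (q / p)))))"
      by (simp only: ennreal_suminf_cmult)
    also have "\<dots> \<le> ennreal (2 ^ (d - 1)) * (ennreal (W1 powr q) * (ennreal (C0 * W2) * ennreal (N powr (q / p))))"
      by (rule mult_left_mono, rule mult_left_mono, rule mult_left_mono, rule sumN) auto
    also have "\<dots> = ennreal (C * N powr (q / p))"
      unfolding C_def using C0 W by (simp add: ennreal_mult'[symmetric] mult_ac)
    finally show "full_int q (T (radial_density F)) \<le> ennreal (C * N powr (q / p))" .
  qed
qed

end

section \<open>The extension operator\<close>

text \<open>Lowering the exponent on a set of finite measure. Where
  \<open>norm (f z) \<le> n\<close> the power is at most \<open>n powr p0\<close>, integrated over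
  A; elsewhere the nonpositive power p0 - P of the modulus is at most that of n. The value p =
  \<infinity> is included.\<close>

lemma nn_integral_powr_le_Lp_norm:
  fixes f :: "'a \<Rightarrow> complex"
  assumes fm [measurable]: "f \<in> borel_measurable M" "A \<in> sets M" and A: "emeasure M A \<le> ennreal m" and m: "m \<ge> 0"
    and f0: "\<And>z. z \<in> space M \<Longrightarrow> z \<notin> A \<Longrightarrow> f z = 0" and p0: "p0 > 0" and p: "ennreal p0 \<le> p"
    and n: "Lp_norm p M f = ennreal n" "n \<ge> 0"
  shows "(\<integral>\<^sup>+ z. ennreal (norm (f z) powr p0) \<partial>M) \<le> ennreal ((m + 1) * n powr p0)"
proof (cases p)
  case top
  have "AE z in M. ennreal (norm (f z)) \<le> esssup M (\<lambda>x. ennreal (norm (f x)))"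
    by (rule esssup_AE)
  hence "AE z in M. ennreal (norm (f z)) \<le> ennreal n" using n top by (simp add: Lp_norm_def)
  hence "AE z in M. ennreal (norm (f z) powr p0) \<le> ennreal (n powr p0) * indicator A z"
    using AE_space
  proof eventually_elim
    case (elim z)
    hence "norm (f z) powr p0 \<le> n powr p0" using n(2) p0 by (intro powr_mono2) auto
    thus ?case using f0[OF elim(2)] by (cases "z \<in> A") (auto intro: ennreal_leI)
  qed
  hence "(\<integral>\<^sup>+ z. ennreal (norm (f z) powr p0) \<partial>M) \<le> (\<integral>\<^sup>+ z. ennreal (n powr p0) * indicator A z \<partial>M)"
    by (rule nn_integral_mono_AE)
  also have "\<dots> = ennreal (n powr p0) * emeasure M A" by (simp add: nn_integral_cmult_indicator)
  also have "\<dots> \<le> ennreal (n powr p0) * ennreal m" using A by (rule mult_left_mono) simp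
  also have "\<dots> = ennreal (n powr p0 * m)" using m by (simp add: ennreal_mult')
  also have "\<dots> \<le> ennreal ((m + 1) * n powr p0)" using m by (intro ennreal_leI) (auto simp: algebra_simps)
  finally show ?thesis .
next
  case (real P)
  have pP: "p0 \<le> P" using p real by (simp add: ennreal_le_iff)
  have P: "P > 0" using pP p0 by simp
  define I where "I = (\<integral>\<^sup>+ z. ennreal (norm (f z) powr P) \<partial>M)"
  have N: "Lp_norm p M f = (if I = \<infinity> then \<infinity> else ennreal (enn2real I powr (1 / P)))"
    using real P by (simp add: Lp_norm_def Let_def I_def)
  have fin: "I \<noteq> \<infinity>" using N n(1) by auto
  hence "ennreal (enn2real I powr (1 / P)) = ennreal n" using N n(1) by simp
  hence "enn2real I powr (1 / P) = n" using n(2) by (simp add: ennreal_inj)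
  hence "n powr P = (enn2real I powr (1 / P)) powr P" by simp
  also have "\<dots> = enn2real I" using P by (simp add: powr_powr)
  finally have I: "I = ennreal (n powr P)" using fin by (simp add: less_top)
  show ?thesis
  proof (cases "n = 0")
    \<comment> \<open>The splitting uses the power p0 - P of n, which carries information only for n
      > 0; here f vanishes almost everywhere.\<close>
    case True
    hence "I = 0" using I P by simp
    hence "AE z in M. ennreal (norm (f z) powr P) = 0" unfolding I_def by (subst (asm) nn_integral_0_iff_AE) auto
    hence "AE z in M. ennreal (norm (f z) powr p0) = 0" by eventually_elim (simp add: ennreal_eq_0_iff)
    hence "(\<integral>\<^sup>+ z. ennreal (norm (f z) powr p0) \<partial>M) = (\<integral>\<^sup>+ z. 0 \<partial>M)" by (rule nn_integral_cong_AE)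
    thus ?thesis by simp
  next
    case False
    hence n0: "n > 0" using n(2) by simp
    have "ennreal (norm (f z) powr p0) \<le> ennreal (n powr p0) * indicator A z + ennreal (n powr (p0 - P)) * ennreal (norm (f z) powr P)"
      if z: "z \<in> space M" for z
    proof (cases "z \<in> A")
      case False
      thus ?thesis using f0[OF z] by simp
    next
      case True
      have "norm (f z) powr p0 \<le> n powr p0 + n powr (p0 - P) * norm (f z) powr P"
      proof (cases "norm (f z) \<le> n")
        case True
        hence "norm (f z) powr p0 \<le> n powr p0" using p0 by (intro powr_mono2) auto
        thus ?thesis by (simp add: add_increasing2)
      next
        case False
        have "norm (f z) powr p0 = norm (f z) powr (p0 - P) * norm (f z) powr P"
          unfolding powr_add[symmetric] by simp
        also have "\<dots> \<le> n powr (p0 - P) * norm (f z) powr P"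
          using False n0 pP by (intro mult_right_mono powr_mono2') auto
        finally show ?thesis by (simp add: add_increasing)
      qed
      thus ?thesis using True by (simp add: ennreal_mult'[symmetric] ennreal_plus[symmetric] ennreal_leI del: ennreal_plus)
    qed
    hence "(\<integral>\<^sup>+ z. ennreal (norm (f z) powr p0) \<partial>M) \<le> (\<integral>\<^sup>+ z. ennreal (n powr p0) * indicator A z + ennreal (n powr (p0 - P)) * ennreal (norm (f z) powr P) \<partial>M)"
      by (rule nn_integral_mono)
    also have "\<dots> = (\<integral>\<^sup>+ z. ennreal (n powr p0) * indicator A z \<partial>M) + (\<integral>\<^sup>+ z. ennreal (n powr (p0 - P)) * ennreal (norm (f z) powr P) \<partial>M)"
      by (rule nn_integral_add) measurable
    also have "\<dots> = ennreal (n powr p0) * emeasure M A + ennreal (n powr (p0 - P)) * I"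
      unfolding I_def by (subst nn_integral_cmult_indicator nn_integral_cmult, measurable)+
    also have "\<dots> \<le> ennreal (n powr p0) * ennreal m + ennreal (n powr (p0 - P)) * ennreal (n powr P)"
      unfolding I by (rule add_right_mono, rule mult_left_mono[OF A]) simp
    also have "\<dots> = ennreal (n powr p0 * m + n powr (p0 - P) * n powr P)"
      using m by (simp add: ennreal_mult'[symmetric] ennreal_plus[symmetric] del: ennreal_plus)
    also have "n powr p0 * m + n powr (p0 - P) * n powr P = (m + 1) * n powr p0"
      unfolding powr_add[symmetric] by (simp add: algebra_simps)
    finally show ?thesis .
  qed
qed

lemma space_paraboloid_measure: "space paraboloid_measure = paraboloid"
  by (simp add: paraboloid_measure_def space_restrict_space)

lemma paraboloid_cball:
  "{z \<in> paraboloid. norm (snd z) \<le> b} \<in> sets (paraboloid_measure :: (real \<times> (real ^ 'd)) measure)" (is "?A \<in> _")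
  "\<exists>m\<ge>0. emeasure (paraboloid_measure :: (real \<times> (real ^ 'd)) measure) {z \<in> paraboloid. norm (snd z) \<le> b} \<le> ennreal m"
proof -
  let ?N = "distr lborel (restrict_space borel paraboloid) lift :: (real \<times> (real ^ 'd)) measure"
  have "{z :: real \<times> (real ^ 'd). norm (snd z) \<le> b} \<in> sets borel"
    by (intro borel_closed closed_Collect_le continuous_intros)
  moreover have "?A = paraboloid \<inter> {z. norm (snd z) \<le> b}" by auto
  ultimately have A: "?A \<in> sets ?N" by (auto simp: sets_restrict_space)
  thus "?A \<in> sets paraboloid_measure" by (simp add: paraboloid_measure_def)
  have "emeasure paraboloid_measure ?A = emeasure ?N ?A"
    unfolding paraboloid_measure_def using A by (subst emeasure_completion) auto
  also have "\<dots> = emeasure lborel (lift -` ?A \<inter> space lborel)"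
    using A by (intro emeasure_distr[OF lift_measurable]) auto
  also have "lift -` ?A \<inter> space lborel = (cball 0 b :: (real ^ 'd) set)"
    by (auto simp: paraboloid_def)
  also have "emeasure lborel (cball 0 b :: (real ^ 'd) set) = ennreal (measure lborel (cball 0 b :: (real ^ 'd) set))"
    by (intro emeasure_eq_ennreal_measure) (use emeasure_lborel_cball_finite in \<open>auto simp: less_top\<close>)
  finally show "\<exists>m\<ge>0. emeasure (paraboloid_measure :: (real \<times> (real ^ 'd)) measure) ?A \<le> ennreal m"
    by (intro exI[of _ "measure lborel (cball 0 b :: (real ^ 'd) set)"]) auto
qed

lemma extension_op_of_profile:
  fixes f :: "real \<times> (real ^ 'd) \<Rightarrow> complex"
  assumes fm: "f \<in> borel_measurable paraboloid_measure" and [measurable]: "F \<in> borel_measurable borel"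
    and ae: "AE y in lborel. f (lift y) = F (norm y)"
  shows "extension_op f (t, x) = (LINT y|lborel. F (norm y) * iexp (t * (norm y)\<^sup>2) * iexp (x \<bullet> y))"
proof -
  have [measurable]: "(\<lambda>y. f (lift y)) \<in> borel_measurable lebesgue" by (rule lift_measurable_lebesgue[OF fm])
  have [measurable]: "(\<lambda>y. iexp (x \<bullet> y + t * (norm y)\<^sup>2)) \<in> borel_measurable lebesgue"
    by (intro measurable_completion) measurable
  have [measurable]: "(\<lambda>y :: real ^ 'd. F (norm y) * iexp (t * (norm y)\<^sup>2) * iexp (x \<bullet> y)) \<in> borel_measurable lborel"
    by measurable
  have "extension_op f (t, x) = (LINT y|lebesgue. f (lift y) * iexp (x \<bullet> y + t * (norm y)\<^sup>2))"
    by (simp add: extension_op_def)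
  also have "\<dots> = (LINT y|lebesgue. F (norm y) * iexp (t * (norm y)\<^sup>2) * iexp (x \<bullet> y))"
  proof (rule integral_cong_AE)
    show "(\<lambda>y. F (norm y) * iexp (t * (norm y)\<^sup>2) * iexp (x \<bullet> y)) \<in> borel_measurable lebesgue"
      by (intro measurable_completion) measurable
    show "AE y in lebesgue. f (lift y) * iexp (x \<bullet> y + t * (norm y)\<^sup>2) = F (norm y) * iexp (t * (norm y)\<^sup>2) * iexp (x \<bullet> y)"
      using AE_completion[OF ae] by eventually_elim (simp add: exp_add[symmetric] ring_distribs add.commute)
  qed measurable
  also have "\<dots> = (LINT y|lborel. F (norm y) * iexp (t * (norm y)\<^sup>2) * iexp (x \<bullet> y))"
    by (rule integral_completion) measurable
  finally show ?thesis .
qed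

lemma extension_op_radial:
  fixes f :: "real \<times> (real ^ 'd) \<Rightarrow> complex"
  assumes d: "2 \<le> CARD('d)" and fm: "f \<in> borel_measurable paraboloid_measure" and Fm [measurable]: "F \<in> borel_measurable borel"
    and ae: "AE y in lborel. f (lift y) = F (norm y)" and F0: "\<And>r. r \<le> 0 \<Longrightarrow> F r = 0"
    and int: "integrable lborel (\<lambda>y :: real ^ 'd. F (norm y))"
  shows "extension_op f (t, x) = quad_ext (\<lambda>r. complex_of_real (r ^ (CARD('d) - 1)) * F r * complex_of_real (sphere_wave CARD('d) (norm x * r))) t"
proof -
  define G where "G r = F r * iexp (t * r\<^sup>2)" for r
  have [measurable]: "G \<in> borel_measurable borel" unfolding G_def by measurable
  have "extension_op f (t, x) = (LINT y|lborel. G (norm y) * iexp (x \<bullet> y))"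
    unfolding G_def by (rule extension_op_of_profile[OF fm Fm ae])
  also have "\<dots> = (LINT r|lborel. indicator {0<..} r *\<^sub>R (complex_of_real (r ^ (CARD('d) - 1) * sphere_wave CARD('d) (norm x * r)) * G r))"
  proof (rule radial_fourier[OF d])
    show "integrable lborel (\<lambda>y :: real ^ 'd. G (norm y))"
      by (rule Bochner_Integration.integrable_bound[OF int]) (auto simp: G_def norm_mult)
  qed measurable
  also have "\<dots> = quad_ext (\<lambda>r. complex_of_real (r ^ (CARD('d) - 1)) * F r * complex_of_real (sphere_wave CARD('d) (norm x * r))) t"
    unfolding quad_ext_def
  proof (intro Bochner_Integration.integral_cong refl)
    fix r :: real
    show "indicator {0<..} r *\<^sub>R (complex_of_real (r ^ (CARD('d) - 1) * sphere_wave CARD('d) (norm x * r)) * G r)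
      = complex_of_real (r ^ (CARD('d) - 1)) * F r * complex_of_real (sphere_wave CARD('d) (norm x * r)) * iexp (t * r\<^sup>2)"
      using F0[of r] by (cases "r > 0") (auto simp: G_def mult_ac)
  qed
  finally show ?thesis .
qed

text \<open>One profile serves several exponents: the L^1 bound gives integrability and the case q =
  \<infinity>, the bounds for p0 feed the radial estimates. The origin is exempted from the support
  condition, as I consists of positive radii and a point is null.\<close>

lemma supported_profile:
  fixes I :: "real set"
  assumes d: "2 \<le> CARD('d::finite)" and I [measurable]: "I \<in> sets borel" and Ib: "I \<subseteq> {0<..b}" and b: "b \<ge> 0"
  shows "\<exists>m\<ge>0. \<forall>(f :: real \<times> (real ^ 'd) \<Rightarrow> complex) p. f \<in> Lp_space p paraboloid_measure \<longrightarrow> cylindrically_symmetric f \<longrightarrow>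
      (\<forall>y. y \<noteq> 0 \<longrightarrow> norm y \<notin> I \<longrightarrow> f (lift y) = 0) \<longrightarrow> 1 \<le> p \<longrightarrow>
      (\<exists>F \<in> borel_measurable borel. (AE y in lborel. f (lift y) = F (norm y)) \<and> (\<forall>r. r \<notin> I \<longrightarrow> F r = 0)
        \<and> integrable lborel (\<lambda>y :: real ^ 'd. F (norm y))
        \<and> (\<integral>\<^sup>+ y. ennreal (norm (F (norm (y :: real ^ 'd)))) \<partial>lborel) \<le> ennreal m * Lp_norm p paraboloid_measure f
        \<and> (\<forall>p0>0. ennreal p0 \<le> p \<longrightarrow>
            (\<integral>\<^sup>+ r. ennreal (r ^ (CARD('d) - 1)) * ennreal (norm (F r) powr p0) \<partial>lborel)
              \<le> ennreal (m * enn2real (Lp_norm p paraboloid_measure f) powr p0 / sphere_area CARD('d))))"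
proof -
  let ?A = "{z \<in> paraboloid. norm (snd z) \<le> b} :: (real \<times> (real ^ 'd)) set"
  let ?pm = "paraboloid_measure :: (real \<times> (real ^ 'd)) measure"
  let ?s = "sphere_area CARD('d)"
  have s: "?s > 0" by (rule sphere_area_pos[OF d])
  obtain m where m: "m \<ge> 0" "emeasure ?pm ?A \<le> ennreal m" using paraboloid_cball(2) by blast
  show ?thesis
  proof (rule exI[of _ "m + 1"], rule conjI, use m in simp, intro allI impI)
    fix f :: "real \<times> (real ^ 'd) \<Rightarrow> complex" and p
    assume f: "f \<in> Lp_space p ?pm" and sym: "cylindrically_symmetric f" and supp: "\<forall>y. y \<noteq> 0 \<longrightarrow> norm y \<notin> I \<longrightarrow> f (lift y) = 0" and p: "1 \<le> p"
    have fm: "f \<in> borel_measurable ?pm" using f by (simp add: Lp_space_def)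
    obtain n where n: "Lp_norm p ?pm f = ennreal n" "n \<ge> 0"
      using f by (cases "Lp_norm p ?pm f") (auto simp: Lp_space_def)
    obtain F1 where F1: "F1 \<in> borel_measurable borel" "AE y in lborel. f (lift y) = F1 (norm y)"
      using radial_profile_exists[OF d fm sym] by blast
    note [measurable] = F1(1)
    define F where "F r = (if r \<in> I then F1 r else 0)" for r
    have Fm [measurable]: "F \<in> borel_measurable borel" unfolding F_def by measurable
    have FI: "\<forall>r. r \<notin> I \<longrightarrow> F r = 0" by (simp add: F_def)
    have Fae: "AE y in lborel. f (lift y) = F (norm y)"
      using F1(2) AE_lborel_singleton[of "0 :: real ^ 'd"] by eventually_elim (use supp in \<open>auto simp: F_def\<close>)
    have low: "(\<integral>\<^sup>+ z. ennreal (norm (f z) powr p0) \<partial>?pm) \<le> ennreal ((m + 1) * n powr p0)" if p0: "p0 > 0" "ennreal p0 \<le> p" for p0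
    proof (rule nn_integral_powr_le_Lp_norm[OF fm paraboloid_cball(1)[of b] m(2) m(1) _ p0 n])
      fix z :: "real \<times> (real ^ 'd)" assume z: "z \<in> space ?pm" "z \<notin> ?A"
      obtain y where zy: "z = lift y" using z(1) unfolding space_paraboloid_measure paraboloid_def by (cases z) auto
      have "norm y > b" using z zy by (simp add: space_paraboloid_measure)
      hence "y \<noteq> 0" "norm y \<notin> I" using b Ib by auto
      thus "f z = 0" using supp zy by blast
    qed
    have eq1: "(\<integral>\<^sup>+ y. ennreal (norm (F (norm (y :: real ^ 'd)))) \<partial>lborel) = (\<integral>\<^sup>+ z. ennreal (norm (f z)) \<partial>?pm)"
      by (subst nn_integral_radial[OF d], measurable) (rule nn_integral_paraboloid[OF d fm Fm Fae, symmetric], measurable)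
    also have "\<dots> = (\<integral>\<^sup>+ z. ennreal (norm (f z) powr 1) \<partial>?pm)" by simp
    also have "\<dots> \<le> ennreal ((m + 1) * n powr 1)" by (rule low) (use p in auto)
    also have "\<dots> = ennreal (m + 1) * Lp_norm p ?pm f" using n m(1) by (simp add: ennreal_mult' mult.commute)
    finally have L1: "(\<integral>\<^sup>+ y. ennreal (norm (F (norm (y :: real ^ 'd)))) \<partial>lborel) \<le> ennreal (m + 1) * Lp_norm p ?pm f" .
    have "\<dots> < \<infinity>" unfolding n(1) by (simp add: ennreal_mult_less_top)
    with L1 have fin: "(\<integral>\<^sup>+ y. ennreal (norm (F (norm (y :: real ^ 'd)))) \<partial>lborel) < \<infinity>" by (rule le_less_trans)
    have int: "integrable lborel (\<lambda>y :: real ^ 'd. F (norm y))"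
      by (rule integrableI_bounded) (measurable, rule fin)
    show "\<exists>F \<in> borel_measurable borel. (AE y in lborel. f (lift y) = F (norm y)) \<and> (\<forall>r. r \<notin> I \<longrightarrow> F r = 0)
        \<and> integrable lborel (\<lambda>y :: real ^ 'd. F (norm y))
        \<and> (\<integral>\<^sup>+ y. ennreal (norm (F (norm (y :: real ^ 'd)))) \<partial>lborel) \<le> ennreal (m + 1) * Lp_norm p ?pm f
        \<and> (\<forall>p0>0. ennreal p0 \<le> p \<longrightarrow>
            (\<integral>\<^sup>+ r. ennreal (r ^ (CARD('d) - 1)) * ennreal (norm (F r) powr p0) \<partial>lborel)
              \<le> ennreal ((m + 1) * enn2real (Lp_norm p ?pm f) powr p0 / ?s))"
    proof (rule bexI[OF _ Fm], rule conjI[OF Fae], rule conjI[OF FI], rule conjI[OF int], rule conjI[OF L1], intro allI impI)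
      fix p0 :: real assume p0: "p0 > 0" "ennreal p0 \<le> p"
      let ?J = "\<integral>\<^sup>+ r. ennreal (r ^ (CARD('d) - 1)) * ennreal (norm (F r) powr p0) \<partial>lborel"
      have "ennreal ?s * ?J = (\<integral>\<^sup>+ r. ennreal ?s * (ennreal (r ^ (CARD('d) - 1)) * ennreal (norm (F r) powr p0)) \<partial>lborel)"
        by (rule nn_integral_cmult[symmetric]) measurable
      also have "\<dots> = (\<integral>\<^sup>+ r. indicator {0<..} r * ennreal (r ^ (CARD('d) - 1) * ?s) * ennreal (norm (F r) powr p0) \<partial>lborel)"
      proof (rule nn_integral_cong)
        fix r :: real
        show "ennreal ?s * (ennreal (r ^ (CARD('d) - 1)) * ennreal (norm (F r) powr p0)) = indicator {0<..} r * ennreal (r ^ (CARD('d) - 1) * ?s) * ennreal (norm (F r) powr p0)"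
        proof (cases "r > 0")
          case True
          thus ?thesis using s by (simp add: ennreal_mult'[symmetric] mult_ac)
        next
          case False
          hence "F r = 0" using FI Ib by auto
          thus ?thesis by simp
        qed
      qed
      also have "\<dots> = (\<integral>\<^sup>+ z. ennreal (norm (f z) powr p0) \<partial>?pm)"
        by (rule nn_integral_paraboloid[OF d fm Fm Fae, symmetric]) measurable
      also have "\<dots> \<le> ennreal ((m + 1) * n powr p0)" by (rule low[OF p0])
      finally have "ennreal (1 / ?s) * (ennreal ?s * ?J) \<le> ennreal (1 / ?s) * ennreal ((m + 1) * n powr p0)"
        by (rule mult_left_mono) simp
      also have "\<dots> = ennreal ((m + 1) * n powr p0 / ?s)" using s by (subst ennreal_mult'[symmetric]) auto
      also have "ennreal (1 / ?s) * (ennreal ?s * ?J) = ?J"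
        using s by (simp add: mult.assoc[symmetric] ennreal_mult'[symmetric])
      finally show "?J \<le> ennreal ((m + 1) * enn2real (Lp_norm p ?pm f) powr p0 / ?s)" using n by simp
    qed
  qed
qed

text \<open>The modulus of the extension is at most the L^1 norm of f, which is controlled since the
  support is bounded.\<close>

lemma extension_estimate_infinity:
  fixes I :: "real set"
  assumes d: "2 \<le> CARD('d::finite)" and I [measurable]: "I \<in> sets borel" and Ib: "I \<subseteq> {0<..b}" and b: "b \<ge> 0" and p: "1 \<le> p"
  shows "\<exists>C\<ge>0. \<forall>f :: real \<times> (real ^ 'd) \<Rightarrow> complex. f \<in> Lp_space p paraboloid_measure \<longrightarrow> cylindrically_symmetric f \<longrightarrow>
      (\<forall>y. y \<noteq> 0 \<longrightarrow> norm y \<notin> I \<longrightarrow> f (lift y) = 0) \<longrightarrow>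
      Lp_norm \<infinity> lborel (extension_op f) \<le> ennreal C * Lp_norm p paraboloid_measure f"
proof -
  let ?pm = "paraboloid_measure :: (real \<times> (real ^ 'd)) measure"
  obtain K a where "radial_kernel (sphere_wave CARD('d)) CARD('d) K a" using sphere_wave_radial_kernel[OF d] by blast
  then interpret radial_kernel "sphere_wave CARD('d)" "CARD('d)" K a .
  obtain m where m: "m \<ge> 0" and prof: "\<forall>(f :: real \<times> (real ^ 'd) \<Rightarrow> complex) p. f \<in> Lp_space p paraboloid_measure \<longrightarrow> cylindrically_symmetric f \<longrightarrow>
      (\<forall>y. y \<noteq> 0 \<longrightarrow> norm y \<notin> I \<longrightarrow> f (lift y) = 0) \<longrightarrow> 1 \<le> p \<longrightarrow>
      (\<exists>F \<in> borel_measurable borel. (AE y in lborel. f (lift y) = F (norm y)) \<and> (\<forall>r. r \<notin> I \<longrightarrow> F r = 0)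
        \<and> integrable lborel (\<lambda>y :: real ^ 'd. F (norm y))
        \<and> (\<integral>\<^sup>+ y. ennreal (norm (F (norm (y :: real ^ 'd)))) \<partial>lborel) \<le> ennreal m * Lp_norm p paraboloid_measure f
        \<and> (\<forall>p0>0. ennreal p0 \<le> p \<longrightarrow>
            (\<integral>\<^sup>+ r. ennreal (r ^ (CARD('d) - 1)) * ennreal (norm (F r) powr p0) \<partial>lborel)
              \<le> ennreal (m * enn2real (Lp_norm p paraboloid_measure f) powr p0 / sphere_area CARD('d))))"
    using supported_profile[OF d I Ib b] by (elim exE conjE) (rule that)
  show ?thesis
  proof (rule exI[of _ m], rule conjI[OF m], intro allI impI)
    fix f :: "real \<times> (real ^ 'd) \<Rightarrow> complex"
    assume f: "f \<in> Lp_space p ?pm" and sym: "cylindrically_symmetric f" and supp: "\<forall>y. y \<noteq> 0 \<longrightarrow> norm y \<notin> I \<longrightarrow> f (lift y) = 0"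
    have fm: "f \<in> borel_measurable ?pm" using f by (simp add: Lp_space_def)
    obtain F where F [measurable]: "F \<in> borel_measurable borel" and Fae: "AE y in lborel. f (lift y) = F (norm y)" and FI: "\<forall>r. r \<notin> I \<longrightarrow> F r = 0"
      and int: "integrable lborel (\<lambda>y :: real ^ 'd. F (norm y))"
      and L1: "(\<integral>\<^sup>+ y. ennreal (norm (F (norm (y :: real ^ 'd)))) \<partial>lborel) \<le> ennreal m * Lp_norm p ?pm f"
      using prof[THEN spec, THEN spec, THEN mp, OF f, THEN mp, OF sym, THEN mp, OF supp, THEN mp, OF p] by (elim bexE conjE) (rule that)
    have F0: "\<And>r. r \<le> 0 \<Longrightarrow> F r = 0" using FI Ib by auto
    have E: "extension_op f z = T (radial_density F) (norm (snd z)) (fst z)" for z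
      unfolding T_def using extension_op_radial[OF d fm F Fae F0 int, of "fst z" "snd z"] by simp
    have [measurable]: "(\<lambda>(\<rho>, t). T (radial_density F) \<rho> t) \<in> borel_measurable (borel \<Otimes>\<^sub>M borel)"
      by (rule T_measurable) measurable
    have Em: "extension_op f \<in> borel_measurable lborel"
    proof -
      have "(\<lambda>z :: real \<times> (real ^ 'd). (\<lambda>(\<rho>, t). T (radial_density F) \<rho> t) (norm (snd z), fst z)) \<in> borel_measurable (borel \<Otimes>\<^sub>M borel)"
        by measurable
      also have "(\<lambda>z :: real \<times> (real ^ 'd). (\<lambda>(\<rho>, t). T (radial_density F) \<rho> t) (norm (snd z), fst z)) = extension_op f"
        by (simp add: E fun_eq_iff)
      finally show ?thesis by (simp add: borel_prod)
    qed
    have bound: "ennreal (norm (extension_op f z)) \<le> ennreal m * Lp_norm p ?pm f" for z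
    proof -
      obtain t x where z: "z = (t, x)" by (cases z)
      let ?g = "\<lambda>y. F (norm y) * iexp (t * (norm y)\<^sup>2) * iexp (x \<bullet> y)"
      have "integrable lborel ?g" by (rule Bochner_Integration.integrable_bound[OF int]) (auto simp: norm_mult)
      hence "ennreal (norm (extension_op f z)) \<le> (\<integral>\<^sup>+ y. ennreal (norm (?g y)) \<partial>lborel)"
        unfolding z extension_op_of_profile[OF fm F Fae] by (rule integral_norm_bound_ennreal)
      also have "\<dots> = (\<integral>\<^sup>+ y. ennreal (norm (F (norm y))) \<partial>(lborel :: (real ^ 'd) measure))" by (simp add: norm_mult)
      finally show ?thesis using L1 by (rule order_trans)
    qed
    show "Lp_norm \<infinity> lborel (extension_op f) \<le> ennreal m * Lp_norm p ?pm f"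
      unfolding Lp_norm_def[of \<infinity>] using Em bound by (auto intro!: esssup_I)
  qed
qed

text \<open>Polar coordinates on the paraboloid and in x transfer a radial estimate to f. The
  exponent p0 of the radial estimate may be smaller than p, which also covers p =
  \<infinity>.\<close>

lemma extension_estimate_of_radial:
  fixes I :: "real set" and p0 q :: real
  assumes d: "2 \<le> CARD('d::finite)" and I [measurable]: "I \<in> sets borel" and Ib: "I \<subseteq> {0<..b}" and b: "b \<ge> 0"
    and rk: "radial_kernel (sphere_wave CARD('d)) CARD('d) K a"
    and p: "1 \<le> p" and p0: "p0 > 0" "ennreal p0 \<le> p" and q: "q > 0" and C: "C > 0"
    and est: "\<forall>F N. F \<in> borel_measurable borel \<longrightarrow> (\<forall>r. r \<notin> I \<longrightarrow> F r = 0) \<longrightarrow> N \<ge> 0 \<longrightarrow>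
     (\<integral>\<^sup>+ r. ennreal (r ^ (CARD('d) - 1)) * ennreal (norm (F r) powr p0) \<partial>lborel) \<le> ennreal N \<longrightarrow>
     radial_kernel.full_int CARD('d) q (radial_kernel.T (sphere_wave CARD('d)) (\<lambda>r. complex_of_real (r ^ (CARD('d) - 1)) * F r)) \<le> ennreal (C * N powr (q / p0))"
  shows "\<exists>C\<ge>0. \<forall>f :: real \<times> (real ^ 'd) \<Rightarrow> complex. f \<in> Lp_space p paraboloid_measure \<longrightarrow> cylindrically_symmetric f \<longrightarrow>
      (\<forall>y. y \<noteq> 0 \<longrightarrow> norm y \<notin> I \<longrightarrow> f (lift y) = 0) \<longrightarrow>
      Lp_norm (ennreal q) lborel (extension_op f) \<le> ennreal C * Lp_norm p paraboloid_measure f"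
proof -
  let ?pm = "paraboloid_measure :: (real \<times> (real ^ 'd)) measure"
  let ?s = "sphere_area CARD('d)"
  interpret radial_kernel "sphere_wave CARD('d)" "CARD('d)" K a by (rule rk)
  have s: "?s > 0" by (rule sphere_area_pos[OF d])
  obtain m where m: "m \<ge> 0" and prof: "\<forall>(f :: real \<times> (real ^ 'd) \<Rightarrow> complex) p. f \<in> Lp_space p paraboloid_measure \<longrightarrow> cylindrically_symmetric f \<longrightarrow>
      (\<forall>y. y \<noteq> 0 \<longrightarrow> norm y \<notin> I \<longrightarrow> f (lift y) = 0) \<longrightarrow> 1 \<le> p \<longrightarrow>
      (\<exists>F \<in> borel_measurable borel. (AE y in lborel. f (lift y) = F (norm y)) \<and> (\<forall>r. r \<notin> I \<longrightarrow> F r = 0)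
        \<and> integrable lborel (\<lambda>y :: real ^ 'd. F (norm y))
        \<and> (\<integral>\<^sup>+ y. ennreal (norm (F (norm (y :: real ^ 'd)))) \<partial>lborel) \<le> ennreal m * Lp_norm p paraboloid_measure f
        \<and> (\<forall>p0>0. ennreal p0 \<le> p \<longrightarrow>
            (\<integral>\<^sup>+ r. ennreal (r ^ (CARD('d) - 1)) * ennreal (norm (F r) powr p0) \<partial>lborel)
              \<le> ennreal (m * enn2real (Lp_norm p paraboloid_measure f) powr p0 / sphere_area CARD('d))))"
    using supported_profile[OF d I Ib b] by (elim exE conjE) (rule that)
  \<comment> \<open>The outer \<open>?s\<close> is from polar coordinates in x;
    \<open>m / ?s\<close> is from polar coordinates on the paraboloid and from lowering p to
    p0.\<close>
  define D where "D = ?s * (C * (m / ?s) powr (q / p0))"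
  have D: "D \<ge> 0" using s C by (simp add: D_def)
  show ?thesis
  proof (rule exI[of _ "D powr (1 / q)"], rule conjI, simp, intro allI impI)
    fix f :: "real \<times> (real ^ 'd) \<Rightarrow> complex"
    assume f: "f \<in> Lp_space p ?pm" and sym: "cylindrically_symmetric f" and supp: "\<forall>y. y \<noteq> 0 \<longrightarrow> norm y \<notin> I \<longrightarrow> f (lift y) = 0"
    have fm: "f \<in> borel_measurable ?pm" using f by (simp add: Lp_space_def)
    define n where "n = enn2real (Lp_norm p ?pm f)"
    have n: "n \<ge> 0" "Lp_norm p ?pm f = ennreal n" using f by (auto simp: n_def Lp_space_def)
    obtain F where F [measurable]: "F \<in> borel_measurable borel" and Fae: "AE y in lborel. f (lift y) = F (norm y)" and FI: "\<forall>r. r \<notin> I \<longrightarrow> F r = 0"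
      and int: "integrable lborel (\<lambda>y :: real ^ 'd. F (norm y))"
      and L1: "(\<integral>\<^sup>+ y. ennreal (norm (F (norm (y :: real ^ 'd)))) \<partial>lborel) \<le> ennreal m * Lp_norm p ?pm f"
      and Lp: "\<forall>p0>0. ennreal p0 \<le> p \<longrightarrow> (\<integral>\<^sup>+ r. ennreal (r ^ (CARD('d) - 1)) * ennreal (norm (F r) powr p0) \<partial>lborel) \<le> ennreal (m * enn2real (Lp_norm p ?pm f) powr p0 / ?s)"
      using prof[THEN spec, THEN spec, THEN mp, OF f, THEN mp, OF sym, THEN mp, OF supp, THEN mp, OF p] by (elim bexE conjE) (rule that)
    have F0: "\<And>r. r \<le> 0 \<Longrightarrow> F r = 0" using FI Ib by auto
    let ?T = "T (radial_density F)"
    have E: "extension_op f (t, x) = ?T (norm x) t" for t x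
      unfolding T_def by (rule extension_op_radial[OF d fm F Fae F0 int])
    have E': "extension_op f z = ?T (norm (snd z)) (fst z)" for z
      by (cases z) (simp only: E fst_conv snd_conv)
    have Tm [measurable]: "(\<lambda>(\<rho>, t). ?T \<rho> t) \<in> borel_measurable (borel \<Otimes>\<^sub>M borel)"
      by (rule T_measurable) measurable
    have N0: "m * n powr p0 / ?s \<ge> 0" using m s by simp
    have full: "full_int q ?T \<le> ennreal (C * (m * n powr p0 / ?s) powr (q / p0))"
      by (rule est[rule_format, OF F FI[rule_format] N0 Lp[rule_format, OF p0, folded n_def]])
    have "(m * n powr p0 / ?s) powr (q / p0) = (m / ?s) powr (q / p0) * n powr q"
    proof -
      have "m * n powr p0 / ?s = (m / ?s) * n powr p0" by simp
      also have "\<dots> powr (q / p0) = (m / ?s) powr (q / p0) * (n powr p0) powr (q / p0)" by (rule powr_mult)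
      finally show ?thesis using p0 by (simp add: powr_powr)
    qed
    hence "ennreal ?s * full_int q ?T \<le> ennreal ?s * ennreal (C * ((m / ?s) powr (q / p0) * n powr q))"
      using mult_left_mono[OF full, of "ennreal ?s"] by simp
    also have "\<dots> = ennreal (D * n powr q)" using s by (simp add: D_def ennreal_mult'[symmetric] mult_ac)
    finally have fs: "ennreal ?s * full_int q ?T \<le> ennreal (D * n powr q)" .
    have "(\<lambda>z :: real \<times> (real ^ 'd). (\<lambda>(\<rho>, t). ?T \<rho> t) (norm (snd z), fst z)) \<in> borel_measurable (lborel \<Otimes>\<^sub>M lborel)"
      by measurable
    hence [measurable]: "(\<lambda>z :: real \<times> (real ^ 'd). ?T (norm (snd z)) (fst z)) \<in> borel_measurable (lborel \<Otimes>\<^sub>M lborel)"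
      by (simp only: prod.case)
    have Jm: "(\<lambda>z :: real \<times> (real ^ 'd). ennreal (norm (?T (norm (snd z)) (fst z)) powr q)) \<in> borel_measurable (lborel \<Otimes>\<^sub>M lborel)"
      by measurable
    let ?J = "\<integral>\<^sup>+ z. ennreal (norm (extension_op f z) powr q) \<partial>lborel"
    have "?J = (\<integral>\<^sup>+ z. ennreal (norm (?T (norm (snd z)) (fst z)) powr q) \<partial>(lborel \<Otimes>\<^sub>M (lborel :: (real ^ 'd) measure)))"
      unfolding lborel_prod by (intro nn_integral_cong) (simp only: E')
    also have "\<dots> = (\<integral>\<^sup>+ t. \<integral>\<^sup>+ x. ennreal (norm (?T (norm (x :: real ^ 'd)) t) powr q) \<partial>lborel \<partial>lborel)"
      unfolding lborel.nn_integral_fst[OF Jm, symmetric] by simp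
    also have "\<dots> = (\<integral>\<^sup>+ t. \<integral>\<^sup>+ \<rho>. indicator {0<..} \<rho> * ennreal (\<rho> ^ (CARD('d) - 1) * ?s) * ennreal (norm (?T \<rho> t) powr q) \<partial>lborel \<partial>lborel)"
      by (intro nn_integral_cong nn_integral_radial[OF d]) measurable
    also have "\<dots> = (\<integral>\<^sup>+ \<rho>. \<integral>\<^sup>+ t. indicator {0<..} \<rho> * ennreal (\<rho> ^ (CARD('d) - 1) * ?s) * ennreal (norm (?T \<rho> t) powr q) \<partial>lborel \<partial>lborel)"
      by (rule lborel_pair.Fubini') measurable
    also have "\<dots> = (\<integral>\<^sup>+ \<rho>. \<integral>\<^sup>+ t. ennreal ?s * (indicator {0<..} \<rho> * ennreal (\<rho> ^ (CARD('d) - 1)) * ennreal (norm (?T \<rho> t) powr q)) \<partial>lborel \<partial>lborel)"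
      using s by (intro nn_integral_cong) (auto simp: indicator_def ennreal_mult' mult_ac)
    also have "\<dots> = ennreal ?s * full_int q ?T"
      unfolding full_int_def by (subst nn_integral_cmult, measurable)+
    finally have J: "?J \<le> ennreal (D * n powr q)" using fs by simp
    have Jfin: "?J \<noteq> \<infinity>" using le_less_trans[OF J ennreal_less_top] by auto
    have "enn2real ?J \<le> D * n powr q" using J D by (simp add: enn2real_leI)
    hence "enn2real ?J powr (1 / q) \<le> (D * n powr q) powr (1 / q)" using q by (intro powr_mono2) auto
    also have "\<dots> = D powr (1 / q) * n" using D q n by (simp add: powr_mult powr_powr)
    finally have "enn2real ?J powr (1 / q) \<le> D powr (1 / q) * n" .
    with Jfin have "Lp_norm (ennreal q) lborel (extension_op f) \<le> ennreal (D powr (1 / q) * n)"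
      using q by (simp add: Lp_norm_def Let_def ennreal_leI)
    also have "\<dots> = ennreal (D powr (1 / q)) * Lp_norm p ?pm f" unfolding n by (simp add: ennreal_mult')
    finally show "Lp_norm (ennreal q) lborel (extension_op f) \<le> ennreal (D powr (1 / q)) * Lp_norm p ?pm f" .
  qed
qed

lemma extension_estimate_annulus:
  fixes k :: int and p0 q :: real
  assumes d: "2 \<le> CARD('d::finite)" and p: "1 \<le> p" and p0: "p0 \<ge> 1" "ennreal p0 \<le> p"
    and q: "q > 2 * (real CARD('d) + 1) / real CARD('d)" and pq: "1 / p0 + 1 / q \<le> 1" "1 / p0 + (2 * real CARD('d) + 1) / q < real CARD('d)"
  shows "\<exists>C\<ge>0. \<forall>f :: real \<times> (real ^ 'd) \<Rightarrow> complex. f \<in> Lp_space p paraboloid_measure \<longrightarrow> cylindrically_symmetric f \<longrightarrow>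
      (\<forall>y. y \<noteq> 0 \<longrightarrow> norm y \<notin> {2 powr k..2 * 2 powr k} \<longrightarrow> f (lift y) = 0) \<longrightarrow>
      Lp_norm (ennreal q) lborel (extension_op f) \<le> ennreal C * Lp_norm p paraboloid_measure f"
proof -
  have "2 * (real CARD('d) + 1) / real CARD('d) > 0" using d by simp
  hence q0: "q > 0" using q by linarith
  obtain K a where rk: "radial_kernel (sphere_wave CARD('d)) CARD('d) K a" using sphere_wave_radial_kernel[OF d] by blast
  obtain C where C: "C > 0" "\<forall>F N. F \<in> borel_measurable borel \<longrightarrow> (\<forall>r. r \<notin> {2 powr k..2 * 2 powr k} \<longrightarrow> F r = 0) \<longrightarrow> N \<ge> 0 \<longrightarrow>
     (\<integral>\<^sup>+ r. ennreal (r ^ (CARD('d) - 1)) * ennreal (norm (F r) powr p0) \<partial>lborel) \<le> ennreal N \<longrightarrow>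
     radial_kernel.full_int CARD('d) q (radial_kernel.T (sphere_wave CARD('d)) (\<lambda>r. complex_of_real (r ^ (CARD('d) - 1)) * F r)) \<le> ennreal (C * N powr (q / p0))"
    using radial_kernel.T_single_annulus_estimate[OF rk p0(1) q pq, of k] by (elim exE conjE) (rule that)
  show ?thesis
  proof (rule extension_estimate_of_radial[OF d _ _ _ rk p _ p0(2) q0 C])
    have "0 < 2 powr real_of_int k" by simp
    thus "{2 powr real_of_int k..2 * 2 powr real_of_int k} \<subseteq> {0<..2 * 2 powr real_of_int k}" by (auto intro: less_le_trans[OF \<open>0 < 2 powr real_of_int k\<close>])
  qed (use p0 in auto)
qed

lemma extension_estimate_ball:
  fixes b p0 q :: real
  assumes d: "2 \<le> CARD('d::finite)" and p: "1 \<le> p" and p0: "p0 \<ge> 1" "ennreal p0 \<le> p" and b: "b \<ge> 0"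
    and q: "q > 2 * (real CARD('d) + 1) / real CARD('d)" and pq: "1 / p0 + 1 / q \<le> 1" "1 / p0 + (2 * real CARD('d) + 1) / q < real CARD('d)"
    and scaling: "real CARD('d) * (1 - 1 / p0) * q = real CARD('d) + 2" and ple: "p0 \<le> q"
  shows "\<exists>C\<ge>0. \<forall>f :: real \<times> (real ^ 'd) \<Rightarrow> complex. f \<in> Lp_space p paraboloid_measure \<longrightarrow> cylindrically_symmetric f \<longrightarrow>
      (\<forall>y. y \<noteq> 0 \<longrightarrow> norm y \<notin> {0<..b} \<longrightarrow> f (lift y) = 0) \<longrightarrow>
      Lp_norm (ennreal q) lborel (extension_op f) \<le> ennreal C * Lp_norm p paraboloid_measure f"
proof -
  have "2 * (real CARD('d) + 1) / real CARD('d) > 0" using d by simp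
  hence q0: "q > 0" using q by linarith
  obtain K a where rk: "radial_kernel (sphere_wave CARD('d)) CARD('d) K a" using sphere_wave_radial_kernel[OF d] by blast
  obtain C where C: "C > 0" "\<forall>F N b. F \<in> borel_measurable borel \<longrightarrow> (\<forall>r. r \<notin> {0<..b} \<longrightarrow> F r = 0) \<longrightarrow> N \<ge> 0 \<longrightarrow>
     (\<integral>\<^sup>+ r. ennreal (r ^ (CARD('d) - 1)) * ennreal (norm (F r) powr p0) \<partial>lborel) \<le> ennreal N \<longrightarrow>
     radial_kernel.full_int CARD('d) q (radial_kernel.T (sphere_wave CARD('d)) (\<lambda>r. complex_of_real (r ^ (CARD('d) - 1)) * F r)) \<le> ennreal (C * N powr (q / p0))"
    using radial_kernel.T_global_estimate[OF rk p0(1) q pq scaling ple] by (elim exE conjE) (rule that)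
  show ?thesis
  proof (rule extension_estimate_of_radial[OF d _ _ b rk p _ p0(2) q0 C(1)])
    show "\<forall>F N. F \<in> borel_measurable borel \<longrightarrow> (\<forall>r. r \<notin> {0<..b} \<longrightarrow> F r = 0) \<longrightarrow> N \<ge> 0 \<longrightarrow>
     (\<integral>\<^sup>+ r. ennreal (r ^ (CARD('d) - 1)) * ennreal (norm (F r) powr p0) \<partial>lborel) \<le> ennreal N \<longrightarrow>
     radial_kernel.full_int CARD('d) q (radial_kernel.T (sphere_wave CARD('d)) (\<lambda>r. complex_of_real (r ^ (CARD('d) - 1)) * F r)) \<le> ennreal (C * N powr (q / p0))"
      using C(2) by (intro allI) (erule allE)+
  qed (use p0 in auto)
qed

section \<open>Choice of the finite exponents and conclusion\<close>

lemma ennreal_one_le_cases: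
  assumes "1 \<le> (p :: ennreal)"
  obtains "p = \<infinity>" | P where "p = ennreal P" "P \<ge> 1"
  using assms by (cases p) auto

text \<open>The radial estimates take a finite exponent. A finite p is kept; for p = \<infinity>
  both conditions persist for every sufficiently large p0.\<close>

lemma annulus_exponent_exists:
  fixes q d :: real and p :: ennreal
  assumes p: "1 \<le> p" and d: "d \<ge> 2" and q: "q > 2 * (d + 1) / d" and pq: "1 / p + 1 / ennreal q \<le> 1" "1 / p + ennreal (2 * d + 1) / ennreal q < ennreal d"
  shows "\<exists>p0\<ge>1. ennreal p0 \<le> p \<and> 1 / p0 + 1 / q \<le> 1 \<and> 1 / p0 + (2 * d + 1) / q < d"
proof -
  have "2 * (d + 1) / d > 2" using d by (simp add: field_simps)
  hence q2: "q > 2" using q by linarith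
  have div: "1 / ennreal q = ennreal (1 / q)" "ennreal (2 * d + 1) / ennreal q = ennreal ((2 * d + 1) / q)"
    using q2 d divide_ennreal[of 1 q] divide_ennreal[of "2 * d + 1" q] by auto
  show ?thesis
    using p
  proof (cases rule: ennreal_one_le_cases)
    case 1
    have lt: "(2 * d + 1) / q < d" using pq(2) 1 d q2 unfolding div by (simp add: ennreal_less_iff)
    define g where "g = d - (2 * d + 1) / q"
    \<comment> \<open>The first entry ensures 1 / p0 + 1 / q \<le> 1, the second that 1 / p0 uses at
      most half of the gap g.\<close>
    define p0 where "p0 = max (q / (q - 1)) (2 / g)"
    have g: "g > 0" using lt by (simp add: g_def)
    have "p0 \<ge> q / (q - 1)" "q / (q - 1) > 1" using q2 by (auto simp: p0_def)
    moreover from this have "p0 > 1" by linarith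
    ultimately have a: "p0 > 1" "1 / p0 \<le> 1 / (q / (q - 1))"
      using q2 by (auto simp: mult.commute pos_divide_le_eq pos_le_divide_eq simp del: divide_divide_eq_right intro!: divide_left_mono mult_pos_pos divide_pos_pos)
    have "p0 \<ge> 2 / g" by (simp add: p0_def)
    hence "1 / p0 \<le> 1 / (2 / g)" using g a(1) by (intro divide_left_mono) auto
    hence b: "1 / p0 \<le> g / 2" by simp
    have "1 / (q / (q - 1)) + 1 / q = 1" using q2 by (simp add: field_simps)
    with a(2) have "1 / p0 + 1 / q \<le> 1" by linarith
    moreover have "1 / p0 + (2 * d + 1) / q < d" using b g by (simp add: g_def)
    ultimately show ?thesis using a(1) 1 by (intro exI[of _ p0]) auto
  next
    case (2 P)
    have P: "1 / p = ennreal (1 / P)" using 2 divide_ennreal[of 1 P] by auto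
    have "1 / P + 1 / q \<le> 1" using pq(1) 2 q2 unfolding P div
      by (simp add: ennreal_plus[symmetric] ennreal_le_1 del: ennreal_plus)
    moreover have "1 / P + (2 * d + 1) / q < d" using pq(2) 2 q2 d unfolding P div
      by (simp add: ennreal_plus[symmetric] ennreal_less_iff del: ennreal_plus)
    ultimately show ?thesis using 2 by (intro exI[of _ P]) auto
  qed
qed

text \<open>The reciprocal u of p0 is solved from the scaling relation
  \<open>d * (1 - u) * q = d + 2\<close>. The hypothesis relating q and p' says 1 / p \<le> u, that
  is p0 \<le> p; and \<open>q > 2 * (d + 1) / d\<close> yields 1 / q \<le> u, that is p0 \<le> q, as
  well as the remaining strict inequality.\<close>

lemma ball_exponent_exists:
  fixes q d :: real and p p' :: ennreal
  assumes p: "1 \<le> p" and d: "d \<ge> 2" and q: "q > 2 * (d + 1) / d" and pp: "1 / p + 1 / p' = 1" and pq: "ennreal (d + 2) / ennreal q \<le> ennreal d / p'"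
  shows "\<exists>p0\<ge>1. ennreal p0 \<le> p \<and> 1 / p0 + 1 / q \<le> 1 \<and> 1 / p0 + (2 * d + 1) / q < d \<and> d * (1 - 1 / p0) * q = d + 2 \<and> p0 \<le> q"
proof -
  have "2 * (d + 1) / d > 2" using d by (simp add: field_simps)
  hence q2: "q > 2" using q by linarith
  have dq: "d * q > 2 * (d + 1)" using q d by (simp add: field_simps)
  define u where "u = 1 - (d + 2) / (d * q)"
  have "(d + 2) / (d * q) < 1" using dq d q2 by (simp add: field_simps)
  hence u: "0 < u" "u < 1" using d q2 by (auto simp: u_def)
  have uq: "1 / q \<le> u" using dq d q2 by (simp add: u_def field_simps)
  have a: "u + 1 / q \<le> 1" using d q2 by (simp add: u_def field_simps)
  have b: "u + (2 * d + 1) / q < d"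
  proof -
    have "(d - 1) * (2 * (d + 1)) < (d - 1) * (d * q)" using dq d by (intro mult_strict_left_mono) auto
    hence "2 * d * d - 2 < d * d * q - d * q" by (simp add: algebra_simps)
    hence "d * q - (d + 2) + (2 * d + 1) * d < d * (d * q)" by (simp add: algebra_simps)
    hence "(d * q - (d + 2) + (2 * d + 1) * d) / (d * q) < d" using d q2 by (simp add: pos_divide_less_eq)
    also have "(d * q - (d + 2) + (2 * d + 1) * d) / (d * q) = u + (2 * d + 1) / q"
      using d q2 by (simp add: u_def add_divide_distrib diff_divide_distrib)
    finally show ?thesis .
  qed
  have c: "d * (1 - u) * q = d + 2" using d q2 by (simp add: u_def)
  have le: "ennreal (1 / u) \<le> p"
    using p
  proof (cases rule: ennreal_one_le_cases)
    case (2 P)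
    have P: "1 / p = ennreal (1 / P)" using 2 divide_ennreal[of 1 P] by auto
    have "1 / p' \<le> 1 / p + 1 / p'" by (rule add_increasing) simp_all
    hence "1 / p' \<le> 1" unfolding pp .
    then obtain v where v: "1 / p' = ennreal v" "v \<ge> 0" by (cases "1 / p'") (auto simp: top_unique)
    have "ennreal (1 / P + v) = ennreal 1" using pp v 2 unfolding P by simp
    hence v1: "1 / P + v = 1" using v 2 by (subst (asm) ennreal_inj) auto
    have "ennreal d / p' = ennreal d * (1 / p')" by (simp add: divide_ennreal_def)
    also have "\<dots> = ennreal (d * v)" unfolding v using d v by (simp add: ennreal_mult')
    finally have "ennreal ((d + 2) / q) \<le> ennreal (d * v)" using pq divide_ennreal[of "d + 2" q] d q2 by simp
    hence "(d + 2) / q \<le> d * v" using d v by (subst (asm) ennreal_le_iff) auto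
    hence "(d + 2) / q / d \<le> v" using d by (subst pos_divide_le_eq) (auto simp: mult.commute)
    hence "1 / P \<le> u" using v1 by (simp add: u_def mult.commute)
    hence "1 / u \<le> P" using u 2 by (simp add: field_simps)
    thus ?thesis using 2 by (simp add: ennreal_leI)
  qed simp
  show ?thesis
  proof (rule exI[of _ "1 / u"], intro conjI)
    show "1 / u \<ge> 1" using u by simp
    show "1 / u \<le> q" using uq u q2 by (simp add: field_simps)
  qed (use a b c le in auto)
qed

lemma dyadic_class_lift_eq_0:
  assumes "f \<in> dyadic_class M" "norm y \<notin> {M..2 * M}"
  shows "f (lift y) = 0"
proof -
  have "lift y \<in> paraboloid - {(\<tau>, \<xi>) \<in> paraboloid. M \<le> norm \<xi> \<and> norm \<xi> \<le> 2 * M}"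
    using assms(2) lift_paraboloid[of y] by auto
  thus ?thesis using assms(1) unfolding dyadic_class_def supported_on_def by blast
qed

lemma supported_on_lift_eq_0:
  assumes "supported_on f S" "\<And>z. z \<in> S \<Longrightarrow> norm (snd z) \<le> b" "y \<noteq> 0" "norm y \<notin> {0<..b}"
  shows "f (lift y) = 0"
proof -
  have "norm y > b" using assms(3,4) by auto
  hence "lift y \<notin> S" using assms(2)[of "lift y"] by auto
  thus ?thesis using assms(1) lift_paraboloid[of y] by (simp add: supported_on_def)
qed

theorem corollary2p3:
  fixes n :: nat
  assumes "n \<ge> 3" and "CARD('d::finite) = n - 1"
  shows
    "(\<forall>(M::real) (p::ennreal) (q::ennreal).
        dyadic M \<longrightarrow> 1 \<le> p \<longrightarrow> 1 \<le> q \<longrightarrow>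
        q > ennreal (2 * real n / (real n - 1)) \<longrightarrow>
        1 / p + 1 / q \<le> 1 \<longrightarrow>
        1 / p + ennreal (2 * real n - 1) / q < ennreal (real n - 1) \<longrightarrow>
        (\<exists>C::real. C \<ge> 0 \<and>
          (\<forall>f :: real \<times> (real ^ 'd) \<Rightarrow> complex.
             f \<in> dyadic_class M \<inter> Lp_space p paraboloid_measure \<longrightarrow>
             Lp_norm q lborel (extension_op f) \<le> ennreal C * Lp_norm p paraboloid_measure f)))
     \<and>
     (\<forall>(S\<^sub>0 :: (real \<times> (real ^ 'd)) set) (p::ennreal) (p'::ennreal) (q::ennreal).
        compact S\<^sub>0 \<longrightarrow> S\<^sub>0 \<noteq> {} \<longrightarrow> S\<^sub>0 \<subseteq> paraboloid \<longrightarrow>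
        1 \<le> p \<longrightarrow> 1 \<le> q \<longrightarrow> 1 / p + 1 / p' = 1 \<longrightarrow>
        q > ennreal (2 * real n / (real n - 1)) \<longrightarrow>
        ennreal (real n + 1) / q \<le> ennreal (real n - 1) / p' \<longrightarrow>
        (\<exists>C::real. C \<ge> 0 \<and>
          (\<forall>f :: real \<times> (real ^ 'd) \<Rightarrow> complex.
             f \<in> Lp_space p paraboloid_measure \<longrightarrow> cylindrically_symmetric f \<longrightarrow>
             supported_on f S\<^sub>0 \<longrightarrow>
             Lp_norm q lborel (extension_op f) \<le> ennreal C * Lp_norm p paraboloid_measure f)))"
proof -
  let ?d = "real CARD('d)"
  have d: "2 \<le> CARD('d)" and d2: "?d \<ge> 2" using assms by auto
  \<comment> \<open>Everything is expressed through the dimension n - 1 of the space variable: 2 n /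
    (n - 1) becomes 2 (d + 1) / d, 2 n - 1 becomes 2 d + 1, and n + 1 becomes d + 2.\<close>
  have n: "real n = ?d + 1" using assms by simp
  have n': "2 * (?d + 1) - 1 = 2 * ?d + 1" "?d + 1 - 1 = ?d" "?d + 1 + 1 = ?d + 2" by simp_all
  show ?thesis unfolding n n'
  proof (intro conjI allI impI)
    fix M :: real and p q :: ennreal
    assume M: "dyadic M" and p: "1 \<le> p" and q1: "1 \<le> q" and q: "q > ennreal (2 * (?d + 1) / ?d)" and pq: "1 / p + 1 / q \<le> 1" "1 / p + ennreal (2 * ?d + 1) / q < ennreal ?d"
    obtain k :: int where "M = 2 powi k" using M by (auto simp: dyadic_def)
    hence k: "M = 2 powr k" by (simp add: powr_real_of_int')
    hence M0: "M > 0" by simp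
    show "\<exists>C\<ge>0. \<forall>f :: real \<times> (real ^ 'd) \<Rightarrow> complex. f \<in> dyadic_class M \<inter> Lp_space p paraboloid_measure \<longrightarrow>
             Lp_norm q lborel (extension_op f) \<le> ennreal C * Lp_norm p paraboloid_measure f"
    proof -
      have "\<exists>C\<ge>0. \<forall>f :: real \<times> (real ^ 'd) \<Rightarrow> complex. f \<in> Lp_space p paraboloid_measure \<longrightarrow> cylindrically_symmetric f \<longrightarrow>
        (\<forall>y. y \<noteq> 0 \<longrightarrow> norm y \<notin> {M..2 * M} \<longrightarrow> f (lift y) = 0) \<longrightarrow>
        Lp_norm q lborel (extension_op f) \<le> ennreal C * Lp_norm p paraboloid_measure f"
        using q1
      proof (cases rule: ennreal_one_le_cases)
        case 1
        show ?thesis unfolding 1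
          by (rule extension_estimate_infinity[OF d _ _ _ p, where b = "2 * M"]) (use M0 in auto)
      next
        case (2 Q)
        have Q: "Q > 2 * (?d + 1) / ?d" using q 2 d2 by (simp add: ennreal_less_iff)
        obtain p0 where "p0 \<ge> 1" "ennreal p0 \<le> p" "1 / p0 + 1 / Q \<le> 1" "1 / p0 + (2 * ?d + 1) / Q < ?d"
          using annulus_exponent_exists[OF p d2 Q pq[unfolded 2]] by blast
        thus ?thesis unfolding 2 k using extension_estimate_annulus[OF d p _ _ Q] by blast
      qed
      then obtain C where "C \<ge> 0" "\<forall>f :: real \<times> (real ^ 'd) \<Rightarrow> complex. f \<in> Lp_space p paraboloid_measure \<longrightarrow> cylindrically_symmetric f \<longrightarrow>
        (\<forall>y. y \<noteq> 0 \<longrightarrow> norm y \<notin> {M..2 * M} \<longrightarrow> f (lift y) = 0) \<longrightarrow>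
        Lp_norm q lborel (extension_op f) \<le> ennreal C * Lp_norm p paraboloid_measure f" by blast
      moreover have "cylindrically_symmetric f" if "f \<in> dyadic_class M" for f :: "real \<times> (real ^ 'd) \<Rightarrow> complex"
        using that by (simp add: dyadic_class_def)
      ultimately show ?thesis using dyadic_class_lift_eq_0 by (intro exI[of _ C]) blast
    qed
  next
    fix S\<^sub>0 :: "(real \<times> (real ^ 'd)) set" and p p' q :: ennreal
    assume S0: "compact S\<^sub>0" and p: "1 \<le> p" and q1: "1 \<le> q" and pp: "1 / p + 1 / p' = 1" and q: "q > ennreal (2 * (?d + 1) / ?d)" and pq: "ennreal (?d + 2) / q \<le> ennreal ?d / p'"
    \<comment> \<open>Compactness enters through a ball containing the frequencies; the constant
      depends on its radius.\<close>
    have "bounded (snd ` S\<^sub>0)" using S0 by (intro compact_imp_bounded compact_continuous_image continuous_intros)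
    then obtain b where b: "b > 0" "\<And>z. z \<in> S\<^sub>0 \<Longrightarrow> norm (snd z) \<le> b" by (auto simp: bounded_pos)
    have "\<exists>C\<ge>0. \<forall>f :: real \<times> (real ^ 'd) \<Rightarrow> complex. f \<in> Lp_space p paraboloid_measure \<longrightarrow> cylindrically_symmetric f \<longrightarrow>
        (\<forall>y. y \<noteq> 0 \<longrightarrow> norm y \<notin> {0<..b} \<longrightarrow> f (lift y) = 0) \<longrightarrow>
        Lp_norm q lborel (extension_op f) \<le> ennreal C * Lp_norm p paraboloid_measure f"
      using q1
    proof (cases rule: ennreal_one_le_cases)
      case 1
      show ?thesis unfolding 1
        by (rule extension_estimate_infinity[OF d _ _ _ p, where b = b]) (use b in auto)
    next
      case (2 Q)
      have Q: "Q > 2 * (?d + 1) / ?d" using q 2 d2 by (simp add: ennreal_less_iff)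
      obtain p0 where "p0 \<ge> 1" "ennreal p0 \<le> p" "1 / p0 + 1 / Q \<le> 1" "1 / p0 + (2 * ?d + 1) / Q < ?d" "?d * (1 - 1 / p0) * Q = ?d + 2" "p0 \<le> Q"
        using ball_exponent_exists[OF p d2 Q pp pq[unfolded 2]] by blast
      thus ?thesis unfolding 2 using extension_estimate_ball[OF d p _ _ _ Q, of p0 b] b(1) by auto
    qed
    then obtain C where "C \<ge> 0" "\<forall>f :: real \<times> (real ^ 'd) \<Rightarrow> complex. f \<in> Lp_space p paraboloid_measure \<longrightarrow> cylindrically_symmetric f \<longrightarrow>
        (\<forall>y. y \<noteq> 0 \<longrightarrow> norm y \<notin> {0<..b} \<longrightarrow> f (lift y) = 0) \<longrightarrow>
        Lp_norm q lborel (extension_op f) \<le> ennreal C * Lp_norm p paraboloid_measure f" by blast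
    thus "\<exists>C\<ge>0. \<forall>f :: real \<times> (real ^ 'd) \<Rightarrow> complex. f \<in> Lp_space p paraboloid_measure \<longrightarrow> cylindrically_symmetric f \<longrightarrow>
        supported_on f S\<^sub>0 \<longrightarrow> Lp_norm q lborel (extension_op f) \<le> ennreal C * Lp_norm p paraboloid_measure f"
      using supported_on_lift_eq_0[OF _ b(2)] by (intro exI[of _ C]) blast
  qed
qed

end
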